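(* Let $\Gamma$ be a connected vertex-transitive graph of valency at most $7$. Then $\Gamma$ is CIS if and only if $\Gamma$ is isomorphic to one of the following graphs: $K_n$ ($1\leq n\leq 8$), $K_{n,n}$ ($2\leq n\leq 7$), $L(K_{3,3})$, $L(K_{4,4})$, $C_4[K_2]$, $K_3[\overline{K_2}]$, $K_3[\overline{K_3}]$, $K_4[\overline{K_2}]$, $K_{3,3}[K_2]$, or $Q_n$ for some $n\geq 4$.
   Context: All graphs are finite, simple and undirected (with non-empty vertex set). A clique (respectively, stable set) is a set of pairwise adjacent (respectively, pairwise non-adjacent) vertices; "maximal" means maximal with respect to inclusion. A graph is CIS if every maximal stable set and every maximal clique have non-empty intersection. A graph is vertex-transitive if for every pair of vertices there is an automorphism mapping one to the other; such a graph is regular, and its valency is the common number of neighbors of its vertices. $K_n$, $C_n$ are the complete graph and the cycle of order $n$, $K_{m,n}$ is the complete bipartite graph with parts of sizes $m$ and $n$, $\overline{\Gamma}$ is the complement of $\Gamma$. $L(\Gamma)$ is the line graph of $\Gamma$: its vertices are the edges of $\Gamma$, two distinct edges being adjacent if and only if they share an endpoint. The lexicographic product $\Gamma_1[\Gamma_2]$ has vertex set $V(\Gamma_1)\times V(\Gamma_2)$, with $(u,x)$ and $(v,y)$ adjacent if and only if either $\{u,v\}\in E(\Gamma_1)$, or $u=v$ and $\{x,y\}\in E(\Gamma_2)$. For $n\geq 3$, $Q_n$ is the graph with vertex set $\mathbb{Z}_n\times\mathbb{Z}_2\times\mathbb{Z}_2$ whose edges are: all pairs $\{(i,x,y),(i+1,y,z)\}$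 with $i\in\mathbb{Z}_n$, $x,y,z\in\mathbb{Z}_2$; and all pairs $\{(i,x,y),(i,u,v)\}$ with $i\in\mathbb{Z}_n$, $x,y,u,v\in\mathbb{Z}_2$, $(x,y)\neq(u,v)$. *)

theory Defs
  imports "Graph_Theory.Graph_Theory"
begin

text \<open>
  Finite simple graphs are modelled by the locale \<^locale>\<open>pair_graph\<close>: a finite vertex set with a
  finite, irreflexive and symmetric set of arcs, an undirected edge \<open>{u, v}\<close> being represented
  by the two arcs \<open>(u, v)\<close> and \<open>(v, u)\<close>. Consequently \<^const>\<open>out_degree\<close> counts neighbours.
  \<^locale>\<open>pair_graph\<close> admits the null graph, but \<^const>\<open>Digraph_Component.connected\<close> excludes it.
\<close>

definition clique :: "'a pair_pre_digraph \<Rightarrow> 'a set \<Rightarrow> bool" where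
  "clique G C \<longleftrightarrow> C \<subseteq> pverts G \<and> (\<forall>u\<in>C. \<forall>v\<in>C. u \<noteq> v \<longrightarrow> (u, v) \<in> parcs G)"

definition stable_set :: "'a pair_pre_digraph \<Rightarrow> 'a set \<Rightarrow> bool" where
  "stable_set G S \<longleftrightarrow> S \<subseteq> pverts G \<and> (\<forall>u\<in>S. \<forall>v\<in>S. u \<noteq> v \<longrightarrow> (u, v) \<notin> parcs G)"

definition maximal_clique :: "'a pair_pre_digraph \<Rightarrow> 'a set \<Rightarrow> bool" where
  "maximal_clique G C \<longleftrightarrow> clique G C \<and> (\<forall>D. clique G D \<and> C \<subseteq> D \<longrightarrow> D = C)"

definition maximal_stable_set :: "'a pair_pre_digraph \<Rightarrow> 'a set \<Rightarrow> bool" where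
  "maximal_stable_set G S \<longleftrightarrow> stable_set G S \<and> (\<forall>T. stable_set G T \<and> S \<subseteq> T \<longrightarrow> T = S)"

definition CIS :: "'a pair_pre_digraph \<Rightarrow> bool" where
  "CIS G \<longleftrightarrow> (\<forall>S C. maximal_stable_set G S \<and> maximal_clique G C \<longrightarrow> S \<inter> C \<noteq> {})"

definition automorphism :: "'a pair_pre_digraph \<Rightarrow> ('a \<Rightarrow> 'a) \<Rightarrow> bool" where
  "automorphism G f \<longleftrightarrow> bij_betw f (pverts G) (pverts G) \<and>
     (\<forall>u\<in>pverts G. \<forall>v\<in>pverts G. (f u, f v) \<in> parcs G \<longleftrightarrow> (u, v) \<in> parcs G)"

definition vertex_transitive :: "'a pair_pre_digraph \<Rightarrow> bool" where
  "vertex_transitive G \<longleftrightarrow>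
     (\<forall>u\<in>pverts G. \<forall>v\<in>pverts G. \<exists>f. automorphism G f \<and> f u = v)"

definition has_valency :: "'a pair_pre_digraph \<Rightarrow> nat \<Rightarrow> bool" where
  "has_valency G d \<longleftrightarrow> (\<forall>v\<in>pverts G. out_degree (with_proj G) v = d)"

definition isomorphic :: "'a pair_pre_digraph \<Rightarrow> 'b pair_pre_digraph \<Rightarrow> bool" where
  "isomorphic G H \<longleftrightarrow> digraph_iso (with_proj G) (with_proj H)"

definition complete_graph :: "nat \<Rightarrow> nat pair_pre_digraph" where
  "complete_graph n =
     \<lparr> pverts = {0..<n}, parcs = {(i, j). i < n \<and> j < n \<and> i \<noteq> j} \<rparr>"

definition complete_bipartite_graph :: "nat \<Rightarrow> nat \<Rightarrow> (nat + nat) pair_pre_digraph" where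
  "complete_bipartite_graph m n =
     \<lparr> pverts = Inl ` {0..<m} \<union> Inr ` {0..<n},
       parcs = (Inl ` {0..<m}) \<times> (Inr ` {0..<n}) \<union> (Inr ` {0..<n}) \<times> (Inl ` {0..<m}) \<rparr>"

text \<open>The following is the cycle \<open>C\<^sub>n\<close> only for \<open>n \<ge> 3\<close>.\<close>

definition cycle_graph :: "nat \<Rightarrow> nat pair_pre_digraph" where
  "cycle_graph n =
     \<lparr> pverts = {0..<n},
       parcs = {(i, j). i < n \<and> j < n \<and> (j = (i + 1) mod n \<or> i = (j + 1) mod n)} \<rparr>"

definition complement_graph :: "'a pair_pre_digraph \<Rightarrow> 'a pair_pre_digraph" where
  "complement_graph G =
     \<lparr> pverts = pverts G,
       parcs = {(u, v). u \<in> pverts G \<and> v \<in> pverts G \<and> u \<noteq> v \<and> (u, v) \<notin> parcs G} \<rparr>"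

definition line_graph :: "'a pair_pre_digraph \<Rightarrow> 'a set pair_pre_digraph" where
  "line_graph G =
     (let E = {{u, v} | u v. (u, v) \<in> parcs G}
      in \<lparr> pverts = E, parcs = {(e, f). e \<in> E \<and> f \<in> E \<and> e \<noteq> f \<and> e \<inter> f \<noteq> {}} \<rparr>)"

definition lex_product ::
    "'a pair_pre_digraph \<Rightarrow> 'b pair_pre_digraph \<Rightarrow> ('a \<times> 'b) pair_pre_digraph" where
  "lex_product G H =
     \<lparr> pverts = pverts G \<times> pverts H,
       parcs = {((u, x), (v, y)).
         u \<in> pverts G \<and> v \<in> pverts G \<and> x \<in> pverts H \<and> y \<in> pverts H \<and>
         ((u, v) \<in> parcs G \<or> u = v \<and> (x, y) \<in> parcs H)} \<rparr>"

text \<open>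
  The residues modulo \<open>n\<close> and modulo 2 are represented by \<open>{0..<n}\<close> and \<open>{0..<2}\<close>.
  The graph \<open>Q\<^sub>n\<close> is only meaningful for \<open>n \<ge> 3\<close>.
\<close>

definition Q_graph :: "nat \<Rightarrow> (nat \<times> nat \<times> nat) pair_pre_digraph" where
  "Q_graph n =
     (let A = {((i, x, y), ((i + 1) mod n, y, z)) | i x y z. i < n \<and> x < 2 \<and> y < 2 \<and> z < 2};
          B = {((i, x, y), (i, u, v)) | i x y u v.
                i < n \<and> x < 2 \<and> y < 2 \<and> u < 2 \<and> v < 2 \<and> (x, y) \<noteq> (u, v)}
      in \<lparr> pverts = {0..<n} \<times> {0..<2} \<times> {0..<2}, parcs = A \<union> A\<inverse> \<union> B \<rparr>)"


section \<open>Consistency of the definitions\<close>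

text \<open>
  On loop-free digraphs without parallel arcs, the library's isomorphisms amount to
  arc-preserving bijections of the vertex sets.
\<close>

lemma isomorphic_iff:
  assumes "pair_wf_digraph G" "pair_wf_digraph H"
  shows "isomorphic G H \<longleftrightarrow>
    (\<exists>f. bij_betw f (pverts G) (pverts H) \<and>
      (\<forall>u\<in>pverts G. \<forall>v\<in>pverts G. (f u, f v) \<in> parcs H \<longleftrightarrow> (u, v) \<in> parcs G))"
    (is "?L \<longleftrightarrow> ?R")
proof
  interpret G: pair_wf_digraph G by fact
  assume ?L
  then obtain h where h: "G.digraph_isomorphism h"
      and H: "with_proj H = app_iso h (with_proj G)"
    by (auto simp: isomorphic_def digraph_iso_def)
  have V: "pverts H = iso_verts h ` pverts G"
    using arg_cong[OF H, of verts] by simp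
  have A: "parcs H = iso_arcs h ` parcs G"
    using arg_cong[OF H, of arcs] by simp
  have T: "iso_tail h = fst" and T': "iso_head h = snd"
    using arg_cong[OF H, of tail] arg_cong[OF H, of head] by simp_all
  have inj: "inj_on (iso_verts h) (pverts G)"
    using h by (simp add: G.digraph_isomorphism_def)
  have arc: "iso_arcs h (u, v) = (iso_verts h u, iso_verts h v)" if "(u, v) \<in> parcs G" for u v
    using h that T T' by (force simp: G.digraph_isomorphism_def prod_eq_iff)
  have "(iso_verts h u, iso_verts h v) \<in> parcs H \<longleftrightarrow> (u, v) \<in> parcs G"
    if uv: "u \<in> pverts G" "v \<in> pverts G" for u v
  proof
    assume "(iso_verts h u, iso_verts h v) \<in> parcs H"
    then obtain a b where ab: "(a, b) \<in> parcs G"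
        "(iso_verts h u, iso_verts h v) = iso_arcs h (a, b)"
      unfolding A by auto
    then have "iso_verts h u = iso_verts h a" "iso_verts h v = iso_verts h b"
      using arc by auto
    then have "u = a" "v = b"
      using inj uv G.in_arcsD1[OF ab(1)] G.in_arcsD2[OF ab(1)] by (auto dest: inj_onD)
    then show "(u, v) \<in> parcs G" using ab by simp
  next
    assume uv: "(u, v) \<in> parcs G"
    then show "(iso_verts h u, iso_verts h v) \<in> parcs H"
      unfolding A using arc[OF uv] by (metis imageI)
  qed
  then show ?R using inj V by (intro exI[of _ "iso_verts h"]) (auto simp: bij_betw_def)
next
  interpret G: pair_wf_digraph G by fact
  interpret H: pair_wf_digraph H by fact
  assume ?R
  then obtain f where f: "bij_betw f (pverts G) (pverts H)"
    and adj: "\<And>u v. u \<in> pverts G \<Longrightarrow> v \<in> pverts G \<Longrightarrow> (f u, f v) \<in> parcs H \<longleftrightarrow> (u, v) \<in> parcs G"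
    by blast
  define h where "h = \<lparr> iso_verts = f, iso_arcs = map_prod f f, iso_head = snd, iso_tail = fst \<rparr>"
  have inj: "inj_on f (pverts G)" and im: "f ` pverts G = pverts H"
    using f by (auto simp: bij_betw_def)
  have "parcs G \<subseteq> pverts G \<times> pverts G"
    using G.in_arcsD1 G.in_arcsD2 by auto
  then have "inj_on (map_prod f f) (parcs G)"
    using map_prod_inj_on[OF inj inj] by (rule inj_on_subset[rotated])
  then have "G.digraph_isomorphism h"
    using inj G.wf_digraph by (auto simp: G.digraph_isomorphism_def h_def)
  moreover have "map_prod f f ` parcs G = parcs H"
  proof (intro equalityI subsetI)
    fix e assume "e \<in> map_prod f f ` parcs G"
    then show "e \<in> parcs H" using adj by (auto dest: G.in_arcsD1 G.in_arcsD2)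
  next
    fix e assume e: "e \<in> parcs H"
    obtain a b where ab: "e = (a, b)" by (cases e)
    then obtain u v where "u \<in> pverts G" "v \<in> pverts G" "a = f u" "b = f v"
      using e im H.in_arcsD1 H.in_arcsD2 by (metis imageE)
    then show "e \<in> map_prod f f ` parcs G" using adj e ab by force
  qed
  then have "with_proj H = app_iso h (with_proj G)"
    using im by (simp add: app_iso_def h_def with_proj_def)
  ultimately show ?L unfolding isomorphic_def digraph_iso_def by blast
qed

lemma vertex_transitive_has_valency:
  assumes "pair_graph G" "vertex_transitive G"
  shows "\<exists>d. has_valency G d"
proof -
  interpret pair_graph G by fact
  have deg: "out_degree (with_proj G) u = card {w \<in> pverts G. (u, w) \<in> parcs G}" for u
  proof -
    have "out_arcs (with_proj G) u = Pair u ` {w \<in> pverts G. (u, w) \<in> parcs G}"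
      by (auto simp: out_arcs_def dest: in_arcsD2)
    then show ?thesis by (simp add: out_degree_def card_image inj_on_def)
  qed
  have "out_degree (with_proj G) u = out_degree (with_proj G) v"
    if uv: "u \<in> pverts G" "v \<in> pverts G" for u v
  proof -
    obtain f where f: "automorphism G f" "f u = v"
      using assms(2) uv by (auto simp: vertex_transitive_def)
    have "bij_betw f {w \<in> pverts G. (u, w) \<in> parcs G} {w \<in> pverts G. (v, w) \<in> parcs G}"
      unfolding bij_betw_def
    proof (intro conjI equalityI subsetI)
      show "inj_on f {w \<in> pverts G. (u, w) \<in> parcs G}"
        using f(1) by (auto simp: automorphism_def bij_betw_def intro: inj_on_subset)
    next
      fix x assume "x \<in> f ` {w \<in> pverts G. (u, w) \<in> parcs G}"
      then show "x \<in> {w \<in> pverts G. (v, w) \<in> parcs G}"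
        using f uv by (auto simp: automorphism_def bij_betw_def)
    next
      fix x assume x: "x \<in> {w \<in> pverts G. (v, w) \<in> parcs G}"
      moreover have "f ` pverts G = pverts G"
        using f(1) by (simp add: automorphism_def bij_betw_def)
      ultimately obtain w where w: "w \<in> pverts G" "x = f w"
        by blast
      then have "(u, w) \<in> parcs G"
        using x f uv unfolding automorphism_def by blast
      then show "x \<in> f ` {w \<in> pverts G. (u, w) \<in> parcs G}" using w by blast
    qed
    then show ?thesis unfolding deg by (rule bij_betw_same_card)
  qed
  then show ?thesis unfolding has_valency_def by blast
qed

lemma pair_graphI:
  assumes "finite (pverts G)"
    and "\<And>u v. (u, v) \<in> parcs G \<Longrightarrow> u \<in> pverts G \<and> u \<noteq> v \<and> (v, u) \<in> parcs G"
  shows "pair_graph G"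
proof -
  have "parcs G \<subseteq> pverts G \<times> pverts G" using assms(2) by auto
  then have "finite (parcs G)" using assms(1) by (meson finite_SigmaI finite_subset)
  then show ?thesis
    using assms assms(2)[THEN conjunct2, THEN conjunct2, THEN assms(2), THEN conjunct1]
    by unfold_locales (auto simp: symmetric_def intro!: symI)
qed

lemma complete_digraph_complete_graph: "complete_digraph n (with_proj (complete_graph n))"
  by (auto simp: complete_digraph_pair_def complete_graph_def)

lemma complete_bipartite_digraph_complete_bipartite_graph:
  "complete_bipartite_digraph m n (with_proj (complete_bipartite_graph m n))"
  unfolding complete_bipartite_digraph_pair_def complete_bipartite_graph_def
  by (intro conjI exI[of _ "Inl ` {0..<m}"] exI[of _ "Inr ` {0..<n}"])
    (auto simp: card_image)

lemma pair_graph_cycle_graph: "n \<ge> 2 \<Longrightarrow> pair_graph (cycle_graph n)"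
  by (rule pair_graphI) (auto simp: cycle_graph_def mod_Suc split: if_splits)

lemma pair_graph_complement_graph: "pair_graph G \<Longrightarrow> pair_graph (complement_graph G)"
proof (rule pair_graphI, goal_cases)
  case 1
  then interpret pair_graph G .
  show ?case by (simp add: complement_graph_def)
next
  case (2 u v)
  then interpret pair_graph G by simp
  show ?case using 2(2) by (auto simp: complement_graph_def arcs_symmetric)
qed

lemma pair_graph_line_graph: "pair_graph G \<Longrightarrow> pair_graph (line_graph G)"
proof (rule pair_graphI, goal_cases)
  case 1
  then interpret pair_graph G .
  have "pverts (line_graph G) = (\<lambda>(u, v). {u, v}) ` parcs G"
    by (auto simp: line_graph_def Let_def)
  then show ?case by simp
next
  case (2 u v)
  then show ?case by (auto simp: line_graph_def Let_def)
qed

lemma pair_graph_lex_product: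
  "pair_graph G \<Longrightarrow> pair_graph H \<Longrightarrow> pair_graph (lex_product G H)"
proof (rule pair_graphI, goal_cases)
  case 1
  interpret G: pair_graph G by fact
  interpret H: pair_graph H by fact
  show ?case by (simp add: lex_product_def)
next
  case (2 u v)
  interpret G: pair_graph G by fact
  interpret H: pair_graph H by fact
  show ?case using 2(3)
    by (auto simp: lex_product_def G.arcs_symmetric H.arcs_symmetric
        dest: G.pair_no_loops H.pair_no_loops)
qed

lemma pair_graph_Q_graph: "n \<ge> 2 \<Longrightarrow> pair_graph (Q_graph n)"
proof (rule pair_graphI, goal_cases)
  case 1
  then show ?case by (simp add: Q_graph_def Let_def)
next
  case (2 u v)
  have "(i + 1) mod n < n \<and> (i + 1) mod n \<noteq> i" if "i < n" for i
    using that 2(1) by (auto simp: mod_Suc)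
  with 2(2) show ?case by (fastforce simp: Q_graph_def Let_def)
qed

end

theory Submission
  imports Defs "HOL-Combinatorics.Permutations"
begin

text \<open>
  Counting pairs of an automorphism \<open>g\<close> and the unique point of \<open>g(S) \<inter> K\<close>, for a maximal stable set
  \<open>S\<close> and a maximal clique \<open>K\<close>, shows that all maximal cliques of a vertex-transitive CIS graph have
  the same size \<open>k\<close>. Both this purity and the CIS property pass to neighbourhoods; for \<open>k = 2\<close> they say
  that every component is complete bipartite. If \<open>t\<close> is the size of the classes of vertices with
  the same closed neighbourhood, then \<open>t\<close> divides \<open>k\<close> and a Hall-type argument in the neighbourhood of
  a vertex gives \<open>2 k \<le> d + 1 + t\<close>. For \<open>d \<le> 7\<close> and a graph that is not complete this leaves
  \<open>k \<in> {2, 3, 4}\<close>, with \<open>t = 1\<close>, or \<open>t = 2\<close> and \<open>k = 4\<close>.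

  For \<open>k = 3\<close> the neighbourhoods are disjoint unions of complete bipartite graphs, and for \<open>k = 4\<close> the
  same holds for the common neighbourhoods of edges. The possible sizes of these are eliminated by
  degree counts and by double counting over invariant relations: as many vertices \<open>w\<close> satisfy
  \<open>R v w\<close> as satisfy \<open>R w v\<close>. The surviving neighbourhoods determine the graph: connected ones lead to
  complete multipartite graphs, two disjoint cliques to the square rook's graph, which is
  \<open>L(K\<^sub>k\<^sub>,\<^sub>k)\<close>, and three triangles in a chain to \<open>Q\<^sub>n\<close>. In the last case the middle cliques partition
  the vertices into blocks of size four arranged in a cycle, and a vertex is determined inside its
  block by its neighbours in the two adjacent blocks.
\<close>

section \<open>Maximal cliques of vertex-transitive CIS graphs\<close>

text \<open>The CIS property enters in the form that no stable set dominates a maximal clique. Since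
  any stable set may be tested, two or three vertices are enough to forbid a configuration: if each
  vertex of a maximal clique is given a neighbour outside it, some two of the chosen vertices must
  be adjacent. The obstacle is that transitivity concerns vertices only. All links are isomorphic,
  but an edge may play different roles in the links of its two ends. The number \<open>l u v\<close>
  of common neighbours is the same seen from both ends, so it carries information from one link to
  the next; the eliminations are therefore organised by the values of \<open>l\<close> on the sides
  of a triangle.\<close>

locale simple_graph =
  fixes E :: "'a \<Rightarrow> 'a \<Rightarrow> bool"
  assumes sym: "E u v \<Longrightarrow> E v u" and irrefl: "\<not> E u u"
begin

lemma neq: "E u v \<Longrightarrow> u \<noteq> v"
  using irrefl by auto

definition cl :: "'a set \<Rightarrow> bool" where
  "cl K \<longleftrightarrow> (\<forall>u\<in>K. \<forall>v\<in>K. u \<noteq> v \<longrightarrow> E u v)"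

definition st :: "'a set \<Rightarrow> bool" where
  "st S \<longleftrightarrow> (\<forall>u\<in>S. \<forall>v\<in>S. \<not> E u v)"

definition mcl :: "'a set \<Rightarrow> 'a set \<Rightarrow> bool" where
  "mcl V K \<longleftrightarrow> K \<subseteq> V \<and> cl K \<and> (\<forall>v\<in>V - K. \<exists>u\<in>K. \<not> E u v)"

definition mst :: "'a set \<Rightarrow> 'a set \<Rightarrow> bool" where
  "mst V S \<longleftrightarrow> S \<subseteq> V \<and> st S \<and> (\<forall>v\<in>V - S. \<exists>u\<in>S. E u v)"

text \<open>Read: no stable set, maximal or not, dominates a non-empty maximal clique;
  \<open>CIS_iff\<close> identifies this with the CIS property. Asking for \<open>K\<close> to be
  non-empty lets an empty neighbourhood satisfy the condition.\<close>

definition cis :: "'a set \<Rightarrow> bool" where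
  "cis V \<longleftrightarrow> (\<forall>K S. mcl V K \<longrightarrow> K \<noteq> {} \<longrightarrow> S \<subseteq> V \<longrightarrow> st S \<longrightarrow> (\<exists>c\<in>K. \<forall>s\<in>S. \<not> E c s))"

definition pure :: "'a set \<Rightarrow> nat \<Rightarrow> bool" where
  "pure V k \<longleftrightarrow> (\<forall>K. mcl V K \<longrightarrow> card K = k)"

definition nb :: "'a set \<Rightarrow> 'a \<Rightarrow> 'a set" where
  "nb V v = {w\<in>V. E v w}"

lemma mem_nb [simp]: "w \<in> nb V v \<longleftrightarrow> w \<in> V \<and> E v w"
  by (simp add: nb_def)

lemma cl_insert: "cl K \<Longrightarrow> (\<And>u. u \<in> K \<Longrightarrow> E v u) \<Longrightarrow> cl (insert v K)"
  unfolding cl_def using sym by auto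

lemma st_insert: "st S \<Longrightarrow> (\<And>u. u \<in> S \<Longrightarrow> \<not> E v u) \<Longrightarrow> st (insert v S)"
  unfolding st_def using sym[of _ v] irrefl[of v] by auto

lemma ex_mcl:
  assumes "finite V" "cl K" "K \<subseteq> V"
  shows "\<exists>K'. mcl V K' \<and> K \<subseteq> K'"
proof -
  let ?P = "{L. cl L \<and> K \<subseteq> L \<and> L \<subseteq> V}"
  have "finite ?P" using assms(1) by (rule finite_subset[rotated, OF finite_Pow_iff[THEN iffD2]]) auto
  moreover have "K \<in> ?P" using assms by auto
  ultimately obtain M where M: "M \<in> ?P" "K \<subseteq> M" "\<forall>b\<in>?P. M \<subseteq> b \<longrightarrow> M = b"
    using finite_has_maximal2 by meson
  have "\<exists>u\<in>M. \<not> E u v" if "v \<in> V - M" for v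
  proof (rule ccontr)
    assume "\<not> (\<exists>u\<in>M. \<not> E u v)"
    then have "insert v M \<in> ?P" using M that cl_insert[of M v] sym by auto
    then show False using M(3) that by blast
  qed
  then show ?thesis using M unfolding mcl_def by auto
qed

lemma ex_mst:
  assumes "finite V" "st S" "S \<subseteq> V"
  shows "\<exists>S'. mst V S' \<and> S \<subseteq> S'"
proof -
  let ?P = "{L. st L \<and> S \<subseteq> L \<and> L \<subseteq> V}"
  have "finite ?P" using assms(1) by (rule finite_subset[rotated, OF finite_Pow_iff[THEN iffD2]]) auto
  moreover have "S \<in> ?P" using assms by auto
  ultimately obtain M where M: "M \<in> ?P" "S \<subseteq> M" "\<forall>b\<in>?P. M \<subseteq> b \<longrightarrow> M = b"
    using finite_has_maximal2 by meson
  have "\<exists>u\<in>M. E u v" if "v \<in> V - M" for v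
  proof (rule ccontr)
    assume "\<not> (\<exists>u\<in>M. E u v)"
    then have "\<not> E v u" if "u \<in> M" for u using that sym[of v u] by auto
    then have "st (insert v M)" using M by (intro st_insert) auto
    then have "insert v M \<in> ?P" using M that by auto
    then show False using M(3) that by blast
  qed
  then show ?thesis using M unfolding mst_def by auto
qed

lemma cisD:
  "cis V \<Longrightarrow> mcl V K \<Longrightarrow> K \<noteq> {} \<Longrightarrow> S \<subseteq> V \<Longrightarrow> st S \<Longrightarrow> (\<And>c. c \<in> K \<Longrightarrow> \<exists>s\<in>S. E c s) \<Longrightarrow> False"
  unfolding cis_def by meson

lemma mcl_adj: "mcl V K \<Longrightarrow> u \<in> K \<Longrightarrow> v \<in> K \<Longrightarrow> u \<noteq> v \<Longrightarrow> E u v"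
  by (simp add: mcl_def cl_def)

lemma mcl_sub: "mcl V K \<Longrightarrow> u \<in> K \<Longrightarrow> u \<in> V"
  by (auto simp: mcl_def)

lemma mcl_max: "mcl V K \<Longrightarrow> v \<in> V \<Longrightarrow> (\<And>u. u \<in> K \<Longrightarrow> u \<noteq> v \<Longrightarrow> E v u) \<Longrightarrow> v \<in> K"
  unfolding mcl_def by (metis DiffI sym)

lemma sym_iff: "E u v \<longleftrightarrow> E v u"
  using sym[of u v] sym[of v u] by auto

section \<open>Passage to neighbourhoods\<close>

lemma mcl_nb:
  assumes "v \<in> V" "mcl (nb V v) K"
  shows "mcl V (insert v K)" "v \<notin> K"
  using assms sym irrefl unfolding mcl_def cl_def by auto

text \<open>Adding \<open>v\<close> to a maximal clique of its neighbourhood gives a maximal clique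
  of \<open>V\<close>, and a non-empty set of neighbours of \<open>v\<close> dominates
  \<open>v\<close> as well.\<close>

lemma cis_nb:
  assumes "cis V" "v \<in> V" shows "cis (nb V v)"
  unfolding cis_def
proof (intro allI impI, rule ccontr)
  fix K S assume *: "mcl (nb V v) K" "K \<noteq> {}" "S \<subseteq> nb V v" "st S" "\<not> (\<exists>c\<in>K. \<forall>s\<in>S. \<not> E c s)"
  have K: "mcl V (insert v K)" using mcl_nb[OF assms(2) *(1)] by simp
  have "S \<noteq> {}" using * by auto
  then show False
    by (intro cisD[OF assms(1) K _, of S]) (use * in \<open>auto simp: subset_iff\<close>)
qed

lemma pure_nb:
  assumes "finite V" "pure V (Suc k)" "v \<in> V" shows "pure (nb V v) k"
  unfolding pure_def
proof (intro allI impI)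
  fix K assume K: "mcl (nb V v) K"
  then have "finite K" using assms(1) unfolding mcl_def by (auto intro: finite_subset simp: nb_def)
  then show "card K = k"
    using assms(2) mcl_nb[OF assms(3) K] unfolding pure_def by fastforce
qed

lemma pure_cl_le:
  assumes "finite V" "pure V k" "cl K" "K \<subseteq> V" shows "card K \<le> k"
proof -
  obtain K' where K': "mcl V K'" "K \<subseteq> K'" using ex_mcl[OF assms(1,3,4)] by auto
  then have "finite K'" using assms(1) unfolding mcl_def by (auto intro: finite_subset)
  then have "card K \<le> card K'" using K'(2) by (rule card_mono)
  then show ?thesis using K'(1) assms(2) by (simp add: pure_def)
qed

lemma pure_cl_mcl:
  assumes "finite V" "pure V k" "cl K" "K \<subseteq> V" "card K = k" shows "mcl V K"
proof -
  obtain K' where K': "mcl V K'" "K \<subseteq> K'" using ex_mcl[OF assms(1,3,4)] by auto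
  then have "finite K'" using assms(1) unfolding mcl_def by (auto intro: finite_subset)
  then have "K = K'" using K' assms(2,5) by (metis card_subset_eq pure_def)
  then show ?thesis using K' by simp
qed

lemma pure_ex_nb:
  assumes "finite V" "pure V k" "2 \<le> k" "v \<in> V" shows "\<exists>w\<in>V. E v w"
proof -
  obtain K where K: "mcl V K" "{v} \<subseteq> K" using ex_mcl[of V "{v}"] assms by (auto simp: cl_def)
  then have "card K \<ge> 2" using assms by (simp add: pure_def)
  then have "\<not> K \<subseteq> {v}" using card_mono[of "{v}" K] by auto
  then obtain w where "w \<in> K" "w \<noteq> v" by auto
  moreover have "K \<subseteq> V" "\<forall>u\<in>K. v \<noteq> u \<longrightarrow> E v u" using K by (auto simp: mcl_def cl_def)
  ultimately show ?thesis by auto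
qed

lemma pure2_triangle_free:
  assumes "finite V" "pure V 2" "a \<in> V" "b \<in> V" "c \<in> V" "E a b" "E b c" "E a c" shows False
proof -
  have "cl {a,b,c}" using assms sym unfolding cl_def by auto
  moreover have "card {a,b,c} = 3" using assms irrefl by (auto simp: card_insert_if)
  ultimately show False using pure_cl_le[OF assms(1,2), of "{a,b,c}"] assms by auto
qed

text \<open>Otherwise the stable set \<open>{a,d}\<close> would dominate the maximal clique
  \<open>{b,c}\<close>. Together with triangle-freeness this makes every component complete
  bipartite.\<close>

lemma pure2_difunctional:
  assumes "finite V" "cis V" "pure V 2" "a \<in> V" "b \<in> V" "c \<in> V" "d \<in> V" "E a b" "E b c" "E c d"
  shows "E a d"
proof (rule ccontr)
  assume "\<not> E a d"
  have "cl {b,c}" "card {b,c} = 2" using assms sym irrefl unfolding cl_def by (auto simp: card_insert_if)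
  then have "mcl V {b,c}" using pure_cl_mcl[OF assms(1,3)] assms by auto
  moreover have "st {a,d}" using \<open>\<not> E a d\<close> sym irrefl by (auto simp: st_def)
  ultimately show False using cisD[OF assms(2), of "{b,c}" "{a,d}"] assms sym by auto
qed

end

section \<open>Counting with automorphisms\<close>

locale cis_graph = simple_graph E for E :: "'a \<Rightarrow> 'a \<Rightarrow> bool" +
  fixes V :: "'a set" and d :: nat
  assumes finV: "finite V" and nonempty: "V \<noteq> {}"
    and EV: "E u v \<Longrightarrow> u \<in> V"
    and connectedE: "A \<subseteq> V \<Longrightarrow> A \<noteq> {} \<Longrightarrow> (\<And>u v. u \<in> A \<Longrightarrow> E u v \<Longrightarrow> v \<in> A) \<Longrightarrow> A = V"
    and transitive: "u \<in> V \<Longrightarrow> v \<in> V \<Longrightarrow> \<exists>f. f permutes V \<and> (\<forall>x y. E (f x) (f y) \<longleftrightarrow> E x y) \<and> f u = v"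
    and regular: "v \<in> V \<Longrightarrow> card {w. E v w} = d"
    and cisV: "cis V"
begin

lemma EV2: "E u v \<Longrightarrow> v \<in> V"
  by (rule EV[OF sym])

text \<open>Automorphisms are taken as permutations of the whole type that fix everything outside
  \<open>V\<close>. They form a finite set, and images and preimages come without side
  conditions.\<close>

definition Aut :: "('a \<Rightarrow> 'a) set" where
  "Aut = {f. f permutes V \<and> (\<forall>x y. E (f x) (f y) \<longleftrightarrow> E x y)}"

lemma Aut_E: "f \<in> Aut \<Longrightarrow> E (f x) (f y) \<longleftrightarrow> E x y"
  by (simp add: Aut_def)

lemma Aut_V: "f \<in> Aut \<Longrightarrow> f x \<in> V \<longleftrightarrow> x \<in> V"
  by (simp add: Aut_def permutes_in_image)

lemma Aut_inj: "f \<in> Aut \<Longrightarrow> inj f"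
  by (auto simp: Aut_def intro: permutes_inj)

lemma Aut_eq: "f \<in> Aut \<Longrightarrow> f x = f y \<longleftrightarrow> x = y"
  by (meson Aut_inj inj_eq)

lemma Aut_surj: "f \<in> Aut \<Longrightarrow> \<exists>x. y = f x"
  by (metis (no_types, lifting) Aut_def mem_Collect_eq permutes_surj surj_def)

lemma Aut_trans: "u \<in> V \<Longrightarrow> v \<in> V \<Longrightarrow> \<exists>f\<in>Aut. f u = v"
  using transitive[of u v] by (auto simp: Aut_def)

lemma finite_Aut: "finite Aut"
  by (rule finite_subset[OF _ finite_permutations[OF finV]]) (auto simp: Aut_def)

lemma Aut_comp: "f \<in> Aut \<Longrightarrow> g \<in> Aut \<Longrightarrow> f \<circ> g \<in> Aut"
  by (auto simp: Aut_def intro: permutes_compose)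

text \<open>Composing with automorphisms on both sides injects one set of transporters into the
  other, and the roles can be exchanged.\<close>

lemma card_transporter:
  assumes "s \<in> V" "c \<in> V" "s' \<in> V" "c' \<in> V"
  shows "card {g\<in>Aut. g s = c} = card {g\<in>Aut. g s' = c'}"
proof -
  have le: "card {g\<in>Aut. g s = c} \<le> card {g\<in>Aut. g s' = c'}"
    if V: "s \<in> V" "c \<in> V" "s' \<in> V" "c' \<in> V" for s c s' c'
  proof -
    obtain h k where h: "h \<in> Aut" "h c = c'" and k: "k \<in> Aut" "k s' = s"
      using Aut_trans V by metis
    have "inj_on (\<lambda>g. h \<circ> g \<circ> k) {g\<in>Aut. g s = c}"
    proof (rule inj_onI)
      fix x y assume "h \<circ> x \<circ> k = h \<circ> y \<circ> k"
      then have "h (x (k z)) = h (y (k z))" for z by (metis comp_apply)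
      then have "x (k z) = y (k z)" for z using Aut_eq[OF h(1)] by auto
      then show "x = y" using Aut_surj[OF k(1)] by (metis ext)
    qed
    moreover have "(\<lambda>g. h \<circ> g \<circ> k) ` {g\<in>Aut. g s = c} \<subseteq> {g\<in>Aut. g s' = c'}"
      using h k Aut_comp by auto
    ultimately show ?thesis using finite_Aut card_inj_on_le by fastforce
  qed
  show ?thesis using le[OF assms] le[OF assms(3,4,1,2)] by simp
qed

text \<open>
  Every translate \<open>g ` S\<close> is a maximal stable set, hence meets \<open>K\<close> in exactly one vertex; \<open>a\<close> is the
  order of a vertex stabilizer.
\<close>

lemma stable_clique_product:
  assumes K: "mcl V K" and S: "mst V S"
  shows "\<exists>a>0. \<forall>K. mcl V K \<longrightarrow> card S * card K * a = card Aut"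
proof -
  obtain v where v: "v \<in> V" using nonempty by auto
  define a where "a = card {g\<in>Aut. g v = v}"
  have "id \<in> {g\<in>Aut. g v = v}" by (auto simp: Aut_def permutes_id)
  then have "a > 0" unfolding a_def using finite_Aut by (auto simp: card_gt_0_iff)
  have a: "card {g\<in>Aut. g s = c} = a" if "s \<in> V" "c \<in> V" for s c
    unfolding a_def using card_transporter that v by blast
  have "card S * card K * a = card Aut" if K: "mcl V K" for K
  proof -
    have sub: "S \<subseteq> V" "K \<subseteq> V" using K S by (auto simp: mst_def mcl_def)
    then have fin: "finite S" "finite K" using finV finite_subset by auto
    have one: "card {p\<in>S \<times> K. g (fst p) = snd p} = 1" if g: "g \<in> Aut" for g
    proof -
      have "\<exists>c\<in>K. \<exists>s\<in>S. g s = c"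
      proof (rule ccontr)
        assume no: "\<not> (\<exists>c\<in>K. \<exists>s\<in>S. g s = c)"
        have "st (g ` S)" using S g by (auto simp: mst_def st_def Aut_E)
        moreover have "g ` S \<subseteq> V" using sub g by (auto simp: Aut_V)
        \<comment> \<open>A vertex of \<open>K\<close> outside the translate pulls back to a vertex
          outside \<open>S\<close>, which \<open>S\<close> dominates by maximality.\<close>
        moreover have "\<exists>s\<in>g ` S. E c s" if c: "c \<in> K" for c
        proof -
          obtain x where x: "c = g x" using Aut_surj[OF g] by auto
          then have "x \<in> V - S" using c no sub Aut_V[OF g] by auto
          then obtain s where "s \<in> S" "E s x" using S by (auto simp: mst_def)
          then show ?thesis using x sym Aut_E[OF g] by auto
        qed
        moreover have "K \<noteq> {}" using K v by (auto simp: mcl_def)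
        ultimately show False using cisD[OF cisV K] by blast
      qed
      then obtain s c where sc: "c \<in> K" "s \<in> S" "g s = c" by auto
      have "s' = s \<and> c' = c" if "c' \<in> K" "s' \<in> S" "g s' = c'" for s' c'
      proof (rule ccontr)
        assume "\<not> (s' = s \<and> c' = c)"
        then have "c' \<noteq> c" using that sc Aut_eq[OF g] by auto
        then have "E c' c" using that sc K by (auto simp: mcl_def cl_def)
        then have "E s' s" using that sc Aut_E[OF g] by auto
        then show False using S that sc by (auto simp: mst_def st_def)
      qed
      then have "p = (s, c)" if "p \<in> S \<times> K" "g (fst p) = snd p" for p
        using that by (cases p) auto
      then have "{p\<in>S \<times> K. g (fst p) = snd p} = {(s,c)}" using sc
        by (intro equalityI subsetI) simp_all
      then show ?thesis by simp
    qed
    have "card Aut = (\<Sum>g\<in>Aut. card {p\<in>S \<times> K. g (fst p) = snd p})" using one by simp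
    also have "\<dots> = (\<Sum>p\<in>S \<times> K. card {g\<in>Aut. g (fst p) = snd p})"
      by (rule sum_multicount_gen) (use finite_Aut fin in auto)
    also have "\<dots> = (\<Sum>p\<in>S \<times> K. a)" using sub by (intro sum.cong refl a) auto
    also have "\<dots> = card S * card K * a" by (simp add: card_cartesian_product)
    finally show ?thesis by simp
  qed
  then show ?thesis using \<open>a > 0\<close> by blast
qed

lemma pure_exists: "\<exists>k. pure V k"
proof -
  obtain S where S: "mst V S" using ex_mst[OF finV, of "{}"] by (auto simp: st_def)
  obtain K where K: "mcl V K" using ex_mcl[OF finV, of "{}"] by (auto simp: cl_def)
  obtain a where a: "a > 0" "\<And>K. mcl V K \<Longrightarrow> card S * card K * a = card Aut"
    using stable_clique_product[OF K S] by auto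
  have "card Aut > 0" using finite_Aut Aut_trans nonempty by (auto simp: card_gt_0_iff)
  then have "card S > 0" using a K by (metis mult_is_0 neq0_conv)
  then have "card K' = card K" if "mcl V K'" for K'
    using a(2)[OF K] a(2)[OF that] a(1) by (metis mult_cancel1 mult_cancel2 neq0_conv)
  then show ?thesis unfolding pure_def by blast
qed

text \<open>Transitivity makes both the out-degree and the in-degree of an invariant relation
  constant on \<open>V\<close>, and each of them sums to the number of related pairs.\<close>

lemma mass_transport:
  assumes inv: "\<And>f u v. f \<in> Aut \<Longrightarrow> R u v \<Longrightarrow> R (f u) (f v)"
    and RV: "\<And>u v. R u v \<Longrightarrow> u \<in> V \<and> v \<in> V" and v: "v \<in> V"
  shows "card {w. R v w} = card {w. R w v}"
proof -
  have fin: "finite {w. R u w}" "finite {w. R w u}" for u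
    using RV by (auto intro: finite_subset[OF _ finV])
  have out: "card {w. R u w} \<le> card {w. R u' w}" if V: "u \<in> V" "u' \<in> V" for u u'
  proof -
    obtain f where f: "f \<in> Aut" "f u = u'" using Aut_trans V by auto
    show ?thesis by (rule card_inj_on_le[of f]) (use f inv fin Aut_inj[OF f(1)] in \<open>auto intro: inj_on_subset\<close>)
  qed
  have "card {w. R w u} \<le> card {w. R w u'}" if V: "u \<in> V" "u' \<in> V" for u u'
  proof -
    obtain f where f: "f \<in> Aut" "f u = u'" using Aut_trans V by auto
    show ?thesis by (rule card_inj_on_le[of f]) (use f inv fin Aut_inj[OF f(1)] in \<open>auto intro: inj_on_subset\<close>)
  qed
  then have "in": "card {w. R w u} = card {w. R w v}" if "u \<in> V" for u using that v by (meson le_antisym)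
  have out: "card {w. R u w} = card {w. R v w}" if "u \<in> V" for u using that v out by (meson le_antisym)
  have "(\<Sum>u\<in>V. card {w\<in>V. R u w}) = (\<Sum>w\<in>V. card {u\<in>V. R u w})"
    by (rule sum_multicount_gen) (use finV in auto)
  moreover have "{w\<in>V. R u w} = {w. R u w}" "{w\<in>V. R w u} = {w. R w u}" for u using RV by auto
  ultimately have "card V * card {w. R v w} = card V * card {w. R w v}"
    using out "in" by simp
  then show ?thesis using finV nonempty by (simp add: card_gt_0_iff)
qed

end

section \<open>Twins and the clique number\<close>

context simple_graph begin

text \<open>
  The proof is an exchange argument. With \<open>M J\<close> the set of members of \<open>C\<close> not adjacent to all of \<open>J\<close>,
  purity gives \<open>card J \<le> card (M J)\<close> for every clique \<open>J\<close> of \<open>X - C\<close>, with equality if \<open>J\<close> is maximal.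
  Hence removing a maximal clique \<open>J\<close> of a set \<open>T\<close> from \<open>T\<close> costs at most \<open>card J\<close> members of \<open>M\<close>.
\<close>

lemma clique_vs_complement:
  assumes fin: "finite X" and pure: "pure X k" and C: "mcl X C"
  shows "card {c\<in>C. \<exists>x\<in>X. x \<noteq> c \<and> \<not> E c x} \<le> card (X - C)"
proof -
  define Z where "Z = X - C"
  define M where "M T = {c\<in>C. \<exists>z\<in>T. \<not> E c z}" for T
  have CX: "C \<subseteq> X" "cl C" and cardC: "card C = k" using C pure by (auto simp: mcl_def pure_def)
  have finC: "finite C" and finZ: "finite Z" using CX fin by (auto simp: Z_def intro: finite_subset)
  have finM: "finite (M T)" for T using finC by (simp add: M_def)
  have M_Un: "M (S \<union> T) = M S \<union> M T" for S T by (auto simp: M_def)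
  have clJ: "cl (J \<union> (C - M J))" if "cl J" for J
  proof -
    have 1: "E b a" "E a b" if "b \<in> C - M J" "a \<in> J" for a b
      using that sym[of b a] by (auto simp: M_def)
    show ?thesis
      unfolding cl_def
    proof (intro ballI impI)
      fix a b assume "a \<in> J \<union> (C - M J)" "b \<in> J \<union> (C - M J)" "a \<noteq> b"
      then show "E a b" using 1[of a b] 1[of b a] \<open>cl J\<close> CX(2) by (auto simp: cl_def)
    qed
  qed
  have cardJ: "card (J \<union> (C - M J)) = card J + (k - card (M J))" if "J \<subseteq> Z" for J
  proof -
    have "card (J \<union> (C - M J)) = card J + card (C - M J)"
      using that finC finZ by (intro card_Un_disjoint) (auto simp: Z_def intro: finite_subset)
    also have "card (C - M J) = k - card (M J)"
      unfolding cardC[symmetric] by (rule card_Diff_subset[OF finM]) (auto simp: M_def)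
    finally show ?thesis .
  qed
  have Mk: "card (M J) \<le> k" for J
    unfolding cardC[symmetric] by (rule card_mono[OF finC]) (auto simp: M_def)
  have ge: "card J \<le> card (M J)" if J: "cl J" "J \<subseteq> Z" for J
  proof -
    have "card (J \<union> (C - M J)) \<le> k"
      by (rule pure_cl_le[OF fin pure clJ[OF J(1)]]) (use J CX in \<open>auto simp: Z_def\<close>)
    then show ?thesis using cardJ[OF J(2)] Mk[of J] by linarith
  qed
  have le: "card (M J) \<le> card J" if J: "mcl Z J" for J
  proof -
    have JZ: "J \<subseteq> Z" "cl J" using J by (auto simp: mcl_def)
    obtain K where K: "mcl X K" "J \<union> (C - M J) \<subseteq> K"
      using ex_mcl[OF fin clJ[OF JZ(2)]] JZ CX by (auto simp: Z_def)
    \<comment> \<open>The clique cannot grow: a member of \<open>C\<close> adjacent to all of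
      \<open>J\<close> is already in \<open>C - M J\<close>, and a further vertex of
      \<open>Z\<close> would extend the maximal clique \<open>J\<close> of \<open>Z\<close>.\<close>
    have "K \<subseteq> J \<union> (C - M J)"
    proof
      fix x assume x: "x \<in> K"
      have adj: "y = x \<or> E y x" if "y \<in> K" for y using K(1) that x by (auto simp: mcl_def cl_def)
      show "x \<in> J \<union> (C - M J)"
      proof (cases "x \<in> C")
        case True
        then have "E x y" if "y \<in> J" for y using adj[of y] that K(2) JZ(1) sym[of y x] True by (auto simp: Z_def)
        then show ?thesis using True by (auto simp: M_def)
      next
        case False
        then have "x \<in> Z" using x K(1) by (auto simp: Z_def mcl_def)
        have "x \<in> J"
        proof (rule ccontr)
          assume "x \<notin> J"
          then obtain u where "u \<in> J" "\<not> E u x" using J \<open>x \<in> Z\<close> by (auto simp: mcl_def)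
          then show False using adj[of u] K(2) \<open>x \<notin> J\<close> by auto
        qed
        then show ?thesis by simp
      qed
    qed
    then have "K = J \<union> (C - M J)" using K(2) by (rule subset_antisym)
    moreover have "card K = k" using K(1) pure by (simp add: pure_def)
    ultimately have "card J + (k - card (M J)) = k" using cardJ[OF JZ(1)] by simp
    then show ?thesis using Mk[of J] by linarith
  qed
  have "card (M Z) \<le> card (M (Z - T)) + card T" if "T \<subseteq> Z" for T
    using finite_subset[OF that finZ] that
  proof (induction T rule: finite_psubset_induct)
    case (psubset T)
    show ?case
    proof (cases "T = {}")
      case False
      then obtain t where t: "t \<in> T" by auto
      obtain J where J: "mcl T J" "{t} \<subseteq> J" using ex_mcl[of T "{t}"] psubset t by (auto simp: cl_def)
      then have JT: "J \<subseteq> T" "cl J" by (auto simp: mcl_def)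
      obtain L where L: "mcl Z L" "J \<subseteq> L" using ex_mcl[OF finZ JT(2)] JT psubset by auto
      have LT: "x \<in> J" if "x \<in> L" "x \<in> T" for x
        using mcl_max[OF J(1) that(2)] mcl_adj[OF L(1) that(1)] L(2) by auto
      have sub: "L - J \<subseteq> Z - T" "L \<subseteq> Z" "cl (L - J)" using L LT by (auto simp: mcl_def cl_def)
      have finL: "finite L" using sub finZ finite_subset by auto
      have 1: "card (M L - M (L - J)) \<le> card J"
      proof -
        have "card (M L - M (L - J)) = card (M L) - card (M (L - J))"
          by (rule card_Diff_subset[OF finM]) (auto simp: M_def)
        moreover have "card (M (L - J)) \<ge> card (L - J)" using ge[of "L - J"] sub by auto
        moreover have "card (L - J) = card L - card J" "card J \<le> card L"
          using finL L by (auto intro: card_Diff_subset card_mono finite_subset)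
        ultimately show ?thesis using le[OF L(1)] by linarith
      qed
      \<comment> \<open>As \<open>J\<close> is maximal in \<open>T\<close>, the rest
        \<open>L - J\<close> lies in \<open>Z - T\<close>. So what putting \<open>J\<close> back
        adds to \<open>M (Z - T)\<close> lies in \<open>M L - M (L - J)\<close>, which has at most
        \<open>card L - card (L - J) = card J\<close> elements.\<close>
      have "M (Z - (T - J)) \<subseteq> M (Z - T) \<union> (M L - M (L - J))"
        using sub L LT JT by (auto simp: M_def)
      then have "card (M (Z - (T - J))) \<le> card (M (Z - T) \<union> (M L - M (L - J)))"
        by (intro card_mono) (auto simp: finM)
      also have "\<dots> \<le> card (M (Z - T)) + card J" using card_Un_le[of "M (Z - T)" "M L - M (L - J)"] 1 by linarith
      finally have 2: "card (M (Z - (T - J))) \<le> card (M (Z - T)) + card J" .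
      have 3: "card (M Z) \<le> card (M (Z - (T - J))) + card (T - J)"
        by (rule psubset.IH) (use t J psubset.prems in auto)
      have "card (T - J) = card T - card J" "card J \<le> card T"
        using JT psubset by (auto intro: card_Diff_subset card_mono finite_subset)
      then show ?thesis using 2 3 by linarith
    qed simp
  qed
  from this[of Z] have "card (M Z) \<le> card Z" by (simp add: M_def)
  moreover have "{c\<in>C. \<exists>x\<in>X. x \<noteq> c \<and> \<not> E c x} \<subseteq> M Z"
    using CX by (auto simp: M_def Z_def cl_def)
  then have "card {c\<in>C. \<exists>x\<in>X. x \<noteq> c \<and> \<not> E c x} \<le> card (M Z)" by (rule card_mono[OF finM])
  ultimately show ?thesis by (simp add: Z_def)
qed

end

context cis_graph begin

definition N :: "'a \<Rightarrow> 'a set" where "N v = {w. E v w}"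

lemma mem_N [simp]: "w \<in> N v \<longleftrightarrow> E v w" by (simp add: N_def)

lemma N_nb: "N v = nb V v" using EV2 by (auto simp: nb_def)

lemma finite_N [simp]: "finite (N v)" using finV by (simp add: N_nb nb_def)

lemma card_N: "v \<in> V \<Longrightarrow> card (N v) = d" using regular by (simp add: N_def)

lemma cis_N: "v \<in> V \<Longrightarrow> cis (N v)" using cis_nb[OF cisV] by (simp add: N_nb)

definition cn :: "'a \<Rightarrow> 'a set" where "cn v = insert v (N v)"

definition twins :: "'a \<Rightarrow> 'a set" where "twins v = {w\<in>V. cn w = cn v}"

lemma finite_cn [simp]: "finite (cn v)" by (simp add: cn_def)

lemma card_cn: "v \<in> V \<Longrightarrow> card (cn v) = Suc d" using card_N irrefl by (simp add: cn_def)

lemma finite_twins: "finite (twins v)" using finV by (simp add: twins_def)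

lemma Aut_cn: "f \<in> Aut \<Longrightarrow> cn (f v) = f ` cn v"
proof -
  assume f: "f \<in> Aut"
  have "x \<in> f ` N v" if "E (f v) x" for x
    using Aut_surj[OF f, of x] Aut_E[OF f] that by auto
  then show ?thesis using Aut_E[OF f] by (auto simp: cn_def)
qed

lemma card_twins:
  assumes "u \<in> V" "v \<in> V" shows "card (twins u) = card (twins v)"
proof -
  have le: "card (twins u) \<le> card (twins v)" if uv: "u \<in> V" "v \<in> V" for u v
  proof -
    obtain f where f: "f \<in> Aut" "f u = v" using Aut_trans uv by auto
    show ?thesis
    proof (rule card_inj_on_le[of f])
      show "inj_on f (twins u)" using Aut_inj[OF f(1)] by (auto intro: inj_on_subset)
      show "f ` twins u \<subseteq> twins v" using f Aut_cn[OF f(1)] Aut_V[OF f(1)] by (auto simp: twins_def)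
    qed (rule finite_twins)
  qed
  show ?thesis using le[OF assms] le[OF assms(2,1)] by simp
qed

end

locale pure_cis_graph = cis_graph +
  fixes k :: nat assumes pureV: "pure V k"
begin

lemma pure_N: "v \<in> V \<Longrightarrow> pure (N v) (k - 1)"
proof -
  assume v: "v \<in> V"
  have "1 \<le> k" using pure_cl_le[OF finV pureV, of "{v}"] v by (auto simp: cl_def)
  then show ?thesis using pure_nb[OF finV _ v, of "k - 1"] pureV by (simp add: N_nb)
qed

lemma twins_sub_mcl:
  assumes "mcl V K" "v \<in> K" shows "twins v \<subseteq> K"
proof
  fix w assume w: "w \<in> twins v"
  show "w \<in> K"
  proof (rule ccontr)
    assume "w \<notin> K"
    then obtain u where u: "u \<in> K" "u \<noteq> w" "\<not> E w u"
      using w mcl_max[OF assms(1), of w] by (auto simp: twins_def)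
    then have "u \<in> cn v" using mcl_adj[OF assms(1,2), of u] by (auto simp: cn_def)
    then have "u \<in> cn w" using w by (simp add: twins_def)
    then show False using u \<open>w \<notin> K\<close> by (auto simp: cn_def)
  qed
qed

lemma mem_twins: "v \<in> V \<Longrightarrow> v \<in> twins v"
  by (simp add: twins_def)

text \<open>A maximal clique contains the twin class of each of its vertices, and by transitivity
  all twin classes have the same size.\<close>

lemma twins_dvd:
  assumes "v \<in> V" shows "card (twins v) dvd k"
proof -
  obtain K where K: "mcl V K" using ex_mcl[OF finV, of "{}"] by (auto simp: cl_def)
  have sub: "K \<subseteq> V" using K by (simp add: mcl_def)
  have "\<Union> (twins ` K) = K" using twins_sub_mcl[OF K] mem_twins sub by blast
  moreover have "card (twins v) dvd card (\<Union> (twins ` K))"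
  proof (rule dvd_partition)
    show "finite (\<Union> (twins ` K))" using finite_subset[OF sub finV] finite_twins by blast
    show "\<forall>c\<in>twins ` K. card (twins v) dvd card c" using card_twins[OF assms] sub by auto
    show "\<forall>c1\<in>twins ` K. \<forall>c2\<in>twins ` K. c1 \<noteq> c2 \<longrightarrow> c1 \<inter> c2 = {}" by (auto simp: twins_def)
  qed
  ultimately show ?thesis using K pureV by (simp add: pure_def)
qed

text \<open>The closed neighbourhood of \<open>v\<close> lies in that of \<open>c\<close>, and by
  regularity both have \<open>d + 1\<close> elements.\<close>

lemma universal_twin:
  assumes "v \<in> V" "E v c" "\<And>x. E v x \<Longrightarrow> x \<noteq> c \<Longrightarrow> E c x"
  shows "c \<in> twins v"
proof -
  have c: "c \<in> V" using assms EV2 by auto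
  have "cn v \<subseteq> cn c" using assms(3) sym[OF assms(2)] by (fastforce simp: cn_def)
  then have "cn v = cn c" using card_subset_eq[of "cn c" "cn v"] by (simp add: card_cn assms c)
  then show ?thesis using c by (simp add: twins_def)
qed

text \<open>\<open>clique_vs_complement\<close> is applied in the neighbourhood of \<open>v\<close>,
  to a maximal clique through \<open>v\<close> with \<open>v\<close> removed. The members of that
  clique which it does not count are adjacent to every other neighbour of \<open>v\<close>, hence
  are twins of \<open>v\<close>; there are at most \<open>card (twins v) - 1\<close> of
  them.\<close>

lemma twin_bound:
  assumes v: "v \<in> V" shows "2 * k \<le> d + 1 + card (twins v)"
proof -
  obtain K where K: "mcl V K" "{v} \<subseteq> K" using ex_mcl[OF finV, of "{v}"] v by (auto simp: cl_def)
  have finK: "finite K" using K finV finite_subset by (auto simp: mcl_def)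
  define C where "C = K - {v}"
  have C: "mcl (N v) C"
    unfolding mcl_def
  proof (intro conjI ballI)
    show "C \<subseteq> N v"
    proof
      fix x assume "x \<in> C"
      then show "x \<in> N v" using mcl_adj[OF K(1), of v x] K(2) by (auto simp: C_def)
    qed
    show "cl C" using mcl_adj[OF K(1)] by (simp add: C_def cl_def)
    fix x assume x: "x \<in> N v - C"
    then have "x \<notin> K" using irrefl by (auto simp: C_def)
    then obtain u where u: "u \<in> K" "\<not> E x u" "u \<noteq> x" using mcl_max[OF K(1), of x] x EV2[of v x] by auto
    then have "u \<noteq> v" using x sym[of v x] by auto
    then show "\<exists>u\<in>C. \<not> E u x" using u sym[of u x] by (auto simp: C_def)
  qed
  have cardC: "card C = k - 1" "C \<subseteq> N v" using pure_N[OF v] C by (simp add: pure_def, simp add: mcl_def)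
  have "C \<subseteq> {c\<in>C. \<exists>x\<in>N v. x \<noteq> c \<and> \<not> E c x} \<union> (twins v - {v})"
  proof
    fix c assume c: "c \<in> C"
    show "c \<in> {c\<in>C. \<exists>x\<in>N v. x \<noteq> c \<and> \<not> E c x} \<union> (twins v - {v})"
    proof (cases "\<exists>x\<in>N v. x \<noteq> c \<and> \<not> E c x")
      case False
      then have "c \<in> twins v" by (intro universal_twin[OF v]) (use c cardC(2) in auto)
      then show ?thesis using c by (simp add: C_def)
    qed (use c in simp)
  qed
  then have "card C \<le> card ({c\<in>C. \<exists>x\<in>N v. x \<noteq> c \<and> \<not> E c x} \<union> (twins v - {v}))"
    using finK finite_twins by (intro card_mono) (auto simp: C_def)
  also have "\<dots> \<le> card {c\<in>C. \<exists>x\<in>N v. x \<noteq> c \<and> \<not> E c x} + card (twins v - {v})"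
    by (rule card_Un_le)
  also have "\<dots> \<le> card (N v - C) + (card (twins v) - 1)"
    using clique_vs_complement[OF finite_N pure_N[OF v] C] mem_twins[OF v] finite_twins by simp
  also have "card (N v - C) = d - (k - 1)"
    using cardC card_N[OF v] finite_subset[OF cardC(2)] by (simp add: card_Diff_subset)
  finally have "k - 1 \<le> d - (k - 1) + (card (twins v) - 1)" using cardC by simp
  moreover have "k - 1 \<le> d" using card_mono[OF finite_N cardC(2)] cardC card_N[OF v] by simp
  moreover have "card (twins v) \<ge> 1" using mem_twins[OF v] finite_twins
    by (metis One_nat_def Suc_leI card_gt_0_iff empty_iff)
  ultimately show ?thesis by linarith
qed

text \<open>Every maximal clique through \<open>v\<close> then coincides with the twin class of
  \<open>v\<close>. So this class is also the closed neighbourhood of \<open>v\<close>; it is closed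
  under adjacency and, by connectedness, all of \<open>V\<close>.\<close>

lemma all_twins_complete:
  assumes v: "v \<in> V" and t: "card (twins v) = k" and uw: "u \<in> V" "w \<in> V" "u \<noteq> w"
  shows "E u w"
proof -
  have cn: "cn v = twins v"
  proof (intro equalityI subsetI)
    fix w assume w: "w \<in> cn v"
    then obtain K where K: "mcl V K" "{v,w} \<subseteq> K"
      using ex_mcl[OF finV, of "{v,w}"] v sym[of v w] EV2[of v w] by (auto simp: cl_def cn_def)
    then have "twins v = K"
      using twins_sub_mcl[OF K(1), of v] pureV t finV
      by (metis card_subset_eq finite_subset insert_subset mcl_def pure_def)
    then show "w \<in> twins v" using K by auto
  next
    fix w assume "w \<in> twins v"
    then show "w \<in> cn v" by (metis (mono_tags, lifting) cn_def insertI1 mem_Collect_eq twins_def)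
  qed
  have "twins v = V"
  proof (rule connectedE)
    fix a b assume "a \<in> twins v" "E a b"
    then show "b \<in> twins v" using cn by (auto simp: twins_def cn_def)
  qed (use mem_twins[OF v] in \<open>auto simp: twins_def\<close>)
  then have "u \<in> twins v" "w \<in> twins v" using uw by auto
  then have "w \<in> cn u" by (auto simp: twins_def cn_def)
  then show ?thesis using uw by (auto simp: cn_def)
qed

lemma small_cases:
  assumes "d \<le> 7" "v \<in> V"
  shows "(\<forall>u\<in>V. \<forall>w\<in>V. u \<noteq> w \<longrightarrow> E u w) \<or>
    (k \<in> {2,3,4} \<and> card (twins v) = 1) \<or> k = 4 \<and> card (twins v) = 2"
proof (cases "card (twins v) = k")
  case True
  then show ?thesis using all_twins_complete assms by blast
next
  case False
  obtain m where m: "k = card (twins v) * m" using twins_dvd[OF assms(2)] by (auto elim: dvdE)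
  have t: "card (twins v) > 0" using mem_twins[OF assms(2)] finite_twins card_gt_0_iff by blast
  have k: "k > 0" using pure_cl_le[OF finV pureV, of "{v}"] assms by (auto simp: cl_def)
  \<comment> \<open>A proper divisor \<open>t\<close> of \<open>k\<close> satisfies
    \<open>2 * t \<le> k\<close>. With \<open>2 * k \<le> d + 1 + t \<le> 8 + t\<close> this leaves
    \<open>k \<le> 5\<close>, and \<open>k = 5\<close> fails because then
    \<open>t = 1\<close>.\<close>
  have "m \<ge> 2" using False m k by (cases m; cases "m - 1") auto
  then have tk: "2 * card (twins v) \<le> k" using m mult_le_mono2[of 2 m "card (twins v)"] by simp
  then have "k \<le> 5" using twin_bound[OF assms(2)] assms(1) by linarith
  then have "k \<in> {1,2,3,4,5}" using k by auto
  moreover have "card (twins v) \<in> {1,2}" using tk t \<open>k \<le> 5\<close> by auto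
  ultimately show ?thesis using tk twins_dvd[OF assms(2)] twin_bound[OF assms(2)] assms(1) by auto
qed

lemma complete_card:
  assumes "\<forall>u\<in>V. \<forall>w\<in>V. u \<noteq> w \<longrightarrow> E u w"
  shows "card V = Suc d"
proof -
  obtain v where v: "v \<in> V" using nonempty by auto
  then have "x \<in> cn v" if "x \<in> V" for x using assms that by (auto simp: cn_def)
  moreover have "cn v \<subseteq> V" using v EV2[of v] by (auto simp: cn_def)
  ultimately have "V = cn v" by auto
  then show ?thesis using card_cn[OF v] by simp
qed

text \<open>The parts are the neighbourhoods of the two ends of an edge. Difunctionality joins them
  completely and makes their union closed under adjacency.\<close>

lemma bipartite_case:
  assumes k: "k = 2"
  shows "\<exists>A B. A \<inter> B = {} \<and> A \<union> B = V \<and> card A = d \<and> card B = d \<and>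
    (\<forall>x\<in>V. \<forall>y\<in>V. E x y \<longleftrightarrow> x \<in> A \<and> y \<in> B \<or> x \<in> B \<and> y \<in> A)"
proof -
  have p: "pure V 2" using pureV k by simp
  note tf = pure2_triangle_free[OF finV p] and link_difunctional = pure2_difunctional[OF finV cisV p]
  obtain v where v: "v \<in> V" using nonempty by auto
  then obtain w where w: "w \<in> V" "E v w" using pure_ex_nb[OF finV p] by auto
  have sub: "N v \<subseteq> V" "N w \<subseteq> V" using EV2 by auto
  have disj: "N w \<inter> N v = {}" using tf[OF v w(1) _ w(2)] EV2 by auto
  have E1: "E x y" if "E w x" "E v y" for x y
    using link_difunctional[of x w v y] that v w EV2[OF that(1)] EV2[OF that(2)] sym[OF that(1)] sym[OF w(2)] by simp
  have E2: "\<not> E x y" if "E w x" "E w y" for x y using tf that w EV2 by blast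
  have E3: "\<not> E x y" if "E v x" "E v y" for x y using tf that v EV2 by blast
  have "N w \<union> N v = V"
  proof (rule connectedE)
    fix a b assume ab: "a \<in> N w \<union> N v" "E a b"
    then have V: "a \<in> V" "b \<in> V" using EV EV2 by auto
    from ab(1) show "b \<in> N w \<union> N v"
    proof
      assume "a \<in> N w"
      then have "E b v" using link_difunctional[of b a w v] ab V v w sym[OF ab(2)] sym[of w a] sym[OF w(2)] by simp
      then show ?thesis using sym[of b v] by simp
    next
      assume "a \<in> N v"
      then have "E b w" using link_difunctional[of b a v w] ab V v w sym[OF ab(2)] sym[of v a] by simp
      then show ?thesis using sym[of b w] by simp
    qed
  qed (use sub w in auto)
  moreover have "E x y \<longleftrightarrow> x \<in> N w \<and> y \<in> N v \<or> x \<in> N v \<and> y \<in> N w" if "x \<in> N w \<union> N v" "y \<in> N w \<union> N v" for x y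
    using that disj E1[of x y] E1[of y x] E2[of x y] E3[of x y] sym[of x y] sym[of y x] by auto
  ultimately have "\<forall>x\<in>V. \<forall>y\<in>V. E x y \<longleftrightarrow> x \<in> N w \<and> y \<in> N v \<or> x \<in> N v \<and> y \<in> N w" "N w \<union> N v = V"
    by (metis, metis)
  with disj card_N[OF w(1)] card_N[OF v] show ?thesis
    by (intro exI[of _ "N w"] exI[of _ "N v"] conjI)
qed

end

section \<open>Clique number three\<close>

context cis_graph begin

lemma Aut_N: "f \<in> Aut \<Longrightarrow> N (f u) = f ` N u"
proof -
  assume f: "f \<in> Aut"
  have "x \<in> f ` N u" if "E (f u) x" for x
    using Aut_surj[OF f, of x] Aut_E[OF f] that by auto
  then show ?thesis using Aut_E[OF f] by auto
qed

definition l :: "'a \<Rightarrow> 'a \<Rightarrow> nat" where "l u v = card (N u \<inter> N v)"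

lemma l_sym: "l u v = l v u"
  by (simp add: l_def Int_commute)

lemma Aut_l: "f \<in> Aut \<Longrightarrow> l (f u) (f v) = l u v"
  unfolding l_def using Aut_inj[of f]
  by (simp add: Aut_N image_Int[symmetric] card_image inj_on_subset[OF _ subset_UNIV])

lemma l_eq_1D: "l u v = 1 \<Longrightarrow> E u x \<Longrightarrow> E v x \<Longrightarrow> E u y \<Longrightarrow> E v y \<Longrightarrow> x = y"
  unfolding l_def One_nat_def card_1_singleton_iff by (metis IntI mem_N singletonD)

lemma l_pos: "E u w \<Longrightarrow> E v w \<Longrightarrow> l u v > 0"
  unfolding l_def by (auto simp: card_gt_0_iff)

lemma nonadjacency_transitive:
  assumes "\<And>x y z. E x z \<Longrightarrow> y \<in> V \<Longrightarrow> E y x \<or> E y z"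
    and "x \<in> V" "y \<in> V" "z \<in> V" "\<not> E x y" "\<not> E y z"
  shows "\<not> E x z"
  using assms(1)[of x z y] assms(3,5,6) sym[of y x] by auto

end

section \<open>Structure of the links for clique number three\<close>

locale cis_graph_3 = pure_cis_graph E V d 3 for E :: "'a \<Rightarrow> 'a \<Rightarrow> bool" and V d
begin

definition tri :: "'a \<Rightarrow> 'a \<Rightarrow> 'a \<Rightarrow> bool" where
  "tri u v w \<longleftrightarrow> E u v \<and> E u w \<and> E v w"

lemma tri_perm: "tri u v w \<Longrightarrow> tri u w v" "tri u v w \<Longrightarrow> tri v u w" "tri u v w \<Longrightarrow> tri v w u"
    "tri u v w \<Longrightarrow> tri w u v" "tri u v w \<Longrightarrow> tri w v u"
  unfolding tri_def by (simp_all add: sym_iff)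

lemma triD: "tri u v w \<Longrightarrow> E u v" "tri u v w \<Longrightarrow> E u w" "tri u v w \<Longrightarrow> E v w"
   "tri u v w \<Longrightarrow> E v u" "tri u v w \<Longrightarrow> E w u" "tri u v w \<Longrightarrow> E w v"
  unfolding tri_def by (simp_all add: sym_iff)

lemma K4_free: "E a b \<Longrightarrow> E a c \<Longrightarrow> E a e \<Longrightarrow> E b c \<Longrightarrow> E b e \<Longrightarrow> E c e \<Longrightarrow> False"
  using pure2_triangle_free[of "N a" b c e] pure_N[of a] EV[of a b] by simp

lemma link_difunctional: "E u a \<Longrightarrow> E u b \<Longrightarrow> E u c \<Longrightarrow> E u e \<Longrightarrow> E a b \<Longrightarrow> E b c \<Longrightarrow> E c e \<Longrightarrow> E a e"
  using pure2_difunctional[of "N u" a b c e] pure_N[of u] cis_N[of u] EV[of u a] by simp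

lemma ex_tri: "E u v \<Longrightarrow> \<exists>w. tri u v w"
  using pure_ex_nb[of "N u" 2 v] pure_N[of u] EV[of u v] by (auto simp: tri_def)

text \<open>Pairwise non-adjacent \<open>a\<close>, \<open>b\<close>, \<open>c\<close> would form a
  stable set dominating the maximal clique \<open>{u,v,w}\<close>.\<close>

lemma transversal:
  assumes "tri u v w" "E u a" "E v b" "E w c" shows "E a b \<or> E a c \<or> E b c"
proof (rule ccontr)
  assume no: "\<not> ?thesis"
  have ne: "u \<noteq> v" "u \<noteq> w" "v \<noteq> w" using triD(1-3)[OF assms(1)] neq by blast+
  have "mcl V {u,v,w}"
    by (rule pure_cl_mcl[OF finV pureV])
      (use triD[OF assms(1)] ne EV[of u v] EV[of v u] EV[of w u] in \<open>auto simp: cl_def card_insert_if\<close>)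
  moreover have "st {a,b,c}" using no sym[of b a] sym[of c a] sym[of c b] by (auto simp: st_def irrefl)
  moreover have "{a,b,c} \<subseteq> V" using assms EV2 by auto
  ultimately show False using cisD[OF cisV, of "{u,v,w}" "{a,b,c}"] assms by auto
qed

text \<open>In the link of \<open>u\<close>, both \<open>x\<close> and \<open>v\<close> are adjacent
  to \<open>w\<close>. Hence they lie in the same part of the same complete bipartite component and
  have the same neighbours there.\<close>

lemma block_eq:
  assumes "tri u v w" "E u x" "E x w" shows "N u \<inter> N x = N u \<inter> N v"
proof -
  note t = triD[OF assms(1)]
  have "E x y \<longleftrightarrow> E v y" if "E u y" for y
    using link_difunctional[of u y x w v] link_difunctional[of u y v w x] that t assms sym[of x w]
      sym_iff[of y x] sym_iff[of y v] by auto
  then show ?thesis by auto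
qed

lemma block_l: "tri u v w \<Longrightarrow> E u x \<Longrightarrow> E x w \<Longrightarrow> l u x = l u v"
  using block_eq[of u v w x] by (simp add: l_def)

text \<open>
  The link of \<open>u\<close> is a disjoint union of complete bipartite graphs. If \<open>u v w\<close> is a triangle, then
  \<open>comp u v w\<close> is the component of the edge \<open>v w\<close>, whose parts have sizes \<open>l u v\<close> and \<open>l u w\<close>.
\<close>

definition comp :: "'a \<Rightarrow> 'a \<Rightarrow> 'a \<Rightarrow> 'a set" where
  "comp u v w = (N u \<inter> N v) \<union> (N u \<inter> N w)"

lemma card_comp: "tri u v w \<Longrightarrow> card (comp u v w) = l u v + l u w"
  unfolding comp_def l_def
  by (rule card_Un_disjoint) (use K4_free[of u v w] in \<open>auto simp: tri_def\<close>)

lemma comp_sub: "comp u v w \<subseteq> N u" by (auto simp: comp_def)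

lemma comp_disjoint:
  assumes "tri u v w" "tri u x y" "x \<notin> comp u v w"
  shows "comp u x y \<inter> comp u v w = {}"
proof -
  note t = triD[OF assms(1)] triD[OF assms(2)]
  have x: "\<not> E x v" "\<not> E x w" using assms(3) t(7) sym[of x v] sym[of x w] by (auto simp: comp_def)
  have y: "\<not> E y v" "\<not> E y w" using link_difunctional[of u x y v w] link_difunctional[of u x y w v] t x by auto
  have False if "E u z" "E z x \<or> E z y" "E z v \<or> E z w" for z
    using that link_difunctional[of u x z v w] link_difunctional[of u x z w v] link_difunctional[of u y z v w] link_difunctional[of u y z w v] x y t(1-3,6-9)
      sym[of z x] sym[of z y] by auto
  note F = this
  have "z \<notin> comp u v w" if "z \<in> comp u x y" for z
    using F[of z] that sym_iff[of z x] sym_iff[of z y] sym_iff[of z v] sym_iff[of z w]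
    by (simp add: comp_def) blast
  then show ?thesis by blast
qed

text \<open>The edge \<open>x y\<close> runs between the two parts of the component of
  \<open>v w\<close>, so its ends have the degrees of \<open>v\<close> and \<open>w\<close> in one
  of the two orders.\<close>

lemma comp_same:
  assumes "tri u v w" "tri u x y" "x \<in> comp u v w"
  shows "(l u x = l u w \<and> l u y = l u v) \<or> (l u x = l u v \<and> l u y = l u w)"
proof -
  note t = triD[OF assms(1)] triD[OF assms(2)]
  have "E x v \<or> E x w" using assms(3) sym[of v x] sym[of w x] by (auto simp: comp_def)
  then show ?thesis
  proof
    assume xv: "E x v"
    then have "E y w" using link_difunctional[of u y x v w] t by blast
    then show ?thesis using block_l[OF tri_perm(1)[OF assms(1)], of x] block_l[OF assms(1), of y] xv t by auto
  next
    assume xw: "E x w"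
    then have "E y v" using link_difunctional[of u y x w v] t by blast
    then show ?thesis using block_l[OF assms(1), of x] block_l[OF tri_perm(1)[OF assms(1)], of y] xw t by auto
  qed
qed

text \<open>Edges of the link of \<open>u\<close> with different pairs of degrees lie in different
  components, which are disjoint subsets of \<open>N u\<close>.\<close>

lemma two_comps:
  assumes "tri u v w" "tri u x y"
    and "\<not> ((l u x = l u w \<and> l u y = l u v) \<or> (l u x = l u v \<and> l u y = l u w))"
  shows "l u v + l u w + (l u x + l u y) \<le> d"
proof -
  have "comp u x y \<inter> comp u v w = {}" using comp_disjoint[OF assms(1,2)] comp_same[OF assms(1,2)] assms(3) by blast
  then have "card (comp u v w \<union> comp u x y) = card (comp u v w) + card (comp u x y)"
    by (intro card_Un_disjoint) (auto simp: comp_def)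
  moreover have "card (comp u v w \<union> comp u x y) \<le> card (N u)"
    by (intro card_mono) (auto simp: comp_def)
  moreover have "u \<in> V" using triD[OF assms(1)] EV by blast
  ultimately show ?thesis using card_N[of u] by (simp add: card_comp assms)
qed

text \<open>Only one corner can be prescribed: the type of a triangle at \<open>u\<close> reappears
  at every vertex, with no control over the other two corners.\<close>

lemma Aut_tri:
  assumes "tri u v w" "u' \<in> V"
  shows "\<exists>v' w'. tri u' v' w' \<and> l u' v' = l u v \<and> l u' w' = l u w \<and> l v' w' = l v w"
proof -
  have "u \<in> V" using triD[OF assms(1)] EV by blast
  then obtain f where f: "f \<in> Aut" "f u = u'" using Aut_trans assms(2) by blast
  then have "tri u' (f v) (f w)" using assms(1) Aut_E[OF f(1)] by (auto simp: tri_def)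
  then show ?thesis using Aut_l[OF f(1)] f(2) by metis
qed

lemma connected_link:
  assumes uvw: "tri u v w" and conn: "\<And>x. E u x \<Longrightarrow> E x v \<or> E x w"
    and xz: "E x z" and y: "y \<in> V"
  shows "E y x \<or> E y z"
proof -
  have c: "E y q \<or> E y r" if "tri p q r" "E p y" for p q r y
  proof -
    have "u \<in> V" "p \<in> V" using triD[OF uvw] triD[OF that(1)] EV by blast+
    then obtain f where f: "f \<in> Aut" "f u = p" using Aut_trans by blast
    have fc: "E x (f v) \<or> E x (f w)" if "E p x" for x
      using Aut_surj[OF f(1), of x] conn that Aut_E[OF f(1)] f(2) by metis
    have ft: "tri p (f v) (f w)" using uvw Aut_E[OF f(1)] f(2) by (auto simp: tri_def)
    note t = triD[OF ft] triD[OF that(1)]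
    note D = link_difunctional[of p]
    from fc[of y] fc[of q] that(2) t show ?thesis
      using D[of y "f v" q r] D[of y "f w" q r] D[of y "f v" "f w" q] D[of y "f w" "f v" q]
        sym[of q "f v"] sym[of q "f w"] by auto
  qed
  have "{y\<in>V. E y x \<or> E y z} = V"
  proof (rule connectedE)
    show "{y\<in>V. E y x \<or> E y z} \<noteq> {}" using xz EV by auto
    \<comment> \<open>Being adjacent to an end of \<open>x z\<close> is passed from \<open>a\<close>
      to its neighbour \<open>b\<close> by applying \<open>c\<close> in triangles that share edges
      with a triangle \<open>x z w\<close>.\<close>
    have step: "E b x \<or> E b z" if "E a b" "E a x" "E x z" for a b x z
    proof -
      obtain w where w: "tri x z w" using ex_tri \<open>E x z\<close> by blast
      note t = triD[OF w]
      have ax: "E x a" by (rule sym) (rule that(2))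
      show ?thesis
      proof (cases "E a z")
        case True
        then show ?thesis using c[of a x z b] that by (auto simp: tri_def)
      next
        case False
        then have aw: "E a w" using c[OF w, of a] ax by auto
        then have "E b x \<or> E b w" using c[of a x w b] that t by (auto simp: tri_def)
        then show ?thesis using c[of w x z b] t sym[of b w] by (auto simp: tri_def)
      qed
    qed
    fix a b assume "a \<in> {y \<in> V. E y x \<or> E y z}" "E a b"
    then show "b \<in> {y \<in> V. E y x \<or> E y z}"
      using step[of a b x z] step[of a b z x] xz sym[OF xz] EV2 by blast
  qed auto
  then show ?thesis using y by auto
qed

end

section \<open>Triangle types when the links are disconnected\<close>

locale cis_graph_3_disconnected = cis_graph_3 +
  assumes d7: "d \<le> 7"
    and disconnected: "tri u v w \<Longrightarrow> \<exists>x. E u x \<and> \<not> E x v \<and> \<not> E x w"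
begin

lemma tri_V: "tri u v w \<Longrightarrow> u \<in> V \<and> v \<in> V \<and> w \<in> V"
  using triD[of u v w] EV[of u v] EV[of v u] EV[of w u] by auto

lemma tri_l_pos: "tri u v w \<Longrightarrow> 0 < l u v \<and> 0 < l u w \<and> 0 < l v w"
  using triD[of u v w] l_pos[of u w v] l_pos[of u v w] l_pos[of v u w] by auto

lemma mem_comp: "z \<in> comp u v w \<longleftrightarrow> E u z \<and> (E v z \<or> E w z)"
  by (auto simp: comp_def)

lemma finite_comp [simp]: "finite (comp u v w)"
  by (simp add: comp_def)

lemma other_comp:
  assumes "tri u v w"
  shows "\<exists>x y. tri u x y \<and> x \<notin> comp u v w \<and> comp u x y \<inter> comp u v w = {}"
proof -
  obtain x where x: "E u x" "\<not> E x v" "\<not> E x w" using disconnected[OF assms] by blast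
  then obtain y where y: "tri u x y" using ex_tri by blast
  have "x \<notin> comp u v w" using x sym[of v x] sym[of w x] by (auto simp: mem_comp)
  then show ?thesis using comp_disjoint[OF assms y] y by blast
qed

lemma card_two_comps:
  assumes "tri u v w" "tri u x y" "comp u x y \<inter> comp u v w = {}"
  shows "card (comp u v w \<union> comp u x y) = l u v + l u w + (l u x + l u y)"
  using card_Un_disjoint[of "comp u v w" "comp u x y"] assms(3) card_comp[OF assms(1)] card_comp[OF assms(2)]
  by (simp add: Int_commute)

lemma card_N_tri: "tri u v w \<Longrightarrow> card (N u) = d"
  using tri_V card_N by blast

lemma tri_bound:
  assumes "tri u v w" shows "l u v + l u w \<le> 5"
proof -
  obtain x y where x: "tri u x y" "comp u x y \<inter> comp u v w = {}" using other_comp[OF assms] by blast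
  have "l u v + l u w + (l u x + l u y) \<le> d"
    using card_mono[of "N u" "comp u v w \<union> comp u x y"] card_N_tri[OF assms]
    by (simp add: comp_sub card_two_comps[OF assms x])
  then show ?thesis using tri_l_pos[OF x(1)] d7 by linarith
qed

text \<open>
  The digits in the names below are the numbers of common neighbours along the three sides of a
  triangle. The components of the links at its corners must fit into at most seven neighbours; where
  this does not suffice, counting an invariant relation in both directions gives the contradiction.
\<close>

lemma no_triangle_322: assumes "tri u v w" "l u v = 3" "l u w = 2" "l v w = 2" shows False
proof -
  obtain x y where x: "tri w x y" "l w x = 3" "l w y = 2" using Aut_tri[OF assms(1)] tri_V[OF assms(1)] assms by metis
  have "l w u = 2" "l w v = 2" using assms l_sym by auto
  \<comment> \<open>The link of \<open>w\<close> would need components of orders 4 and 5.\<close>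
  then show False using two_comps[OF tri_perm(4)[OF assms(1)] x(1)] x d7 by simp
qed

text \<open>The link of \<open>v\<close> would need components of orders 4 and 5.\<close>

lemma no_triangle_321: assumes "tri u v w" "l u v = 3" "l u w = 2" "l v w = 1" shows False
proof -
  obtain x y where x: "tri v x y" "l v x = 3" "l v y = 2" using Aut_tri[OF assms(1)] tri_V[OF assms(1)] assms by metis
  have "l v u = 3" using assms l_sym by auto
  then show False using two_comps[OF tri_perm(2)[OF assms(1)] x(1)] x d7 assms(4) by simp
qed

text \<open>All four vertices in the component of \<open>v w\<close> in the link of \<open>u\<close>
  are related to \<open>u\<close>, whereas the vertices to which \<open>u\<close> is related lie
  outside this component. So the in-degree of \<open>R\<close> is at least 4 and its out-degree at
  most \<open>d - 4\<close>.\<close>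

lemma no_triangle_221: assumes t: "tri u v w" "l u v = 2" "l u w = 2" "l v w = 1" shows False
proof -
  define R where "R a b \<longleftrightarrow> (\<exists>c. tri a b c \<and> l a b = 2 \<and> l a c = 1)" for a b
  have u: "u \<in> V" using tri_V[OF t(1)] by simp
  have mt: "card {b. R u b} = card {a. R a u}"
  proof (rule mass_transport[OF _ _ u])
    fix f a b assume "f \<in> Aut" "R a b"
    then show "R (f a) (f b)" unfolding R_def tri_def using Aut_E Aut_l by metis
  qed (use tri_V R_def in blast)
  have "comp u v w \<subseteq> {a. R a u}"
  proof
    fix x assume x: "x \<in> comp u v w"
    have gen: "R x u" if "tri u v w" "l u v = 2" "l u w = 2" "l v w = 1" "E u x" "E v x" for v w
    proof -
      have "E x v" using that(6) by (rule sym)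
      have "l u x = l u w" using block_l[OF tri_perm(1)[OF that(1)] that(5) \<open>E x v\<close>] .
      moreover have "l v x = l v w" using block_l[OF tri_perm(3)[OF that(1)] that(6)] sym[OF that(5)] by simp
      ultimately have "l x u = 2" "l x v = 1" using that l_sym by auto
      moreover have "tri x u v" using that triD[OF that(1)] sym by (simp add: tri_def)
      ultimately show ?thesis unfolding R_def by blast
    qed
    then show "x \<in> {a. R a u}" using x t gen[of v w] gen[of w v] tri_perm(1)[OF t(1)] l_sym[of v w]
      by (auto simp: mem_comp)
  qed
  moreover have "finite {a. R a u}"
    by (rule finite_subset[OF _ finV]) (use tri_V R_def in blast)
  ultimately have "4 \<le> card {a. R a u}" using card_mono[of "{a. R a u}" "comp u v w"] card_comp[OF t(1)] t by simp
  moreover have "{b. R u b} \<subseteq> N u - comp u v w"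
  proof
    fix b assume "b \<in> {b. R u b}"
    then obtain c where c: "tri u b c" "l u b = 2" "l u c = 1" by (auto simp: R_def)
    then have "b \<notin> comp u v w" using comp_same[OF t(1) c(1)] t by auto
    then show "b \<in> N u - comp u v w" using triD[OF c(1)] by simp
  qed
  then have "card {b. R u b} \<le> card (N u - comp u v w)" by (intro card_mono) auto
  moreover have "card (N u - comp u v w) = d - 4"
    using card_Diff_subset[of "comp u v w" "N u"] comp_sub card_N[OF u] card_comp[OF t(1)] t by simp
  ultimately show False using mt d7 by linarith
qed

text \<open>The in-degree of \<open>R\<close> is at least \<open>l u v\<close> and its out-degree at
  most \<open>d - (l u v + 1)\<close>, which leaves only the value 3 for \<open>l u v\<close> and
  both degrees. But the out-neighbours of \<open>u\<close> come in pairs, each pair being a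
  component of its link, so there cannot be three.\<close>

lemma no_triangle_k11: assumes t: "tri u v w" "l u v \<ge> 3" "l u w = 1" "l v w = 1" shows False
proof -
  define R where "R a b \<longleftrightarrow> (\<exists>c. tri a b c \<and> l a b = 1 \<and> l a c = 1)" for a b
  have u: "u \<in> V" using tri_V[OF t(1)] by simp
  have mt: "card {b. R u b} = card {a. R a u}"
  proof (rule mass_transport[OF _ _ u])
    fix f a b assume "f \<in> Aut" "R a b"
    then show "R (f a) (f b)" unfolding R_def tri_def using Aut_E Aut_l by metis
  qed (use tri_V R_def in blast)
  have "N u \<inter> N v \<subseteq> {a. R a u}"
  proof
    fix x assume x: "x \<in> N u \<inter> N v"
    then have xv: "E x v" using sym by simp
    have "l u x = l u w" using block_l[OF tri_perm(1)[OF t(1)] _ xv] x by simp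
    moreover have "l v x = l v w" using block_l[OF tri_perm(3)[OF t(1)]] x sym[of u x] by simp
    ultimately have "l x u = 1" "l x v = 1" using t l_sym by auto
    moreover have "tri x u v" using x xv sym[of u x] triD(1)[OF t(1)] by (simp add: tri_def)
    ultimately show "x \<in> {a. R a u}" unfolding R_def by blast
  qed
  moreover have "finite {a. R a u}"
    by (rule finite_subset[OF _ finV]) (use tri_V R_def in blast)
  ultimately have ge: "l u v \<le> card {a. R a u}" unfolding l_def by (intro card_mono)
  have out: "{b. R u b} \<subseteq> N u - comp u v w"
  proof
    fix b assume "b \<in> {b. R u b}"
    then obtain c where c: "tri u b c" "l u b = 1" "l u c = 1" by (auto simp: R_def)
    then have "b \<notin> comp u v w" using comp_same[OF t(1) c(1)] t by auto
    then show "b \<in> N u - comp u v w" using triD[OF c(1)] by simp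
  qed
  then have "card {b. R u b} \<le> card (N u - comp u v w)" by (intro card_mono) auto
  moreover have "card (N u - comp u v w) = d - (l u v + 1)"
    using card_Diff_subset[of "comp u v w" "N u"] comp_sub card_N[OF u] card_comp[OF t(1)] t by simp
  ultimately have 3: "l u v = 3" "card {b. R u b} = 3" "card (N u - comp u v w) = 3" using mt d7 ge t(2) by linarith+
  then have eq: "{b. R u b} = N u - comp u v w" using out by (intro card_subset_eq) auto
  obtain b c where c: "tri u b c" "l u b = 1" "l u c = 1" using 3(2)
    by (metis (mono_tags, lifting) R_def card.empty empty_Collect_eq zero_neq_numeral)
  have bR: "R u b" "R u c" using c tri_perm(1)[OF c(1)] by (auto simp: R_def)
  then have "{b,c} \<subseteq> {b. R u b}" by simp
  moreover have "card {b,c} \<le> 2" by (simp add: card_insert_if)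
  ultimately have "\<exists>e. R u e \<and> e \<noteq> b \<and> e \<noteq> c" using 3(2)
    by (metis (mono_tags, lifting) insertCI mem_Collect_eq numeral_le_iff semiring_norm(69) subsetI subset_antisym verit_la_disequality numeral_le_iff Suc_n_not_le_n eval_nat_numeral(3))
  then obtain e where e: "R u e" "e \<noteq> b" "e \<noteq> c" by blast
  then obtain g where g: "tri u e g" "l u e = 1" "l u g = 1" by (auto simp: R_def)
  have "{b,c,e,g} \<subseteq> {b. R u b}" using bR e g tri_perm(1)[OF g(1)] by (auto simp: R_def)
  moreover have "g \<noteq> b \<and> g \<noteq> c"
    using l_eq_1D[OF c(2), of c e] l_eq_1D[OF c(3), of b e] triD[OF c(1)] triD[OF g(1)] e by auto
  ultimately have "card {b,c,e,g} \<le> 3" "card {b,c,e,g} = 4"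
    using card_mono[of "{b. R u b}" "{b,c,e,g}"] 3(2) eq e triD(3)[OF c(1)] triD(3)[OF g(1)] neq
    by (auto simp: card_insert_if)
  then show False by simp
qed

lemma tri_types:
  assumes "tri u v w"
  shows "(l u v = 1 \<and> l u w = 1 \<and> l v w = 1) \<or> (l u v = 2 \<and> l u w = 2 \<and> l v w = 2) \<or>
    (l u v = 2 \<and> l u w = 1 \<and> l v w = 1) \<or> (l u v = 1 \<and> l u w = 2 \<and> l v w = 1) \<or>
    (l u v = 1 \<and> l u w = 1 \<and> l v w = 2)"
proof -
  have gen: "(l u v = 1 \<and> l u w = 1 \<and> l v w = 1) \<or> (l u v = 2 \<and> l u w = 2 \<and> l v w = 2) \<or>
      (l u v = 2 \<and> l u w = 1 \<and> l v w = 1)"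
    if t: "tri u v w" and ord: "l u v \<ge> l u w" "l u w \<ge> l v w" for u v w
  proof -
    have "l u v + l u w \<le> 5" "0 < l v w" using tri_bound[OF t] tri_l_pos[OF t] by auto
    moreover have "\<not> (l u v \<ge> 3 \<and> l u w = 1 \<and> l v w = 1)" using no_triangle_k11[OF t] by blast
    moreover have "\<not> (l u v = 2 \<and> l u w = 2 \<and> l v w = 1)" using no_triangle_221[OF t] by blast
    moreover have "\<not> (l u v = 3 \<and> l u w = 2 \<and> l v w = 1)" using no_triangle_321[OF t] by blast
    moreover have "\<not> (l u v = 3 \<and> l u w = 2 \<and> l v w = 2)" using no_triangle_322[OF t] by blast
    moreover have "(a = 1 \<and> b = 1 \<and> c = 1) \<or> (a = 2 \<and> b = 2 \<and> c = 2) \<or> (a = 2 \<and> b = 1 \<and> c = 1)"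
      if "a + b \<le> 5" "0 < c" "\<not> (a \<ge> 3 \<and> b = 1 \<and> c = 1)" "\<not> (a = 2 \<and> b = 2 \<and> c = 1)"
        "\<not> (a = 3 \<and> b = 2 \<and> c = 1)" "\<not> (a = 3 \<and> b = 2 \<and> c = 2)" "a \<ge> b" "b \<ge> c" for a b c :: nat
      using that by presburger
    ultimately show ?thesis using ord by blast
  qed
  note p = tri_perm[OF assms]
  consider "l u v \<ge> l u w" "l u w \<ge> l v w" | "l u v \<ge> l v w" "l v w \<ge> l u w" | "l u w \<ge> l u v" "l u v \<ge> l v w"
    | "l u w \<ge> l v w" "l v w \<ge> l u v" | "l v w \<ge> l u v" "l u v \<ge> l u w" | "l v w \<ge> l u w" "l u w \<ge> l u v" by linarith
  then show ?thesis
  proof cases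
    case 1 then show ?thesis using gen[OF assms] by blast
  next
    case 2 then show ?thesis using gen[OF p(2)] by (metis l_sym)
  next
    case 3 then show ?thesis using gen[OF p(1)] by (metis l_sym)
  next
    case 4 then show ?thesis using gen[OF p(4)] by (metis l_sym)
  next
    case 5 then show ?thesis using gen[OF p(3)] by (metis l_sym)
  next
    case 6 then show ?thesis using gen[OF p(5)] by (metis l_sym)
  qed
qed

end

section \<open>Triangles all of whose sides have two common neighbours\<close>

context cis_graph begin

lemma l_2D:
  assumes "l u v = 2" "E u x" "E v x" "E u y" "E v y" "E u z" "E v z"
  shows "x = y \<or> y = z \<or> x = z"
proof (rule ccontr)
  assume "\<not> ?thesis"
  then have "card {x,y,z} = 3" by auto
  moreover have "card {x,y,z} \<le> card (N u \<inter> N v)" by (rule card_mono) (use assms in auto)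
  ultimately show False using assms(1) by (simp add: l_def)
qed

lemma l_ge_2: "E u x \<Longrightarrow> E v x \<Longrightarrow> E u y \<Longrightarrow> E v y \<Longrightarrow> x \<noteq> y \<Longrightarrow> 2 \<le> l u v"
  using card_mono[of "N u \<inter> N v" "{x,y}"] by (simp add: l_def)

lemma l_eq_2D: "l u v = 2 \<Longrightarrow> \<exists>x y. x \<noteq> y \<and> E u x \<and> E v x \<and> E u y \<and> E v y"
proof -
  assume "l u v = 2"
  then obtain x y where "N u \<inter> N v = {x,y}" "x \<noteq> y" unfolding l_def card_2_iff by blast
  then have "x \<in> N u \<inter> N v" "y \<in> N u \<inter> N v" by auto
  then show ?thesis using \<open>x \<noteq> y\<close> by auto
qed

end

context cis_graph_3_disconnected begin

lemma tri_comp: "tri u v w \<Longrightarrow> v \<in> comp u v w \<and> w \<in> comp u v w"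
  using triD[of u v w] by (simp add: mem_comp)

lemma third_comp:
  assumes "tri u v w" "tri u x y" "x \<notin> comp u v w" "l u v + l u w + (l u x + l u y) < d"
  shows "\<exists>p q. tri u p q \<and> p \<notin> comp u v w \<and> p \<notin> comp u x y \<and>
     comp u p q \<inter> comp u v w = {} \<and> comp u p q \<inter> comp u x y = {} \<and>
     l u v + l u w + (l u x + l u y) + (l u p + l u q) \<le> d"
proof -
  have dis: "comp u x y \<inter> comp u v w = {}" using comp_disjoint[OF assms(1-3)] .
  have sub: "comp u v w \<union> comp u x y \<subseteq> N u" by (simp add: comp_sub)
  have "\<not> N u \<subseteq> comp u v w \<union> comp u x y"
    using card_mono[of "comp u v w \<union> comp u x y" "N u"] assms(4) card_two_comps[OF assms(1,2) dis] card_N_tri[OF assms(1)] by auto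
  then obtain p where p: "E u p" "p \<notin> comp u v w" "p \<notin> comp u x y" using mem_N by (metis UnI1 UnI2 subsetI)
  then obtain q where q: "tri u p q" using ex_tri by blast
  have d: "comp u p q \<inter> comp u v w = {}" "comp u p q \<inter> comp u x y = {}"
    using comp_disjoint[OF assms(1) q p(2)] comp_disjoint[OF assms(2) q p(3)] by auto
  have "card ((comp u v w \<union> comp u x y) \<union> comp u p q) = card (comp u v w \<union> comp u x y) + card (comp u p q)"
    by (rule card_Un_disjoint) (use d in auto)
  moreover have "card ((comp u v w \<union> comp u x y) \<union> comp u p q) \<le> card (N u)"
    by (rule card_mono) (simp_all add: comp_sub)
  ultimately show ?thesis using p q d card_N_tri[OF assms(1)] card_comp[OF q] card_two_comps[OF assms(1,2) dis] by auto
qed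

text \<open>Such a triangle forces valency 6, every link being a 4-cycle and a separate edge, and
  gives triangles \<open>u v w\<close> of type 111. Any vertex has at most two edges with a single
  common neighbour. A neighbour \<open>z\<close> of \<open>u\<close> therefore misses most of the
  outer neighbours of \<open>v\<close> and \<open>w\<close>, and the missed ones must be joined to
  each other by more such edges than are available.\<close>

lemma no_triangle_222: assumes t0: "tri u0 v0 w0" "l u0 v0 = 2" "l u0 w0 = 2" shows False
proof -
  have S: "\<exists>p q v w. tri u p q \<and> l u p = 2 \<and> l u q = 2 \<and> tri u v w \<and> l u v = 1 \<and> l u w = 1 \<and> l v w = 1 \<and>
      v \<notin> comp u p q \<and> d = 6" if u: "u \<in> V" for u
  proof -
    obtain p q where p: "tri u p q" "l u p = 2" "l u q = 2" using Aut_tri[OF t0(1) u] t0 by metis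
    obtain x y where x: "tri u x y" "x \<notin> comp u p q" "comp u x y \<inter> comp u p q = {}" using other_comp[OF p(1)] by blast
    \<comment> \<open>The 4-cycle and the single edge take six neighbours of \<open>a\<close>, and a
      seventh would need a component of its own with at least two vertices.\<close>
    have six: "l a b + l a c \<noteq> 2 \<or> d = 6" if abc: "tri a b c" for a b c
    proof (rule ccontr)
      assume *: "\<not> ?thesis"
      obtain p' q' where p': "tri a p' q'" "l a p' = 2" "l a q' = 2" using Aut_tri[OF t0(1)] tri_V[OF abc] t0 by metis
      have lt: "l a b = 1" "l a c = 1" using * tri_l_pos[OF abc] by auto
      then have b: "b \<notin> comp a p' q'" using comp_same[OF p'(1) abc] p' by auto
      have "6 \<le> d" using two_comps[OF p'(1) abc] lt p' by simp
      then have "l a p' + l a q' + (l a b + l a c) < d" using * lt p' by simp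
      then obtain r s where "tri a r s" "l a p' + l a q' + (l a b + l a c) + (l a r + l a s) \<le> d"
        using third_comp[OF p'(1) abc b] by blast
      then show False using tri_l_pos[of a r s] lt p' d7 by linarith
    qed
    have le: "l u p + l u q + (l u x + l u y) \<le> d"
      using card_two_comps[OF p(1) x(1) x(3)] card_mono[of "N u" "comp u p q \<union> comp u x y"] card_N[OF u]
      by (simp add: comp_sub)
    then have "l u x + l u y \<le> 3" using p d7 by simp
    then consider "l u x = 1 \<and> l u y = 1 \<and> l x y = 1" | "l u x = 2 \<and> l u y = 1 \<and> l x y = 1" | "l u x = 1 \<and> l u y = 2 \<and> l x y = 1" |
       "l u x = 1 \<and> l u y = 1 \<and> l x y = 2" using tri_types[OF x(1)] by auto
    then show ?thesis
    proof cases
      case 1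
      then show ?thesis using p x six[OF x(1)] by auto
    next
      case 2
      then have "d = 6" using six[OF tri_perm(4)[OF x(1)]] l_sym[of y u] l_sym[of y x] by simp
      then show ?thesis using le p 2 by simp
    next
      case 3
      then have "d = 6" using six[OF tri_perm(2)[OF x(1)]] l_sym[of x u] by simp
      then show ?thesis using le p 3 by simp
    next
      case 4
      then have d: "d = 6" using six[OF x(1)] by simp
      obtain p' q' where p': "tri x p' q'" "l x p' = 2" "l x q' = 2" using Aut_tri[OF t0(1)] tri_V[OF x(1)] t0 by metis
      have "l x u = 1" using 4 l_sym by simp
      then have "l x p' + l x q' + (l x u + l x y) \<le> d"
        by (intro two_comps[OF p'(1) tri_perm(2)[OF x(1)]]) (use 4 p' in auto)
      then show ?thesis using d 4 p' l_sym[of x u] by simp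
    qed
  qed
  obtain u where u: "u \<in> V" using nonempty by blast
  have d: "d = 6" using S[OF u] by blast
  have S2: "\<exists>p q v w. tri u p q \<and> l u p = 2 \<and> l u q = 2 \<and> v \<noteq> w \<and> E u v \<and> N u = comp u p q \<union> {v,w}" if u: "u \<in> V" for u
  proof -
    obtain p q v w where p: "tri u p q" "l u p = 2" "l u q = 2" "tri u v w" "l u v = 1" "l u w = 1" "v \<notin> comp u p q"
      using S[OF u] by blast
    have dis: "comp u v w \<inter> comp u p q = {}" using comp_disjoint[OF p(1,4,7)] .
    have "comp u p q \<union> comp u v w = N u"
      by (rule card_subset_eq) (use comp_sub card_two_comps[OF p(1,4) dis] card_N[OF u] p d in auto)
    moreover have "{v,w} = comp u v w"
      by (rule card_subset_eq) (use tri_comp[OF p(4)] card_comp[OF p(4)] p(5,6) neq[OF triD(3)[OF p(4)]] in auto)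
    ultimately show ?thesis using p neq[OF triD(3)[OF p(4)]] triD(1)[OF p(4)] by metis
  qed
  have l2: "l u z = 2" if "tri u p q" "l u p = 2" "l u q = 2" "z \<in> comp u p q" for u p q z
    using that block_l[OF that(1), of z] block_l[OF tri_perm(1)[OF that(1)], of z] sym[of p z] sym[of q z] by (auto simp: mem_comp)
  have one: "card {z. E u z \<and> l u z = 1} \<le> 2" if u: "u \<in> V" for u
  proof -
    obtain p q v w where p: "tri u p q" "l u p = 2" "l u q = 2" "N u = comp u p q \<union> {v,w}" using S2[OF u] by blast
    have "{z. E u z \<and> l u z = 1} \<subseteq> {v,w}"
    proof
      fix z assume z: "z \<in> {z. E u z \<and> l u z = 1}"
      then have "z \<in> comp u p q \<union> {v,w}" using p(4) mem_N by blast
      then show "z \<in> {v,w}" using l2[OF p(1-3), of z] z by auto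
    qed
    then have "card {z. E u z \<and> l u z = 1} \<le> card {v,w}" by (rule card_mono[rotated]) simp
    then show ?thesis by (simp add: card_insert_if split: if_splits)
  qed
  have fin: "finite {z. E u z \<and> l u z = 1}" for u by (rule finite_subset[of _ "N u"]) auto
  have three: False if "E u x" "l u x = 1" "E u y" "l u y = 1" "E u z" "l u z = 1" "x \<noteq> y" "x \<noteq> z" "y \<noteq> z" for u x y z
    using card_mono[OF fin[of u], of "{x,y,z}"] one[of u] EV[OF that(1)] that by auto
  have two: "l u z = 2" if "tri u v w" "l u v = 1" "l u w = 1" "E u z" "z \<noteq> v" "z \<noteq> w" for u v w z
  proof -
    obtain y where "tri u z y" using ex_tri \<open>E u z\<close> by blast
    then have "l u z = 1 \<or> l u z = 2" using tri_types by blast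
    then show ?thesis using three[of u v w z] that triD[OF that(1)] neq[of v w] by blast
  qed
  \<comment> \<open>Non-adjacent vertices of the 4-cycle in the link of \<open>z\<close> lie in the
    same part and so have the same neighbours there.\<close>
  have same: "N z \<inter> N a = N z \<inter> N b" if z: "E z a" "l z a = 2" "E z b" "l z b = 2" "\<not> E a b" for z a b
  proof -
    obtain p q v w where p: "tri z p q" "l z p = 2" "l z q = 2" "tri z v w" "l z v = 1" "l z w = 1" "v \<notin> comp z p q"
      using S[of z] EV[OF z(1)] by blast
    have dis: "comp z v w \<inter> comp z p q = {}" using comp_disjoint[OF p(1,4,7)] .
    have Un: "comp z p q \<union> comp z v w = N z"
      by (rule card_subset_eq) (use comp_sub card_two_comps[OF p(1,4) dis] card_N[of z] EV[OF z(1)] p d in auto)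
    have vw: "l z x = 1" if "x \<in> comp z v w" for x
      using that p block_l[OF p(4), of x] block_l[OF tri_perm(1)[OF p(4)], of x] sym[of v x] sym[of w x] by (auto simp: mem_comp)
    have c: "x \<in> comp z p q" if "E z x" "l z x = 2" for x using Un vw[of x] that mem_N by fastforce
    have ab: "E p a \<or> E q a" "E p b \<or> E q b" using c[of a] c[of b] z by (auto simp: mem_comp)
    have "E a b" if "E p a" "E q b" "tri z p q" for p q
      using link_difunctional[of z a p q b] that z triD[OF that(3)] sym[OF \<open>E p a\<close>] by blast
    then have "(E a p \<and> E b p) \<or> (E a q \<and> E b q)" using ab z(5) p(1) tri_perm(1)[OF p(1)] sym[of p a] sym[of p b] sym[of q a] sym[of q b] by blast
    then show ?thesis
      using block_eq[OF tri_perm(1)[OF p(1)] z(1)] block_eq[OF tri_perm(1)[OF p(1)] z(3)]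
       block_eq[OF p(1) z(1)] block_eq[OF p(1) z(3)] by auto
  qed
  \<comment> \<open>If \<open>l z y = 2\<close>, applying \<open>same\<close> at \<open>z\<close>
    and at \<open>y\<close> turns a common neighbour of \<open>z\<close> and \<open>y\<close> into
    one of \<open>u\<close> and \<open>v\<close>. It is therefore \<open>w\<close>, which makes
    \<open>z\<close> a second common neighbour of \<open>u\<close> and \<open>w\<close>.\<close>
  have cross: "l z y = 1" if t: "tri u v w" "l u v = 1" "l u w = 1" "l v w = 1"
    and z: "E u z" "z \<noteq> v" "z \<noteq> w" and y: "E v y" "y \<noteq> u" "y \<noteq> w" and zy: "E z y" for u v w z y
  proof (rule ccontr)
    assume "l z y \<noteq> 1"
    moreover obtain y' where "tri z y y'" using ex_tri zy by blast
    ultimately have l: "l z y = 2" using tri_types by blast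
    note td = triD[OF t(1)]
    have lu: "l z u = 2" using two[OF t(1-3) z] l_sym by simp
    have lv: "l y v = 2" using two[OF tri_perm(2)[OF t(1)], of y] t l_sym y by auto
    have uy: "\<not> E u y" using l_eq_1D[OF t(2), of y w] y td by blast
    have zv: "\<not> E z v" using l_eq_1D[OF t(2), of z w] z td sym[of z v] by blast
    have e1: "N z \<inter> N u = N z \<inter> N y" using same[of z u y] lu l uy z(1) zy sym by blast
    have e2: "N y \<inter> N z = N y \<inter> N v" using same[of y z v] lv l l_sym zv y(1) zy sym by metis
    obtain c where c: "E z c" "E y c" using l_eq_2D[OF l] by blast
    then have "E u c" "E v c" using e1 e2 by (auto simp: set_eq_iff)
    then have "c = w" using l_eq_1D[OF t(2), of c w] td by blast
    then have "E w z" using c sym by blast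
    then show False using l_eq_1D[OF t(3), of z v] z td by blast
  qed
  obtain v w where t: "tri u v w" "l u v = 1" "l u w = 1" "l v w = 1" using S[OF u] by blast
  note td = triD[OF t(1)] and tV = tri_V[OF t(1)]
  have "\<not> N u \<subseteq> {v,w}" using card_mono[of "{v,w}" "N u"] card_N[OF u] d by (auto simp: card_insert_if split: if_splits)
  then obtain z where z: "E u z" "z \<noteq> v" "z \<noteq> w" by (auto simp: subset_iff)
  \<comment> \<open>By \<open>cross\<close> and \<open>one\<close>, \<open>z\<close> sees at most
    two of the eight outer neighbours of \<open>v\<close> and \<open>w\<close>, so \<open>B\<close>
    and \<open>C\<close> have at least six elements together. But \<open>transversal\<close> joins
    \<open>B\<close> completely to \<open>C\<close>, by edges with one common neighbour, which
    allows at most two elements in each.\<close>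
  define B where "B = {y \<in> N v - {u,w}. \<not> E z y}"
  define C where "C = {y \<in> N w - {u,v}. \<not> E z y}"
  let ?L = "{y. E z y \<and> l z y = 1}"
  have v4: "card (N v - {u,w}) = 4" and w4: "card (N w - {u,v}) = 4"
    using card_Diff_subset[of "{u,w}" "N v"] card_Diff_subset[of "{u,v}" "N w"] card_N d tV td neq by auto
  have wperm: "tri u w v" "l u w = 1" "l u v = 1" "l w v = 1" using t tri_perm(1)[OF t(1)] l_sym[of w v] by auto
  have L1: "(N v - {u,w}) - B \<subseteq> ?L" using cross[OF t z] by (auto simp: B_def)
  have L2: "(N w - {u,v}) - C \<subseteq> ?L" using cross[OF wperm z(1,3,2)] by (auto simp: C_def)
  have "y = u" if "E v y" "E w y" for y using l_eq_1D[OF t(4) that, of u] td by simp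
  then have dis: "(N v - {u,w}) \<inter> (N w - {u,v}) = {}" by auto
  have finBC: "finite B" "finite C" by (auto simp: B_def C_def intro: finite_subset[of _ "N v"] finite_subset[of _ "N w"])
  have zV: "z \<in> V" using EV2[OF z(1)] .
  have "card (((N v - {u,w}) - B) \<union> ((N w - {u,v}) - C)) \<le> card ?L" by (rule card_mono[OF fin]) (use L1 L2 in auto)
  moreover have "card (((N v - {u,w}) - B) \<union> ((N w - {u,v}) - C)) = card ((N v - {u,w}) - B) + card ((N w - {u,v}) - C)"
    by (rule card_Un_disjoint) (use dis in auto)
  moreover have BC: "B \<subseteq> N v - {u,w}" "C \<subseteq> N w - {u,v}" by (auto simp: B_def C_def)
  moreover have "card ((N v - {u,w}) - B) = 4 - card B" "card ((N w - {u,v}) - C) = 4 - card C"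
    using card_Diff_subset[OF finBC(1) BC(1)] card_Diff_subset[OF finBC(2) BC(2)] v4 w4 by simp_all
  moreover have "card B \<le> 4" "card C \<le> 4" using card_mono[OF _ BC(1)] card_mono[OF _ BC(2)] v4 w4 by simp_all
  ultimately have sum: "6 \<le> card B + card C" "card B \<le> 4" "card C \<le> 4" using one[OF zV] by linarith+
  have "B \<noteq> {}" "C \<noteq> {}" using sum by auto
  then obtain b c where bc: "b \<in> B" "c \<in> C" by blast
  have bc1: "E b c \<and> l b c = 1" if "b \<in> B" "c \<in> C" for b c
  proof -
    have "E b c" using transversal[OF t(1) z(1), of b c] that by (auto simp: B_def C_def)
    then show ?thesis using cross[OF tri_perm(3)[OF t(1)], of b c] t l_sym that by (auto simp: B_def C_def)
  qed
  have "card C \<le> 2" using card_mono[OF fin[of b], of C] one[of b] bc1[OF bc(1)] bc EV[of b c] by fastforce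
  moreover have "card B \<le> 2"
  proof -
    have "B \<subseteq> {y. E c y \<and> l c y = 1}" using bc1[OF _ bc(2)] sym l_sym by auto
    then show ?thesis using card_mono[OF fin[of c], of B] one[of c] EV2[of b c] bc1[OF bc] by simp
  qed
  ultimately show False using sum by simp
qed


section \<open>Triangles with exactly one side having two common neighbours\<close>

lemma tri_types_without_222:
  assumes "tri u v w"
  shows "(l u v = 1 \<and> l u w = 1 \<and> l v w = 1) \<or> (l u v = 2 \<and> l u w = 1 \<and> l v w = 1) \<or>
    (l u v = 1 \<and> l u w = 2 \<and> l v w = 1) \<or> (l u v = 1 \<and> l u w = 1 \<and> l v w = 2)"
  using tri_types[OF assms] no_triangle_222[OF assms] by blast

lemma comp_11:
  assumes "tri u v w" "l u v = 1" "l u w = 1" shows "comp u v w = {v,w}"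
proof -
  have "{v,w} = comp u v w"
    by (rule card_subset_eq) (use tri_comp[OF assms(1)] card_comp[OF assms(1)] assms neq[OF triD(3)[OF assms(1)]] in auto)
  then show ?thesis by simp
qed

text \<open>The surroundings of a triangle \<open>u v w\<close> of type 211 as they arise in valency
  5: the path \<open>y x y'\<close> and the edges \<open>v1 v2\<close> and \<open>w1 w2\<close> are
  the components of the links of \<open>u\<close>, \<open>v\<close>, \<open>w\<close> that avoid the
  triangle.\<close>

definition prism :: "'a \<Rightarrow> 'a \<Rightarrow> 'a \<Rightarrow> 'a \<Rightarrow> 'a \<Rightarrow> 'a \<Rightarrow> 'a \<Rightarrow> 'a \<Rightarrow> 'a \<Rightarrow> 'a \<Rightarrow> bool" where
  "prism u v w x y y' v1 v2 w1 w2 \<longleftrightarrow> tri u v w \<and> tri u x y \<and> tri u x y' \<and> \<not> E y y' \<and> y \<noteq> y' \<and>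
     tri v v1 v2 \<and> tri w w1 w2 \<and> l u y = 1 \<and> l u y' = 1 \<and> l x y = 1 \<and> l x y' = 1 \<and>
     l v v1 = 1 \<and> l v v2 = 1 \<and> l w w1 = 1 \<and> l w w2 = 1 \<and> l v1 v2 = 2 \<and> l w1 w2 = 2 \<and>
     \<not> E u v1 \<and> \<not> E u v2 \<and> \<not> E u w1 \<and> \<not> E u w2 \<and> \<not> E w v1 \<and> \<not> E w v2 \<and> \<not> E v w1 \<and> \<not> E v w2 \<and>
     \<not> E v x \<and> \<not> E v y \<and> \<not> E v y' \<and> \<not> E w x \<and> \<not> E w y \<and> \<not> E w y'"

lemma prism_swap:
  assumes "prism u v w x y y' v1 v2 w1 w2"
  shows "prism u w v x y y' w1 w2 v1 v2" "prism u v w x y y' v2 v1 w1 w2"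
  using assms tri_perm l_sym unfolding prism_def by metis+

lemma prism_transversal:
  assumes "prism u v w x y y' v1 v2 w1 w2" "z \<in> {x,y,y'}" "b \<in> {v1,v2}" "c \<in> {w1,w2}"
  shows "E z b \<or> E z c \<or> E b c"
  using assms unfolding prism_def by (intro transversal[of u v w z b c]) (auto dest: triD)

lemma prism_disjoint:
  assumes "prism u v w x y y' v1 v2 w1 w2" "a \<in> {v1,v2,w1,w2}"
  shows "\<not> (E x a \<and> E y a)" "\<not> (E x a \<and> E y' a)"
proof -
  note p = assms(1)[unfolded prism_def]
  have "a \<noteq> u" using p assms(2) triD(4,5)[of u v w] by blast
  then show "\<not> (E x a \<and> E y a)" "\<not> (E x a \<and> E y' a)"
    using l_eq_1D[of x y a u] l_eq_1D[of x y' a u] p triD[of u x y] triD[of u x y'] by blast+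
qed

text \<open>Then \<open>w\<close> and \<open>v1\<close> are the only common neighbours of
  \<open>w1\<close> and \<open>w2\<close>, and \<open>v2\<close> is adjacent to neither
  \<open>w1\<close> nor \<open>w2\<close>. By \<open>prism_transversal\<close> each of
  \<open>x\<close> and \<open>y\<close> sees \<open>v2\<close> or both \<open>w1\<close> and
  \<open>w2\<close>; the latter would be a third common neighbour, and \<open>x\<close> and
  \<open>y\<close> cannot both see \<open>v2\<close>.\<close>

lemma prism_two_neighbors:
  assumes p: "prism u v w x y y' v1 v2 w1 w2" and E: "E v1 w1" "E v1 w2" shows False
proof -
  note q = p[unfolded prism_def]
  have tv: "tri v v1 v2" and tw: "tri w w1 w2" and tu: "tri u v w" "tri u x y" using q by auto
  have ne: "v1 \<noteq> w" "v2 \<noteq> w1" "v2 \<noteq> w2" using q triD[OF tv] triD[OF tw] triD[OF tu(1)] by blast+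
  have w1v1: "N w1 \<inter> N v1 = N w1 \<inter> N w"
    using block_eq[of w1 w w2 v1] tri_perm[OF tw] sym[OF E(1)] E(2) by blast
  have w2v1: "N w2 \<inter> N v1 = N w2 \<inter> N w"
    using block_eq[of w2 w w1 v1] tri_perm[OF tw] sym[OF E(2)] E(1) by blast
  have "\<not> E v2 w1"
  proof
    assume "E v2 w1"
    then have "v2 \<in> N w1 \<inter> N v1" using triD[OF tv] sym[of v2 w1] by simp
    then have "E w1 v2" "E w v2" using w1v1 by auto
    then show False using q by blast
  qed
  moreover have "\<not> E v2 w2"
  proof
    assume "E v2 w2"
    then have "v2 \<in> N w2 \<inter> N v1" using triD[OF tv] sym[of v2 w2] by simp
    then have "E w v2" using w2v1 by auto
    then show False using q by blast
  qed
  ultimately have z: "E z v2 \<or> (E z w1 \<and> E z w2)" if "z \<in> {x,y,y'}" for z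
    using prism_transversal[OF p that, of v2 w1] prism_transversal[OF p that, of v2 w2] by blast
  have "\<not> (E z w1 \<and> E z w2)" if "E u z" "z \<noteq> w" for z
  proof
    assume *: "E z w1 \<and> E z w2"
    have "z \<noteq> v1" using that q by blast
    then show False using l_2D[of w1 w2 w v1 z] q triD[OF tw] sym[OF E(1)] sym[OF E(2)] * sym[of z w1] sym[of z w2] that ne by blast
  qed
  moreover have "x \<noteq> w" "y \<noteq> w" using q triD[OF tu(1)] by blast+
  ultimately have "E x v2 \<and> E y v2" using z[of x] z[of y] triD[OF tu(2)] by blast
  then show False using prism_disjoint(1)[OF p, of v2] by blast
qed

lemma prism_valency_ne_5:
  assumes d: "d = 5" and p: "prism u v w x y y' v1 v2 w1 w2" shows False
proof -
  \<comment> \<open>In the link of \<open>v1\<close> the component of \<open>v\<close> and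
    \<open>v2\<close> has three vertices. In valency 5 the remaining two are \<open>y\<close> and
    \<open>y'\<close>, which would have to be adjacent.\<close>
  have A: False if p: "prism u v w x y y' v1 v2 w1 w2" and E: "E y v1" "E y' v1" "\<not> E y v2" "\<not> E y' v2" for v w v1 v2 w1 w2
  proof -
    note q = p[unfolded prism_def]
    have t: "tri v1 v v2" "l v1 v = 1" "l v1 v2 = 2" using q tri_perm l_sym by metis+
    have y: "y \<notin> comp v1 v v2" "y' \<notin> comp v1 v v2" using E q sym[of v y] sym[of v y'] sym[of v2 y] sym[of v2 y'] by (auto simp: mem_comp)
    obtain g where g: "tri v1 y g" using ex_tri[OF sym[OF E(1)]] by blast
    have dis: "comp v1 y g \<inter> comp v1 v v2 = {}" using comp_disjoint[OF t(1) g y(1)] .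
    have c: "card (comp v1 v v2 \<union> comp v1 y g) = 3 + (l v1 y + l v1 g)" using card_two_comps[OF t(1) g dis] t by simp
    have "card (comp v1 v v2 \<union> comp v1 y g) \<le> 5"
      using card_mono[of "N v1" "comp v1 v v2 \<union> comp v1 y g"] card_N_tri[OF g] d by (simp add: comp_sub)
    then have l: "l v1 y = 1" "l v1 g = 1" using c tri_l_pos[OF g] by linarith+
    then have "comp v1 v v2 \<union> comp v1 y g = N v1"
      using c card_N_tri[OF g] d by (intro card_subset_eq) (auto simp: comp_sub)
    moreover have "y' \<in> N v1" using E(2) sym by simp
    ultimately have "y' \<in> {y,g}" using y(2) comp_11[OF g l] by blast
    then show False using q triD[OF g] by blast
  qed
  \<comment> \<open>Each of \<open>x\<close>, \<open>y\<close>, \<open>y'\<close> sees a vertex of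
    \<open>{v1,w2}\<close> and one of \<open>{v2,w1}\<close>. Whatever \<open>x\<close> sees is
    missed by \<open>y\<close> and \<open>y'\<close>, so these behave alike: either both are further
    common neighbours of \<open>v1\<close>, \<open>v2\<close> or of \<open>w1\<close>,
    \<open>w2\<close>, or \<open>A\<close> applies.\<close>
  have B: False if p: "prism u v w x y y' v1 v2 w1 w2" and n: "\<not> E v1 w2" "\<not> E v2 w1" for v1 v2 w1 w2
  proof -
    note q = p[unfolded prism_def]
    have T: "(E z v1 \<or> E z w2) \<and> (E z v2 \<or> E z w1)" if "z \<in> {x,y,y'}" for z
      using prism_transversal[OF p that, of v1 w2] prism_transversal[OF p that, of v2 w1] n by blast
    have D: "E x a \<Longrightarrow> \<not> E y a \<and> \<not> E y' a" if "a \<in> {v1,v2,w1,w2}" for a using prism_disjoint[OF p that] by blast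
    have tt: "tri u x y" "tri u x y'" "tri u v w" "tri v v1 v2" "tri w w1 w2" using q by blast+
    note Ts = T[of x] T[of y] T[of y']
    consider "E x v1" "E x v2" | "E x w2" "E x w1" | "E x v1" "E x w1" | "E x w2" "E x v2" using Ts by blast
    then show False
    proof cases
      case 1
      then have "E y w1" "E y w2" "E y' w1" "E y' w2" using Ts D by blast+
      then show False using l_2D[of w1 w2 w y y'] q triD[OF tt(5)] triD[OF tt(3)] triD[OF tt(1)] triD[OF tt(2)] sym[of y w1] sym[of y w2] sym[of y' w1] sym[of y' w2] by blast
    next
      case 2
      then have "E y v1" "E y v2" "E y' v1" "E y' v2" using Ts D by blast+
      then show False using l_2D[of v1 v2 v y y'] q triD[OF tt(4)] triD[OF tt(3)] triD[OF tt(1)] triD[OF tt(2)] sym[of y v1] sym[of y v2] sym[of y' v1] sym[of y' v2] by blast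
    next
      case 3
      then have "E y v2" "E y' v2" "\<not> E y v1" "\<not> E y' v1" using Ts D by blast+
      then show False using A[OF prism_swap(2)[OF p]] by blast
    next
      case 4
      then have "E y v1" "E y' v1" "\<not> E y v2" "\<not> E y' v2" using Ts D by blast+
      then show False using A[OF p] by blast
    qed
  qed
  have p2: "prism u v w x y y' v2 v1 w1 w2" using prism_swap(2)[OF p] .
  have p3: "prism u w v x y y' w1 w2 v1 v2" using prism_swap(1)[OF p] .
  have p4: "prism u w v x y y' w2 w1 v1 v2" using prism_swap(2)[OF p3] .
  have p5: "prism u v w x y y' v1 v2 w2 w1" using prism_swap(1)[OF p4] .
  have "\<not> (E v1 w1 \<and> E v1 w2)" "\<not> (E v2 w1 \<and> E v2 w2)" "\<not> (E v1 w1 \<and> E v2 w1)" "\<not> (E v1 w2 \<and> E v2 w2)"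
    using prism_two_neighbors[OF p] prism_two_neighbors[OF p2] prism_two_neighbors[OF p3] prism_two_neighbors[OF p4]
      sym[of v1 w1] sym[of v1 w2] sym[of v2 w1] sym[of v2 w2] by blast+
  \<comment> \<open>The edges between \<open>{v1,v2}\<close> and \<open>{w1,w2}\<close> form a
    matching, so \<open>B\<close> applies, possibly after exchanging \<open>w1\<close> and
    \<open>w2\<close>.\<close>
  then have "(\<not> E v1 w2 \<and> \<not> E v2 w1) \<or> (\<not> E v1 w1 \<and> \<not> E v2 w2)" by blast
  then show False using B[OF p] B[OF p5] by blast
qed

end

context cis_graph_3_disconnected begin

lemma comp_disjoint_21_11:
  assumes "tri u m y" "l u m = 2" "l u y = 1" "tri u x x'" "l u x = 1" "l u x' = 1"
  shows "comp u x x' \<inter> comp u m y = {}"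
proof (rule comp_disjoint[OF assms(1,4)])
  show "x \<notin> comp u m y" using comp_same[OF assms(1,4)] assms by auto
qed

lemma notin_comp_nonadjacent: "z \<notin> comp u v w \<Longrightarrow> E u z \<Longrightarrow> \<not> E v z \<and> \<not> E w z"
  by (simp add: mem_comp)

text \<open>The surroundings, as they arise in valency 7, of a corner \<open>v\<close> of a triangle
  of type 111: besides the edge \<open>u w\<close>, the link of \<open>v\<close> consists of the
  edge \<open>v1 v2\<close> and the path \<open>v4 v3 v5\<close>.\<close>

definition arm :: "'a \<Rightarrow> 'a \<Rightarrow> 'a \<Rightarrow> 'a \<Rightarrow> 'a \<Rightarrow> 'a \<Rightarrow> 'a \<Rightarrow> 'a \<Rightarrow> bool" where
  "arm v u w v1 v2 v3 v4 v5 \<longleftrightarrow> tri v v1 v2 \<and> tri v v3 v4 \<and> tri v v3 v5 \<and> v4 \<noteq> v5 \<and>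
     l v1 v2 = 2 \<and> l v3 v4 = 1 \<and> l v3 v5 = 1 \<and> distinct [v,u,w,v1,v2,v3,v4,v5] \<and>
     (\<forall>x\<in>{v1,v2,v3,v4,v5}. E v x \<and> \<not> E u x \<and> \<not> E w x)"

text \<open>Some \<open>c\<close> among \<open>w3\<close>, \<open>w4\<close> is missed by
  \<open>z\<close>. Then every vertex of the path \<open>v4 v3 v5\<close> is seen by
  \<open>z\<close> or \<open>c\<close>, and neither of these sees both ends of an edge of the path.
  If \<open>z\<close> misses \<open>v1\<close> and \<open>v2\<close>, every vertex of the arm at
  \<open>w\<close> missed by \<open>z\<close> is adjacent to both, and besides \<open>v\<close> they
  have only one common neighbour.\<close>

lemma arm_neighbors:
  assumes t: "tri u v w" and av: "arm v u w v1 v2 v3 v4 v5" and aw: "arm w v u w1 w2 w3 w4 w5"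
    and z: "E u z" "z \<noteq> v" "z \<noteq> w"
  shows "(E z v3 \<and> \<not> E z v4 \<and> \<not> E z v5) \<or> (\<not> E z v3 \<and> E z v4 \<and> E z v5)"
    and "E z v1 \<or> E z v2 \<or> (E z w1 \<and> E z w2 \<and> E z w4 \<and> E z w5)"
proof -
  note v = av[unfolded arm_def] and w = aw[unfolded arm_def]
  have tv: "tri v v1 v2" "tri v v3 v4" "tri v v3 v5" and tw: "tri w w1 w2" "tri w w3 w4" "tri w w3 w5" using v w by auto
  note vd = triD[OF tv(1)] triD[OF tv(2)] triD[OF tv(3)] and wd = triD[OF tw(1)] triD[OF tw(2)] triD[OF tw(3)]
  have T: "E z b \<or> E z c \<or> E b c" if "b \<in> {v1,v2,v3,v4,v5}" "c \<in> {w1,w2,w3,w4,w5}" for b c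
    using transversal[OF t z(1), of b c] v w that by blast
  have nv: "\<not> (E z v3 \<and> E z v4)" "\<not> (E z v3 \<and> E z v5)"
    using l_eq_1D[of v3 v4 z v] l_eq_1D[of v3 v5 z v] v z(2) vd sym[of z v3] sym[of z v4] sym[of z v5] by blast+
  have nw: "\<not> (E z w3 \<and> E z w4)" "\<not> (E z w3 \<and> E z w5)"
    using l_eq_1D[of w3 w4 z w] l_eq_1D[of w3 w5 z w] w z(3) wd sym[of z w3] sym[of z w4] sym[of z w5] by blast+
  have c: "\<not> (E v3 c \<and> E v4 c)" "\<not> (E v3 c \<and> E v5 c)" if "c \<in> {w1,w2,w3,w4,w5}" for c
  proof -
    have "c \<noteq> v" using w that by auto
    then show "\<not> (E v3 c \<and> E v4 c)" "\<not> (E v3 c \<and> E v5 c)"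
      using l_eq_1D[of v3 v4 c v] l_eq_1D[of v3 v5 c v] v vd by blast+
  qed
  show 1: "(E z v3 \<and> \<not> E z v4 \<and> \<not> E z v5) \<or> (\<not> E z v3 \<and> E z v4 \<and> E z v5)"
  proof (cases "E z w3")
    case True
    then have "\<not> E z w4" using nw by blast
    then show ?thesis using c[of w4] T[of v3 w4] T[of v4 w4] T[of v5 w4] nv by blast
  next
    case False
    then show ?thesis using c[of w3] T[of v3 w3] T[of v4 w3] T[of v5 w3] nv by blast
  qed
  show "E z v1 \<or> E z v2 \<or> (E z w1 \<and> E z w2 \<and> E z w4 \<and> E z w5)"
  proof (rule ccontr)
    assume no: "\<not> ?thesis"
    have two: "c = c'" if "c \<in> {w1,w2,w3,w4,w5}" "c' \<in> {w1,w2,w3,w4,w5}" "\<not> E z c" "\<not> E z c'" for c c'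
    proof -
      have "E v1 c" "E v2 c" "E v1 c'" "E v2 c'" using T[OF _ that(1)] T[OF _ that(2)] no that by blast+
      moreover have "c \<noteq> v" "c' \<noteq> v" using w that by auto
      ultimately show ?thesis using l_2D[of v1 v2 c c' v] v vd by blast
    qed
    have "distinct [w1,w2,w3,w4,w5]" using w by simp
    then have ne: "w4 \<noteq> w5" "w1 \<noteq> w3" "w2 \<noteq> w3" "w3 \<noteq> w4" "w1 \<noteq> w4" "w1 \<noteq> w5" "w2 \<noteq> w4" "w3 \<noteq> w5" "w2 \<noteq> w5" by auto
    show False
    proof (cases "E z w3")
      case True
      then show False using nw two[of w4 w5] ne by blast
    next
      case False
      then show False using two[of w3 w1] two[of w3 w2] two[of w3 w4] two[of w3 w5] ne no by blast
    qed
  qed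
qed

text \<open>The neighbours \<open>u\<close>, \<open>u4\<close>, \<open>u5\<close> of
  \<open>u3\<close> leave room for at most four in the other two arms. So \<open>u3\<close> sees
  only the middle vertex of each path there, and \<open>u4\<close>, \<open>u5\<close> see the ends.
  Now \<open>transversal\<close> joins the ends of one path to those of the other, and
  \<open>u4 v4 w4\<close> is a triangle with two sides having at least two common
  neighbours.\<close>

lemma no_arms:
  assumes t: "tri u v w" and au: "arm u v w u1 u2 u3 u4 u5" and av: "arm v u w v1 v2 v3 v4 v5" and aw: "arm w v u w1 w2 w3 w4 w5"
  shows False
proof -
  note u = au[unfolded arm_def] and v = av[unfolded arm_def] and w = aw[unfolded arm_def]
  have aw': "arm w u v w1 w2 w3 w4 w5" and av': "arm v w u v1 v2 v3 v4 v5" using av aw unfolding arm_def by auto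
  have tu: "tri u u3 u4" "tri u u3 u5" using u by auto
  note t' = tri_perm(1)[OF t]
  have U: "x = u \<or> E u x" if "x \<in> {u,u1,u2,u3,u4,u5}" for x using u that by blast
  have du0: "distinct [v,u,w,v1,v2,v3,v4,v5]" "distinct [w,v,u,w1,w2,w3,w4,w5]" "distinct [u,v,w,u1,u2,u3,u4,u5]" using u v w by blast+
  have Vy: "y \<noteq> u \<and> \<not> E u y \<and> E v y" if "y \<in> {v1,v2,v3,v4,v5}" for y
  proof -
    have "y \<noteq> u" using du0(1) that by (auto simp del: One_nat_def)
    then show ?thesis using v that by blast
  qed
  have Wy: "y \<noteq> u \<and> \<not> E u y \<and> \<not> E v y" if "y \<in> {w1,w2,w3,w4,w5}" for y
  proof -
    have "y \<noteq> u" using du0(2) that by (auto simp del: One_nat_def)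
    then show ?thesis using w that by blast
  qed
  have ne: "x \<noteq> y" if "x \<in> {u,u1,u2,u3,u4,u5}" "y \<in> {v1,v2,v3,v4,v5}" for x y
    using U[OF that(1)] Vy[OF that(2)] by blast
  have ne2: "x \<noteq> y" if "x \<in> {u,u1,u2,u3,u4,u5}" "y \<in> {w1,w2,w3,w4,w5}" for x y
    using U[OF that(1)] Wy[OF that(2)] by blast
  have ne3: "x \<noteq> y" if "x \<in> {v1,v2,v3,v4,v5}" "y \<in> {w1,w2,w3,w4,w5}" for x y
    using Vy[OF that(1)] Wy[OF that(2)] by blast
  have z: "E u z" "z \<noteq> v" "z \<noteq> w" if "z \<in> {u3,u4,u5}" for z
  proof -
    show "E u z" using u that by blast
    show "z \<noteq> v" "z \<noteq> w" using du0(3) that by auto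
  qed
  note A = arm_neighbors[OF t av aw z] and B = arm_neighbors[OF t' aw' av' z(1,3,2)]
  have "u3 \<in> V" using tri_V[OF tu(1)] by blast
  then have d3: "card (N u3) \<le> 7" using card_N d7 by simp
  have du: "u \<noteq> u4" "u \<noteq> u5" "u4 \<noteq> u5" and dv: "distinct [v1,v2,v3,v4,v5]" and dw: "distinct [w1,w2,w3,w4,w5]" using du0 by simp_all
  have nb: "E u3 u" "E u3 u4" "E u3 u5" using triD[OF tu(1)] triD[OF tu(2)] by blast+
  have big: False if A: "A \<subseteq> {v1,v2,v3,v4,v5}" and B: "B \<subseteq> {w1,w2,w3,w4,w5}" and E: "\<forall>x\<in>A \<union> B. E u3 x" and c: "5 \<le> card A + card B" for A B
  proof -
    have fin: "finite A" "finite B" using A B finite_subset by blast+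
    have "A \<inter> B = {}"
    proof (rule equals0I)
      fix x assume "x \<in> A \<inter> B"
      then show False using ne3[OF subsetD[OF A, of x] subsetD[OF B, of x]] by simp
    qed
    then have "card (A \<union> B) = card A + card B" using fin by (simp add: card_Un_disjoint)
    moreover have "x \<notin> A \<union> B" if "x \<in> {u,u4,u5}" for x
    proof -
      have x: "x \<in> {u,u1,u2,u3,u4,u5}" using that by blast
      show ?thesis using ne[OF x subsetD[OF A, of x]] ne2[OF x subsetD[OF B, of x]] by blast
    qed
    then have "{u,u4,u5} \<inter> (A \<union> B) = {}" by blast
    then have "card ({u,u4,u5} \<union> (A \<union> B)) = card {u,u4,u5} + card (A \<union> B)" using fin by (intro card_Un_disjoint) auto
    moreover have "card {u,u4,u5} = 3" using du by simp
    moreover have "card ({u,u4,u5} \<union> (A \<union> B)) \<le> card (N u3)" by (rule card_mono) (use nb E in auto)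
    ultimately show False using c d3 by linarith
  qed
  have hv: "E u3 v1 \<or> E u3 v2"
  proof (rule ccontr)
    assume "\<not> ?thesis"
    then have "E u3 w1" "E u3 w2" "E u3 w4" "E u3 w5" "E u3 v3 \<or> E u3 v4" using A[of u3] by blast+
    then show False using big[of "{v3}" "{w1,w2,w4,w5}"] big[of "{v4}" "{w1,w2,w4,w5}"] dw by auto
  qed
  have hw: "E u3 w1 \<or> E u3 w2"
  proof (rule ccontr)
    assume "\<not> ?thesis"
    then have "E u3 v1" "E u3 v2" "E u3 v4" "E u3 v5" "E u3 w3 \<or> E u3 w4" using B[of u3] by blast+
    then show False using big[of "{v1,v2,v4,v5}" "{w3}"] big[of "{v1,v2,v4,v5}" "{w4}"] dv by auto
  qed
  obtain b where b: "b = v1 \<or> b = v2" "E u3 b" using hv by blast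
  obtain c where c: "c = w1 \<or> c = w2" "E u3 c" using hw by blast
  have nbc: "b \<noteq> v3" "b \<noteq> v4" "b \<noteq> v5" "c \<noteq> w3" "c \<noteq> w4" "c \<noteq> w5" "v4 \<noteq> v5" "w4 \<noteq> w5" using b c dv dw by auto
  have A3: "E u3 v3 \<and> \<not> E u3 v4 \<and> \<not> E u3 v5"
  proof (rule ccontr)
    assume "\<not> ?thesis"
    then have e: "E u3 v4" "E u3 v5" using A[of u3] by blast+
    obtain c' where c': "c' = w3 \<or> c' = w4" "E u3 c'" using B(1)[of u3] by blast
    show False by (rule big[of "{b,v4,v5}" "{c,c'}"]) (use e b c c' nbc in auto)
  qed
  have B3: "E u3 w3 \<and> \<not> E u3 w4 \<and> \<not> E u3 w5"
  proof (rule ccontr)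
    assume "\<not> ?thesis"
    then have e: "E u3 w4" "E u3 w5" using B[of u3] by blast+
    show False by (rule big[of "{b,v3}" "{c,w4,w5}"]) (use e b c nbc A3 in auto)
  qed
  have n4: "\<not> E x v3" "\<not> E x w3" if x: "x = u4 \<or> x = u5" for x
  proof -
    have "l u3 x = 1" "E x u" using u x triD[OF tu(1)] triD[OF tu(2)] by auto
    then show "\<not> E x v3" "\<not> E x w3" using l_eq_1D[of u3 x v3 u] l_eq_1D[of u3 x w3 u] A3 B3 nb ne[of u v3] ne2[of u w3] by auto
  qed
  have a4: "E u4 v4" "E u4 v5" "E u5 v4" "E u4 w4" "E u4 w5" "E u5 w4"
    using n4[of u4] n4[of u5] A(1)[of u4] A(1)[of u5] B(1)[of u4] B(1)[of u5] by auto
  have vw: "E v4 w4" "E v4 w5" "E v5 w4"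
    using transversal[OF t, of u3 v4 w4] transversal[OF t, of u3 v4 w5] transversal[OF t, of u3 v5 w4] A3 B3 u v w by auto
  have "tri u4 v4 w4" using a4 vw by (simp add: tri_def)
  moreover have "2 \<le> l u4 v4" using l_ge_2[of u4 w4 v4 w5] a4 vw dw by simp
  moreover have "2 \<le> l u4 w4" using l_ge_2[of u4 v4 w4 v5] a4 sym[OF vw(1)] sym[OF vw(3)] dv by simp
  ultimately show False using tri_types_without_222[of u4 v4 w4] by auto
qed

text \<open>Every link has a component that is a path with three vertices and one that is a single
  edge. If these exhaust the link, the valency is 5 and a \<open>prism\<close> arises. Otherwise
  there is a third component, which can only be another edge, and the valency is 7.\<close>

lemma no_triangle_211:
  assumes t0: "tri u0 v0 w0" "l u0 v0 = 2" shows False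
proof -
  have l0: "l u0 w0 = 1" "l v0 w0 = 1" using tri_types_without_222[OF t0(1)] t0(2) by auto
  have P: "\<exists>m y y'. tri u m y \<and> tri u m y' \<and> y \<noteq> y' \<and> \<not> E y y' \<and> l u m = 2 \<and> l u y = 1 \<and> l u y' = 1 \<and> l m y = 1 \<and> l m y' = 1"
    if u: "u \<in> V" for u
  proof -
    obtain m x where m: "tri u m x" "l u m = 2" using Aut_tri[OF t0(1) u] t0(2) by metis
    obtain y y' where y: "y \<noteq> y'" "E u y" "E m y" "E u y'" "E m y'" using l_eq_2D[OF m(2)] by blast
    then have t: "tri u m y" "tri u m y'" using triD[OF m(1)] by (auto simp: tri_def)
    then show ?thesis using tri_types_without_222[OF t(1)] tri_types_without_222[OF t(2)] m(2) y K4_free[of u m y y'] triD[OF m(1)]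
      by (intro exI[of _ m] exI[of _ y] exI[of _ y']) auto
  qed
  have D: "\<exists>x x'. tri u x x' \<and> l u x = 1 \<and> l u x' = 1 \<and> l x x' = 2" if u: "u \<in> V" for u
    using Aut_tri[OF tri_perm(4)[OF t0(1)] u] l0 t0(2) l_sym by metis
  obtain v where v: "v \<in> V" using nonempty by blast
  show False
  proof (cases "d = 5")
    case True
    obtain w u where w: "tri v w u" "l v w = 2" "l v u = 1" "l w u = 1" using P[OF v] by blast
    have wV: "w \<in> V" "u \<in> V" using tri_V[OF w(1)] by auto
    obtain v1 v2 where v1: "tri v v1 v2" "l v v1 = 1" "l v v2 = 1" "l v1 v2 = 2" using D[OF v] by blast
    obtain w1 w2 where w1: "tri w w1 w2" "l w w1 = 1" "l w w2 = 1" "l w1 w2 = 2" using D[OF wV(1)] by blast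
    obtain x y y' where x: "tri u x y" "tri u x y'" "y \<noteq> y'" "\<not> E y y'" "l u x = 2" "l u y = 1" "l u y' = 1" "l x y = 1" "l x y' = 1"
      using P[OF wV(2)] by blast
    have wp: "tri w v u" "l w v = 2" "tri u v w" "l u v = 1" "l u w = 1" "l v w = 2"
      using tri_perm(2)[OF w(1)] tri_perm(4)[OF w(1)] w l_sym[of w v] l_sym[of u v] l_sym[of u w] by auto
    have "v1 \<notin> comp v w u" "v2 \<notin> comp v w u" "w1 \<notin> comp w v u" "w2 \<notin> comp w v u"
      using comp_disjoint_21_11[OF w(1-3) v1(1-3)] comp_disjoint_21_11[OF wp(1,2) w(4) w1(1-3)] tri_comp[OF v1(1)] tri_comp[OF w1(1)] by auto
    then have n1: "\<not> E w v1 \<and> \<not> E u v1 \<and> \<not> E w v2 \<and> \<not> E u v2 \<and> \<not> E v w1 \<and> \<not> E u w1 \<and> \<not> E v w2 \<and> \<not> E u w2"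
      using notin_comp_nonadjacent triD[OF v1(1)] triD[OF w1(1)] by metis
    have "x \<notin> comp u v w" "y \<notin> comp u v w" "y' \<notin> comp u v w"
      using comp_disjoint_21_11[OF x(1,5,6) wp(3-5)] comp_disjoint_21_11[OF x(2,5,7) wp(3-5)] tri_comp[OF x(1)] tri_comp[OF x(2)] by auto
    then have n2: "\<not> E v x \<and> \<not> E w x \<and> \<not> E v y \<and> \<not> E w y \<and> \<not> E v y' \<and> \<not> E w y'"
      using notin_comp_nonadjacent triD[OF x(1)] triD[OF x(2)] by metis
    have "prism u v w x y y' v1 v2 w1 w2"
      unfolding prism_def using n1 n2 x w1 v1 wp by blast
    then show False using prism_valency_ne_5[OF True] by blast
  next
    case False
    have T: "\<exists>p q. tri u p q \<and> l u p = 1 \<and> l u q = 1 \<and> l p q = 1" if u: "u \<in> V" for u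
    proof -
      obtain m y where m: "tri u m y" "l u m = 2" "l u y = 1" using P[OF u] by blast
      obtain x x' where x: "tri u x x'" "l u x = 1" "l u x' = 1" "l x x' = 2" using D[OF u] by blast
      have dis: "comp u x x' \<inter> comp u m y = {}" using comp_disjoint_21_11[OF m x(1-3)] .
      then have xn: "x \<notin> comp u m y" using tri_comp[OF x(1)] by blast
      have "5 \<le> d" using card_two_comps[OF m(1) x(1) dis] card_mono[of "N u" "comp u m y \<union> comp u x x'"] card_N[OF u] m x
        by (simp add: comp_sub)
      then have "l u m + l u y + (l u x + l u x') < d" using False m x by simp
      then obtain p q where p: "tri u p q" "comp u p q \<inter> comp u m y = {}" "comp u p q \<inter> comp u x x' = {}"
          "l u m + l u y + (l u x + l u x') + (l u p + l u q) \<le> d"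
        using third_comp[OF m(1) x(1) xn] by blast
      then have l1: "l u p = 1" "l u q = 1" and d: "d = 7" using m x d7 tri_l_pos[OF p(1)] by linarith+
      have "l p q \<noteq> 2"
      proof
        assume pq: "l p q = 2"
        \<comment> \<open>Here \<open>a\<close> is the corner opposite the side with two common
          neighbours. If the third component were of this kind as well, \<open>u\<close> would be
          related to \<open>x\<close>, \<open>x'\<close>, \<open>p\<close>, \<open>q\<close>. But if
          \<open>a\<close> is related to \<open>u\<close>, the third corner is the middle vertex
          \<open>m\<close> of the path, so \<open>a\<close> is one of the two common neighbours of
          \<open>u\<close> and \<open>m\<close>.\<close>
        define R where "R a b \<longleftrightarrow> (\<exists>c. tri a b c \<and> l a b = 1 \<and> l a c = 1 \<and> l b c = 2)" for a b
        have mt: "card {b. R u b} = card {a. R a u}"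
        proof (rule mass_transport[OF _ _ u])
          fix f a b assume "f \<in> Aut" "R a b"
          then show "R (f a) (f b)" unfolding R_def tri_def using Aut_E Aut_l by metis
        qed (use tri_V R_def in blast)
        have "R u x" "R u x'" "R u p" "R u q" unfolding R_def
          using x p(1) l1 pq tri_perm(1)[OF x(1)] tri_perm(1)[OF p(1)] l_sym[of x' x] l_sym[of q p] by auto
        then have "{x,x',p,q} \<subseteq> {b. R u b}" by simp
        moreover have "finite {b. R u b}" by (rule finite_subset[OF _ finV]) (use tri_V R_def in blast)
        ultimately have "card {x,x',p,q} \<le> card {b. R u b}" by (intro card_mono)
        moreover have "card {x,x',p,q} = 4"
          using p(3) tri_comp[OF x(1)] tri_comp[OF p(1)] neq[OF triD(3)[OF x(1)]] neq[OF triD(3)[OF p(1)]] by (auto simp: card_insert_if)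
        moreover have "{a. R a u} \<subseteq> N u \<inter> N m"
        proof
          fix a assume "a \<in> {a. R a u}"
          then obtain c where c: "tri a u c" "l a u = 1" "l u c = 2" by (auto simp: R_def)
          have tc: "tri u c a" using tri_perm(3)[OF c(1)] .
          have "c \<in> comp u m y"
          proof (rule ccontr)
            assume cn: "c \<notin> comp u m y"
            have "comp u c a \<inter> comp u m y = {}" using comp_disjoint[OF m(1) tc cn] .
            moreover have "c \<notin> comp u x x'" using comp_same[OF x(1) tc] c x by auto
            then have "comp u c a \<inter> comp u x x' = {}" using comp_disjoint[OF x(1) tc] by blast
            ultimately have "card ((comp u m y \<union> comp u x x') \<union> comp u c a) = card (comp u m y \<union> comp u x x') + card (comp u c a)"
              by (intro card_Un_disjoint) auto
            moreover have "card ((comp u m y \<union> comp u x x') \<union> comp u c a) \<le> card (N u)"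
              by (rule card_mono) (simp_all add: comp_sub)
            ultimately show False using card_two_comps[OF m(1) x(1) dis] card_comp[OF tc] card_N[OF u] d m x c l_sym[of u a] by simp
          qed
          then have cc: "E u c" "E m c \<or> E y c" by (auto simp: mem_comp)
          have "\<not> E m c"
            using block_l[OF tri_perm(1)[OF m(1)], of c] cc(1) c(3) m(3) sym[of m c] by auto
          then have "c = m" using cc l_eq_1D[OF m(3), of c m] triD[OF m(1)] by blast
          then show "a \<in> N u \<inter> N m" using triD[OF tc] by auto
        qed
        then have "card {a. R a u} \<le> 2" using card_mono[of "N u \<inter> N m" "{a. R a u}"] m(2) by (simp add: l_def)
        ultimately show False using mt by simp
      qed
      then show ?thesis using tri_types_without_222[OF p(1)] p(1) l1 by auto
    qed
    obtain u w where t: "tri v u w" "l v u = 1" "l v w = 1" "l u w = 1" using T[OF v] by blast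
    have arm: "\<exists>v1 v2 v3 v4 v5. arm v u w v1 v2 v3 v4 v5" if t: "tri v u w" "l v u = 1" "l v w = 1" "l u w = 1" for v u w
    proof -
      have v: "v \<in> V" using tri_V[OF t(1)] by blast
      obtain m y y' where m: "tri v m y" "tri v m y'" "y \<noteq> y'" "\<not> E y y'" "l v m = 2" "l v y = 1" "l v y' = 1" "l m y = 1" "l m y' = 1" using P[OF v] by blast
      obtain x x' where x: "tri v x x'" "l v x = 1" "l v x' = 1" "l x x' = 2" using D[OF v] by blast
      note td = triD[OF t(1)] and md = triD[OF m(1)] triD[OF m(2)] and xd = triD[OF x(1)]
      have "x \<notin> comp v m y" "x \<notin> comp v m y'" "x' \<notin> comp v m y" "x' \<notin> comp v m y'"
        using comp_disjoint_21_11[OF m(1,5,6) x(1-3)] comp_disjoint_21_11[OF m(2,5,7) x(1-3)] tri_comp[OF x(1)] by auto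
      then have xm: "x \<noteq> m" "x \<noteq> y" "x \<noteq> y'" "x' \<noteq> m" "x' \<noteq> y" "x' \<noteq> y'" using tri_comp[OF m(1)] tri_comp[OF m(2)] by auto
      have cuw: "comp v u w = {u,w}" using comp_11[OF t(1-3)] .
      have "m \<notin> comp v u w" "y \<notin> comp v u w" "y' \<notin> comp v u w"
        using comp_disjoint_21_11[OF m(1,5,6) t(1-3)] comp_disjoint_21_11[OF m(2,5,7) t(1-3)] tri_comp[OF m(1)] tri_comp[OF m(2)] by auto
      moreover have "x \<notin> comp v u w"
      proof
        assume "x \<in> comp v u w"
        then consider "x = u" | "x = w" using cuw by blast
        then show False
        proof cases
          case 1
          then have "x' = w" using l_eq_1D[OF t(2), of x' w] xd td by blast
          then show False using 1 x t by simp
        next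
          case 2
          then have "x' = u" using l_eq_1D[OF t(3), of x' u] xd td by blast
          then show False using 2 x t l_sym[of w u] by simp
        qed
      qed
      then have "comp v x x' \<inter> comp v u w = {}" using comp_disjoint[OF t(1) x(1)] by blast
      then have "x \<notin> comp v u w" "x' \<notin> comp v u w" using tri_comp[OF x(1)] by auto
      ultimately have nn: "\<not> E u z \<and> \<not> E w z \<and> z \<noteq> u \<and> z \<noteq> w" if "z \<in> {x,x',m,y,y'}" for z
        using that notin_comp_nonadjacent[of _ v u w] md xd cuw by auto
      have "distinct [v,u,w,x,x',m,y,y']"
        using nn xm m(3) neq[OF md(1)] neq[OF md(2)] neq[OF md(3)] neq[OF md(8)] neq[OF md(9)] neq[OF xd(1)] neq[OF xd(2)] neq[OF xd(3)] neq[OF td(1)] neq[OF td(2)] neq[OF td(3)] by auto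
      then have "arm v u w x x' m y y'" unfolding arm_def using m x nn md xd by auto
      then show ?thesis by blast
    qed
    note p = tri_perm[OF t(1)]
    obtain a1 a2 a3 a4 a5 where "arm v u w a1 a2 a3 a4 a5" using arm[OF t] by blast
    moreover obtain b1 b2 b3 b4 b5 where "arm u v w b1 b2 b3 b4 b5" using arm[OF p(2)] t l_sym[of u v] by auto
    moreover obtain c1 c2 c3 c4 c5 where "arm w u v c1 c2 c3 c4 c5" using arm[OF p(5)] t l_sym[of w u] l_sym[of w v] l_sym[of u v] by auto
    ultimately show False using no_arms[OF t(1)] by blast
  qed
qed

section \<open>Every edge in exactly one triangle\<close>

lemma l_eq_1:
  assumes "E u v" shows "l u v = 1"
proof -
  obtain w where "tri u v w" using ex_tri assms by blast
  then show ?thesis using tri_types_without_222[of u v w] no_triangle_211[of u v w] by auto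
qed

lemma comp_eq: "tri u v w \<Longrightarrow> comp u v w = {v,w}"
  using comp_11[of u v w] l_eq_1[of u v] l_eq_1[of u w] triD[of u v w] by blast

text \<open>With \<open>d > 4\<close> the link of \<open>w\<close> has two edges besides
  \<open>u v\<close>. The vertices \<open>u1\<close> and \<open>u2\<close> see different ends of
  each outer edge at \<open>v\<close> and \<open>w\<close>. The ends \<open>b\<close>,
  \<open>c\<close>, \<open>e\<close> seen by \<open>u2\<close> are missed by \<open>u1\<close>, so
  \<open>transversal\<close> joins \<open>b\<close> to \<open>c\<close> and to \<open>e\<close>;
  then \<open>c\<close> and \<open>e\<close> are two common neighbours of \<open>u2\<close> and
  \<open>b\<close>.\<close>

lemma card_le_4: "d \<le> 4"
proof (rule ccontr)
  assume d: "\<not> d \<le> 4"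
  obtain u where u: "u \<in> V" using nonempty by blast
  obtain v where "E u v" using pure_ex_nb[OF finV pureV _ u] by auto
  then obtain w where t: "tri u v w" using ex_tri by blast
  note td = triD[OF t]
  obtain u1 u2 where u1: "tri u u1 u2" "comp u u1 u2 \<inter> comp u v w = {}" using other_comp[OF t] by blast
  have tv: "tri v u w" and tw: "tri w u v" using tri_perm[OF t] by auto
  obtain v1 v2 where v1: "tri v v1 v2" "comp v v1 v2 \<inter> comp v u w = {}" using other_comp[OF tv] by blast
  obtain w1 w2 where w1: "tri w w1 w2" "w1 \<notin> comp w u v" "comp w w1 w2 \<inter> comp w u v = {}" using other_comp[OF tw] by blast
  obtain w3 w4 where w3: "tri w w3 w4" "comp w w3 w4 \<inter> comp w u v = {}" "comp w w3 w4 \<inter> comp w w1 w2 = {}"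
    using third_comp[OF tw w1(1,2)] l_eq_1[OF td(5)] l_eq_1[OF td(6)] l_eq_1[OF triD(1)[OF w1(1)]] l_eq_1[OF triD(2)[OF w1(1)]] d by auto
  note C = comp_eq[OF t] comp_eq[OF tv] comp_eq[OF tw] comp_eq[OF u1(1)] comp_eq[OF v1(1)] comp_eq[OF w1(1)] comp_eq[OF w3(1)]
  note ud = triD[OF u1(1)] and vd = triD[OF v1(1)] and wd = triD[OF w1(1)] and wd3 = triD[OF w3(1)]
  have hit: "E z b \<or> E z b'" if t: "tri u v w" and z: "E u z" "z \<noteq> w" and b: "tri v b b'" and c: "tri w c c'" "c \<noteq> v" "c' \<noteq> v"
    for z v w b b' c c'
  proof (rule ccontr)
    assume no: "\<not> ?thesis"
    note t1 = triD[OF b] and t2 = triD[OF c(1)]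
    have "\<not> (E z c \<and> E z c')" using l_eq_1D[OF l_eq_1[OF t2(3)], of z w] z(2) t2 sym[of z c] sym[of z c'] by blast
    then obtain x where x: "x = c \<or> x = c'" "\<not> E z x" by blast
    then have "E b x" "E b' x" using transversal[OF t z(1), of b x] transversal[OF t z(1), of b' x] no t1 t2 by blast+
    then have "x = v" using l_eq_1D[OF l_eq_1[OF t1(3)], of x v] t1 by blast
    then show False using x(1) c by blast
  qed
  have one: "\<not> (E z b \<and> E z b')" if "tri v b b'" "z \<noteq> v" for z v b b'
    using l_eq_1D[OF l_eq_1[OF triD(3)[OF that(1)]], of z v] that(2) triD[OF that(1)] sym[of z b] sym[of z b'] by blast
  have ne: "u1 \<noteq> v" "u1 \<noteq> w" "u2 \<noteq> v" "u2 \<noteq> w" "v1 \<noteq> u" "v2 \<noteq> u" "v1 \<noteq> w" "v2 \<noteq> w"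
      "w1 \<noteq> u" "w2 \<noteq> u" "w1 \<noteq> v" "w2 \<noteq> v" "w3 \<noteq> u" "w4 \<noteq> u" "w3 \<noteq> v" "w4 \<noteq> v"
    using u1(2) v1(2) w1(3) w3(2) unfolding C by blast+
  have dis: "{w1,w2} \<inter> {w3,w4} = {}" using w3(3) unfolding C by blast
  note tp = tri_perm(1)[OF t]
  have hv: "E z v1 \<or> E z v2" if "z = u1 \<or> z = u2" for z using hit[OF t _ _ v1(1) w1(1)] ne ud that by blast
  have hw1: "E z w1 \<or> E z w2" if "z = u1 \<or> z = u2" for z using hit[OF tp _ _ w1(1) v1(1)] ne ud that by blast
  have hw3: "E z w3 \<or> E z w4" if "z = u1 \<or> z = u2" for z using hit[OF tp _ _ w3(1) v1(1)] ne ud that by blast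
  have un: "\<not> (E u1 x \<and> E u2 x)" if "x \<noteq> u" for x
    using l_eq_1D[OF l_eq_1[OF ud(3)], of x u] that ud by blast
  have b: "\<exists>b. (b = v1 \<or> b = v2) \<and> \<not> E u1 b \<and> E u2 b" using one[OF v1(1), of u1] hv[of u1] hv[of u2] un[of v1] un[of v2] ne by blast
  have c: "\<exists>c. (c = w1 \<or> c = w2) \<and> \<not> E u1 c \<and> E u2 c" using one[OF w1(1), of u1] hw1[of u1] hw1[of u2] un[of w1] un[of w2] ne by blast
  have e: "\<exists>e. (e = w3 \<or> e = w4) \<and> \<not> E u1 e \<and> E u2 e" using one[OF w3(1), of u1] hw3[of u1] hw3[of u2] un[of w3] un[of w4] ne by blast
  obtain b c e where bce: "b = v1 \<or> b = v2" "\<not> E u1 b" "E u2 b" "c = w1 \<or> c = w2" "\<not> E u1 c" "E u2 c" "e = w3 \<or> e = w4" "\<not> E u1 e" "E u2 e"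
    using b c e by blast
  then have "E b c" "E b e" using transversal[OF t ud(1), of b c] transversal[OF t ud(1), of b e] vd wd wd3 by blast+
  then have "c = e" using l_eq_1D[OF l_eq_1[OF bce(3)], of c e] bce by blast
  then show False using bce dis by blast
qed

lemma two_edges:
  assumes u: "u \<in> V"
  shows "d = 4 \<and> (\<exists>A B. N u = A \<union> B \<and> A \<inter> B = {} \<and> cl A \<and> cl B \<and> card A = 2 \<and> card B = 2 \<and> (\<forall>a\<in>A. \<forall>b\<in>B. \<not> E a b))"
proof -
  obtain v where "E u v" using pure_ex_nb[OF finV pureV _ u] by auto
  then obtain w where t: "tri u v w" using ex_tri by blast
  obtain x y where x: "tri u x y" "comp u x y \<inter> comp u v w = {}" using other_comp[OF t] by blast
  note C = comp_eq[OF t] comp_eq[OF x(1)]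
  note td = triD[OF t] triD[OF x(1)]
  have c: "card (comp u v w \<union> comp u x y) = 4"
    using card_two_comps[OF t x] l_eq_1[OF td(1)] l_eq_1[OF td(2)] l_eq_1[OF td(7)] l_eq_1[OF td(8)] by simp
  then have "4 \<le> d" using card_mono[of "N u" "comp u v w \<union> comp u x y"] card_N[OF u] by (simp add: comp_sub)
  then have d: "d = 4" using card_le_4 by simp
  have Un: "comp u v w \<union> comp u x y = N u"
    by (rule card_subset_eq) (use comp_sub c d card_N[OF u] in auto)
  have "\<not> E a b" if "a \<in> {v,w}" "b \<in> {x,y}" for a b
  proof
    assume "E a b"
    moreover have "E u b" using that td by blast
    ultimately have "b \<in> comp u v w" using that td(1,2) by (auto simp: mem_comp)
    then show False using x(2) C that by blast
  qed
  moreover have "cl {v,w}" "cl {x,y}" using td by (auto simp: cl_def)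
  moreover have "card {v,w} = 2" "card {x,y} = 2" using neq[OF td(3)] neq[OF td(9)] by auto
  ultimately show ?thesis using d Un x(2) unfolding C by (intro conjI exI[of _ "{v,w}"] exI[of _ "{x,y}"]) auto
qed

end

section \<open>Neighbourhoods that are unions of two cliques\<close>

text \<open>A greedy choice: each set is large enough to avoid \<open>F\<close> and all earlier
  choices.\<close>

lemma distinct_representatives_avoiding:
  assumes "finite I" "finite F" "\<And>i. i \<in> I \<Longrightarrow> finite (S i) \<and> card I + card F \<le> card (S i)"
  shows "\<exists>g. inj_on g I \<and> (\<forall>i\<in>I. g i \<in> S i - F)"
  using assms
proof (induction I arbitrary: F rule: finite_induct)
  case (insert i I)
  have "\<not> S i \<subseteq> F" using insert.prems(2)[of i] insert.hyps card_mono[OF insert.prems(1), of "S i"] by auto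
  then obtain s where s: "s \<in> S i" "s \<notin> F" by blast
  have "\<exists>g. inj_on g I \<and> (\<forall>i\<in>I. g i \<in> S i - insert s F)"
  proof (rule insert.IH)
    fix j assume "j \<in> I"
    then show "finite (S j) \<and> card I + card (insert s F) \<le> card (S j)"
      using insert.prems(2)[of j] insert.prems(1) insert.hyps s by simp
  qed (use insert.prems in simp)
  then obtain g where g: "inj_on g I" "\<forall>i\<in>I. g i \<in> S i - insert s F" by blast
  have "inj_on (g(i := s)) (insert i I)" using g insert.hyps by (auto simp: inj_on_def)
  moreover have "\<forall>j\<in>insert i I. (g(i := s)) j \<in> S j - F" using g s by auto
  ultimately show ?case by blast
qed (simp)

text \<open>Sets of size \<open>card I - 1\<close> can fail to have distinct representatives only if
  they are all equal. Here \<open>a\<close> receives an element \<open>x\<close> outside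
  \<open>S b\<close>, the other indices are served greedily away from \<open>x\<close>, and
  \<open>b\<close> comes last, when at most \<open>card I - 2\<close> elements of \<open>S b\<close>
  are taken.\<close>

lemma distinct_representatives:
  assumes fin: "finite I" and S: "\<And>i. i \<in> I \<Longrightarrow> finite (S i) \<and> card I \<le> Suc (card (S i)) \<and> card (S i) = m"
    and ab: "a \<in> I" "b \<in> I" "S a \<noteq> S b"
  shows "\<exists>g. inj_on g I \<and> (\<forall>i\<in>I. g i \<in> S i)"
proof -
  have "\<not> S a \<subseteq> S b" using S[OF ab(1)] S[OF ab(2)] ab(3) card_subset_eq[of "S b" "S a"] by auto
  then obtain x where x: "x \<in> S a" "x \<notin> S b" by blast
  define J where "J = I - {a,b}"
  have "a \<noteq> b" using ab by auto
  then have J: "finite J" "card I = card J + 2" "I = insert a (insert b J)" "a \<notin> J" "b \<notin> J"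
    using fin ab card_Diff_subset[of "{a,b}" I] card_mono[OF fin, of "{a,b}"] by (auto simp: J_def)
  obtain g where g: "inj_on g J" "\<forall>i\<in>J. g i \<in> S i - {x}"
    using distinct_representatives_avoiding[OF J(1), of "{x}" S] S J by fastforce
  have "\<not> S b \<subseteq> g ` J"
    using S[OF ab(2)] J(2) card_mono[of "g ` J" "S b"] card_image_le[OF J(1), of g] J(1) by auto
  then obtain y where y: "y \<in> S b" "y \<notin> g ` J" by blast
  have "inj_on (g(a := x, b := y)) I"
    using g y x J \<open>a \<noteq> b\<close> unfolding J(3) inj_on_def by auto
  moreover have "\<forall>i\<in>I. (g(a := x, b := y)) i \<in> S i" using g x y \<open>a \<noteq> b\<close> unfolding J(3) by auto
  ultimately show ?thesis by blast
qed

locale rook_cis_graph = pure_cis_graph +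
  assumes k2: "2 \<le> k"
    and link: "u \<in> V \<Longrightarrow> \<exists>A B. N u = A \<union> B \<and> A \<inter> B = {} \<and> cl A \<and> cl B \<and> card A = k - 1 \<and> card B = k - 1 \<and>
      (\<forall>a\<in>A. \<forall>b\<in>B. \<not> E a b)"
begin

lemma card_mcl: "mcl V K \<Longrightarrow> card K = k"
  using pureV by (simp add: pure_def)

lemma finite_mcl: "mcl V K \<Longrightarrow> finite K"
  using finV finite_subset by (auto simp: mcl_def)

lemma edge_mcl: "E u v \<Longrightarrow> \<exists>K. mcl V K \<and> u \<in> K \<and> v \<in> K"
  using ex_mcl[OF finV, of "{u,v}"] EV[of u v] EV2[of u v] sym[of u v] by (auto simp: cl_def)

text \<open>No edge joins the two cliques of the link, so completing each by \<open>u\<close> gives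
  the only maximal cliques through \<open>u\<close>. Vertices and maximal cliques thus form a
  geometry of points and lines with two lines through each point, to be recognised as a
  grid.\<close>

lemma two_cliques:
  assumes u: "u \<in> V"
  shows "\<exists>K1 K2. mcl V K1 \<and> mcl V K2 \<and> K1 \<inter> K2 = {u} \<and> (\<forall>K. mcl V K \<longrightarrow> u \<in> K \<longrightarrow> K = K1 \<or> K = K2)"
proof -
  obtain A B where A: "N u = A \<union> B" "A \<inter> B = {}" "cl A" "cl B" "card A = k - 1" "card B = k - 1" "\<forall>a\<in>A. \<forall>b\<in>B. \<not> E a b"
    using link[OF u] by blast
  have fin: "finite A" "finite B" using finite_N[of u] A(1) by (metis finite_Un)+
  have un: "u \<notin> A" "u \<notin> B" using A(1) irrefl mem_N by blast+
  have M: "mcl V (insert u A)" "mcl V (insert u B)"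
  proof -
    have nu: "E u x" if "x \<in> A \<union> B" for x using that A(1) mem_N by blast
    then have s: "A \<union> B \<subseteq> V" using EV2 by blast
    have "cl (insert u A)" "cl (insert u B)" using cl_insert[OF A(3), of u] cl_insert[OF A(4), of u] nu by blast+
    then show "mcl V (insert u A)" "mcl V (insert u B)"
      using pure_cl_mcl[OF finV pureV] u s fin un A(5,6) k2 by auto
  qed
  have "K = insert u A \<or> K = insert u B" if K: "mcl V K" "u \<in> K" for K
  proof -
    have KN: "x \<in> A \<or> x \<in> B \<or> x = u" if "x \<in> K" for x
      using mcl_adj[OF K(1,2) that] A(1) mem_N by blast
    have "\<not> (x \<in> A \<and> y \<in> B)" if "x \<in> K" "y \<in> K" for x y
      using mcl_adj[OF K(1) that] A(7) A(2) by blast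
    then have "(\<forall>x\<in>K. x \<notin> B) \<or> (\<forall>x\<in>K. x \<notin> A)" by blast
    then have "K \<subseteq> insert u A \<or> K \<subseteq> insert u B" using KN by auto
    then show ?thesis
      using card_subset_eq[OF finite_mcl[OF M(1)], of K] card_subset_eq[OF finite_mcl[OF M(2)], of K]
        card_mcl[OF K(1)] card_mcl[OF M(1)] card_mcl[OF M(2)] by auto
  qed
  moreover have "insert u A \<inter> insert u B = {u}" using A(2) un by blast
  ultimately show ?thesis using M by (intro exI[of _ "insert u A"] exI[of _ "insert u B"]) simp
qed

lemma mcl_eq:
  assumes "mcl V K" "mcl V K'" "u \<in> K" "u \<in> K'" "v \<in> K" "v \<in> K'" "u \<noteq> v" shows "K = K'"
proof -
  have "u \<in> V" using mcl_sub[OF assms(1,3)] .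
  then obtain K1 K2 where K: "K1 \<inter> K2 = {u}" "\<forall>K. mcl V K \<longrightarrow> u \<in> K \<longrightarrow> K = K1 \<or> K = K2"
    using two_cliques[of u] by blast
  then have "K = K1 \<or> K = K2" "K' = K1 \<or> K' = K2" using assms(1-4) by simp_all
  moreover have "v \<notin> K1 \<inter> K2" using K(1) assms(7) by simp
  ultimately show ?thesis using assms(5,6) by auto
qed

text \<open>The second maximal clique through \<open>u\<close>; arbitrary unless \<open>K\<close> is a maximal clique containing \<open>u\<close>.\<close>

definition other :: "'a set \<Rightarrow> 'a \<Rightarrow> 'a set" where
  "other K u = (SOME K'. mcl V K' \<and> u \<in> K' \<and> K' \<noteq> K)"

lemma other:
  assumes "mcl V K" "u \<in> K"
  shows "mcl V (other K u)" "u \<in> other K u" "other K u \<noteq> K"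
proof -
  have "u \<in> V" using mcl_sub[OF assms] .
  then obtain K1 K2 where K: "mcl V K1" "mcl V K2" "K1 \<inter> K2 = {u}" using two_cliques[of u] by blast
  have "K1 \<noteq> K2" using K(3) card_mcl[OF K(1)] k2 by auto
  then have "\<exists>K'. mcl V K' \<and> u \<in> K' \<and> K' \<noteq> K" using K by (metis Int_iff insertI1)
  then have "mcl V (other K u) \<and> u \<in> other K u \<and> other K u \<noteq> K" unfolding other_def by (rule someI_ex)
  then show "mcl V (other K u)" "u \<in> other K u" "other K u \<noteq> K" by auto
qed

lemma other_unique:
  assumes "mcl V K" "u \<in> K" "mcl V K'" "u \<in> K'" shows "K' = K \<or> K' = other K u"
proof -
  have "u \<in> V" using mcl_sub[OF assms(1,2)] .
  then obtain K1 K2 where "\<forall>K. mcl V K \<longrightarrow> u \<in> K \<longrightarrow> K = K1 \<or> K = K2" using two_cliques[of u] by blast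
  then have "K = K1 \<or> K = K2" "K' = K1 \<or> K' = K2" "other K u = K1 \<or> other K u = K2"
    using assms other[OF assms(1,2)] by simp_all
  then show ?thesis using other(3)[OF assms(1,2)] by auto
qed

lemma other_meet:
  assumes "mcl V K" "u \<in> K" "x \<in> K" "x \<in> other K u" shows "x = u"
  using mcl_eq[OF assms(1) other(1)[OF assms(1,2)] assms(2) other(2)[OF assms(1,2)] assms(3,4)] other(3)[OF assms(1,2)] by metis

text \<open>The maximal clique containing the triangle \<open>x u v\<close> shares \<open>u\<close>
  and \<open>v\<close> with \<open>K\<close> and so equals \<open>K\<close>, but
  \<open>other K u\<close> meets \<open>K\<close> only in \<open>u\<close>.\<close>

lemma no_clique_triangle:
  assumes K: "mcl V K" and uv: "u \<in> K" "v \<in> K" "u \<noteq> v" and x: "x \<in> other K u" "x \<in> other K v" shows False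
proof -
  have "x \<noteq> u" using other_meet[OF K uv(2,1)] x uv by metis
  have "x \<noteq> v" using other_meet[OF K uv(1,2)] x uv by metis
  have e: "E x u" "E x v" "E u v"
    using mcl_adj[OF other(1)[OF K uv(1)] x(1) other(2)[OF K uv(1)]] mcl_adj[OF other(1)[OF K uv(2)] x(2) other(2)[OF K uv(2)]]
      mcl_adj[OF K uv] \<open>x \<noteq> u\<close> \<open>x \<noteq> v\<close> by auto
  then have "cl {x,u,v}" using sym[OF e(1)] sym[OF e(2)] sym[OF e(3)] by (auto simp: cl_def)
  then obtain K' where K': "mcl V K'" "{x,u,v} \<subseteq> K'" using ex_mcl[OF finV, of "{x,u,v}"] EV[OF e(1)] EV2[OF e(1)] EV2[OF e(2)] by blast
  then have "K' = K" using mcl_eq[OF K'(1) K, of u v] uv by blast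
  then show False using other_meet[OF K uv(1) _ x(1)] K' \<open>x \<noteq> u\<close> by blast
qed

text \<open>A maximal clique \<open>C\<close> serves as one column. The second cliques
  \<open>D c\<close> through its vertices are the rows, and \<open>X c x\<close> is the column
  through the vertex \<open>x\<close> of row \<open>D c\<close>.\<close>

lemma rook_coordinates:
  shows "\<exists>r c. bij_betw (\<lambda>v. (r v, c v)) V ({..<k} \<times> {..<k}) \<and>
    (\<forall>u\<in>V. \<forall>v\<in>V. E u v \<longleftrightarrow> u \<noteq> v \<and> ((r u :: nat) = r v \<or> (c u :: nat) = c v))"
proof -
  obtain C where C: "mcl V C" using ex_mcl[OF finV, of "{}"] by (auto simp: cl_def)
  have cardC: "card C = k" "finite C" using card_mcl[OF C] finite_mcl[OF C] by auto
  define D where "D c = other C c" for c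
  have D: "mcl V (D c)" "c \<in> D c" "D c \<noteq> C" if "c \<in> C" for c using other[OF C that] by (auto simp: D_def)
  have DC: "x = c" if "c \<in> C" "x \<in> C" "x \<in> D c" for c x using other_meet[OF C that(1,2)] that(3) by (simp add: D_def)
  have DD: "c = c'" if "c \<in> C" "c' \<in> C" "x \<in> D c" "x \<in> D c'" for c c' x
    using no_clique_triangle[OF C that(1,2)] that(3,4) unfolding D_def by blast
  define X where "X c x = other (D c) x" for c x
  have X: "mcl V (X c x)" "x \<in> X c x" "X c x \<noteq> D c" if "c \<in> C" "x \<in> D c" for c x
    using other[OF D(1)[OF that(1)] that(2)] by (auto simp: X_def)
  have XD: "y = x" if "c \<in> C" "x \<in> D c" "y \<in> D c" "y \<in> X c x" for c x y
    using other_meet[OF D(1)[OF that(1)] that(2,3)] that(4) by (simp add: X_def)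
  have Xc: "X c c = C" if "c \<in> C" for c using other_unique[OF D(1,2) C, OF that that that] D(3)[OF that] by (simp add: X_def)
  have XC: "X c x \<inter> C = {}" if c: "c \<in> C" "x \<in> D c" "x \<noteq> c" for c x
  proof (rule equals0I)
    fix c' assume c': "c' \<in> X c x \<inter> C"
    have "c' \<noteq> c" using XD[OF c(1,2) D(2)[OF c(1)]] c' c(3) by blast
    have "x \<notin> C" using DC[OF c(1) _ c(2)] c(3) by blast
    then have "X c x \<noteq> C" using X(2)[OF c(1,2)] by blast
    then have "X c x = D c'" using other_unique[OF C _ X(1)[OF c(1,2)], of c'] c' by (simp add: D_def)
    then show False using DD[of c c' x] c c' X(2)[OF c(1,2)] \<open>c' \<noteq> c\<close> by blast
  qed
  define S where "S c = X c ` (D c - {c})" for c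
  have Sinj: "inj_on (X c) (D c - {c})" if "c \<in> C" for c
    using XD[OF that] X(2)[OF that] by (intro inj_onI) (metis DiffD1)
  have cardS: "card (S c) = k - 1" "finite (S c)" if "c \<in> C" for c
    using card_image[OF Sinj[OF that]] card_mcl[OF D(1)[OF that]] finite_mcl[OF D(1)[OF that]] D(2)[OF that] by (auto simp: S_def)
  \<comment> \<open>All rows meet the same columns. Otherwise distinct columns \<open>g c\<close>
    can be chosen, one from each \<open>S c\<close>; the vertices \<open>x c\<close> where they
    cross the rows are pairwise non-adjacent and dominate \<open>C\<close>.\<close>
  have Seq: "S a = S b" if ab: "a \<in> C" "b \<in> C" for a b
  proof (rule ccontr)
    assume ne: "S a \<noteq> S b"
    have "finite (S c) \<and> card C \<le> Suc (card (S c)) \<and> card (S c) = k - 1" if "c \<in> C" for c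
      using cardS[OF that] cardC by simp
    then obtain g where g: "inj_on g C" "\<forall>c\<in>C. g c \<in> S c"
      using distinct_representatives[OF cardC(2) _ ab ne] by blast
    have "\<forall>c\<in>C. \<exists>x. x \<in> D c \<and> x \<noteq> c \<and> g c = X c x" using g(2) by (auto simp: S_def)
    then obtain x where x: "\<forall>c\<in>C. x c \<in> D c \<and> x c \<noteq> c \<and> g c = X c (x c)" by metis
    have "\<not> E (x c) (x c')" if c: "c \<in> C" "c' \<in> C" for c c'
    proof
      assume e: "E (x c) (x c')"
      then have ne: "c \<noteq> c'" using irrefl by auto
      obtain K where K: "mcl V K" "x c \<in> K" "x c' \<in> K" using edge_mcl[OF e] by blast
      have k1: "K = D c \<or> K = g c" using other_unique[OF D(1)[OF c(1)] _ K(1,2)] x c by (simp add: X_def)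
      have k2: "K = D c' \<or> K = g c'" using other_unique[OF D(1)[OF c(2)] _ K(1,3)] x c by (simp add: X_def)
      have "D c \<noteq> D c'" using DC[OF c(1,2)] D(2)[OF c(2)] ne by auto
      moreover have "D c \<noteq> g c'" using XC[of c' "x c'"] x c D(2)[OF c(1)] by auto
      moreover have "D c' \<noteq> g c" using XC[of c "x c"] x c D(2)[OF c(2)] by auto
      moreover have "g c \<noteq> g c'" using g(1) c ne by (auto simp: inj_on_def)
      ultimately show False using k1 k2 by auto
    qed
    then have "st (x ` C)" by (auto simp: st_def)
    moreover have "x ` C \<subseteq> V" using x D(1) mcl_sub by blast
    moreover have "\<exists>s\<in>x ` C. E c s" if c: "c \<in> C" for c
      using mcl_adj[OF D(1)[OF c] D(2)[OF c], of "x c"] x c by (metis imageI)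
    moreover have "C \<noteq> {}" using cardC k2 by auto
    ultimately show False using cisD[OF cisV C] by blast
  qed
  \<comment> \<open>By \<open>Seq\<close> a column meets all \<open>k\<close> rows. It has only
    \<open>k\<close> vertices and so lies in the union of the rows, which is therefore closed under
    adjacency.\<close>
  have VD: "\<Union> (D ` C) = V"
  proof (rule connectedE)
    show "\<Union> (D ` C) \<subseteq> V" using D(1) mcl_sub by blast
    show "\<Union> (D ` C) \<noteq> {}" using D(2) cardC k2 by fastforce
    fix v w assume "v \<in> \<Union> (D ` C)" "E v w"
    then obtain c where c: "c \<in> C" "v \<in> D c" by blast
    obtain K where K: "mcl V K" "v \<in> K" "w \<in> K" using edge_mcl[OF \<open>E v w\<close>] by blast
    consider "K = D c" | "K = X c v" using other_unique[OF D(1)[OF c(1)] c(2) K(1,2)] by (auto simp: X_def)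
    then show "w \<in> \<Union> (D ` C)"
    proof cases
      case 1 then show ?thesis using K c by blast
    next
      case 2
      show ?thesis
      proof (cases "v = c")
        case True
        then have "w \<in> C" using 2 K Xc[OF c(1)] by simp
        then show ?thesis using D(2) by blast
      next
        case False
        then have "K \<in> S c" using 2 c by (auto simp: S_def)
        then have "\<forall>c'\<in>C. K \<in> S c'" using Seq c by blast
        then have "\<forall>c'\<in>C. \<exists>x. x \<in> D c' \<and> x \<in> K" using X(2) by (fastforce simp: S_def)
        then obtain y where y: "\<forall>c'\<in>C. y c' \<in> D c' \<and> y c' \<in> K" by metis
        have "inj_on y C" using y DD by (intro inj_onI) metis
        then have "card (y ` C) = card K" using card_image cardC card_mcl[OF K(1)] by metis
        then have "y ` C = K" using y by (intro card_subset_eq finite_mcl[OF K(1)]) auto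
        then show ?thesis using K(3) y by blast
      qed
    qed
  qed
  have "\<forall>v\<in>V. \<exists>c\<in>C. v \<in> D c" using VD by blast
  then obtain row where row: "\<forall>v\<in>V. row v \<in> C \<and> v \<in> D (row v)" by metis
  define col where "col v = X (row v) v" for v
  obtain c0 where c0: "c0 \<in> C" using cardC k2 by fastforce
  define Q where "Q = insert C (S c0)"
  have "C \<notin> S c0" using XC[OF c0] c0 unfolding S_def by blast
  then have cardQ: "card Q = k" "finite Q" using cardS[OF c0] k2 by (auto simp: Q_def)
  have colQ: "col v \<in> Q" if "v \<in> V" for v
  proof (cases "v = row v")
    case True
    then show ?thesis using Xc[of v] row that by (metis Q_def col_def insertI1)
  next
    case False
    then have "col v \<in> S (row v)" using row that by (auto simp: S_def col_def)
    then show ?thesis using Seq[OF c0, of "row v"] row that by (auto simp: Q_def)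
  qed
  have mcol: "mcl V (col v)" "v \<in> col v" if "v \<in> V" for v using X row that unfolding col_def by auto
  have Dcol: "D c \<noteq> col v" if "c \<in> C" "v \<in> V" for c v
  proof (cases "v = row v")
    case True
    then show ?thesis using D(3)[OF that(1)] Xc row that unfolding col_def by metis
  next
    case False
    then show ?thesis using XC[of "row v" v] row that D(2)[OF that(1)] unfolding col_def by blast
  qed
  have E: "E u v \<longleftrightarrow> u \<noteq> v \<and> (row u = row v \<or> col u = col v)" if uv: "u \<in> V" "v \<in> V" for u v
  proof
    assume e: "E u v"
    obtain K where K: "mcl V K" "u \<in> K" "v \<in> K" using edge_mcl[OF e] by blast
    have K2: "K = D (row u) \<or> K = col u" "K = D (row v) \<or> K = col v"
      using other_unique[OF D(1)[of "row u"] _ K(1,2)] other_unique[OF D(1)[of "row v"] _ K(1,3)]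
        bspec[OF row uv(1)] bspec[OF row uv(2)] unfolding col_def X_def by auto
    have rr: "row u \<in> C" "row v \<in> C" using bspec[OF row uv(1)] bspec[OF row uv(2)] by simp_all
    have rv: "row v = row u" if "D (row u) = D (row v)" by (rule DC[OF rr]) (simp only: that D(2)[OF rr(2)])
    have "D (row u) \<noteq> col v" "D (row v) \<noteq> col u" using Dcol[OF rr(1) uv(2)] Dcol[OF rr(2) uv(1)] by auto
    then have "D (row u) = D (row v) \<or> col u = col v" using K2 by (elim disjE) auto
    then have "row v = row u \<or> col u = col v" using rv by (elim disjE) simp_all
    then show "u \<noteq> v \<and> (row u = row v \<or> col u = col v)" using neq[OF e] by (elim disjE) simp_all
  next
    assume "u \<noteq> v \<and> (row u = row v \<or> col u = col v)"
    moreover have "row u \<in> C" "u \<in> D (row u)" "v \<in> D (row v)" using row uv by auto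
    moreover have "u \<in> col u" "v \<in> col v" using mcol uv by auto
    ultimately show "E u v" using mcl_adj[OF D(1)[of "row u"], of u v] mcl_adj[OF mcol(1)[OF uv(1)], of u v] by auto
  qed
  have inj: "inj_on (\<lambda>v. (row v, col v)) V"
  proof (rule inj_onI)
    fix u v assume uv: "u \<in> V" "v \<in> V" "(row u, col u) = (row v, col v)"
    show "u = v"
    proof (rule ccontr)
      assume "u \<noteq> v"
      then have "D (row u) = col u" using mcl_eq[OF D(1)[of "row u"] mcol(1)[OF uv(1)], of u v] row uv mcol by auto
      then show False using Dcol row uv by blast
    qed
  qed
  \<comment> \<open>The rows partition \<open>V\<close>, so there are \<open>k * k\<close> vertices
    and the injective coordinate map is onto.\<close>
  have "card V = (\<Sum>c\<in>C. card (D c))"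
    unfolding VD[symmetric] by (rule card_UN_disjoint) (use cardC finite_mcl D(1) DD in blast)+
  also have "\<dots> = k * k" using card_mcl D(1) cardC by simp
  finally have "card ((\<lambda>v. (row v, col v)) ` V) = card (C \<times> Q)" using cardC cardQ by (simp add: card_image[OF inj] card_cartesian_product)
  moreover have "(\<lambda>v. (row v, col v)) ` V \<subseteq> C \<times> Q" using row colQ by auto
  ultimately have bij: "bij_betw (\<lambda>v. (row v, col v)) V (C \<times> Q)"
    using inj cardC cardQ by (simp add: bij_betw_def card_subset_eq)
  obtain f where f: "bij_betw f C {..<k}" using ex_bij_betw_finite_nat[OF cardC(2)] cardC(1) by (auto simp: atLeast0LessThan)
  obtain h where h: "bij_betw h Q {..<k}" using ex_bij_betw_finite_nat[OF cardQ(2)] cardQ(1) by (auto simp: atLeast0LessThan)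
  have "bij_betw (map_prod f h \<circ> (\<lambda>v. (row v, col v))) V ({..<k} \<times> {..<k})"
    by (rule bij_betw_trans[OF bij bij_betw_map_prod[OF f h]])
  then have b: "bij_betw (\<lambda>v. ((f \<circ> row) v, (h \<circ> col) v)) V ({..<k} \<times> {..<k})" by (simp add: comp_def)
  have fr: "f (row u) = f (row v) \<longleftrightarrow> row u = row v" and hc: "h (col u) = h (col v) \<longleftrightarrow> col u = col v"
    if uv: "u \<in> V" "v \<in> V" for u v
    using inj_on_eq_iff[of f C "row u" "row v"] inj_on_eq_iff[of h Q "col u" "col v"] f h
      bspec[OF row uv(1)] bspec[OF row uv(2)] colQ[OF uv(1)] colQ[OF uv(2)] by (auto simp: bij_betw_def)
  have "E u v \<longleftrightarrow> u \<noteq> v \<and> ((f \<circ> row) u = (f \<circ> row) v \<or> (h \<circ> col) u = (h \<circ> col) v)" if "u \<in> V" "v \<in> V" for u v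
    using E[OF that] fr[OF that] hc[OF that] by simp
  then show ?thesis using b by (intro exI[of _ "f \<circ> row"] exI[of _ "h \<circ> col"]) simp
qed

end

section \<open>Clique number four\<close>

locale cis_graph_4 = pure_cis_graph E V d 4 for E :: "'a \<Rightarrow> 'a \<Rightarrow> bool" and V d
begin

lemma K5_free: "E a b \<Longrightarrow> E a c \<Longrightarrow> E a e \<Longrightarrow> E a f \<Longrightarrow> E b c \<Longrightarrow> E b e \<Longrightarrow> E b f \<Longrightarrow> E c e \<Longrightarrow> E c f \<Longrightarrow> E e f \<Longrightarrow> False"
proof -
  assume e: "E a b" "E a c" "E a e" "E a f" "E b c" "E b e" "E b f" "E c e" "E c f" "E e f"
  then have "cl {a,b,c,e,f}" using e[THEN sym] by (auto simp: cl_def)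
  moreover have "card {a,b,c,e,f} = 5" using e[THEN neq] by (auto simp: card_insert_if)
  moreover have "{a,b,c,e,f} \<subseteq> V" using EV[OF e(1)] e(1-4)[THEN EV2] by simp
  ultimately show False using pure_cl_le[OF finV pureV] by fastforce
qed

definition clique4 :: "'a \<Rightarrow> 'a \<Rightarrow> 'a \<Rightarrow> 'a \<Rightarrow> bool" where
  "clique4 a b c e \<longleftrightarrow> E a b \<and> E a c \<and> E a e \<and> E b c \<and> E b e \<and> E c e"

lemma clique4D: "clique4 a b c e \<Longrightarrow> E a b" "clique4 a b c e \<Longrightarrow> E a c" "clique4 a b c e \<Longrightarrow> E a e"
    "clique4 a b c e \<Longrightarrow> E b c" "clique4 a b c e \<Longrightarrow> E b e" "clique4 a b c e \<Longrightarrow> E c e"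
    "clique4 a b c e \<Longrightarrow> E b a" "clique4 a b c e \<Longrightarrow> E c a" "clique4 a b c e \<Longrightarrow> E e a"
    "clique4 a b c e \<Longrightarrow> E c b" "clique4 a b c e \<Longrightarrow> E e b" "clique4 a b c e \<Longrightarrow> E e c"
  unfolding clique4_def by (simp_all add: sym_iff)

lemma clique4_perm: "clique4 a b c e \<Longrightarrow> clique4 b a c e" "clique4 a b c e \<Longrightarrow> clique4 a c b e" "clique4 a b c e \<Longrightarrow> clique4 a b e c"
  unfolding clique4_def by (simp_all add: sym_iff)

lemma clique4_dominated:
  assumes "clique4 a b c e" "S \<subseteq> V" "st S" "\<exists>s\<in>S. E a s" "\<exists>s\<in>S. E b s" "\<exists>s\<in>S. E c s" "\<exists>s\<in>S. E e s"
  shows False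
proof -
  note D = clique4D[OF assms(1)]
  have "cl {a,b,c,e}" using D by (auto simp: cl_def)
  moreover have "card {a,b,c,e} = 4" using D(1-6)[THEN neq] by (auto simp: card_insert_if)
  moreover have "{a,b,c,e} \<subseteq> V" using EV[OF D(1)] D(1-3)[THEN EV2] by simp
  ultimately have "mcl V {a,b,c,e}" by (intro pure_cl_mcl[OF finV pureV])
  then show False using cisD[OF cisV, of "{a,b,c,e}" S] assms by auto
qed

text \<open>Otherwise \<open>{s,t}\<close> would be a stable set dominating a maximal clique. It
  plays the role that \<open>transversal\<close> has for clique number three.\<close>

lemma dominating_pair:
  assumes "clique4 a b c e" "s \<in> V" "t \<in> V" "E a s \<or> E a t" "E b s \<or> E b t" "E c s \<or> E c t" "E e s \<or> E e t"
  shows "E s t"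
proof (rule ccontr)
  assume "\<not> E s t"
  then have "st {s,t}" using sym[of t s] irrefl by (auto simp: st_def)
  then show False using clique4_dominated[OF assms(1), of "{s,t}"] assms by auto
qed

lemma edge_N: "E u v \<Longrightarrow> nb (N u) v = N u \<inter> N v"
  by auto

lemma pure_edge:
  assumes "E u v" shows "cis (N u \<inter> N v)" "pure (N u \<inter> N v) 2" "finite (N u \<inter> N v)"
proof -
  have u: "u \<in> V" using EV assms .
  have "cis (nb (N u) v)" by (rule cis_nb[OF cis_N[OF u]]) (use assms in simp)
  moreover have "pure (nb (N u) v) 2" by (rule pure_nb[OF finite_N]) (use pure_N[OF u] assms in simp_all)
  ultimately show "cis (N u \<inter> N v)" "pure (N u \<inter> N v) 2" "finite (N u \<inter> N v)" using edge_N[OF assms] by auto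
qed

lemma common_link_difunctional:
  assumes "E u v" "E u a" "E v a" "E u b" "E v b" "E u c" "E v c" "E u e" "E v e" "E a b" "E b c" "E c e"
  shows "E a e"
  using pure2_difunctional[OF pure_edge(3,1,2)[OF assms(1)], of a b c e] assms by simp

lemma ex_clique4:
  assumes "E u v" "E u a" "E v a" shows "\<exists>b. clique4 u v a b"
  using pure_ex_nb[OF pure_edge(3,2)[OF assms(1)], of a] assms by (auto simp: clique4_def)

lemma ex_clique4': assumes "E u v" shows "\<exists>a b. clique4 u v a b"
proof -
  have "u \<in> V" using EV assms .
  then have "\<exists>a\<in>N u. E v a" using pure_ex_nb[OF finite_N pure_N, of u v] assms by simp
  then obtain a where "E u a" "E v a" by auto
  then show ?thesis using ex_clique4[OF assms] by blast
qed

text \<open>The relation \<open>F\<close> is adjacency without the edges between twins. Two adjacent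
  \<open>F\<close>-neighbours of a vertex are twins, since otherwise five vertices would be pairwise
  adjacent. Two adjacent twin classes form a maximal clique, so \<open>dominating_pair\<close> makes
  \<open>F\<close> difunctional. Hence \<open>F\<close> is complete bipartite, and \<open>E\<close>
  adds a perfect matching inside each part.\<close>

lemma twin_case:
  assumes tw: "\<And>v. v \<in> V \<Longrightarrow> card (twins v) = 2" and d: "3 < d"
  shows "\<exists>A B. A \<inter> B = {} \<and> A \<union> B = V \<and> card A = d - 1 \<and> card B = d - 1 \<and>
     (\<forall>x\<in>V. card (twins x) = 2 \<and> twins x \<subseteq> (if x \<in> A then A else B)) \<and>
    (\<forall>x\<in>V. \<forall>y\<in>V. E x y \<longleftrightarrow> x \<noteq> y \<and> (x \<in> A \<and> y \<in> B \<or> x \<in> B \<and> y \<in> A \<or> y \<in> twins x))"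
proof -
  obtain t where t: "\<And>v. v \<in> V \<Longrightarrow> t v \<noteq> v \<and> twins v = {v, t v}"
  proof -
    have "\<exists>w. w \<noteq> v \<and> twins v = {v,w}" if "v \<in> V" for v
    proof -
      obtain a b where "twins v = {a,b}" "a \<noteq> b" using tw[OF \<open>v \<in> V\<close>] by (auto simp: card_2_iff)
      then show ?thesis using mem_twins[OF that] by (metis insert_commute insert_iff singletonD)
    qed
    then show ?thesis using that by metis
  qed
  have tV: "t v \<in> V" if "v \<in> V" for v using t[OF that] by (auto simp: twins_def)
  have cnt: "cn (t v) = cn v" if "v \<in> V" for v using t[OF that] by (auto simp: twins_def)
  have twin_eq: "w = v \<or> w = t v" if "v \<in> V" "w \<in> V" "cn w = cn v" for v w
    using t[OF that(1)] that by (auto simp: twins_def)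
  have Et: "E v (t v)" if "v \<in> V" for v
  proof -
    have "t v \<in> cn (t v)" by (simp add: cn_def)
    then have "t v \<in> cn v" using cnt[OF that] by simp
    then show ?thesis using t[OF that] by (simp add: cn_def)
  qed
  have Etw: "E (t v) x" if "v \<in> V" "E v x" "x \<noteq> t v" for v x
    using cnt[OF that(1)] that by (auto simp: cn_def)
  have tt: "t (t v) = v" if "v \<in> V" for v
    using twin_eq[of "t v" v] cnt[OF that] tV[OF that] t[OF that] t[OF tV[OF that]] that by metis
  define F where "F v x \<longleftrightarrow> v \<in> V \<and> E v x \<and> x \<noteq> t v" for v x
  have FV: "v \<in> V \<and> x \<in> V" if "F v x" for v x using that EV2 by (auto simp: F_def)
  have FE: "E v x" if "F v x" for v x using that by (simp add: F_def)
  have Fsym: "F x v" if "F v x" for v x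
    using that EV2[of v x] sym[of v x] tt[of v] tt[of x] by (auto simp: F_def)
  have Ft: "F (t v) x" if "F v x" for v x
    using that Etw[of v x] tV[of v] tt[of v] neq[of v x] by (auto simp: F_def)
  have Ft2: "F v (t x)" if "F v x" for v x using Fsym[OF Ft[OF Fsym[OF that]]] .
  have matching: "y = t x" if e: "F v x" "F v y" "E x y" for v x y
  proof (rule ccontr)
    assume ne: "y \<noteq> t x"
    have V: "v \<in> V" "x \<in> V" "y \<in> V" using FV e by auto
    have xy: "F x y" using V e(3) ne by (simp add: F_def)
    show False
      using K5_free[of v "t v" x "t x" y] Et[OF V(1)] Et[OF V(2)] FE[OF e(1)] FE[OF e(2)] FE[OF Ft[OF e(1)]] FE[OF Ft[OF e(2)]]
        FE[OF Ft2[OF e(1)]] FE[OF Ft[OF Ft2[OF e(1)]]] e(3) FE[OF Ft[OF xy]] by blast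
  qed
  have path: "F a b" if p: "F a v" "F v w" "F w b" for a v w b
  proof -
    have V: "a \<in> V" "v \<in> V" "w \<in> V" "b \<in> V" using FV p by auto
    have "clique4 v (t v) w (t w)"
      unfolding clique4_def using Et[OF V(2)] Et[OF V(3)] FE[OF p(2)] FE[OF Ft[OF p(2)]] FE[OF Ft2[OF p(2)]] FE[OF Ft[OF Ft2[OF p(2)]]] by blast
    moreover have "E v a" "E (t v) a" "E w b" "E (t w) b"
      using FE[OF Fsym[OF p(1)]] FE[OF Ft[OF Fsym[OF p(1)]]] FE[OF p(3)] FE[OF Ft[OF p(3)]] by auto
    ultimately have "E a b" using dominating_pair[of v "t v" w "t w" a b] V by blast
    moreover have "b \<noteq> t a"
    proof
      assume "b = t a"
      then have wa: "F w a" using Ft2[OF p(3)] tt[OF V(1)] by simp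
      then have "w = t a" using matching[of v a w] Fsym[OF p(1)] p(2) FE[OF Fsym[OF wa]] by blast
      then show False using Fsym[OF wa] by (simp add: F_def)
    qed
    ultimately show ?thesis using V by (simp add: F_def)
  qed
  obtain v where v: "v \<in> V" using nonempty by blast
  have "\<not> N v \<subseteq> {t v}" using card_N[OF v] d card_mono[of "{t v}" "N v"] by auto
  then obtain w where w: "E v w" "w \<noteq> t v" by (auto simp: subset_iff)
  have vw: "F v w" using v w by (simp add: F_def)
  then have wv: "F w v" by (rule Fsym)
  define A where "A = {x. F w x}"
  define B where "B = {x. F v x}"
  have card: "card {x. F u x} = d - 1" if u: "u \<in> V" for u
  proof -
    have "{x. F u x} = N u - {t u}" using u by (auto simp: F_def)
    then show ?thesis using card_N[OF u] Et[OF u] by simp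
  qed
  have disj: "A \<inter> B = {}"
  proof (rule equals0I)
    fix x assume "x \<in> A \<inter> B"
    then have x: "F v x" "F w x" by (auto simp: A_def B_def)
    then have "w = t x" using matching[of v x w] vw FE[OF Fsym[OF x(2)]] by blast
    then show False using Fsym[OF x(2)] by (simp add: F_def)
  qed
  have AB: "A \<union> B = V"
  proof (rule connectedE)
    show "A \<union> B \<subseteq> V" "A \<union> B \<noteq> {}" using FV vw by (auto simp: A_def B_def)
    fix a x assume a: "a \<in> A \<union> B" "E a x"
    show "x \<in> A \<union> B"
    proof (cases "x = t a")
      case True
      then show ?thesis using a(1) Ft2 by (auto simp: A_def B_def)
    next
      case False
      then have ax: "F a x" using a EV by (simp add: F_def)
      then show ?thesis using a(1) path[OF vw _ ax] path[OF wv _ ax] by (auto simp: A_def B_def)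
    qed
  qed
  have cross: "F x y" if "x \<in> A" "y \<in> B" for x y
    using path[of x w v y] that Fsym[of w x] wv by (auto simp: A_def B_def)
  have tA: "twins x \<subseteq> A" if "x \<in> A" for x
    using that t[of x] Ft2[of w x] FV[of w x] by (auto simp: A_def)
  have tB: "twins x \<subseteq> B" if "x \<in> B" for x
    using that t[of x] Ft2[of v x] FV[of v x] by (auto simp: B_def)
  have "E x y \<longleftrightarrow> x \<noteq> y \<and> (x \<in> A \<and> y \<in> B \<or> x \<in> B \<and> y \<in> A \<or> y \<in> twins x)" if xy: "x \<in> V" "y \<in> V" for x y
  proof
    assume e: "E x y"
    have "y = t x" if "x \<in> A" "y \<in> A" using matching[of w x y] that e by (simp add: A_def)
    moreover have "y = t x" if "x \<in> B" "y \<in> B" using matching[of v x y] that e by (simp add: B_def)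
    ultimately have "x \<in> A \<and> y \<in> B \<or> x \<in> B \<and> y \<in> A \<or> y = t x" using AB xy by blast
    then show "x \<noteq> y \<and> (x \<in> A \<and> y \<in> B \<or> x \<in> B \<and> y \<in> A \<or> y \<in> twins x)"
      using t[OF xy(1)] neq[OF e] by auto
  next
    assume r: "x \<noteq> y \<and> (x \<in> A \<and> y \<in> B \<or> x \<in> B \<and> y \<in> A \<or> y \<in> twins x)"
    then consider "x \<in> A" "y \<in> B" | "x \<in> B" "y \<in> A" | "y = t x" using t[OF xy(1)] by auto
    then show "E x y"
    proof cases
      case 1 then show ?thesis using cross FE by blast
    next
      case 2 then show ?thesis using cross[of y x] FE Fsym by blast
    next
      case 3 then show ?thesis using Et[OF xy(1)] by simp
    qed
  qed
  moreover have "card A = d - 1" "card B = d - 1" using card FV[OF vw] by (auto simp: A_def B_def)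
  moreover have "card (twins x) = 2 \<and> twins x \<subseteq> (if x \<in> A then A else B)" if "x \<in> V" for x
    using tw[OF that] tA tB AB that by auto
  ultimately show ?thesis using disj AB by (intro exI[of _ A] exI[of _ B] conjI ballI) simp_all
qed

text \<open>The common neighbours of adjacent \<open>u\<close> and \<open>v\<close> induce a
  disjoint union of complete bipartite graphs; the edge is split if there are at least two
  components.\<close>

definition split_edge :: "'a \<Rightarrow> 'a \<Rightarrow> bool" where
  "split_edge u v \<longleftrightarrow> (\<exists>a b x. clique4 u v a b \<and> E u x \<and> E v x \<and> \<not> E a x \<and> \<not> E b x)"

lemma Aut_clique4: "f \<in> Aut \<Longrightarrow> clique4 (f a) (f b) (f c) (f e) \<longleftrightarrow> clique4 a b c e"
  by (simp add: clique4_def Aut_E)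

lemma Aut_split_edge: "f \<in> Aut \<Longrightarrow> split_edge u v \<Longrightarrow> split_edge (f u) (f v)"
  unfolding split_edge_def using Aut_clique4 Aut_E by meson

lemma split_edge_pairs:
  assumes "split_edge v w"
  shows "\<exists>a b c e. clique4 v w a b \<and> clique4 v w c e \<and> \<not> E a c \<and> \<not> E a e \<and> \<not> E b c \<and> \<not> E b e"
proof -
  obtain a b c where a: "clique4 v w a b" "E v c" "E w c" "\<not> E a c" "\<not> E b c"
    using assms by (auto simp: split_edge_def)
  note D = clique4D[OF a(1)]
  obtain e where e: "clique4 v w c e" using ex_clique4[OF D(1) a(2,3)] by blast
  note De = clique4D[OF e]
  have "\<not> E a e" using common_link_difunctional[OF D(1), of b a e c] D De a by blast
  moreover have "\<not> E b e" using common_link_difunctional[OF D(1), of a b e c] D De a by blast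
  ultimately show ?thesis using a e by blast
qed

end

section \<open>Split edges\<close>

locale cis_graph_4_twin_free = cis_graph_4 +
  assumes d7: "d \<le> 7"
    and twin_free: "E v w \<Longrightarrow> \<exists>x. E v x \<and> x \<noteq> w \<and> \<not> E w x"
begin

text \<open>By transitivity every vertex would share its neighbourhood with another one. The
  neighbours \<open>w\<close>, \<open>a\<close>, \<open>b\<close>, \<open>c\<close> of
  \<open>v\<close> have four different neighbourhoods, so together with their false twins, which are
  adjacent to \<open>v\<close> too, they give eight neighbours.\<close>

lemma no_false_twins:
  assumes s: "split_edge v w" and z: "N w = N z" "w \<noteq> z" shows False
proof -
  obtain a b c e where a: "clique4 v w a b" "clique4 v w c e" "\<not> E a c" "\<not> E a e" "\<not> E b c" "\<not> E b e"
    using split_edge_pairs[OF s] by blast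
  note D = clique4D[OF a(1)] clique4D[OF a(2)]
  have wV: "w \<in> V" "v \<in> V" using EV2[OF D(1)] EV[OF D(1)] by auto
  have tw: "\<exists>u'. u' \<noteq> u \<and> N u' = N u" if u: "u \<in> V" for u
  proof -
    obtain f where f: "f \<in> Aut" "f w = u" using Aut_trans wV u by blast
    then show ?thesis using z Aut_N[OF f(1)] Aut_eq[OF f(1)] by metis
  qed
  define g where "g u = {x \<in> N v. N x = N u}" for u
  have g2: "2 \<le> card (g u)" if u: "E v u" for u
  proof -
    obtain u' where u': "u' \<noteq> u" "N u' = N u" using tw[of u] EV2[OF u] by blast
    have "v \<in> N u" using sym[OF u] by simp
    then have "E u' v" using u'(2) mem_N by blast
    then have "{u,u'} \<subseteq> g u" using u u' sym[of u' v] by (simp add: g_def)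
    then have "card {u,u'} \<le> card (g u)" by (rule card_mono[rotated]) (rule finite_subset[OF _ finite_N[of v]], auto simp: g_def)
    then show ?thesis using u'(1) by simp
  qed
  have N: "N w \<noteq> N a" "N w \<noteq> N b" "N w \<noteq> N c" "N a \<noteq> N b" "N a \<noteq> N c" "N b \<noteq> N c"
  proof -
    show "N w \<noteq> N a" "N w \<noteq> N b" "N w \<noteq> N c" using D irrefl mem_N by blast+
    show "N a \<noteq> N b" using D irrefl mem_N by blast
    show "N a \<noteq> N c" using D(6) a(5) sym[of c b] mem_N by blast
    show "N b \<noteq> N c" using D(12) a(3) sym[of c a] mem_N by blast
  qed
  have dis: "g x \<inter> g y = {}" if "N x \<noteq> N y" for x y using that by (auto simp: g_def)
  have fin: "finite (g x)" for x by (rule finite_subset[OF _ finite_N[of v]]) (auto simp: g_def)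
  have "card (g w \<union> (g a \<union> (g b \<union> g c))) = card (g w) + (card (g a) + (card (g b) + card (g c)))"
    using dis[OF N(1)] dis[OF N(2)] dis[OF N(3)] dis[OF N(4)] dis[OF N(5)] dis[OF N(6)] fin
    by (simp add: card_Un_disjoint Int_Un_distrib)
  moreover have "card (g w \<union> (g a \<union> (g b \<union> g c))) \<le> card (N v)" by (rule card_mono) (auto simp: g_def)
  ultimately show False using g2[of w] g2[of a] g2[of b] g2[of c] D card_N[OF wV(2)] d7 by linarith
qed

text \<open>
  The link of \<open>v\<close> consists of the triangle \<open>x y b\<close> with two further triangles attached to it at \<open>x\<close>
  and at \<open>y\<close>, which is the link of a vertex of \<open>Q\<^sub>n\<close>.
\<close>

definition chain_link :: "'a \<Rightarrow> 'a \<Rightarrow> 'a \<Rightarrow> 'a \<Rightarrow> 'a \<Rightarrow> 'a \<Rightarrow> 'a \<Rightarrow> 'a \<Rightarrow> bool" where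
  "chain_link v x y b x1 x2 y1 y2 \<longleftrightarrow> clique4 v x y b \<and> clique4 v x x1 x2 \<and> clique4 v y y1 y2 \<and>
     N v = {x,y,b,x1,x2,y1,y2} \<and> \<not> E x y1 \<and> \<not> E x y2 \<and> \<not> E y x1 \<and> \<not> E y x2 \<and> \<not> E b x1 \<and> \<not> E b x2 \<and>
     \<not> E b y1 \<and> \<not> E b y2 \<and> \<not> E x1 y1 \<and> \<not> E x1 y2 \<and> \<not> E x2 y1 \<and> \<not> E x2 y2"

text \<open>The neighbours \<open>w\<close>, \<open>a\<close>, \<open>b\<close>, \<open>c\<close>,
  \<open>e\<close> of \<open>v\<close> leave at most two for the set \<open>R\<close> of those not
  adjacent to \<open>w\<close>. Twin-freeness makes \<open>R\<close> non-empty, and a 4-clique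
  through \<open>v\<close> and one of its members must contain a second one. The fourth vertex of
  that clique is where the third triangle of the chain is attached.\<close>

lemma split_edge_chain:
  assumes s: "split_edge v w"
  shows "d = 7 \<and> (\<exists>x y b x1 x2 y1 y2. chain_link v x y b x1 x2 y1 y2)"
proof -
  obtain a b c e where a: "clique4 v w a b" "clique4 v w c e" "\<not> E a c" "\<not> E a e" "\<not> E b c" "\<not> E b e"
    using split_edge_pairs[OF s] by blast
  note D = clique4D[OF a(1)] clique4D[OF a(2)]
  have V: "v \<in> V" "w \<in> V" using EV2[OF D(1)] EV[OF D(1)] by auto
  have ne: "w \<noteq> a" "w \<noteq> b" "w \<noteq> c" "w \<noteq> e" "a \<noteq> b" "c \<noteq> e" "a \<noteq> c" "a \<noteq> e" "b \<noteq> c" "b \<noteq> e"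
    using D neq a by blast+
  \<comment> \<open>In the clique \<open>v w p q\<close>, \<open>z\<close> dominates
    \<open>v\<close>, \<open>p\<close>, \<open>q\<close> and any neighbour of \<open>w\<close>
    dominates \<open>w\<close>. So \<open>z\<close> is adjacent to all neighbours of
    \<open>w\<close>, and by regularity both have the same neighbourhood.\<close>
  have FT: False if z: "E v z" "z \<noteq> w" "\<not> E w z" "clique4 v w p q" "E z p" "E z q" for z p q
  proof -
    have zV: "z \<in> V" using EV2[OF z(1)] .
    have "E z y" if "E w y" for y
      by (rule dominating_pair[OF z(4) zV EV2[OF that]]) (use z that sym[OF z(5)] sym[OF z(6)] in auto)
    then have "N w \<subseteq> N z" by auto
    then have "N w = N z" using card_N[OF zV] card_N[OF V(2)] by (intro card_subset_eq) auto
    then show False using no_false_twins[OF s] z(2) by blast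
  qed
  define R where "R = {z. E v z \<and> z \<noteq> w \<and> \<not> E w z}"
  have R: "R \<subseteq> N v" by (auto simp: R_def)
  have finR: "finite R" using finite_subset[OF R] by simp
  have abR: "{w,a,b,c,e} \<inter> R = {}" using D by (auto simp: R_def)
  have "card ({w,a,b,c,e} \<union> R) \<le> card (N v)" using D R by (intro card_mono) auto
  moreover have "card ({w,a,b,c,e} \<union> R) = card {w,a,b,c,e} + card R" by (rule card_Un_disjoint) (use finR abR in auto)
  moreover have "card {w,a,b,c,e} = 5" using ne by simp
  ultimately have dR: "5 + card R \<le> d" using card_N[OF V(1)] by simp
  obtain z1 where z1: "z1 \<in> R" using twin_free[OF D(1)] by (auto simp: R_def)
  have z1': "E v z1" "z1 \<noteq> w" "\<not> E w z1" using z1 by (auto simp: R_def)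
  obtain p q where pq: "clique4 v z1 p q" using ex_clique4' z1' by blast
  note P = clique4D[OF pq]
  have "\<exists>z2 p. z2 \<in> R \<and> clique4 v z1 z2 p"
  proof (rule ccontr)
    assume no: "\<not> ?thesis"
    have "p \<notin> R" "q \<notin> R" using no pq clique4_perm(3)[OF pq] by blast+
    then have "E w p" "E w q" using P z1'(3) by (auto simp: R_def)
    then have "clique4 v w p q" using P D by (simp add: clique4_def)
    then show False using FT[OF z1'] P by blast
  qed
  then obtain z2 p where z2: "z2 \<in> R" "clique4 v z1 z2 p" by blast
  note P = clique4D[OF z2(2)]
  have z2': "E v z2" "z2 \<noteq> w" "\<not> E w z2" using z2 by (auto simp: R_def)
  have "card {z1,z2} \<le> card R" by (rule card_mono[OF finR]) (use z1 z2 in auto)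
  then have R2: "card R = 2" and d: "d = 7" using dR d7 neq[OF P(4)] by auto
  have Req: "R = {z1,z2}" using z1 z2 R2 neq[OF P(4)] card_subset_eq[OF finR, of "{z1,z2}"] by simp
  have Nv: "N v = {w,a,b,c,e,z1,z2}"
  proof -
    have "{w,a,b,c,e} \<union> R \<subseteq> N v" using D R by auto
    moreover have "card ({w,a,b,c,e} \<union> R) = 7"
      using card_Un_disjoint[of "{w,a,b,c,e}" R] finR abR \<open>card {w,a,b,c,e} = 5\<close> R2 by simp
    ultimately have "{w,a,b,c,e} \<union> R = N v" using card_N[OF V(1)] d by (intro card_subset_eq) auto
    then show ?thesis using Req by auto
  qed
  have zn: "\<not> E w z1" "\<not> E w z2" "\<not> E z1 w" "\<not> E z2 w" using z1' z2' sym by blast+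
  have core: ?thesis if ab: "clique4 v w a b" and ce: "clique4 v w c e" and n: "\<not> E a c" "\<not> E a e" "\<not> E b c" "\<not> E b e"
    and Nv: "N v = {w,a,b,c,e,z1,z2}" and p: "E z1 a" "E z2 a" for a b c e
  proof -
    note D = clique4D[OF ab] clique4D[OF ce]
    have zb: "\<not> E z1 b" "\<not> E z2 b" using FT[OF z1' ab] FT[OF z2' ab] p by blast+
    have zce: "\<not> (E z1 c \<and> E z1 e)" "\<not> (E z2 c \<and> E z2 e)" using FT[OF z1' ce] FT[OF z2' ce] by blast+
    \<comment> \<open>In the clique \<open>v a z1 z2\<close>, \<open>b\<close> dominates
      \<open>a\<close> and \<open>g\<close> dominates the other three vertices.\<close>
    have bad: False if "E z1 g" "E z2 g" "E w g" "E v g" "\<not> E b g" for g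
    proof -
      have "clique4 v a z1 z2" using D P p sym[OF p(1)] sym[OF p(2)] by (simp add: clique4_def)
      then have "E g b" using dominating_pair[of v a z1 z2 g b] that D sym[OF that(1)] sym[OF that(2)] EV2[OF that(4)] EV2[OF D(3)]
        by (simp add: sym_iff)
      then show False using that sym by blast
    qed
    \<comment> \<open>The clique on \<open>v\<close>, \<open>z1\<close>, \<open>g\<close> needs a
      fourth vertex among the seven known neighbours of \<open>v\<close>, and only \<open>z2\<close>
      qualifies; this leads to \<open>bad\<close>.\<close>
    have third: "E z2 g" if z: "z = z1" "E z g" "g = c \<or> g = e" for z g
    proof -
      have vg: "E v g" using z D by blast
      obtain h where h: "clique4 v z g h" using ex_clique4[OF P(1) vg] z by blast
      note H = clique4D[OF h]
      have "h \<in> {w,a,b,c,e,z1,z2}" using H(3) Nv mem_N by blast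
      then show ?thesis using H z zn zb n zce irrefl sym[of c a] sym[of c b] sym[of e a] sym[of e b] sym[of c e] by blast
    qed
    have third': "E z1 g" if z: "z = z2" "E z g" "g = c \<or> g = e" for z g
    proof -
      have vg: "E v g" using z D by blast
      obtain h where h: "clique4 v z g h" using ex_clique4[OF P(2) vg] z by blast
      note H = clique4D[OF h]
      have "h \<in> {w,a,b,c,e,z1,z2}" using H(3) Nv mem_N by blast
      then show ?thesis using H z zn zb n zce irrefl sym[of c a] sym[of c b] sym[of e a] sym[of e b] sym[of c e] by blast
    qed
    have "\<not> E z1 c" "\<not> E z1 e" "\<not> E z2 c" "\<not> E z2 e"
      using third[of z1 c] third[of z1 e] third'[of z2 c] third'[of z2 e] bad[of c] bad[of e] D n by blast+
    then have "chain_link v w a b c e z1 z2"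
      unfolding chain_link_def
      using ab ce n Nv zn zb P D sym[OF p(1)] sym[OF p(2)] sym[of a z1] sym[of b z1] sym[of b z2] sym[of c z1] sym[of c z2] sym[of e z1] sym[of e z2]
      by (intro conjI) (assumption | auto simp: clique4_def)+
    then show ?thesis using d by blast
  qed
  have "p \<in> {w,a,b,c,e,z1,z2}" using P(3) Nv mem_N by blast
  then consider "p = a" | "p = b" | "p = c" | "p = e" using P zn irrefl by blast
  then show ?thesis
  proof cases
    case 1 then show ?thesis using core[OF a Nv] P by blast
  next
    case 2
    have "N v = {w,b,a,c,e,z1,z2}" using Nv by auto
    then show ?thesis using core[OF clique4_perm(3)[OF a(1)] a(2) a(5,6,3,4)] P 2 by blast
  next
    case 3
    have "N v = {w,c,e,a,b,z1,z2}" using Nv by auto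
    then show ?thesis using core[OF a(2,1)] a sym[of c a] sym[of c b] sym[of e a] sym[of e b] P 3 by blast
  next
    case 4
    have "N v = {w,e,c,a,b,z1,z2}" using Nv by auto
    then show ?thesis using core[OF clique4_perm(3)[OF a(2)] a(1)] a sym[of c a] sym[of c b] sym[of e a] sym[of e b] P 4 by blast
  qed
qed

end

section \<open>No split edges\<close>

locale cis_graph_4_unsplit = cis_graph_4 +
  assumes d7: "d \<le> 7" and unsplit: "\<not> split_edge u v"
begin

lemma simple_edge: "clique4 u v a b \<Longrightarrow> E u x \<Longrightarrow> E v x \<Longrightarrow> E a x \<or> E b x"
  using unsplit by (auto simp: split_edge_def)

text \<open>If \<open>y\<close> sees \<open>a\<close>, it is a common neighbour of the ends of the
  unsplit edge \<open>v a\<close>, whose common neighbours are dominated by \<open>b\<close> and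
  \<open>c\<close>.\<close>

lemma adjacent_to_two:
  assumes "clique4 v a b c" "E v y" "E y a \<or> E y b \<or> E y c"
  shows "(E y a \<and> E y b) \<or> (E y a \<and> E y c) \<or> (E y b \<and> E y c)"
proof -
  have "clique4 v b a c" "clique4 v c a b" using clique4_perm assms(1) by blast+
  then show ?thesis using simple_edge[of v a b c y] simple_edge[of v b a c y] simple_edge[of v c a b y] assms
      sym_iff[of y a] sym_iff[of y b] sym_iff[of y c] by auto
qed

lemma component_closed:
  assumes "clique4 v a b c" "E v y" "E v x" "E x y" "E y a \<or> E y b \<or> E y c"
  shows "E x a \<or> E x b \<or> E x c"
proof -
  note D = clique4D[OF assms(1)]
  have gen: "E x a \<or> E x b" if "E y a" "E y b" "E v a" "E v b" "E a b" for a b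
  proof -
    have "clique4 v y a b" using that assms by (simp add: clique4_def)
    then have "(E x y \<and> E x a) \<or> (E x y \<and> E x b) \<or> (E x a \<and> E x b)" using adjacent_to_two[of v y a b x] assms by auto
    then show ?thesis by blast
  qed
  show ?thesis using adjacent_to_two[OF assms(1,2,5)] gen[of a b] gen[of a c] gen[of b c] D by auto
qed

text \<open>The closure argument of \<open>connected_link\<close> with 4-cliques: a neighbour of
  \<open>v\<close> now sees two of the three other vertices of each 4-clique through
  \<open>v\<close>.\<close>

lemma connected_links:
  assumes conn: "\<And>v a b c x. clique4 v a b c \<Longrightarrow> E v x \<Longrightarrow> E x a \<or> E x b \<or> E x c"
    and xz: "E x z" and y: "y \<in> V"
  shows "E y x \<or> E y z"
proof -
  have two: "(E y a \<and> E y b) \<or> (E y a \<and> E y c) \<or> (E y b \<and> E y c)" if "clique4 v a b c" "E v y" for v a b c y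
    using adjacent_to_two[OF that conn[OF that]] .
  have "{y\<in>V. E y x \<or> E y z} = V"
  proof (rule connectedE)
    show "{y\<in>V. E y x \<or> E y z} \<noteq> {}" using xz EV by auto
    have step: "E b x \<or> E b z" if ab: "E a b" and ax: "E a x" and xz: "E x z" for a b x z
    proof -
      obtain w1 w2 where w: "clique4 x z w1 w2" using ex_clique4'[OF xz] by blast
      note W = clique4D[OF w]
      have w': "clique4 w1 x z w2" using W by (simp add: clique4_def)
      have w'': "clique4 w2 x z w1" using W by (simp add: clique4_def)
      have t: "(E a z \<and> E a w1) \<or> (E a z \<and> E a w2) \<or> (E a w1 \<and> E a w2)" using two[OF w sym[OF ax]] .
      show ?thesis
      proof (cases "E a z")
        case True
        then obtain g where "g = w1 \<or> g = w2" "E a g" using t by blast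
        then have "clique4 a x z g" using W ax True by (auto simp: clique4_def)
        then show ?thesis using two[of a x z g b] ab by auto
      next
        case False
        then have aw: "E a w1" "E a w2" using t by auto
        then have "clique4 a x w1 w2" using W ax by (simp add: clique4_def)
        then have "E b x \<or> (E b w1 \<and> E b w2)" using two[of a x w1 w2 b] ab by auto
        then show ?thesis using two[OF w', of b] sym[of b w1] by auto
      qed
    qed
    fix a b assume "a \<in> {y \<in> V. E y x \<or> E y z}" "E a b"
    then show "b \<in> {y \<in> V. E y x \<or> E y z}"
      using step[of a b x z] step[of a b z x] xz sym[OF xz] EV2[of a b] by auto
  qed auto
  then show ?thesis using y by auto
qed

definition two_components :: "'a \<Rightarrow> 'a \<Rightarrow> 'a \<Rightarrow> 'a \<Rightarrow> 'a \<Rightarrow> 'a \<Rightarrow> 'a \<Rightarrow> bool" where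
  "two_components v a b c x y z \<longleftrightarrow> clique4 v a b c \<and> clique4 v x y z \<and>
     (\<forall>p\<in>N v. \<not> ((E p a \<or> E p b \<or> E p c) \<and> (E p x \<or> E p y \<or> E p z)))"

lemma ex_two_components:
  assumes "clique4 v a b c" "E v x" "\<not> E x a" "\<not> E x b" "\<not> E x c"
  shows "\<exists>y z. two_components v a b c x y z"
proof -
  obtain y z where c: "clique4 v x y z" using ex_clique4' assms(2) by blast
  note D = clique4D[OF c]
  have no: "\<not> (E p a \<or> E p b \<or> E p c)" if "E v p" "E p x \<or> E p y \<or> E p z" for p
  proof
    assume p: "E p a \<or> E p b \<or> E p c"
    have "E q a \<or> E q b \<or> E q c" if "E v q" "E q p" for q using component_closed[OF assms(1) \<open>E v p\<close> that p] .
    note q = this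
    have "E x a \<or> E x b \<or> E x c" if "E y a \<or> E y b \<or> E y c" using component_closed[OF assms(1) D(2) D(1) D(4) that] .
    moreover have "E x a \<or> E x b \<or> E x c" if "E z a \<or> E z b \<or> E z c" using component_closed[OF assms(1) D(3) D(1) D(5) that] .
    ultimately show False using that(2) q[of x] q[of y] q[of z] D assms(3-5) sym[of p x] sym[of p y] sym[of p z] by blast
  qed
  then have "two_components v a b c x y z" using assms(1) c unfolding two_components_def by auto
  then show ?thesis by blast
qed

lemma two_components_swap: "two_components v a b c x y z \<Longrightarrow> two_components v x y z a b c"
  unfolding two_components_def by blast

lemma two_components_disjoint:
  assumes "two_components v a b c x y z"
  shows "card {a,b,c,x,y,z} = 6" "{a,b,c,x,y,z} \<subseteq> N v"
    "p \<in> {a,b,c} \<Longrightarrow> q \<in> {x,y,z} \<Longrightarrow> \<not> E p q"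
proof -
  note D = clique4D[of v a b c] clique4D[of v x y z]
  have c: "clique4 v a b c" "clique4 v x y z" using assms by (auto simp: two_components_def)
  note D = clique4D[OF c(1)] clique4D[OF c(2)]
  have n: "\<not> ((E p a \<or> E p b \<or> E p c) \<and> (E p x \<or> E p y \<or> E p z))" if "E v p" for p
    using assms that by (auto simp: two_components_def)
  show "{a,b,c,x,y,z} \<subseteq> N v" using D by auto
  show "\<not> E p q" if "p \<in> {a,b,c}" "q \<in> {x,y,z}" for p q using n[of p] that D by blast
  have ne: "p \<noteq> q" if "p \<in> {a,b,c}" "q \<in> {x,y,z}" for p q using n[of p] that D by blast
  then have "{a,b,c} \<inter> {x,y,z} = {}" by blast
  then have "card ({a,b,c} \<union> {x,y,z}) = card {a,b,c} + card {x,y,z}" by (intro card_Un_disjoint) auto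
  moreover have "card {a,b,c} = 3" using neq[OF D(4)] neq[OF D(5)] neq[OF D(6)] by simp
  moreover have "card {x,y,z} = 3" using neq[OF D(16)] neq[OF D(17)] neq[OF D(18)] by simp
  moreover have "{a,b,c} \<union> {x,y,z} = {a,b,c,x,y,z}" by auto
  ultimately show "card {a,b,c,x,y,z} = 6" by simp
qed

lemma two_components_6:
  assumes t: "two_components v a b c x y z" and d: "d = 6"
  shows "\<exists>A B. N v = A \<union> B \<and> A \<inter> B = {} \<and> cl A \<and> cl B \<and> card A = 3 \<and> card B = 3 \<and> (\<forall>a\<in>A. \<forall>b\<in>B. \<not> E a b)"
proof -
  note T = two_components_disjoint[OF t]
  have c: "clique4 v a b c" "clique4 v x y z" using t by (auto simp: two_components_def)
  note D = clique4D[OF c(1)] clique4D[OF c(2)]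
  have "v \<in> V" using EV[OF D(1)] .
  then have "{a,b,c,x,y,z} = N v" using T(1,2) card_N d by (intro card_subset_eq) auto
  then have "N v = {a,b,c} \<union> {x,y,z}" by auto
  moreover have "cl {a,b,c}" "cl {x,y,z}" using D by (auto simp: cl_def)
  moreover have "card {a,b,c} = 3" using neq[OF D(4)] neq[OF D(5)] neq[OF D(6)] by simp
  moreover have "card {x,y,z} = 3" using neq[OF D(16)] neq[OF D(17)] neq[OF D(18)] by simp
  moreover have "{a,b,c} \<inter> {x,y,z} = {}"
  proof (rule equals0I)
    fix p assume p: "p \<in> {a,b,c} \<inter> {x,y,z}"
    have "\<not> E a x \<and> \<not> E a y \<and> \<not> E a z \<and> \<not> E b x \<and> \<not> E b y \<and> \<not> E b z \<and> \<not> E c x \<and> \<not> E c y \<and> \<not> E c z" using T(3) by blast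
    then show False using p D by blast
  qed
  moreover have "\<forall>p\<in>{a,b,c}. \<forall>q\<in>{x,y,z}. \<not> E p q" using T(3) by blast
  ultimately show ?thesis by (intro exI[of _ "{a,b,c}"] exI[of _ "{x,y,z}"] conjI)
qed

end

context cis_graph_4_unsplit begin

text \<open>The link of \<open>v\<close> is the disjoint union of a triangle and \<open>K\<^sub>1\<^sub>,\<^sub>1\<^sub>,\<^sub>2\<close>.\<close>

definition kite :: "'a \<Rightarrow> 'a \<Rightarrow> 'a \<Rightarrow> 'a \<Rightarrow> 'a \<Rightarrow> 'a \<Rightarrow> 'a \<Rightarrow> 'a \<Rightarrow> bool" where
  "kite v a b c s t p q \<longleftrightarrow> clique4 v a b c \<and> clique4 v s t p \<and> clique4 v s t q \<and> \<not> E p q \<and> p \<noteq> q \<and>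
     N v = {a,b,c,s,t,p,q} \<and> {a,b,c} \<inter> {s,t,p,q} = {} \<and> (\<forall>x\<in>{a,b,c}. \<forall>y\<in>{s,t,p,q}. \<not> E x y)"

lemma kite_swap: "kite v a b c s t p q \<Longrightarrow> kite v a b c t s p q" "kite v a b c s t p q \<Longrightarrow> kite v a b c s t q p"
  unfolding kite_def clique4_def by (auto simp: sym_iff)

text \<open>The seventh neighbour \<open>p\<close> attaches to one of the two triangles. It sees at
  least two of its vertices by \<open>adjacent_to_two\<close>, and not all three because that would
  give five pairwise adjacent vertices.\<close>

lemma two_components_7:
  assumes t: "two_components v a b c x y z" and d: "d = 7"
  shows "\<exists>a b c s t p q. kite v a b c s t p q"
proof -
  note T = two_components_disjoint[OF t]
  have c: "clique4 v a b c" "clique4 v x y z" using t by (auto simp: two_components_def)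
  note D = clique4D[OF c(1)] clique4D[OF c(2)]
  have v: "v \<in> V" using EV[OF D(1)] .
  have "\<not> N v \<subseteq> {a,b,c,x,y,z}" using card_mono[of "{a,b,c,x,y,z}" "N v"] T(1) card_N[OF v] d by auto
  then obtain p where p: "E v p" "p \<notin> {a,b,c,x,y,z}" by (auto simp: subset_iff)
  have "card (insert p {a,b,c,x,y,z}) = 7" using p T(1) by (subst card_insert_disjoint) auto
  then have Nv: "insert p {a,b,c,x,y,z} = N v" using T(2) card_N[OF v] d p by (intro card_subset_eq) auto
  obtain g h where g: "clique4 v p g h" using ex_clique4' p by blast
  note G = clique4D[OF g]
  have "g \<in> insert p {a,b,c,x,y,z}" using G(2) Nv mem_N by blast
  then have g': "g \<in> {a,b,c} \<or> g \<in> {x,y,z}" using G(4) irrefl by blast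
  have core: ?thesis if t: "two_components v a b c x y z" and Nv: "N v = {a,b,c,x,y,z,p}" and p: "p \<notin> {a,b,c,x,y,z}" and g: "g \<in> {x,y,z}" for a b c x y z
  proof -
    note T = two_components_disjoint[OF t]
    have c: "clique4 v a b c" "clique4 v x y z" using t by (auto simp: two_components_def)
    note D = clique4D[OF c(1)] clique4D[OF c(2)]
    have px: "E p x \<or> E p y \<or> E p z" using g G(4) by blast
    then have pn: "\<not> (E p a \<or> E p b \<or> E p c)" using t \<open>E v p\<close> by (auto simp: two_components_def)
    have dis: "{a,b,c} \<inter> {x,y,z,p} = {}"
    proof (rule equals0I)
      fix q assume q: "q \<in> {a,b,c} \<inter> {x,y,z,p}"
      have "\<not> E a x \<and> \<not> E a y \<and> \<not> E a z \<and> \<not> E b x \<and> \<not> E b y \<and> \<not> E b z \<and> \<not> E c x \<and> \<not> E c y \<and> \<not> E c z" using T(3) by blast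
      then show False using q p D by blast
    qed
    have nadj: "\<forall>u\<in>{a,b,c}. \<forall>w\<in>{x,y,z,p}. \<not> E u w" using T(3) pn sym[of a p] sym[of b p] sym[of c p] by blast
    have K: "\<exists>s t p q. kite v a b c s t p q" if st: "clique4 v s t q" "E p s" "E p t" "{s,t,q} = {x,y,z}" for s t q
    proof -
      note S = clique4D[OF st(1)]
      have "clique4 v s t p" using S st(2,3)[THEN sym] \<open>E v p\<close> by (simp add: clique4_def)
      moreover have "\<not> E p q" using K5_free[of v s t q p] S st(2,3)[THEN sym] \<open>E v p\<close> sym[of p q] by blast
      moreover have "p \<noteq> q" using p st(4) by blast
      moreover have "{a,b,c,s,t,p,q} = {a,b,c,x,y,z,p}" "{s,t,p,q} = {x,y,z,p}" using st(4) by blast+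
      ultimately have "kite v a b c s t p q" unfolding kite_def using c(1) st(1) Nv dis nadj by simp
      then show ?thesis by blast
    qed
    have "clique4 v x y z" "clique4 v x z y" "clique4 v y z x" using D by (auto simp: clique4_def)
    moreover have "{x,z,y} = {x,y,z}" "{y,z,x} = {x,y,z}" by auto
    ultimately show ?thesis using adjacent_to_two[OF c(2) \<open>E v p\<close> px] K[of x y z] K[of x z y] K[of y z x] by blast
  qed
  have N1: "N v = {a,b,c,x,y,z,p}" "N v = {x,y,z,a,b,c,p}" using Nv by auto
  show ?thesis using g' core[OF t N1(1) p(2)] core[OF two_components_swap[OF t] N1(2)] p(2) by auto
qed

lemma kite_common:
  assumes "kite v a b c s t p q"
  shows "N v \<inter> N s = {t,p,q}" "N v \<inter> N t = {s,p,q}" "N v \<inter> N p = {s,t}" "N v \<inter> N q = {s,t}"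
    "N v \<inter> N a = {b,c}" "N v \<inter> N b = {a,c}" "N v \<inter> N c = {a,b}"
proof -
  have c: "clique4 v a b c" "clique4 v s t p" "clique4 v s t q" and n: "\<not> E p q" "\<not> E q p" and Nv: "N v = {a,b,c,s,t,p,q}"
    using assms sym[of q p] by (auto simp: kite_def)
  have x: "\<not> E x y \<and> \<not> E y x" if "x \<in> {a,b,c}" "y \<in> {s,t,p,q}" for x y
    using assms that sym[of y x] unfolding kite_def by blast
  have N2: "N v \<inter> N u = {w \<in> {a,b,c,s,t,p,q}. E u w}" for u unfolding Nv[symmetric] by auto
  note D = clique4D[OF c(1)] clique4D[OF c(2)] clique4D[OF c(3)]
  have X: "\<not> E a s" "\<not> E a t" "\<not> E a p" "\<not> E a q" "\<not> E b s" "\<not> E b t" "\<not> E b p" "\<not> E b q" "\<not> E c s" "\<not> E c t" "\<not> E c p" "\<not> E c q"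
    "\<not> E s a" "\<not> E t a" "\<not> E p a" "\<not> E q a" "\<not> E s b" "\<not> E t b" "\<not> E p b" "\<not> E q b" "\<not> E s c" "\<not> E t c" "\<not> E p c" "\<not> E q c"
    using x by simp_all
  show "N v \<inter> N s = {t,p,q}" "N v \<inter> N t = {s,p,q}" "N v \<inter> N p = {s,t}" "N v \<inter> N q = {s,t}"
    "N v \<inter> N a = {b,c}" "N v \<inter> N b = {a,c}" "N v \<inter> N c = {a,b}"
    unfolding N2 using D X n irrefl by auto
qed

lemma kite_l:
  assumes "kite v a b c s t p q"
  shows "l v s = 3" "l v t = 3" "l v p = 2" "l v q = 2" "l v a = 2" "l v b = 2" "l v c = 2"
proof -
  have c: "clique4 v a b c" "clique4 v s t p" "clique4 v s t q" and n: "p \<noteq> q" using assms by (auto simp: kite_def)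
  note D = clique4D(4-6)[OF c(1), THEN neq] clique4D(4-6)[OF c(2), THEN neq] clique4D(4-6)[OF c(3), THEN neq]
  show "l v s = 3" "l v t = 3" "l v p = 2" "l v q = 2" "l v a = 2" "l v b = 2" "l v c = 2"
    unfolding l_def kite_common[OF assms] using D n by auto
qed

text \<open>
  The relation \<open>R\<close> has out-degree at most 2 and in-degree at least 3, against \<open>mass_transport\<close>.
\<close>

lemma no_kite:
  assumes K: "\<And>v. v \<in> V \<Longrightarrow> \<exists>a b c s t p q. kite v a b c s t p q"
  shows False
proof -
  define R where "R v p \<longleftrightarrow> E v p \<and> l v p = 2 \<and> (\<exists>s. E v s \<and> E p s \<and> l v s = 3)" for v p
  have RV: "R u v \<Longrightarrow> u \<in> V \<and> v \<in> V" for u v using EV EV2 by (auto simp: R_def)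
  have mt: "card {w. R v w} = card {w. R w v}" if "v \<in> V" for v
  proof (rule mass_transport[OF _ RV that])
    fix f a b assume f: "f \<in> Aut" "R a b"
    then obtain s where "E a b" "l a b = 2" "E a s" "E b s" "l a s = 3" by (auto simp: R_def)
    then have "E (f a) (f b)" "l (f a) (f b) = 2" "E (f a) (f s)" "E (f b) (f s)" "l (f a) (f s) = 3"
      using Aut_E[OF f(1)] Aut_l[OF f(1)] by auto
    then show "R (f a) (f b)" unfolding R_def by blast
  qed
  have out: "card {w. R v w} \<le> 2" if v: "v \<in> V" for v
  proof -
    obtain a b c s t p q where k: "kite v a b c s t p q" using K[OF v] by blast
    note l = kite_l[OF k] and C = kite_common[OF k]
    have Nv: "N v = {a,b,c,s,t,p,q}" using k by (simp add: kite_def)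
    \<comment> \<open>In a kite only \<open>s\<close> and \<open>t\<close> have three common
      neighbours with \<open>v\<close>; among the vertices having two, only \<open>p\<close> and
      \<open>q\<close> are adjacent to \<open>s\<close> or \<open>t\<close>.\<close>
    have "w = p \<or> w = q" if w: "R v w" for w
    proof -
      obtain r where r: "E v w" "l v w = 2" "r \<in> N v \<inter> N w" "l v r = 3" using w by (auto simp: R_def)
      have "w \<in> {a,b,c,s,t,p,q}" using r(1) Nv mem_N by blast
      moreover have "w \<noteq> a"
      proof
        assume "w = a"
        then have "r = b \<or> r = c" using r(3) C(5) by blast
        then show False using r(4) l by auto
      qed
      moreover have "w \<noteq> b"
      proof
        assume "w = b"
        then have "r = a \<or> r = c" using r(3) C(6) by blast
        then show False using r(4) l by auto
      qed
      moreover have "w \<noteq> c"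
      proof
        assume "w = c"
        then have "r = a \<or> r = b" using r(3) C(7) by blast
        then show False using r(4) l by auto
      qed
      moreover have "w \<noteq> s" "w \<noteq> t" using r l by auto
      ultimately show ?thesis by blast
    qed
    then have "{w. R v w} \<subseteq> {p,q}" by blast
    then have "card {w. R v w} \<le> card {p,q}" by (rule card_mono[rotated]) simp
    also have "\<dots> \<le> 2" by (simp add: card_insert_if)
    finally show ?thesis .
  qed
  \<comment> \<open>Since \<open>l s v = 3\<close>, \<open>v\<close> is one of the two central
    vertices of the kite at \<open>s\<close>. The common neighbours of \<open>s\<close> and
    \<open>v\<close> are then the other centre and the non-adjacent pair of that kite. As
    \<open>p\<close> and \<open>q\<close> are not adjacent, \<open>p\<close> is not the centre, so
    \<open>l s p = 2\<close>.\<close>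
  have step: "R s p" if k: "kite v a b c s t p q" for v a b c s t p q
  proof -
    note C = kite_common[OF k] and l = kite_l[OF k]
    have c: "clique4 v s t p" "clique4 v s t q" "\<not> E p q" "p \<noteq> q" using k by (auto simp: kite_def)
    note D = clique4D[OF c(1)] clique4D[OF c(2)]
    obtain a' b' c' s' t' p' q' where k': "kite s a' b' c' s' t' p' q'" using K[of s] EV2[OF D(1)] by blast
    note C' = kite_common[OF k'] and l' = kite_l[OF k']
    have c': "clique4 s s' t' p'" "clique4 s s' t' q'" using k' by (auto simp: kite_def)
    note D' = clique4D[OF c'(1)] clique4D[OF c'(2)]
    have "v \<in> {a',b',c',s',t',p',q'}" using k' D(7) mem_N unfolding kite_def by blast
    moreover have lsv: "l s v = 3" using l l_sym by simp
    ultimately have "v = s' \<or> v = t'" using l' by auto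
    moreover have "l s p = 2" if r: "r = t' \<or> r = s'" "N s \<inter> N v = {r,p',q'}" "E r p'" "E r q'" for r
    proof -
      have e: "{r,p',q'} = {t,p,q}" using r C(1) by (simp add: Int_commute)
      have "p \<noteq> r"
      proof
        assume "p = r"
        moreover have "q \<in> {p',q',r}" using e by blast
        ultimately show False using r(3,4) c(3,4) by blast
      qed
      then have "p = p' \<or> p = q'" using e by blast
      then show ?thesis using l' by auto
    qed
    ultimately have "l s p = 2" using C'(1,2) D' by blast
    then show ?thesis unfolding R_def using D lsv by blast
  qed
  obtain v where v: "v \<in> V" using nonempty by blast
  obtain a b c s t p q where k: "kite v a b c s t p q" using K[OF v] by blast
  have c: "clique4 v s t p" using k by (auto simp: kite_def)
  note D = clique4D[OF c]
  have "R s p" "R t p" using step[OF k] step[OF kite_swap(1)[OF k]] by auto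
  moreover have "R v p" unfolding R_def using D kite_l[OF k] by blast
  ultimately have "{v,s,t} \<subseteq> {w. R w p}" by simp
  moreover have "finite {w. R w p}" by (rule finite_subset[OF _ finV]) (use RV in blast)
  ultimately have "card {v,s,t} \<le> card {w. R w p}" by (intro card_mono)
  moreover have "card {v,s,t} = 3" using neq[OF D(1)] neq[OF D(2)] neq[OF D(4)] by simp
  ultimately show False using mt[of p] out[of p] EV2[OF D(3)] by simp
qed

lemma unsplit_cases:
  "(\<forall>x y z. E x z \<longrightarrow> y \<in> V \<longrightarrow> E y x \<or> E y z) \<or>
   (d = 6 \<and> (\<forall>v\<in>V. \<exists>A B. N v = A \<union> B \<and> A \<inter> B = {} \<and> cl A \<and> cl B \<and> card A = 3 \<and> card B = 3 \<and> (\<forall>a\<in>A. \<forall>b\<in>B. \<not> E a b)))"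
proof (cases "\<forall>v a b c x. clique4 v a b c \<longrightarrow> E v x \<longrightarrow> E x a \<or> E x b \<or> E x c")
  case True
  have "E y x \<or> E y z" if "E x z" "y \<in> V" for x y z
    by (rule connected_links[OF _ that]) (use True in simp)
  then show ?thesis by simp
next
  case False
  then obtain u a b c x where u: "clique4 u a b c" "E u x" "\<not> E x a" "\<not> E x b" "\<not> E x c" by blast
  have uV: "u \<in> V" using EV[OF u(2)] .
  have T: "\<exists>a b c x y z. two_components v a b c x y z" if v: "v \<in> V" for v
  proof -
    obtain f where f: "f \<in> Aut" "f u = v" using Aut_trans uV v by blast
    have "clique4 v (f a) (f b) (f c)" using u(1) Aut_clique4[OF f(1), of u a b c] f(2) by simp
    moreover have "E v (f x)" using u(2) Aut_E[OF f(1), of u x] f(2) by simp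
    ultimately show ?thesis using ex_two_components[of v "f a" "f b" "f c" "f x"] u(3-5) Aut_E[OF f(1)] by blast
  qed
  obtain a b c x y z where t: "two_components u a b c x y z" using T[OF uV] by blast
  have "6 \<le> card (N u)" using card_mono[OF finite_N two_components_disjoint(2)[OF t]] two_components_disjoint(1)[OF t] by simp
  then have "d = 6 \<or> d = 7" using card_N[OF uV] d7 by linarith
  then show ?thesis
  proof
    assume "d = 6"
    then have "\<forall>v\<in>V. \<exists>A B. N v = A \<union> B \<and> A \<inter> B = {} \<and> cl A \<and> cl B \<and> card A = 3 \<and> card B = 3 \<and> (\<forall>a\<in>A. \<forall>b\<in>B. \<not> E a b)"
      using T two_components_6 by (meson)
    then show ?thesis using \<open>d = 6\<close> by simp
  next
    assume "d = 7"
    then have "\<exists>a b c s t p q. kite v a b c s t p q" if "v \<in> V" for v using T[OF that] two_components_7[of v] by blast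
    then have False by (rule no_kite)
    then show ?thesis ..
  qed
qed

end

section \<open>Chains of cliques\<close>

text \<open>A walk that never turns back must repeat a vertex. The first vertex to be repeated is
  the starting one, since every later vertex already has both its neighbours on the walk. By
  connectedness the cycle so closed is all of \<open>X\<close>.\<close>

lemma two_regular_cycle:
  assumes fin: "finite X" and x0: "x0 \<in> X"
    and SX: "\<And>x y. S x y \<Longrightarrow> x \<in> X \<and> y \<in> X" and Ssym: "\<And>x y. S x y \<Longrightarrow> S y x" and Sirr: "\<And>x. \<not> S x x"
    and two: "\<And>x. x \<in> X \<Longrightarrow> \<exists>a b. a \<noteq> b \<and> (\<forall>y. S x y \<longleftrightarrow> y = a \<or> y = b)"
    and conn: "\<And>A. A \<subseteq> X \<Longrightarrow> A \<noteq> {} \<Longrightarrow> (\<And>x y. x \<in> A \<Longrightarrow> S x y \<Longrightarrow> y \<in> A) \<Longrightarrow> A = X"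
  shows "\<exists>(n::nat) w. 3 \<le> n \<and> bij_betw w {..<n} X \<and>
    (\<forall>i<n. \<forall>j<n. S (w i) (w j) \<longleftrightarrow> j = (i + 1) mod n \<or> i = (j + 1) mod n)"
proof -
  have "\<exists>z. z \<noteq> y \<and> (\<forall>v. S x v \<longleftrightarrow> v = y \<or> v = z)" if xy: "S x y" for x y
  proof -
    obtain a b where ab: "a \<noteq> b" "\<forall>v. S x v \<longleftrightarrow> v = a \<or> v = b" using two SX[OF xy] by blast
    then have "y = a \<or> y = b" using xy by blast
    then show ?thesis using ab by metis
  qed
  then obtain oth where oth: "oth x y \<noteq> y \<and> (\<forall>v. S x v \<longleftrightarrow> v = y \<or> v = oth x y)" if "S x y" for x y by metis
  obtain x1 where x1: "S x0 x1" using two[OF x0] by blast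
  \<comment> \<open>The state is a pair of consecutive vertices; \<open>oth x y\<close> is the
    neighbour of \<open>x\<close> other than \<open>y\<close>.\<close>
  define p where "p = rec_nat (x0, x1) (\<lambda>_ q. (snd q, oth (snd q) (fst q)))"
  define w where "w k = fst (p k)" for k
  have pS: "p (Suc k) = (snd (p k), oth (snd (p k)) (fst (p k)))" for k by (simp add: p_def)
  have w0: "w 0 = x0" "w 1 = x1" by (simp_all add: w_def p_def)
  have wS: "w (Suc k) = snd (p k)" for k by (simp add: w_def pS)
  have wSS: "w (Suc (Suc k)) = oth (w (Suc k)) (w k)" for k by (simp add: w_def pS)
  have adj: "S (w k) (w (Suc k))" for k
  proof (induction k)
    case 0 then show ?case using x1 w0 by simp
  next
    case (Suc k)
    then show ?case using oth[OF Ssym[OF Suc]] wSS[of k] by simp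
  qed
  have nbr: "S (w (Suc k)) v \<longleftrightarrow> v = w k \<or> v = w (Suc (Suc k))" for k v
    using oth[OF Ssym[OF adj[of k]]] wSS[of k] by simp
  have ne2: "w (Suc (Suc k)) \<noteq> w k" for k using oth[OF Ssym[OF adj[of k]]] wSS[of k] by simp
  have ne1: "w (Suc k) \<noteq> w k" for k using adj[of k] Sirr by metis
  have wX: "w k \<in> X" for k using SX[OF adj[of k]] by blast
  have "\<not> inj w"
  proof
    assume "inj w"
    then have "infinite (range w)" using finite_imageD infinite_UNIV_nat by blast
    moreover have "range w \<subseteq> X" using wX by blast
    ultimately show False using fin finite_subset by blast
  qed
  then obtain a b where "a < b" "w a = w b" unfolding inj_def by (metis linorder_neqE_nat)
  then have ex: "\<exists>n. \<exists>i<n. w i = w n" by blast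
  define n where "n = (LEAST n. \<exists>i<n. w i = w n)"
  have n: "\<exists>i<n. w i = w n" using LeastI_ex[OF ex] by (simp add: n_def)
  have least: "\<not> (\<exists>i<m. w i = w m)" if "m < n" for m
    using that not_less_Least[of m "\<lambda>n. \<exists>i<n. w i = w n"] unfolding n_def by blast
  have inj: "i = j" if "i < n" "j < n" "w i = w j" for i j
    using least[of i] least[of j] that by (metis linorder_neqE_nat)
  obtain i where i: "i < n" "w i = w n" using n by blast
  have "i = 0"
  proof (rule ccontr)
    assume "i \<noteq> 0"
    then obtain i' where i': "i = Suc i'" by (cases i) auto
    obtain n' where n': "n = Suc n'" using i by (cases n) auto
    have "S (w i) (w n')" using Ssym[OF adj[of n']] i(2) n' by simp
    then have "w n' = w i' \<or> w n' = w (Suc i)" using nbr[of i' "w n'"] i' by simp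
    then show False
    proof
      assume "w n' = w i'"
      then have "n' = i'" using inj[of n' i'] n' i' i(1) by simp
      then show False using i(1) n' i' by simp
    next
      assume e: "w n' = w (Suc i)"
      show False
      proof (cases "Suc i = n")
        case True
        then show False using ne1[of i] i(2) by simp
      next
        case False
        then have "n' = Suc i" using inj[of n' "Suc i"] e n' i(1) by simp
        then show False using ne2[of i] i(2) n' by simp
      qed
    qed
  qed
  then have wn: "w n = w 0" "0 < n" using i by auto
  have n3: "3 \<le> n"
  proof (rule ccontr)
    assume "\<not> 3 \<le> n"
    then have "n = 1 \<or> n = 2" using wn(2) by auto
    then show False using ne1[of 0] ne2[of 0] wn(1) by (auto simp: numeral_2_eq_2)
  qed
  obtain n' where n': "n = Suc n'" using n3 by (cases n) auto
  have ln: "S (w 0) (w n')" using Ssym[OF adj[of n']] wn(1) n' by simp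
  have nbr0: "S (w 0) v \<longleftrightarrow> v = w 1 \<or> v = w n'" for v
  proof -
    have "w 1 \<noteq> w n'" using inj[of 1 n'] n' n3 by auto
    moreover have "S (w 0) (w 1)" using adj[of 0] by simp
    ultimately show ?thesis using oth[of "w 0" "w 1"] ln by metis
  qed
  have im: "w ` {..<n} = X"
  proof (rule conn)
    show "w ` {..<n} \<subseteq> X" "w ` {..<n} \<noteq> {}" using wX wn(2) by auto
    fix x y assume "x \<in> w ` {..<n}" and xy: "S x y"
    then obtain k where k: "k < n" "x = w k" by blast
    show "y \<in> w ` {..<n}"
    proof (cases k)
      case 0
      then have "y = w 1 \<or> y = w n'" using xy k nbr0 by simp
      then show ?thesis using n' n3 by auto
    next
      case (Suc k')
      then have "y = w k' \<or> y = w (Suc k)" using xy k nbr[of k'] by simp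
      moreover have "w (Suc k) \<in> w ` {..<n}"
        using wn k by (cases "Suc k = n") auto
      ultimately show ?thesis using k Suc by auto
    qed
  qed
  have "S (w i) (w j) \<longleftrightarrow> j = (i + 1) mod n \<or> i = (j + 1) mod n" if ij: "i < n" "j < n" for i j
  proof (cases i)
    case 0
    have "S (w i) (w j) \<longleftrightarrow> j = 1 \<or> j = n'"
      using nbr0[of "w j"] inj[of j 1] inj[of j n'] ij n' n3 0 by auto
    then show ?thesis using 0 ij n' n3 by (auto simp: mod_Suc)
  next
    case (Suc i')
    have "S (w i) (w j) \<longleftrightarrow> w j = w i' \<or> w j = w (Suc i)" using nbr[of i' "w j"] Suc by simp
    moreover have "w j = w i' \<longleftrightarrow> j = i'" using inj[of j i'] ij Suc by auto
    moreover have "w j = w (Suc i) \<longleftrightarrow> j = (i + 1) mod n"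
    proof (cases "Suc i = n")
      case True
      then show ?thesis using wn inj[of j 0] ij by auto
    next
      case False
      then show ?thesis using inj[of j "Suc i"] ij by auto
    qed
    moreover have "i = (j + 1) mod n \<longleftrightarrow> j = i'" using ij Suc by (auto simp: mod_Suc)
    ultimately show ?thesis by blast
  qed
  moreover have "bij_betw w {..<n} X" using im inj by (auto simp: bij_betw_def inj_on_def)
  ultimately show ?thesis using n3 by blast
qed

locale chain_cis_graph = cis_graph_4_twin_free +
  assumes chain: "v \<in> V \<Longrightarrow> \<exists>x y b x1 x2 y1 y2. chain_link v x y b x1 x2 y1 y2"
begin

text \<open>
  In the graph \<open>Q\<^sub>n\<close> these are the pairs of vertices of a fibre \<open>{i} \<times> \<int>\<^sub>2 \<times> \<int>\<^sub>2\<close> that agree in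
  exactly one of the last two coordinates, so that they form a 4-cycle on each fibre.
\<close>

definition heavy :: "'a \<Rightarrow> 'a \<Rightarrow> bool" where "heavy u v \<longleftrightarrow> E u v \<and> l u v = 4"

lemma heavy_sym: "heavy u v \<Longrightarrow> heavy v u"
  using sym[of u v] l_sym[of u v] by (simp add: heavy_def)

lemma heavy_E: "heavy u v \<Longrightarrow> E u v" by (simp add: heavy_def)

lemma chain_swap: "chain_link v x y b x1 x2 y1 y2 \<Longrightarrow> chain_link v y x b y1 y2 x1 x2"
proof -
  assume c: "chain_link v x y b x1 x2 y1 y2"
  then have "clique4 v y x b" "N v = {y,x,b,y1,y2,x1,x2}" unfolding chain_link_def using clique4_perm(2)[of v x y b] by auto
  moreover have "\<not> E y1 x1" "\<not> E y1 x2" "\<not> E y2 x1" "\<not> E y2 x2"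
    using c sym[of y1 x1] sym[of y1 x2] sym[of y2 x1] sym[of y2 x2] unfolding chain_link_def by blast+
  ultimately show ?thesis using c unfolding chain_link_def by simp
qed

lemma chain_cliques:
  "chain_link v x y b x1 x2 y1 y2 \<Longrightarrow> clique4 v x y b"
  "chain_link v x y b x1 x2 y1 y2 \<Longrightarrow> clique4 v x x1 x2"
  "chain_link v x y b x1 x2 y1 y2 \<Longrightarrow> clique4 v y y1 y2"
  by (simp_all add: chain_link_def)

lemma chain_common:
  assumes "chain_link v x y b x1 x2 y1 y2"
  shows "N v \<inter> N x = {y,b,x1,x2}" "N v \<inter> N y = {x,b,y1,y2}" "N v \<inter> N b = {x,y}"
    "N v \<inter> N x1 = {x,x2}" "N v \<inter> N x2 = {x,x1}" "N v \<inter> N y1 = {y,y2}" "N v \<inter> N y2 = {y,y1}"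
proof -
  note c = assms[unfolded chain_link_def]
  have Nv: "N v = {x,y,b,x1,x2,y1,y2}" using c by blast
  have N2: "N v \<inter> N u = {w \<in> {x,y,b,x1,x2,y1,y2}. E u w}" for u unfolding Nv[symmetric] by auto
  note D = clique4D[OF chain_cliques(1)[OF assms]] clique4D[OF chain_cliques(2)[OF assms]] clique4D[OF chain_cliques(3)[OF assms]]
  have n: "\<not> E x y1" "\<not> E x y2" "\<not> E y x1" "\<not> E y x2" "\<not> E b x1" "\<not> E b x2" "\<not> E b y1" "\<not> E b y2" "\<not> E x1 y1" "\<not> E x1 y2" "\<not> E x2 y1" "\<not> E x2 y2"
    using c by blast+
  have n': "\<not> E y1 x" "\<not> E y2 x" "\<not> E x1 y" "\<not> E x2 y" "\<not> E x1 b" "\<not> E x2 b" "\<not> E y1 b" "\<not> E y2 b" "\<not> E y1 x1" "\<not> E y2 x1" "\<not> E y1 x2" "\<not> E y2 x2"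
    using n sym by blast+
  show "N v \<inter> N x = {y,b,x1,x2}" "N v \<inter> N y = {x,b,y1,y2}" "N v \<inter> N b = {x,y}"
    "N v \<inter> N x1 = {x,x2}" "N v \<inter> N x2 = {x,x1}" "N v \<inter> N y1 = {y,y2}" "N v \<inter> N y2 = {y,y1}"
    unfolding N2 using D n n' irrefl by auto
qed

lemma chain_distinct:
  assumes "chain_link v x y b x1 x2 y1 y2"
  shows "distinct [v,x,y,b,x1,x2,y1,y2]"
proof -
  note c = assms[unfolded chain_link_def]
  note D = clique4D[OF chain_cliques(1)[OF assms]] clique4D[OF chain_cliques(2)[OF assms]] clique4D[OF chain_cliques(3)[OF assms]]
  have n: "\<not> E x y1" "\<not> E x y2" "\<not> E y x1" "\<not> E y x2" "\<not> E b x1" "\<not> E b x2" "\<not> E b y1" "\<not> E b y2" "\<not> E x1 y1" "\<not> E x1 y2" "\<not> E x2 y1" "\<not> E x2 y2"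
    using c by blast+
  have "v \<noteq> x" "v \<noteq> y" "v \<noteq> b" "v \<noteq> x1" "v \<noteq> x2" "v \<noteq> y1" "v \<noteq> y2" "x \<noteq> y" "x \<noteq> b" "x \<noteq> x1" "x \<noteq> x2" "y \<noteq> b" "y \<noteq> y1" "y \<noteq> y2" "x1 \<noteq> x2" "y1 \<noteq> y2"
    using D neq by blast+
  moreover have "x \<noteq> y1" "x \<noteq> y2" "y \<noteq> x1" "y \<noteq> x2" "b \<noteq> x1" "b \<noteq> x2" "b \<noteq> y1" "b \<noteq> y2" "x1 \<noteq> y1" "x1 \<noteq> y2" "x2 \<noteq> y1" "x2 \<noteq> y2"
    using D n by blast+
  ultimately show ?thesis by simp
qed

lemma chain_heavy:
  assumes "chain_link v x y b x1 x2 y1 y2"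
  shows "heavy v z \<longleftrightarrow> z = x \<or> z = y"
proof -
  note D = chain_distinct[OF assms] and C = chain_common[OF assms]
  have "l v x = 4" "l v y = 4" "l v b = 2" "l v x1 = 2" "l v x2 = 2" "l v y1 = 2" "l v y2 = 2"
    unfolding l_def C using D by auto
  moreover have "N v = {x,y,b,x1,x2,y1,y2}" using assms by (simp add: chain_link_def)
  then have "E v z \<longleftrightarrow> z \<in> {x,y,b,x1,x2,y1,y2}" using mem_N by blast
  ultimately show ?thesis unfolding heavy_def by auto
qed

lemma l_2_or_heavy: "E u v \<Longrightarrow> l u v = 2 \<or> heavy u v"
proof -
  assume e: "E u v"
  obtain x y b x1 x2 y1 y2 where c: "chain_link u x y b x1 x2 y1 y2" using chain[OF EV[OF e]] by blast
  note D = chain_distinct[OF c] and C = chain_common[OF c]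
  have "l u b = 2" "l u x1 = 2" "l u x2 = 2" "l u y1 = 2" "l u y2 = 2"
    unfolding l_def C using D by auto
  moreover have "v \<in> {x,y,b,x1,x2,y1,y2}" using c e mem_N unfolding chain_link_def by blast
  ultimately show ?thesis using chain_heavy[OF c, of v] by blast
qed

lemma heavy_at_most_two:
  assumes "heavy v a" "heavy v b" "heavy v c" "a \<noteq> b" "a \<noteq> c" "b \<noteq> c" shows False
proof -
  have "v \<in> V" using heavy_E[OF assms(1)] EV by blast
  then show False using chain chain_heavy assms by metis
qed

text \<open>Each triangle in the link of \<open>v\<close> contains one of the two attaching vertices
  of the chain, and these are the heavy neighbours of \<open>v\<close>.\<close>

lemma clique4_heavy:
  assumes "clique4 v p q r" shows "heavy v p \<or> heavy v q \<or> heavy v r"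
proof (rule ccontr)
  assume no: "\<not> ?thesis"
  note P = clique4D[OF assms]
  obtain x y b x1 x2 y1 y2 where c: "chain_link v x y b x1 x2 y1 y2" using chain[OF EV[OF P(1)]] by blast
  note C = chain_common[OF c] and D = chain_distinct[OF c] and rr = chain_heavy[OF c]
  have p: "p \<in> {x,y,b,x1,x2,y1,y2}" using c P(1) mem_N unfolding chain_link_def by blast
  have "q \<in> N v \<inter> N p" "r \<in> N v \<inter> N p" using P by auto
  moreover have "p \<noteq> x" "p \<noteq> y" "q \<noteq> x" "q \<noteq> y" "r \<noteq> x" "r \<noteq> y" "q \<noteq> r" using no rr neq[OF P(6)] by auto
  ultimately have no2: "N v \<inter> N p \<noteq> {x,g}" "N v \<inter> N p \<noteq> {y,g}" for g by blast+
  from p consider "p = b" | "p = x1" | "p = x2" | "p = y1" | "p = y2" using \<open>p \<noteq> x\<close> \<open>p \<noteq> y\<close> by blast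
  then show False using C(3-7) no2 by cases metis+
qed

text \<open>The four common neighbours of a heavy pair induce two disjoint edges; \<open>r s\<close>
  is the one other than \<open>a b\<close>.\<close>

lemma opposite_pair:
  assumes heavy: "heavy p q" and a: "E p a" "E q a" "E p b" "E q b" "E a b"
  shows "\<exists>r s. clique4 p q r s \<and> N p \<inter> N q = {a,b,r,s} \<and> \<not> E r a \<and> \<not> E r b \<and> \<not> E s a \<and> \<not> E s b"
proof -
  obtain x y c x1 x2 y1 y2 where c: "chain_link p x y c x1 x2 y1 y2" using chain[OF EV[OF a(1)]] by blast
  have core: ?thesis if c: "chain_link p q y c x1 x2 y1 y2" for y c x1 x2 y1 y2
  proof -
    note C = chain_common[OF c] and ch = c[unfolded chain_link_def]
    note D = clique4D[OF chain_cliques(1)[OF c]] clique4D[OF chain_cliques(2)[OF c]]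
    have "a \<in> N p \<inter> N q" "b \<in> N p \<inter> N q" using a by auto
    then have ab: "a \<in> {y,c,x1,x2}" "b \<in> {y,c,x1,x2}" using C(1) by auto
    have n: "\<not> E y x1" "\<not> E y x2" "\<not> E c x1" "\<not> E c x2" "\<not> E x1 y" "\<not> E x2 y" "\<not> E x1 c" "\<not> E x2 c" using ch sym by blast+
    have "(a = y \<and> b = c) \<or> (a = c \<and> b = y) \<or> (a = x1 \<and> b = x2) \<or> (a = x2 \<and> b = x1)"
      using ab n a(5) irrefl[of y] irrefl[of c] irrefl[of x1] irrefl[of x2] by fast
    then have "{a,b} = {y,c} \<or> {a,b} = {x1,x2}" by auto
    then show ?thesis
    proof
      assume e: "{a,b} = {y,c}"
      then have "{a,b,x1,x2} = {y,c,x1,x2}" by auto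
      then have "N p \<inter> N q = {a,b,x1,x2}" using C(1) by simp
      moreover have "a = y \<or> a = c" "b = y \<or> b = c" using e by blast+
      then have "\<not> E x1 a" "\<not> E x1 b" "\<not> E x2 a" "\<not> E x2 b" using n by blast+
      ultimately show ?thesis using chain_cliques(2)[OF c] by blast
    next
      assume e: "{a,b} = {x1,x2}"
      then have "{a,b,y,c} = {y,c,x1,x2}" by auto
      then have "N p \<inter> N q = {a,b,y,c}" using C(1) by simp
      moreover have "a = x1 \<or> a = x2" "b = x1 \<or> b = x2" using e by blast+
      then have "\<not> E y a" "\<not> E y b" "\<not> E c a" "\<not> E c b" using n by blast+
      ultimately show ?thesis using chain_cliques(1)[OF c] by blast
    qed
  qed
  have "q = x \<or> q = y" using chain_heavy[OF c] heavy by blast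
  then show ?thesis using core c chain_swap[OF c] by blast
qed

text \<open>The heavy neighbours of \<open>y\<close> are \<open>v\<close> and \<open>b\<close>,
  those of \<open>v\<close> are \<open>x\<close> and \<open>y\<close>. So the heavy edge at
  \<open>y1\<close> in the clique \<open>v y y1 y2\<close> can only be \<open>y1 y2\<close>. It has
  a pair \<open>r s\<close> opposite to \<open>v y\<close>, which \<open>dominating_pair\<close>
  joins to \<open>x\<close> and \<open>b\<close>; thus \<open>b\<close> and \<open>x\<close> have
  the four common neighbours \<open>v\<close>, \<open>y\<close>, \<open>r\<close>,
  \<open>s\<close>.\<close>

lemma diagonal_half:
  assumes c: "chain_link v x y b x1 x2 y1 y2" and heavy: "heavy b y" shows "heavy b x"
proof -
  note D = clique4D[OF chain_cliques(1)[OF c]] clique4D[OF chain_cliques(3)[OF c]] and dis = chain_distinct[OF c]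
  have ne: "y1 \<noteq> v" "y1 \<noteq> b" "v \<noteq> b" "y1 \<noteq> x" "y1 \<noteq> y" using dis by auto
  have vy: "heavy v y" "\<not> heavy v y1" using chain_heavy[OF c] ne by blast+
  have "clique4 y1 v y y2" using D by (simp add: clique4_def)
  then have "heavy y1 v \<or> heavy y1 y \<or> heavy y1 y2" by (rule clique4_heavy)
  moreover have "\<not> heavy y1 v" using vy heavy_sym by blast
  moreover have "\<not> heavy y1 y" using heavy_at_most_two[of y v b y1] heavy_sym[OF vy(1)] heavy_sym[OF heavy] heavy_sym[of y1 y] ne by blast
  ultimately have R12: "heavy y1 y2" by blast
  obtain r s where rs: "clique4 y1 y2 r s" "\<not> E r v" "\<not> E r y" "\<not> E s v" "\<not> E s y"
    using opposite_pair[OF R12, of v y] D by blast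
  note RS = clique4D[OF rs(1)]
  have V: "x \<in> V" "b \<in> V" "r \<in> V" "s \<in> V" using EV2 D(1,3) RS(2,3) by blast+
  have K: "clique4 v y y1 y2" using chain_cliques(3)[OF c] .
  have e: "E x r" "E x s" "E b r" "E b s"
    using dominating_pair[OF K V(1,3)] dominating_pair[OF K V(1,4)] dominating_pair[OF K V(2,3)] dominating_pair[OF K V(2,4)] D RS by blast+
  have d4: "v \<noteq> y" "v \<noteq> r" "v \<noteq> s" "y \<noteq> r" "y \<noteq> s" "r \<noteq> s" using D(2) rs neq[OF RS(6)] irrefl D(8) by blast+
  have "{v,y,r,s} \<subseteq> N b \<inter> N x" using e D by auto
  then have "card {v,y,r,s} \<le> l b x" unfolding l_def by (rule card_mono[rotated]) simp
  moreover have "card {v,y,r,s} = 4" using d4 by simp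
  ultimately show ?thesis using l_2_or_heavy[of b x] D(11) by auto
qed

lemma square:
  assumes c: "chain_link v x y b x1 x2 y1 y2"
  shows "heavy b x" "heavy b y"
proof -
  have "clique4 b v x y" using clique4D[OF chain_cliques(1)[OF c]] by (simp add: clique4_def)
  then have "heavy b v \<or> heavy b x \<or> heavy b y" by (rule clique4_heavy)
  moreover have "\<not> heavy b v" using chain_heavy[OF c, of b] chain_distinct[OF c] heavy_sym[of b v] by auto
  ultimately have "heavy b x \<or> heavy b y" by blast
  then show "heavy b x" "heavy b y" using diagonal_half[OF c] diagonal_half[OF chain_swap[OF c]] by blast+
qed

end

lemma Q_arc_iff:
  assumes "i < n" "x < 2" "y < 2" "j < n" "x' < 2" "y' < 2"
  shows "((i, x, y), (j, x', y')) \<in> parcs (Q_graph n) \<longleftrightarrow>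
    (j = (i + 1) mod n \<and> x' = y) \<or> (i = (j + 1) mod n \<and> x = y') \<or> (i = j \<and> (x, y) \<noteq> (x', y'))"
  using assms unfolding Q_graph_def Let_def by auto

section \<open>Blocks and their cyclic arrangement\<close>

context chain_cis_graph begin

text \<open>The component of \<open>v\<close> in the graph of heavy edges. It is a 4-cycle, so two
  steps reach every vertex.\<close>

definition block :: "'a \<Rightarrow> 'a set" where
  "block v = insert v ({z. heavy v z} \<union> {z. \<exists>u. heavy v u \<and> heavy u z})"

lemma heavy_square:
  assumes "chain_link v x y b x1 x2 y1 y2"
  shows "heavy v z \<longleftrightarrow> z = x \<or> z = y" "heavy x z \<longleftrightarrow> z = v \<or> z = b" "heavy y z \<longleftrightarrow> z = v \<or> z = b" "heavy b z \<longleftrightarrow> z = x \<or> z = y"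
proof -
  note s = square[OF assms] and d = chain_distinct[OF assms]
  have vx: "heavy v x" "heavy v y" using chain_heavy[OF assms] by auto
  have ne: "v \<noteq> b" "x \<noteq> y" using d by auto
  show "heavy v z \<longleftrightarrow> z = x \<or> z = y" by (rule chain_heavy[OF assms])
  show "heavy x z \<longleftrightarrow> z = v \<or> z = b" using heavy_at_most_two[of x v b z] heavy_sym[OF vx(1)] heavy_sym[OF s(1)] ne by blast
  show "heavy y z \<longleftrightarrow> z = v \<or> z = b" using heavy_at_most_two[of y v b z] heavy_sym[OF vx(2)] heavy_sym[OF s(2)] ne by blast
  show "heavy b z \<longleftrightarrow> z = x \<or> z = y" using heavy_at_most_two[of b x y z] s ne by blast
qed

lemma block_square:
  assumes "chain_link v x y b x1 x2 y1 y2" shows "block v = {v,x,y,b}"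
  unfolding block_def using heavy_square[OF assms] by auto

lemma block_self [simp]: "v \<in> block v" by (simp add: block_def)

lemma block_eq:
  assumes "v \<in> V" "u \<in> block v" shows "block u = block v"
proof -
  obtain x y b x1 x2 y1 y2 where c: "chain_link v x y b x1 x2 y1 y2" using chain[OF assms(1)] by blast
  note s = heavy_square[OF c]
  have "block x = {v,x,y,b}" "block y = {v,x,y,b}" "block b = {v,x,y,b}" unfolding block_def using s by auto
  moreover have "u = v \<or> u = x \<or> u = y \<or> u = b" using assms(2) block_square[OF c] by simp
  ultimately show ?thesis using block_square[OF c] by (elim disjE) simp_all
qed

lemma block_properties:
  assumes "v \<in> V" shows "card (block v) = 4" "block v \<subseteq> V" "u \<in> block v \<Longrightarrow> w \<in> block v \<Longrightarrow> u \<noteq> w \<Longrightarrow> E u w"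
proof -
  obtain x y b x1 x2 y1 y2 where c: "chain_link v x y b x1 x2 y1 y2" using chain[OF assms] by blast
  note D = clique4D[OF chain_cliques(1)[OF c]] and m = block_square[OF c]
  show "card (block v) = 4" unfolding m using chain_distinct[OF c] by simp
  show "block v \<subseteq> V" unfolding m using D(1-3)[THEN EV2] assms by simp
  have "cl {v,x,y,b}" using D by (auto simp: cl_def)
  then show "E u w" if "u \<in> block v" "w \<in> block v" "u \<noteq> w" using that unfolding m cl_def by blast
qed

lemma valency_7: assumes "v \<in> V" shows "d = 7"
proof -
  obtain x y b x1 x2 y1 y2 where c: "chain_link v x y b x1 x2 y1 y2" using chain[OF assms] by blast
  have "N v = set [x,y,b,x1,x2,y1,y2]" using c by (simp add: chain_link_def)
  moreover have "distinct [x,y,b,x1,x2,y1,y2]" using chain_distinct[OF c] by simp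
  ultimately show ?thesis using card_N[OF assms] distinct_card[of "[x,y,b,x1,x2,y1,y2]"] by simp
qed

text \<open>Let \<open>r t\<close> be the pair opposite to \<open>v x\<close> on the heavy edge
  \<open>y b\<close>. In the clique \<open>v x y b\<close>, \<open>x1\<close> and \<open>x2\<close>
  dominate \<open>v\<close> and \<open>x\<close> while \<open>r\<close> and \<open>t\<close>
  dominate \<open>y\<close> and \<open>b\<close>. So \<open>dominating_pair\<close> joins
  \<open>x1\<close> and \<open>x2\<close> to \<open>r\<close> and \<open>t\<close>, and these four
  turn out to be the block of \<open>x1\<close>. The edges between the two blocks join matching
  halves completely.\<close>

lemma block_link:
  assumes c: "chain_link v x y b x1 x2 y1 y2"
  shows "x1 \<notin> block v" "x2 \<in> block x1" "u \<in> block v \<Longrightarrow> w \<in> block x1 \<Longrightarrow> E u w \<longleftrightarrow> (u \<in> {v,x} \<longleftrightarrow> w \<in> {x1,x2})"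
proof -
  note s = heavy_square[OF c] and m = block_square[OF c] and dis = chain_distinct[OF c] and ch = c[unfolded chain_link_def]
  note D = clique4D[OF chain_cliques(1)[OF c]] clique4D[OF chain_cliques(2)[OF c]]
  have ne: "x1 \<noteq> v" "x1 \<noteq> x" "x1 \<noteq> y" "x1 \<noteq> b" "x1 \<noteq> x2" using dis by auto
  show x1: "x1 \<notin> block v" unfolding m using ne by simp
  have V: "v \<in> V" "x1 \<in> V" "x2 \<in> V" using EV[OF D(1)] D(14,15)[THEN EV2] by auto
  have "clique4 x1 v x x2" using D by (simp add: clique4_def)
  then have "heavy x1 v \<or> heavy x1 x \<or> heavy x1 x2" by (rule clique4_heavy)
  moreover have "\<not> heavy x1 v" "\<not> heavy x1 x" using s(1)[of x1] s(2)[of x1] heavy_sym[of x1 v] heavy_sym[of x1 x] ne by blast+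
  ultimately have R12: "heavy x1 x2" by blast
  show x2M: "x2 \<in> block x1" using R12 by (simp add: block_def)
  have Ryb: "heavy y b" using s(3) by blast
  obtain r t where rt: "clique4 y b r t" "\<not> E r v" "\<not> E r x" "\<not> E t v" "\<not> E t x" using opposite_pair[OF Ryb, of v x] D by blast
  note RT = clique4D[OF rt(1)]
  have rV: "r \<in> V" "t \<in> V" using RT(2,3)[THEN EV2] by auto
  have K: "clique4 v x y b" using chain_cliques(1)[OF c] .
  have xr: "E x1 r" "E x1 t" "E x2 r" "E x2 t"
    using dominating_pair[OF K V(2) rV(1)] dominating_pair[OF K V(2) rV(2)] dominating_pair[OF K V(3) rV(1)] dominating_pair[OF K V(3) rV(2)] D RT by blast+
  have vr: "v \<noteq> r" "v \<noteq> t" "x \<noteq> r" "x \<noteq> t" using rt D by blast+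
  obtain g h where gh: "N x1 \<inter> N x2 = {v,x,g,h}" "\<not> E g v" "\<not> E g x" "\<not> E h v" "\<not> E h x" using opposite_pair[OF R12, of v x] D by blast
  have "r \<in> N x1 \<inter> N x2" "t \<in> N x1 \<inter> N x2" using xr by auto
  then have common: "N x1 \<inter> N x2 = {v,x,r,t}" using gh(1) vr neq[OF RT(6)] by auto
  obtain p q e p1 p2 q1 q2 where c1: "chain_link x1 p q e p1 p2 q1 q2" using chain[OF V(2)] by blast
  note D1 = clique4D[OF chain_cliques(1)[OF c1]] and dis1 = chain_distinct[OF c1]
  have M1: "block x1 = {x1,p,q,e}" using block_square[OF c1] .
  have "\<exists>q'. block x1 = {x1,x2,q',e} \<and> clique4 x1 x2 q' e \<and> distinct [x1,x2,q',e]"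
  proof -
    have "x2 = p \<or> x2 = q" using chain_heavy[OF c1] R12 by blast
    moreover have "block x1 = {x1,q,p,e}" using M1 by auto
    moreover have "distinct [x1,p,q,e]" "distinct [x1,q,p,e]" using dis1 by auto
    ultimately show ?thesis using M1 chain_cliques(1)[OF c1] clique4_perm(2)[OF chain_cliques(1)[OF c1]] by blast
  qed
  then obtain q' where q: "block x1 = {x1,x2,q',e}" "clique4 x1 x2 q' e" "distinct [x1,x2,q',e]" by blast
  note Q = clique4D[OF q(2)]
  have "v \<notin> block x1" using block_eq[OF V(2), of v] x1 block_self[of x1] by metis
  moreover have "x \<in> block v" using m by simp
  then have "x \<notin> block x1" using block_eq[OF V(2), of x] block_eq[OF V(1), of x] x1 block_self[of x1] by metis
  ultimately have nq: "q' \<noteq> v" "q' \<noteq> x" "e \<noteq> v" "e \<noteq> x" using q(1) by auto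
  have "q' \<in> N x1 \<inter> N x2" "e \<in> N x1 \<inter> N x2" using Q by auto
  then have "q' \<in> {r,t}" "e \<in> {r,t}" using common nq by auto
  then have M1': "block x1 = {x1,x2,r,t}" using q(1,3) by auto
  have n: "\<not> E y x1" "\<not> E y x2" "\<not> E b x1" "\<not> E b x2" using ch by blast+
  have n2: "\<not> E v r" "\<not> E v t" "\<not> E x r" "\<not> E x t" using rt sym by blast+
  have d1: "r \<noteq> x1" "r \<noteq> x2" "t \<noteq> x1" "t \<noteq> x2" using xr neq by blast+
  have d2: "y \<noteq> v" "y \<noteq> x" "b \<noteq> v" "b \<noteq> x" using dis by auto
  have "E v x1" "E v x2" "E x x1" "E x x2" "E y r" "E y t" "E b r" "E b t" using D RT by blast+
  then show "E u w \<longleftrightarrow> (u \<in> {v,x} \<longleftrightarrow> w \<in> {x1,x2})" if "u \<in> block v" "w \<in> block x1"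
    using that n n2 d1 d2 unfolding m M1' by auto
qed

lemma block_disjoint:
  assumes c: "chain_link v x y b x1 x2 y1 y2" shows "y1 \<notin> block x1" "block x1 \<inter> block y1 = {}"
proof -
  note L = block_link[OF c] and dis = chain_distinct[OF c]
  have v: "v \<in> V" using EV clique4D(1)[OF chain_cliques(1)[OF c]] by blast
  have x1: "x1 \<in> V" "y1 \<in> V" "E v y1" using EV2 clique4D(2)[OF chain_cliques(2)[OF c]] clique4D(2)[OF chain_cliques(3)[OF c]] by blast+
  have "y1 \<notin> {x1,x2}" using dis by auto
  then show n: "y1 \<notin> block x1" using L(3)[of v y1] x1(3) by auto
  show "block x1 \<inter> block y1 = {}"
  proof (rule equals0I)
    fix z assume "z \<in> block x1 \<inter> block y1"
    then have "block z = block x1" "block z = block y1" using block_eq[OF x1(1), of z] block_eq[OF x1(2), of z] by simp_all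
    then show False using n block_self[of y1] by metis
  qed
qed

text \<open>A count: three neighbours in the own block and two in each of the two adjacent blocks
  already make seven.\<close>

lemma external_neighbors:
  assumes c: "chain_link v x y b x1 x2 y1 y2" and u: "u \<in> block v" and w: "E u w" "w \<notin> block v"
  shows "w \<in> block x1 \<or> w \<in> block y1"
proof -
  note c' = chain_swap[OF c]
  have v: "v \<in> V" using EV clique4D(1)[OF chain_cliques(1)[OF c]] by blast
  have x1: "x1 \<in> V" "y1 \<in> V" using EV2 clique4D(2)[OF chain_cliques(2)[OF c]] clique4D(2)[OF chain_cliques(3)[OF c]] by blast+
  have uV: "u \<in> V" using block_properties(2)[OF v] u by blast
  have fin: "finite (block z)" if "z \<in> V" for z using block_properties(2)[OF that] finV finite_subset by blast
  have two: "card (N u \<inter> block x1) = 2" if c: "chain_link v x y b x1 x2 y1 y2" for x y x1 x2 y1 y2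
  proof -
    have x1: "x1 \<in> V" using EV2 clique4D(2)[OF chain_cliques(2)[OF c]] by blast
    note L = block_link[OF c]
    have x12: "{x1,x2} \<subseteq> block x1" "x1 \<noteq> x2" using L(2) chain_distinct[OF c] by auto
    show ?thesis
    proof (cases "u \<in> {v,x}")
      case True
      then have "N u \<inter> block x1 = {x1,x2}" using L(3)[OF u] x12(1) by auto
      then show ?thesis using x12 by simp
    next
      case False
      then have "N u \<inter> block x1 = block x1 - {x1,x2}" using L(3)[OF u] by auto
      then show ?thesis using x12 block_properties(1)[OF x1] card_Diff_subset[of "{x1,x2}" "block x1"] by simp
    qed
  qed
  have m3: "card (block v - {u}) = 3" using block_properties(1)[OF v] u fin[OF v] by simp
  have d1: "block v \<inter> block x1 = {}"
  proof (rule equals0I)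
    fix z assume "z \<in> block v \<inter> block x1"
    then have "block z = block v" "block z = block x1" using block_eq[OF v, of z] block_eq[OF x1(1), of z] by simp_all
    then show False using block_link(1)[OF c] block_self[of x1] by metis
  qed
  have d2: "block v \<inter> block y1 = {}"
  proof (rule equals0I)
    fix z assume "z \<in> block v \<inter> block y1"
    then have "block z = block v" "block z = block y1" using block_eq[OF v, of z] block_eq[OF x1(2), of z] by simp_all
    then show False using block_link(1)[OF c'] block_self[of y1] by metis
  qed
  let ?S = "(block v - {u}) \<union> ((N u \<inter> block x1) \<union> (N u \<inter> block y1))"
  have "card ((N u \<inter> block x1) \<union> (N u \<inter> block y1)) = 4"
    using card_Un_disjoint[of "N u \<inter> block x1" "N u \<inter> block y1"] block_disjoint(2)[OF c] two[OF c] two[OF c'] by auto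
  moreover have "card ?S = card (block v - {u}) + card ((N u \<inter> block x1) \<union> (N u \<inter> block y1))"
    by (rule card_Un_disjoint) (use fin[OF v] d1 d2 in auto)
  ultimately have "card ?S = 7" using m3 by simp
  moreover have "x \<in> N u" if "x \<in> block v - {u}" for x using block_properties(3)[OF v u, of x] that by auto
  then have "?S \<subseteq> N u" by blast
  ultimately have "?S = N u" using card_N[OF uV] valency_7[OF v] by (intro card_subset_eq) auto
  moreover have "w \<in> N u" using w(1) by simp
  ultimately have "w \<in> ?S" by blast
  then show ?thesis using w(2) by blast
qed

text \<open>Whichever halves of their blocks contain \<open>u\<close> and \<open>w\<close>, some
  vertex \<open>p\<close> of the middle block sees both. In the chain at \<open>p\<close> the
  adjacent vertices \<open>u\<close> and \<open>w\<close> would belong to the same outer pair, hence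
  to the same block. This is what later excludes \<open>n = 3\<close>.\<close>

lemma neighbor_blocks_nonadjacent:
  assumes c: "chain_link v x y b x1 x2 y1 y2" and u: "u \<in> block x1" and w: "w \<in> block y1" shows "\<not> E u w"
proof
  assume e: "E u w"
  note c' = chain_swap[OF c] and m = block_square[OF c] and dis = chain_distinct[OF c]
  have v: "v \<in> V" using EV clique4D(1)[OF chain_cliques(1)[OF c]] by blast
  have x1: "x1 \<in> V" "y1 \<in> V" using EV2 clique4D(2)[OF chain_cliques(2)[OF c]] clique4D(2)[OF chain_cliques(3)[OF c]] by blast+
  note L1 = block_link(3)[OF c] and L2 = block_link(3)[OF c']
  have m4: "v \<in> block v" "x \<in> block v" "y \<in> block v" "b \<in> block v" unfolding m by auto
  have ne: "x \<noteq> v" "y \<noteq> v" "y \<noteq> x" "b \<noteq> v" "b \<noteq> x" "b \<noteq> y" using dis by auto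
  have "\<exists>p\<in>block v. E p u \<and> E p w"
    using L1[OF m4(1) u] L1[OF m4(2) u] L1[OF m4(3) u] L1[OF m4(4) u] L2[OF m4(1) w] L2[OF m4(2) w] L2[OF m4(3) w] L2[OF m4(4) w] ne m4
    by (cases "u \<in> {x1,x2}"; cases "w \<in> {y1,y2}") auto
  then obtain p where p: "p \<in> block v" "E p u" "E p w" by blast
  have Mp: "block p = block v" using block_eq[OF v p(1)] .
  obtain x' y' b' x1' x2' y1' y2' where cp: "chain_link p x' y' b' x1' x2' y1' y2'" using chain EV[OF p(2)] by blast
  have disj: "z \<notin> block v" if "z \<in> block x1 \<or> z \<in> block y1" for z
  proof
    assume "z \<in> block v"
    then have "block z = block v" using block_eq v by blast
    moreover have "block z = block x1 \<or> block z = block y1" using that block_eq x1 by blast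
    ultimately show False using block_link(1)[OF c] block_link(1)[OF c'] block_self[of x1] block_self[of y1] by metis
  qed
  have "u \<notin> block p" "w \<notin> block p" using disj[of u] disj[of w] u w Mp by simp_all
  then have "u \<notin> {p,x',y',b'}" "w \<notin> {p,x',y',b'}" using block_square[OF cp] by simp_all
  moreover have Np: "N p = {x',y',b',x1',x2',y1',y2'}" using cp by (simp add: chain_link_def)
  ultimately have uw: "u \<in> {x1',x2',y1',y2'}" "w \<in> {x1',x2',y1',y2'}" using p mem_N by blast+
  have n: "\<not> E x1' y1'" "\<not> E x1' y2'" "\<not> E x2' y1'" "\<not> E x2' y2'" using cp by (auto simp: chain_link_def)
  then have n': "\<not> E y1' x1'" "\<not> E y2' x1'" "\<not> E y1' x2'" "\<not> E y2' x2'" using sym by blast+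
  have "(u \<in> {x1',x2'} \<and> w \<in> {x1',x2'}) \<or> (u \<in> {y1',y2'} \<and> w \<in> {y1',y2'})" using uw e n n' by auto
  moreover have "x2' \<in> block x1'" "y2' \<in> block y1'" using block_link(2)[OF cp] block_link(2)[OF chain_swap[OF cp]] .
  moreover have "x1' \<in> V" "y1' \<in> V" using EV2 Np mem_N by blast+
  ultimately have "block u = block w" using block_eq[of x1'] block_eq[of y1'] block_self[of x1'] block_self[of y1'] by blast
  moreover have "block u = block x1" "block w = block y1" using block_eq[OF x1(1) u] block_eq[OF x1(2) w] .
  ultimately show False using block_disjoint(1)[OF c] block_self[of y1] by metis
qed

definition touches :: "'a set \<Rightarrow> 'a set \<Rightarrow> bool" where
  "touches K L \<longleftrightarrow> K \<in> block ` V \<and> L \<in> block ` V \<and> K \<noteq> L \<and> (\<exists>u\<in>K. \<exists>w\<in>L. E u w)"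

lemma touches_sym: "touches K L \<Longrightarrow> touches L K"
  unfolding touches_def using sym by blast

lemma block_mem_eq: "K \<in> block ` V \<Longrightarrow> u \<in> K \<Longrightarrow> block u = K \<and> u \<in> V"
  using block_eq block_properties(2) by blast

lemma touches_iff:
  assumes c: "chain_link v x y b x1 x2 y1 y2" shows "touches (block v) L \<longleftrightarrow> L = block x1 \<or> L = block y1"
proof -
  have v: "v \<in> V" using EV clique4D(1)[OF chain_cliques(1)[OF c]] by blast
  have x1: "x1 \<in> V" "y1 \<in> V" "E v x1" "E v y1" using EV2 clique4D(2)[OF chain_cliques(2)[OF c]] clique4D(2)[OF chain_cliques(3)[OF c]] by blast+
  have "block x1 \<noteq> block v" "block y1 \<noteq> block v" using block_link(1)[OF c] block_link(1)[OF chain_swap[OF c]] block_self[of x1] block_self[of y1] by metis+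
  then have "touches (block v) (block x1)" "touches (block v) (block y1)" unfolding touches_def using v x1 block_self by blast+
  moreover have "L = block x1 \<or> L = block y1" if BL: "touches (block v) L"
  proof -
    obtain u w where uw: "u \<in> block v" "w \<in> L" "E u w" "L \<in> block ` V" "block v \<noteq> L" using BL by (auto simp: touches_def)
    have wL: "block w = L" using block_mem_eq uw by blast
    have "w \<notin> block v" using wL uw(5) block_eq[OF v] by blast
    then have "w \<in> block x1 \<or> w \<in> block y1" using external_neighbors[OF c uw(1,3)] by blast
    then show ?thesis using wL block_eq x1 by blast
  qed
  ultimately show ?thesis by blast
qed

lemma touches_two: assumes "K \<in> block ` V" shows "\<exists>L L'. L \<noteq> L' \<and> \<not> touches L L' \<and> (\<forall>Z. touches K Z \<longleftrightarrow> Z = L \<or> Z = L')"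
proof -
  obtain v where v: "v \<in> V" "K = block v" using assms by blast
  obtain x y b x1 x2 y1 y2 where c: "chain_link v x y b x1 x2 y1 y2" using chain[OF v(1)] by blast
  have "block x1 \<noteq> block y1" using block_disjoint(1)[OF c] block_self[of y1] by metis
  moreover have "\<not> touches (block x1) (block y1)" using neighbor_blocks_nonadjacent[OF c] by (auto simp: touches_def)
  ultimately show ?thesis using touches_iff[OF c] v(2) by blast
qed

lemma touches_link: assumes "touches K L" shows "\<exists>U D. \<forall>u\<in>K. \<forall>w\<in>L. E u w \<longleftrightarrow> (u \<in> U \<longleftrightarrow> w \<in> D)"
proof -
  obtain v where v: "v \<in> V" "K = block v" using assms by (auto simp: touches_def)
  obtain x y b x1 x2 y1 y2 where c: "chain_link v x y b x1 x2 y1 y2" using chain[OF v(1)] by blast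
  have "L = block x1 \<or> L = block y1" using touches_iff[OF c, of L] assms v(2) by simp
  then show ?thesis
  proof
    assume L: "L = block x1"
    show ?thesis
      by (intro exI[of _ "{v,x}"] exI[of _ "{x1,x2}"] ballI block_link(3)[OF c]) (simp_all add: v(2)[symmetric] L[symmetric])
  next
    assume L: "L = block y1"
    show ?thesis
      by (intro exI[of _ "{v,y}"] exI[of _ "{y1,y2}"] ballI block_link(3)[OF chain_swap[OF c]]) (simp_all add: v(2)[symmetric] L[symmetric])
  qed
qed

lemma touches_separates:
  assumes "touches K L" "touches K L'" "L \<noteq> L'" "u \<in> K" "u' \<in> K" "\<And>w. w \<in> L \<union> L' \<Longrightarrow> E u w \<longleftrightarrow> E u' w"
  shows "u = u'"
proof -
  obtain v where v: "v \<in> V" "K = block v" using assms by (auto simp: touches_def)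
  obtain x y b x1 x2 y1 y2 where c: "chain_link v x y b x1 x2 y1 y2" using chain[OF v(1)] by blast
  have "L = block x1 \<or> L = block y1" "L' = block x1 \<or> L' = block y1" using touches_iff[OF c] assms(1,2) v(2) by simp_all
  then have "L \<union> L' = block x1 \<union> block y1" using assms(3) by blast
  then have "x1 \<in> L \<union> L'" "y1 \<in> L \<union> L'" using block_self[of x1] block_self[of y1] by simp_all
  then have e: "E u x1 \<longleftrightarrow> E u' x1" "E u y1 \<longleftrightarrow> E u' y1" using assms(6) by blast+
  have um: "u \<in> block v" "u' \<in> block v" using assms(4,5) v(2) by simp_all
  have "u \<in> {v,x} \<longleftrightarrow> u' \<in> {v,x}"
    using block_link(3)[OF c um(1) block_self[of x1]] block_link(3)[OF c um(2) block_self[of x1]] e(1) by simp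
  moreover have "u \<in> {v,y} \<longleftrightarrow> u' \<in> {v,y}"
    using block_link(3)[OF chain_swap[OF c] um(1) block_self[of y1]] block_link(3)[OF chain_swap[OF c] um(2) block_self[of y1]] e(2) by simp
  moreover have "u \<in> {v,x,y,b}" "u' \<in> {v,x,y,b}" using um block_square[OF c] by simp_all
  moreover have "distinct [v,x,y,b]" using chain_distinct[OF c] by simp
  ultimately show ?thesis by auto
qed

lemma Q_coordinates:
  "\<exists>n\<ge>4. \<exists>f. bij_betw f V ({0..<n} \<times> {0..<2} \<times> {0..<2}) \<and> (\<forall>u\<in>V. \<forall>w\<in>V. E u w \<longleftrightarrow> (f u, f w) \<in> parcs (Q_graph n))"
proof -
  obtain v0 where v0: "v0 \<in> V" using nonempty by blast
  have "\<exists>(n::nat) m. 3 \<le> n \<and> bij_betw m {..<n} (block ` V) \<and> (\<forall>i<n. \<forall>j<n. touches (m i) (m j) \<longleftrightarrow> j = (i + 1) mod n \<or> i = (j + 1) mod n)"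
  proof (rule two_regular_cycle)
    show "finite (block ` V)" using finV by simp
    show "block v0 \<in> block ` V" using v0 by simp
    show "touches x y \<Longrightarrow> x \<in> block ` V \<and> y \<in> block ` V" for x y by (simp add: touches_def)
    show "touches x y \<Longrightarrow> touches y x" for x y by (rule touches_sym)
    show "\<not> touches x x" for x by (simp add: touches_def)
    show "\<exists>a b. a \<noteq> b \<and> (\<forall>y. touches x y \<longleftrightarrow> y = a \<or> y = b)" if "x \<in> block ` V" for x using touches_two[OF that] by blast
    fix A assume A: "A \<subseteq> block ` V" "A \<noteq> {}" "\<And>x y. x \<in> A \<Longrightarrow> touches x y \<Longrightarrow> y \<in> A"
    have "{u \<in> V. block u \<in> A} = V"
    proof (rule connectedE)
      show "{u \<in> V. block u \<in> A} \<noteq> {}" using A(1,2) by blast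
      fix u w assume u: "u \<in> {u \<in> V. block u \<in> A}" and e: "E u w"
      have "block w \<in> A"
      proof (cases "block u = block w")
        case False
        then have "touches (block u) (block w)" unfolding touches_def using u e EV2[OF e] block_self by blast
        then show ?thesis using A(3) u by blast
      qed (use u in simp)
      then show "w \<in> {u \<in> V. block u \<in> A}" using EV2[OF e] by simp
    qed blast
    then show "A = block ` V" using A(1) by blast
  qed
  then obtain n :: nat and m where n3: "3 \<le> n" and m: "bij_betw m {..<n} (block ` V)"
    and adj: "\<And>i j. i < n \<Longrightarrow> j < n \<Longrightarrow> touches (m i) (m j) \<longleftrightarrow> j = (i + 1) mod n \<or> i = (j + 1) mod n" by blast
  define s where "s i = (i + 1) mod n" for i
  define p where "p i = (i + n - 1) mod n" for i
  have sn: "s i < n" "p i < n" for i using n3 by (auto simp: s_def p_def)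
  have sp: "s (p i) = i" "s i \<noteq> p i" "s i \<noteq> i" if "i < n" for i
    using that n3 by (cases i; auto simp: s_def p_def mod_Suc)+
  have mM: "m i \<in> block ` V" if "i < n" for i using m that by (auto simp: bij_betw_def)
  have minj: "m i = m j \<longleftrightarrow> i = j" if "i < n" "j < n" for i j using m that by (auto simp: bij_betw_def inj_on_def)
  have Bs: "touches (m i) (m (s i))" if "i < n" for i using adj[OF that sn(1)] by (simp add: s_def)
  have Bp: "touches (m i) (m (p i))" if "i < n" for i using touches_sym[OF Bs[OF sn(2)[of i]]] sp(1)[OF that] by simp
  have "n \<noteq> 3"
  proof
    assume n: "n = 3"
    have "touches (m 0) (m 1)" "touches (m 0) (m 2)" "touches (m 1) (m 2)" using adj[of 0 1] adj[of 0 2] adj[of 1 2] n by simp_all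
    moreover have "m 1 \<noteq> m 2" using minj[of 1 2] n by simp
    moreover obtain L L' where "L \<noteq> L'" "\<not> touches L L'" "\<forall>Z. touches (m 0) Z \<longleftrightarrow> Z = L \<or> Z = L'" using touches_two[OF mM[of 0]] n by auto
    ultimately show False using touches_sym by metis
  qed
  then have n4: "4 \<le> n" using n3 by simp
  have "\<exists>U D. \<forall>u\<in>m i. \<forall>w\<in>m (s i). E u w \<longleftrightarrow> (u \<in> U \<longleftrightarrow> w \<in> D)" if "i < n" for i using touches_link[OF Bs[OF that]] .
  then obtain U D where UD: "\<And>i u w. i < n \<Longrightarrow> u \<in> m i \<Longrightarrow> w \<in> m (s i) \<Longrightarrow> E u w \<longleftrightarrow> (u \<in> U i \<longleftrightarrow> w \<in> D i)" by metis
  have "\<exists>i<n. block u = m i" if "u \<in> V" for u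
  proof -
    have "block u \<in> m ` {..<n}" using m that by (simp add: bij_betw_def)
    then show ?thesis by auto
  qed
  then obtain ix where ix: "\<And>u. u \<in> V \<Longrightarrow> ix u < n \<and> block u = m (ix u)" by metis
  have mem: "u \<in> m (ix u)" if "u \<in> V" for u using ix[OF that] block_self[of u] by simp
  have mem_iff: "u \<in> m i \<longleftrightarrow> ix u = i" if "u \<in> V" "i < n" for u i
    using block_mem_eq[OF mM[OF that(2)], of u] ix[OF that(1)] minj[of "ix u" i] mem[OF that(1)] that(2) by metis
  \<comment> \<open>The last two coordinates record the half of the block facing the preceding block
    and the half facing the next one. By \<open>UD\<close> a neighbour \<open>w\<close> of
    \<open>u\<close> in the next block is one whose second coordinate equals the third coordinate of
    \<open>u\<close>, as in \<open>Q_graph\<close>.\<close>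
  define f where "f u = (ix u, if u \<in> D (p (ix u)) then 0 else 1 :: nat, if u \<in> U (ix u) then 0 else 1 :: nat)" for u
  have inj: "inj_on f V"
  proof (rule inj_onI)
    fix u u' assume u: "u \<in> V" "u' \<in> V" "f u = f u'"
    define i where "i = ix u"
    have i: "ix u' = i" "i < n" and l: "u \<in> U i \<longleftrightarrow> u' \<in> U i" "u \<in> D (p i) \<longleftrightarrow> u' \<in> D (p i)"
      using u ix[OF u(1)] by (auto simp: f_def i_def split: if_splits)
    have um: "u \<in> m i" "u' \<in> m i" using mem[OF u(1)] mem[OF u(2)] i(1) by (simp_all add: i_def)
    have eqs: "E u w \<longleftrightarrow> E u' w" if w: "w \<in> m (s i) \<union> m (p i)" for w
    proof (cases "w \<in> m (s i)")
      case True
      then show ?thesis using UD[OF i(2) um(1)] UD[OF i(2) um(2)] l(1) by simp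
    next
      case False
      then have w: "w \<in> m (p i)" using w by blast
      have "E w u \<longleftrightarrow> E w u'" using UD[OF sn(2) w, of u] UD[OF sn(2) w, of u'] um sp(1)[OF i(2)] l(2) by simp
      then show ?thesis using sym_iff[of w u] sym_iff[of w u'] by simp
    qed
    have ne: "m (s i) \<noteq> m (p i)" using minj[OF sn] sp(2)[OF i(2)] by simp
    show "u = u'" by (rule touches_separates[OF Bs[OF i(2)] Bp[OF i(2)] ne um eqs])
  qed
  have "V = \<Union> (block ` V)" using block_properties(2) block_self by blast
  moreover have "card (\<Union> (block ` V)) = (\<Sum>K\<in>block ` V. card K)"
  proof (rule card_Union_disjoint)
    show "pairwise disjnt (block ` V)"
      unfolding pairwise_def disjnt_def
    proof (intro ballI impI equals0I)
      fix K L z assume "K \<in> block ` V" "L \<in> block ` V" "K \<noteq> L" "z \<in> K \<inter> L"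
      then show False using block_mem_eq[of K z] block_mem_eq[of L z] by auto
    qed
    show "finite K" if K: "K \<in> block ` V" for K
    proof -
      have "K \<subseteq> V" using block_mem_eq[OF K] by blast
      then show ?thesis using finV by (rule finite_subset)
    qed
  qed
  ultimately have "card V = (\<Sum>K\<in>block ` V. card K)" by simp
  also have "\<dots> = (\<Sum>K\<in>block ` V. 4)" by (intro sum.cong refl) (use block_properties(1) in blast)
  also have "\<dots> = 4 * n" using bij_betw_same_card[OF m] by simp
  finally have cV: "card V = 4 * n" .
  have sub: "f ` V \<subseteq> {0..<n} \<times> {0..<2} \<times> {0..<2}" using ix by (auto simp: f_def)
  have "f ` V = {0..<n} \<times> {0..<2} \<times> {0..<2}"
    by (rule card_subset_eq) (use sub card_image[OF inj] cV in \<open>auto simp: card_cartesian_product\<close>)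
  then have bij: "bij_betw f V ({0..<n} \<times> {0..<2} \<times> {0..<2})" using inj by (simp add: bij_betw_def)
  have "E u w \<longleftrightarrow> (f u, f w) \<in> parcs (Q_graph n)" if uw: "u \<in> V" "w \<in> V" for u w
  proof -
    define i j where "i = ix u" and "j = ix w"
    have ij: "i < n" "j < n" using ix uw by (auto simp: i_def j_def)
    have mu: "u \<in> m i" "w \<in> m j" using mem uw by (auto simp: i_def j_def)
    have Mu: "block u = m i" "block w = m j" using ix uw by (auto simp: i_def j_def)
    have arc: "(f u, f w) \<in> parcs (Q_graph n) \<longleftrightarrow>
      (j = s i \<and> (w \<in> D (p j) \<longleftrightarrow> u \<in> U i)) \<or> (i = s j \<and> (u \<in> D (p i) \<longleftrightarrow> w \<in> U j)) \<or> (i = j \<and> f u \<noteq> f w)"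
      unfolding f_def i_def[symmetric] j_def[symmetric]
      by (subst Q_arc_iff) (use ij in \<open>auto simp: s_def\<close>)
    have fin: "f u \<noteq> f w \<longleftrightarrow> u \<noteq> w" using inj uw by (auto simp: inj_on_def)
    have ps: "p (s i) = i" if "i < n" for i using that n3 by (auto simp: s_def p_def mod_Suc)
    \<comment> \<open>As \<open>n \<ge> 3\<close>, no index is both successor and predecessor of
      another, so the disjuncts of \<open>arc\<close> exclude each other.\<close>
    have ss: "s i \<noteq> j \<or> s j \<noteq> i" using ij n3 by (auto simp: s_def mod_Suc split: if_splits)
    consider "i = j" | "j = s i" | "i = s j" | "i \<noteq> j" "j \<noteq> s i" "i \<noteq> s j" by blast
    then show ?thesis
    proof cases
      case 1
      then have "E u w \<longleftrightarrow> u \<noteq> w" using block_properties(3)[OF uw(1), of u w] Mu mu neq by auto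
      then show ?thesis using arc fin 1 sp(3)[OF ij(1)] by metis
    next
      case 2
      then have "E u w \<longleftrightarrow> (u \<in> U i \<longleftrightarrow> w \<in> D i)" using UD[OF ij(1) mu(1)] mu(2) by simp
      then show ?thesis using arc 2 ps[OF ij(1)] ss sp(3)[OF ij(1)] by metis
    next
      case 3
      then have "E w u \<longleftrightarrow> (w \<in> U j \<longleftrightarrow> u \<in> D j)" using UD[OF ij(2) mu(2)] mu(1) by simp
      then show ?thesis using arc 3 ps[OF ij(2)] ss sp(3)[OF ij(2)] sym_iff[of u w] by metis
    next
      case 4
      have "\<not> E u w"
      proof
        assume "E u w"
        moreover have "m i \<noteq> m j" using minj ij 4 by simp
        ultimately have "touches (m i) (m j)" unfolding touches_def using mM ij mu by blast
        then show False using adj[OF ij] 4 by (auto simp: s_def)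
      qed
      then show ?thesis using arc 4 by blast
    qed
  qed
  then show ?thesis using bij n4 by blast
qed

end

section \<open>The listed graphs\<close>

definition adj :: "'a pair_pre_digraph \<Rightarrow> 'a \<Rightarrow> 'a \<Rightarrow> bool" where
  "adj G u v \<longleftrightarrow> (u, v) \<in> parcs G"

lemma simple_graph_adj: "pair_graph G \<Longrightarrow> simple_graph (adj G)"
proof -
  assume "pair_graph G"
  then interpret pair_graph G .
  show ?thesis by unfold_locales (auto simp: adj_def arcs_symmetric dest: pair_no_loops)
qed

lemma adj_verts: "pair_graph G \<Longrightarrow> adj G u v \<Longrightarrow> u \<in> pverts G \<and> v \<in> pverts G"
proof -
  assume "pair_graph G" "adj G u v"
  then interpret pair_graph G by simp
  show ?thesis using \<open>adj G u v\<close> by (auto simp: adj_def dest: in_arcsD1 in_arcsD2)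
qed

lemma maximal_clique_iff:
  assumes "pair_graph G"
  shows "maximal_clique G K \<longleftrightarrow> simple_graph.mcl (adj G) (pverts G) K"
proof -
  interpret simple_graph "adj G" using simple_graph_adj[OF assms] .
  have c: "clique G D \<longleftrightarrow> D \<subseteq> pverts G \<and> cl D" for D by (auto simp: clique_def cl_def adj_def)
  show ?thesis
  proof
    assume K: "maximal_clique G K"
    then have Kc: "K \<subseteq> pverts G" "cl K" by (auto simp: maximal_clique_def c)
    have "\<exists>u\<in>K. \<not> adj G u v" if v: "v \<in> pverts G - K" for v
    proof (rule ccontr)
      assume "\<not> ?thesis"
      then have "adj G v u" if "u \<in> K" for u using sym[of u v] that by blast
      then have "clique G (insert v K)" using c cl_insert[OF Kc(2)] Kc(1) v by auto
      then have "insert v K = K" using K by (auto simp: maximal_clique_def)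
      then show False using v by blast
    qed
    then show "mcl (pverts G) K" using Kc by (simp add: mcl_def)
  next
    assume K: "mcl (pverts G) K"
    have "D = K" if D: "clique G D" "K \<subseteq> D" for D
    proof -
      have "x \<in> K" if "x \<in> D" for x
        by (rule mcl_max[OF K]) (use D that in \<open>auto simp: clique_def adj_def\<close>)
      then show ?thesis using D(2) by blast
    qed
    then show "maximal_clique G K" using K by (simp add: maximal_clique_def c mcl_def)
  qed
qed

lemma maximal_stable_set_iff:
  assumes "pair_graph G"
  shows "maximal_stable_set G S \<longleftrightarrow> simple_graph.mst (adj G) (pverts G) S"
proof -
  interpret simple_graph "adj G" using simple_graph_adj[OF assms] .
  have c: "stable_set G D \<longleftrightarrow> D \<subseteq> pverts G \<and> st D" for D
    unfolding stable_set_def st_def adj_def using irrefl[unfolded adj_def] by metis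
  show ?thesis
  proof
    assume S: "maximal_stable_set G S"
    then have Sc: "S \<subseteq> pverts G" "st S" by (auto simp: maximal_stable_set_def c)
    have "\<exists>u\<in>S. adj G u v" if v: "v \<in> pverts G - S" for v
    proof (rule ccontr)
      assume "\<not> ?thesis"
      then have "\<not> adj G v u" if "u \<in> S" for u using sym[of v u] that by blast
      then have "stable_set G (insert v S)" using c st_insert[OF Sc(2)] Sc(1) v by auto
      then have "insert v S = S" using S by (auto simp: maximal_stable_set_def)
      then show False using v by blast
    qed
    then show "mst (pverts G) S" using Sc by (simp add: mst_def)
  next
    assume S: "mst (pverts G) S"
    have "D = S" if D: "stable_set G D" "S \<subseteq> D" for D
    proof -
      have "x \<in> S" if x: "x \<in> D" for x
      proof (rule ccontr)
        assume "x \<notin> S"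
        then obtain u where "u \<in> S" "adj G u x" using S D(1) x unfolding mst_def c by blast
        then show False using D x unfolding c st_def by blast
      qed
      then show ?thesis using D(2) by blast
    qed
    then show "maximal_stable_set G S" using S by (simp add: maximal_stable_set_def c mst_def)
  qed
qed

text \<open>A stable set dominating a maximal clique extends to a maximal stable set that still
  misses the clique; conversely, a maximal stable set missing a clique dominates it.\<close>

lemma CIS_iff:
  assumes G: "pair_graph G" and ne: "pverts G \<noteq> {}"
  shows "CIS G \<longleftrightarrow> simple_graph.cis (adj G) (pverts G)"
proof -
  interpret pair_graph G by fact
  interpret simple_graph "adj G" using simple_graph_adj[OF G] .
  have fin: "finite (pverts G)" by simp
  show ?thesis
  proof
    assume C: "CIS G"
    show "cis (pverts G)"
      unfolding cis_def
    proof (intro allI impI, rule ccontr)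
      fix K S assume K: "mcl (pverts G) K" "K \<noteq> {}" and S: "S \<subseteq> pverts G" "st S" and no: "\<not> (\<exists>c\<in>K. \<forall>s\<in>S. \<not> adj G c s)"
      obtain S' where S': "mst (pverts G) S'" "S \<subseteq> S'" using ex_mst[OF fin S(2,1)] by blast
      have "S' \<inter> K \<noteq> {}" using C K(1) S'(1) by (auto simp: CIS_def maximal_clique_iff[OF G] maximal_stable_set_iff[OF G])
      then obtain c where c: "c \<in> S'" "c \<in> K" by blast
      then obtain s where "s \<in> S" "adj G c s" using no by blast
      then show False using S' c(1) unfolding mst_def st_def by blast
    qed
  next
    assume C: "cis (pverts G)"
    show "CIS G"
      unfolding CIS_def maximal_clique_iff[OF G] maximal_stable_set_iff[OF G]
    proof (intro allI impI notI)
      fix S K assume SK: "mst (pverts G) S \<and> mcl (pverts G) K" "S \<inter> K = {}"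
      have K: "mcl (pverts G) K" and S: "mst (pverts G) S" using SK by auto
      have "K \<noteq> {}" using K ne by (auto simp: mcl_def)
      moreover have "\<exists>s\<in>S. adj G c s" if c: "c \<in> K" for c
      proof -
        have "c \<in> pverts G - S" using c mcl_sub[OF K c] SK(2) by blast
        then obtain s where "s \<in> S" "adj G s c" using S by (auto simp: mst_def)
        then show ?thesis using sym[of s c] by blast
      qed
      ultimately show False using cisD[OF C K, of S] S by (auto simp: mst_def)
    qed
  qed
qed

lemma cis_transfer:
  assumes "simple_graph E" "simple_graph F" and f: "bij_betw f V W"
    and adj: "\<And>u v. u \<in> V \<Longrightarrow> v \<in> V \<Longrightarrow> F (f u) (f v) \<longleftrightarrow> E u v"
    and cis: "simple_graph.cis F W"
  shows "simple_graph.cis E V"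
proof -
  interpret E: simple_graph E by fact
  interpret F: simple_graph F by fact
  have im: "f ` V = W" and inj: "inj_on f V" using f by (auto simp: bij_betw_def)
  show ?thesis
    unfolding E.cis_def
  proof (intro allI impI, rule ccontr)
    fix K S assume K: "E.mcl V K" "K \<noteq> {}" and S: "S \<subseteq> V" "E.st S" and no: "\<not> (\<exists>c\<in>K. \<forall>s\<in>S. \<not> E c s)"
    have KV: "K \<subseteq> V" using K by (simp add: E.mcl_def)
    have "F.mcl W (f ` K)"
      unfolding F.mcl_def
    proof (intro conjI ballI)
      show "f ` K \<subseteq> W" using KV im by blast
      show "F.cl (f ` K)"
        unfolding F.cl_def
      proof (intro ballI impI)
        fix a b assume "a \<in> f ` K" "b \<in> f ` K" "a \<noteq> b"
        then obtain u v where "u \<in> K" "v \<in> K" "a = f u" "b = f v" "u \<noteq> v" by blast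
        then show "F a b" using E.mcl_adj[OF K(1), of u v] adj[of u v] KV by blast
      qed
      fix w assume w: "w \<in> W - f ` K"
      then obtain v where v: "v \<in> V" "w = f v" "v \<notin> K" using im by blast
      then obtain u where "u \<in> K" "\<not> E u v" using K(1) by (auto simp: E.mcl_def)
      then show "\<exists>u\<in>f ` K. \<not> F u w" using v adj KV by auto
    qed
    moreover have "f ` S \<subseteq> W" using S im by blast
    moreover have "F.st (f ` S)" unfolding F.st_def using S adj by (auto simp: E.st_def subset_iff)
    moreover have "\<exists>s\<in>f ` S. F c s" if c: "c \<in> f ` K" for c
    proof -
      obtain k where k: "k \<in> K" "c = f k" using c by blast
      then obtain s where s: "s \<in> S" "E k s" using no by blast
      then have "F (f k) (f s)" using adj[of k s] k KV S(1) by blast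
      then show ?thesis using k s(1) by blast
    qed
    ultimately show False using F.cisD[OF cis, of "f ` K" "f ` S"] K(2) by blast
  qed
qed

lemma CIS_isomorphic:
  assumes G: "pair_graph G" "pverts G \<noteq> {}" and H: "pair_graph H" "CIS H" and iso: "isomorphic G H"
  shows "CIS G"
proof -
  interpret G: pair_graph G by fact
  interpret H: pair_graph H by fact
  obtain f where f: "bij_betw f (pverts G) (pverts H)"
    "\<forall>u\<in>pverts G. \<forall>v\<in>pverts G. (f u, f v) \<in> parcs H \<longleftrightarrow> (u, v) \<in> parcs G"
    using iso isomorphic_iff[OF G.pair_wf_digraph_axioms H.pair_wf_digraph_axioms] by blast
  have ne: "pverts H \<noteq> {}" using f(1) G(2) by (auto simp: bij_betw_def)
  have "simple_graph.cis (adj G) (pverts G)"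
    by (rule cis_transfer[OF simple_graph_adj[OF G(1)] simple_graph_adj[OF H(1)] f(1)])
      (use f(2) CIS_iff[OF H(1) ne] H(2) in \<open>auto simp: adj_def\<close>)
  then show ?thesis using CIS_iff[OF G] by blast
qed

section \<open>The CIS property of the listed graphs\<close>

lemma multipartite_cis:
  assumes "simple_graph E" and tr: "\<And>x y z. x \<in> V \<Longrightarrow> y \<in> V \<Longrightarrow> z \<in> V \<Longrightarrow> \<not> E x y \<Longrightarrow> \<not> E y z \<Longrightarrow> \<not> E x z"
  shows "simple_graph.cis E V"
proof -
  interpret simple_graph E by fact
  show ?thesis
    unfolding cis_def
  proof (intro allI impI)
    fix K S assume K: "mcl V K" "K \<noteq> {}" and S: "S \<subseteq> V" "st S"
    show "\<exists>c\<in>K. \<forall>s\<in>S. \<not> E c s"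
    proof (cases "S = {}")
      case True
      then show ?thesis using K(2) by blast
    next
      case False
      then obtain s where s: "s \<in> S" by blast
      \<comment> \<open>All of \<open>S\<close> lies in the class of \<open>s\<close>, and by
        maximality \<open>K\<close> has a vertex in this class too.\<close>
      have "\<exists>u\<in>K. \<not> E u s"
      proof (cases "s \<in> K")
        case True
        then show ?thesis using irrefl by blast
      next
        case False
        then show ?thesis using K(1) s S(1) by (auto simp: mcl_def)
      qed
      then obtain u where u: "u \<in> K" "\<not> E u s" by blast
      have "\<not> E u s'" if "s' \<in> S" for s'
        using tr[of u s s'] u mcl_sub[OF K(1) u(1)] S s that by (auto simp: st_def)
      then show ?thesis using u(1) by blast
    qed
  qed
qed

lemma multipartite_CIS:
  assumes "pair_graph G" "pverts G \<noteq> {}"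
    and "\<And>x y z. x \<in> pverts G \<Longrightarrow> y \<in> pverts G \<Longrightarrow> z \<in> pverts G \<Longrightarrow> (x, z) \<in> parcs G \<Longrightarrow> (x, y) \<in> parcs G \<or> (y, z) \<in> parcs G"
  shows "CIS G"
  unfolding CIS_iff[OF assms(1,2)]
  by (rule multipartite_cis[OF simple_graph_adj[OF assms(1)]]) (use assms(3) in \<open>auto simp: adj_def\<close>)

text \<open>A maximal clique projects onto a maximal clique of \<open>G\<close> and has maximal
  cliques of \<open>H\<close> as fibres; a stable set projects onto a stable set and has stable
  fibres. An undominated vertex in the projection, followed by an undominated one in its fibre,
  gives the required vertex.\<close>

lemma lex_product_CIS:
  assumes G: "pair_graph G" "pverts G \<noteq> {}" "CIS G" and H: "pair_graph H" "pverts H \<noteq> {}" "CIS H"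
  shows "CIS (lex_product G H)"
proof -
  interpret G: simple_graph "adj G" using simple_graph_adj[OF G(1)] .
  interpret H: simple_graph "adj H" using simple_graph_adj[OF H(1)] .
  let ?L = "lex_product G H"
  have L: "pair_graph ?L" using pair_graph_lex_product[OF G(1) H(1)] .
  interpret L: simple_graph "adj ?L" using simple_graph_adj[OF L] .
  have cG: "G.cis (pverts G)" and cH: "H.cis (pverts H)" using CIS_iff[OF G(1,2)] CIS_iff[OF H(1,2)] G(3) H(3) by auto
  have LV: "pverts ?L = pverts G \<times> pverts H" by (simp add: lex_product_def)
  have LA: "adj ?L (u, x) (v, y) \<longleftrightarrow> adj G u v \<or> u = v \<and> adj H x y"
    if "u \<in> pverts G" "v \<in> pverts G" "x \<in> pverts H" "y \<in> pverts H" for u x v y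
    using that by (auto simp: lex_product_def adj_def)
  have "L.cis (pverts ?L)"
    unfolding L.cis_def LV
  proof (intro allI impI)
    fix K S assume K: "L.mcl (pverts G \<times> pverts H) K" "K \<noteq> {}" and S: "S \<subseteq> pverts G \<times> pverts H" "L.st S"
    have KV: "u \<in> pverts G \<and> x \<in> pverts H" if "(u, x) \<in> K" for u x using L.mcl_sub[OF K(1) that] by auto
    have SV: "u \<in> pverts G \<and> x \<in> pverts H" if "(u, x) \<in> S" for u x using S(1) that by auto
    obtain y0 where y0: "y0 \<in> pverts H" using H(2) by blast
    have Kadj: "adj G u v" if "(u, x) \<in> K" "(v, y) \<in> K" "u \<noteq> v" for u x v y
      using L.mcl_adj[OF K(1) that(1,2)] LA KV[OF that(1)] KV[OF that(2)] that(3) by auto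
    have K1: "G.mcl (pverts G) (fst ` K)"
      unfolding G.mcl_def
    proof (intro conjI ballI)
      show "fst ` K \<subseteq> pverts G" using KV by auto
      show "G.cl (fst ` K)" using Kadj by (auto simp: G.cl_def)
      fix v assume v: "v \<in> pverts G - fst ` K"
      show "\<exists>u\<in>fst ` K. \<not> adj G u v"
      proof (rule ccontr)
        assume no: "\<not> ?thesis"
        have "(v, y0) \<in> K"
        proof (rule L.mcl_max[OF K(1)])
          show "(v, y0) \<in> pverts G \<times> pverts H" using v y0 by simp
          fix p assume p: "p \<in> K" "p \<noteq> (v, y0)"
          obtain u x where ux: "p = (u, x)" by (cases p)
          then have "adj G v u" using no p(1) G.sym[of u v] by force
          then show "adj ?L (v, y0) p" using LA v y0 KV p(1) ux by auto
        qed
        then show False using v by force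
      qed
    qed
    have S1: "G.st (fst ` S)"
      unfolding G.st_def
    proof (intro ballI notI)
      fix u v assume "u \<in> fst ` S" "v \<in> fst ` S" and uv: "adj G u v"
      then obtain x y where xy: "(u, x) \<in> S" "(v, y) \<in> S" by auto
      then have "adj ?L (u, x) (v, y)" using LA SV uv by auto
      then show False using S(2) xy by (auto simp: L.st_def)
    qed
    have "fst ` S \<subseteq> pverts G" using SV by auto
    then obtain u where u: "u \<in> fst ` K" "\<forall>s\<in>fst ` S. \<not> adj G u s" using cG K1 S1 K(2) unfolding G.cis_def by blast
    have uV: "u \<in> pverts G" using u(1) KV by auto
    have K2: "H.mcl (pverts H) {x. (u, x) \<in> K}"
      unfolding H.mcl_def
    proof (intro conjI ballI)
      show "{x. (u, x) \<in> K} \<subseteq> pverts H" using KV by auto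
      have "adj H x y" if "(u, x) \<in> K" "(u, y) \<in> K" "x \<noteq> y" for x y
        using L.mcl_adj[OF K(1) that(1,2)] that(3) LA[of u u x y] KV[OF that(1)] KV[OF that(2)] G.irrefl by auto
      then show "H.cl {x. (u, x) \<in> K}" by (auto simp: H.cl_def)
      fix x assume x: "x \<in> pverts H - {x. (u, x) \<in> K}"
      show "\<exists>y\<in>{x. (u, x) \<in> K}. \<not> adj H y x"
      proof (rule ccontr)
        assume no: "\<not> ?thesis"
        have "(u, x) \<in> K"
        proof (rule L.mcl_max[OF K(1)])
          show "(u, x) \<in> pverts G \<times> pverts H" using x uV by simp
          fix p assume p: "p \<in> K" "p \<noteq> (u, x)"
          obtain v y where vy: "p = (v, y)" by (cases p)
          obtain x' where x': "(u, x') \<in> K" using u(1) by auto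
          have "adj G u v \<or> u = v \<and> adj H x y"
          proof (cases "u = v")
            case True
            then show ?thesis using no p(1) vy H.sym[of y x] by auto
          next
            case False
            then show ?thesis using Kadj[OF x', of v y] p(1) vy by simp
          qed
          then show "adj ?L (u, x) p" using LA KV p(1) vy x uV by auto
        qed
        then show False using x by simp
      qed
    qed
    have S2: "H.st {x. (u, x) \<in> S}"
      unfolding H.st_def
    proof (intro ballI notI)
      fix x y assume "x \<in> {x. (u, x) \<in> S}" "y \<in> {x. (u, x) \<in> S}" and e: "adj H x y"
      then have xy: "(u, x) \<in> S" "(u, y) \<in> S" by auto
      then have "adj ?L (u, x) (u, y)" using LA SV e by auto
      then show False using S(2) xy by (auto simp: L.st_def)
    qed
    have "{x. (u, x) \<in> S} \<subseteq> pverts H" "{x. (u, x) \<in> K} \<noteq> {}" using SV u(1) by auto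
    then have "\<exists>c\<in>{x. (u, x) \<in> K}. \<forall>s\<in>{x. (u, x) \<in> S}. \<not> adj H c s"
      using cH[unfolded H.cis_def, rule_format, OF K2 _ _ S2] by simp
    then obtain c where c: "(u, c) \<in> K" "\<forall>x. (u, x) \<in> S \<longrightarrow> \<not> adj H c x" by auto
    have "\<not> adj ?L (u, c) s" if s: "s \<in> S" for s
    proof -
      obtain v y where vy: "s = (v, y)" by (cases s)
      have "\<not> adj G u v" using u(2) s vy by force
      moreover have "\<not> (u = v \<and> adj H c y)" using c(2) s vy by auto
      moreover have "adj ?L (u, c) (v, y) \<longleftrightarrow> adj G u v \<or> u = v \<and> adj H c y"
        by (rule LA) (use vy SV[of v y] KV[OF c(1)] s in simp_all)
      ultimately show ?thesis using vy by simp
    qed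
    then show "\<exists>c\<in>K. \<forall>s\<in>S. \<not> adj ?L c s" using c(1) by blast
  qed
  then show ?thesis using CIS_iff[OF L] G(2) H(2) by (simp add: LV)
qed

definition rook_graph :: "nat \<Rightarrow> (nat \<times> nat) pair_pre_digraph" where
  "rook_graph k = \<lparr> pverts = {..<k} \<times> {..<k},
     parcs = {((i, j), (i', j')). i < k \<and> j < k \<and> i' < k \<and> j' < k \<and> (i, j) \<noteq> (i', j') \<and> (i = i' \<or> j = j')} \<rparr>"

lemma pair_graph_rook_graph: "pair_graph (rook_graph k)"
  by (rule pair_graphI) (auto simp: rook_graph_def)

text \<open>The maximal cliques are the rows and columns, and a stable set has at most one cell in
  each. If it misses a row it has fewer than \<open>k\<close> cells and misses a column too; the
  cell where they cross has no neighbour in it.\<close>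

lemma rook_CIS:
  assumes "0 < k" shows "CIS (rook_graph k)"
proof -
  interpret simple_graph "adj (rook_graph k)" using simple_graph_adj[OF pair_graph_rook_graph] .
  let ?V = "pverts (rook_graph k)"
  have V: "?V = {..<k} \<times> {..<k}" by (simp add: rook_graph_def)
  have A: "adj (rook_graph k) (i, j) (i', j') \<longleftrightarrow> (i, j) \<noteq> (i', j') \<and> (i = i' \<or> j = j')"
    if "(i, j) \<in> ?V" "(i', j') \<in> ?V" for i j i' j' using that unfolding adj_def by (auto simp: rook_graph_def)
  have pigeon: "\<exists>j<k. \<forall>i<k. \<not> P i j" if P: "\<And>i j j'. P i j \<Longrightarrow> P i j' \<Longrightarrow> j = j'" and a: "a < k" "\<And>j. \<not> P a j" for P a
  proof (rule ccontr)
    assume "\<not> ?thesis"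
    then have "\<forall>j<k. \<exists>i<k. P i j" by blast
    then obtain g where g: "\<forall>j<k. g j < k \<and> P (g j) j" by metis
    have "inj_on g {..<k}" using g P by (intro inj_onI) (metis lessThan_iff)
    moreover have "g ` {..<k} \<subseteq> {..<k} - {a}" using g a(2) by auto
    ultimately have "card {..<k} \<le> card ({..<k} - {a})" by (intro card_inj_on_le) auto
    then show False using a(1) by simp
  qed
  have "cis ?V"
    unfolding cis_def
  proof (intro allI impI)
    fix K S assume K: "mcl ?V K" "K \<noteq> {}" and S: "S \<subseteq> ?V" "st S"
    obtain a b where ab: "(a, b) \<in> K" using K(2) by auto
    have KV: "p \<in> ?V" if "p \<in> K" for p using mcl_sub[OF K(1) that] .
    have abk: "a < k" "b < k" using KV[OF ab] V by auto
    have Kadj: "i = i' \<or> j = j'" if "(i, j) \<in> K" "(i', j') \<in> K" for i j i' j'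
      using mcl_adj[OF K(1) that] A[OF KV[OF that(1)] KV[OF that(2)]] by auto
    have SV: "i < k \<and> j < k" if "(i, j) \<in> S" for i j using S(1) that V by auto
    have Snon: "i = i' \<and> j = j'" if "(i, j) \<in> S" "(i', j') \<in> S" "i = i' \<or> j = j'" for i j i' j'
      using S that A[of i j i' j'] unfolding st_def by blast
    have "(\<forall>p\<in>K. fst p = a) \<or> (\<forall>p\<in>K. snd p = b)"
    proof (rule ccontr)
      assume "\<not> ?thesis"
      then obtain i j i' j' where "(i, j) \<in> K" "i \<noteq> a" "(i', j') \<in> K" "j' \<noteq> b" by force
      then show False using Kadj[of i j a b] Kadj[of i' j' a b] Kadj[of i j i' j'] ab by auto
    qed
    then show "\<exists>c\<in>K. \<forall>s\<in>S. \<not> adj (rook_graph k) c s"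
    proof
      assume row: "\<forall>p\<in>K. fst p = a"
      have inK: "(a, j) \<in> K" if "j < k" for j
      proof (rule mcl_max[OF K(1)])
        show "(a, j) \<in> ?V" using abk that V by simp
        fix u assume "u \<in> K" "u \<noteq> (a, j)"
        then show "adj (rook_graph k) (a, j) u" using row KV[of u] A[of a j "fst u" "snd u"] abk that V by (cases u) auto
      qed
      show ?thesis
      proof (cases "\<exists>j. (a, j) \<in> S")
        case True
        then show ?thesis using inK SV S(2) unfolding st_def by blast
      next
        case False
        have "\<exists>j<k. \<forall>i<k. (i, j) \<notin> S" using pigeon[of "\<lambda>i j. (i, j) \<in> S" a] Snon abk False by blast
        then obtain j where j: "j < k" "\<forall>i<k. (i, j) \<notin> S" by blast
        have "\<not> adj (rook_graph k) (a, j) s" if s: "s \<in> S" for s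
          using A[of a j "fst s" "snd s"] s S(1) SV[of "fst s" "snd s"] abk j False V by (cases s) auto
        then show ?thesis using inK[OF j(1)] by blast
      qed
    next
      assume col: "\<forall>p\<in>K. snd p = b"
      have inK: "(i, b) \<in> K" if "i < k" for i
      proof (rule mcl_max[OF K(1)])
        show "(i, b) \<in> ?V" using abk that V by simp
        fix u assume "u \<in> K" "u \<noteq> (i, b)"
        then show "adj (rook_graph k) (i, b) u" using col KV[of u] A[of i b "fst u" "snd u"] abk that V by (cases u) auto
      qed
      show ?thesis
      proof (cases "\<exists>i. (i, b) \<in> S")
        case True
        then show ?thesis using inK SV S(2) unfolding st_def by blast
      next
        case False
        have "\<exists>i<k. \<forall>j<k. (i, j) \<notin> S" using pigeon[of "\<lambda>j i. (i, j) \<in> S" b] Snon abk False by blast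
        then obtain i where i: "i < k" "\<forall>j<k. (i, j) \<notin> S" by blast
        have "\<not> adj (rook_graph k) (i, b) s" if s: "s \<in> S" for s
          using A[of i b "fst s" "snd s"] s S(1) SV[of "fst s" "snd s"] abk i False V by (cases s) auto
        then show ?thesis using inK[OF i(1)] by blast
      qed
    qed
  qed
  moreover have "?V \<noteq> {}" using assms by (auto simp: V)
  ultimately show ?thesis using CIS_iff[OF pair_graph_rook_graph] by blast
qed

text \<open>A maximal clique is a block, or it consists of all \<open>(i, x, y)\<close> and
  \<open>(i + 1, y, z)\<close> for fixed \<open>i\<close> and \<open>y\<close>. A stable set has at
  most one vertex in each block, so one neighbouring block alone cannot dominate both halves facing
  it. For a block, the halves missed from either side intersect. In the other case the stable set
  must have a vertex in each of the two blocks outside the clique, and with only two residues these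
  are adjacent.\<close>

lemma Q_CIS:
  assumes n: "4 \<le> n" shows "CIS (Q_graph n)"
proof -
  have G: "pair_graph (Q_graph n)" using pair_graph_Q_graph n by simp
  interpret simple_graph "adj (Q_graph n)" using simple_graph_adj[OF G] .
  let ?V = "pverts (Q_graph n)"
  let ?E = "adj (Q_graph n)"
  have V: "?V = {0..<n} \<times> {0..<2} \<times> {0..<2}" by (simp add: Q_graph_def Let_def)
  define s where "s i = (i + 1) mod n" for i
  have sn: "s i < n" for i using n by (simp add: s_def)
  have sinj: "i = j" if "s i = s j" "i < n" "j < n" for i j using that n by (auto simp: s_def mod_Suc split: if_splits)
  \<comment> \<open>Three steps do not close up because \<open>n \<ge> 4\<close>; hence no clique
    meets three consecutive blocks.\<close>
  have s1: "s i \<noteq> i" "s (s i) \<noteq> i" "s (s (s i)) \<noteq> i" if "i < n" for i using that n by (auto simp: s_def mod_Suc)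
  have A: "?E (i, x, y) (j, x', y') \<longleftrightarrow> (j = s i \<and> x' = y) \<or> (i = s j \<and> x = y') \<or> (i = j \<and> (x, y) \<noteq> (x', y'))"
    if "(i, x, y) \<in> ?V" "(j, x', y') \<in> ?V" for i x y j x' y'
    unfolding adj_def s_def by (rule Q_arc_iff) (use that V in auto)
  have AD: "(j = s i \<and> x' = y) \<or> (i = s j \<and> x = y') \<or> (i = j \<and> (x, y) \<noteq> (x', y'))"
    if "?E (i, x, y) (j, x', y')" for i x y j x' y'
    using A[of i x y j x' y'] adj_verts[OF G that] that by blast
  have "cis ?V"
    unfolding cis_def
  proof (intro allI impI, rule ccontr)
    fix K S assume K: "mcl ?V K" "K \<noteq> {}" and S: "S \<subseteq> ?V" "st S" and no: "\<not> (\<exists>c\<in>K. \<forall>t\<in>S. \<not> ?E c t)"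
    have dom: "\<exists>t\<in>S. ?E c t" if "c \<in> K" for c using no that by blast
    have KS: "c \<notin> S" if "c \<in> K" for c using dom[OF that] S(2) by (auto simp: st_def)
    have KV: "p \<in> ?V" if "p \<in> K" for p using mcl_sub[OF K(1) that] .
    have SV: "p \<in> ?V" if "p \<in> S" for p using S(1) that by blast
    have Sblock: "(x, y) = (x', y')" if "(i, x, y) \<in> S" "(i, x', y') \<in> S" for i x y x' y'
      using A[OF SV[OF that(1)] SV[OF that(2)]] S(2) that unfolding st_def by blast
    have Snext: "x' \<noteq> y" if "(i, x, y) \<in> S" "(s i, x', y') \<in> S" for i x y x' y'
      using A[OF SV[OF that(1)] SV[OF that(2)]] S(2) that unfolding st_def by blast
    have V2: "i < n" "x < 2" "y < 2" if "(i, x, y) \<in> ?V" for i x y using that V by auto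
    have below: False
      if i: "i < n" "\<And>x. x < 2 \<Longrightarrow> \<exists>j w. (j, w, x) \<in> S \<and> s j = i" for i
    proof -
      obtain j w where j: "(j, w, 0) \<in> S" "s j = i" using i(2)[of 0] by auto
      obtain j' w' where j': "(j', w', 1) \<in> S" "s j' = i" using i(2)[of 1] by auto
      have "j = j'" using sinj[of j j'] j j' V2(1)[OF SV[OF j(1)]] V2(1)[OF SV[OF j'(1)]] by simp
      then show False using Sblock[of j w 0 w' 1] j j' by simp
    qed
    have above: False
      if z: "\<And>z. z < 2 \<Longrightarrow> \<exists>w. (i, z, w) \<in> S" for i
    proof -
      obtain w w' where "(i, 0, w) \<in> S" "(i, 1, w') \<in> S" using z[of 0] z[of 1] by auto
      then show False using Sblock[of i 0 w 1 w'] by simp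
    qed
    show False
    proof (cases "\<exists>i x y z. (i, x, y) \<in> K \<and> (s i, y, z) \<in> K")
      case True
      then obtain i x0 y z0 where iy: "(i, x0, y) \<in> K" "(s i, y, z0) \<in> K" by blast
      have i: "i < n" "y < 2" using V2[OF KV[OF iy(1)]] by auto
      have Kform: "(j = i \<and> q = y) \<or> (j = s i \<and> p = y)" if w: "(j, p, q) \<in> K" for j p q
      proof (cases "(j, p, q) = (i, x0, y) \<or> (j, p, q) = (s i, y, z0)")
        case False
        then have "?E (i, x0, y) (j, p, q)" "?E (s i, y, z0) (j, p, q)" using mcl_adj[OF K(1) iy(1) w] mcl_adj[OF K(1) iy(2) w] by auto
        from AD[OF this(1)] AD[OF this(2)] show ?thesis
          using s1[OF i(1)] s1[OF sn[of i]] sinj[of j i] sinj[of i j] i(1) V2(1)[OF KV[OF w]] by auto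
      qed auto
      have L1: "(i, x, y) \<in> K" if "x < 2" for x
      proof (rule mcl_max[OF K(1)])
        show m: "(i, x, y) \<in> ?V" using i that V by simp
        fix u assume u: "u \<in> K" "u \<noteq> (i, x, y)"
        obtain j p q where jp: "u = (j, p, q)" by (cases u)
        show "?E (i, x, y) u" using Kform[of j p q] u A[OF m, of j p q] KV[OF u(1)] jp by auto
      qed
      have L2: "(s i, y, z) \<in> K" if "z < 2" for z
      proof (rule mcl_max[OF K(1)])
        show m: "(s i, y, z) \<in> ?V" using sn i that V by simp
        fix u assume u: "u \<in> K" "u \<noteq> (s i, y, z)"
        obtain j p q where jp: "u = (j, p, q)" by (cases u)
        show "?E (s i, y, z) u" using Kform[of j p q] u A[OF m, of j p q] KV[OF u(1)] jp by auto
      qed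
      have 1: "\<exists>x' y'. (i, x', y') \<in> S \<and> y' \<noteq> y"
      proof (rule ccontr)
        assume no1: "\<not> ?thesis"
        have "\<exists>j w. (j, w, x) \<in> S \<and> s j = i" if x: "x < 2" for x
        proof -
          obtain t where t: "t \<in> S" "?E (i, x, y) t" using dom[OF L1[OF x]] by blast
          obtain j p q where jp: "t = (j, p, q)" by (cases t)
          have tS: "(j, p, q) \<in> S" using t jp by simp
          have q2: "q < 2" "p < 2" using V2[OF SV[OF tS]] by auto
          from AD[of i x y j p q] t(2) jp have "(j = s i \<and> p = y) \<or> (i = s j \<and> x = q) \<or> i = j" by auto
          moreover have "\<not> (j = s i \<and> p = y)" using KS[OF L2[OF q2(1)]] tS by auto
          moreover have "i \<noteq> j"
          proof
            assume "i = j"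
            then have "q = y" using no1 tS by blast
            then show False using KS[OF L1[OF q2(2)]] tS \<open>i = j\<close> by auto
          qed
          ultimately show ?thesis using tS by auto
        qed
        then show False using below[OF i(1)] by blast
      qed
      have 2: "\<exists>y' z'. (s i, y', z') \<in> S \<and> y' \<noteq> y"
      proof (rule ccontr)
        assume no1: "\<not> ?thesis"
        have "\<exists>w. (s (s i), z, w) \<in> S" if z: "z < 2" for z
        proof -
          obtain t where t: "t \<in> S" "?E (s i, y, z) t" using dom[OF L2[OF z]] by blast
          obtain j p q where jp: "t = (j, p, q)" by (cases t)
          have tS: "(j, p, q) \<in> S" using t jp by simp
          have q2: "q < 2" "p < 2" and jn: "j < n" using V2[OF SV[OF tS]] by auto
          from AD[of "s i" y z j p q] t(2) jp have "(j = s (s i) \<and> p = z) \<or> (s i = s j \<and> y = q) \<or> s i = j" by auto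
          moreover have "\<not> (s i = s j \<and> y = q)" using KS[OF L1[OF q2(2)]] tS sinj[of i j] i(1) jn by auto
          moreover have "s i \<noteq> j"
          proof
            assume "s i = j"
            then have "p = y" using no1 tS by blast
            then show False using KS[OF L2[OF q2(1)]] tS \<open>s i = j\<close> by auto
          qed
          ultimately show ?thesis using tS by auto
        qed
        then show False using above by blast
      qed
      obtain x' y' where a: "(i, x', y') \<in> S" "y' \<noteq> y" using 1 by blast
      obtain y'' z' where b: "(s i, y'', z') \<in> S" "y'' \<noteq> y" using 2 by blast
      have "y' < 2" "y'' < 2" using V2[OF SV[OF a(1)]] V2[OF SV[OF b(1)]] by auto
      then have "y'' = y'" using a(2) b(2) i(2) by linarith
      then show False using Snext[OF a(1) b(1)] by simp
    next
      case False
      obtain i x0 y0 where i0: "(i, x0, y0) \<in> K" using K(2) by auto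
      have i: "i < n" using V2(1)[OF KV[OF i0]] .
      have Kform: "j = i" if w: "(j, p, q) \<in> K" for j p q
      proof (cases "(j, p, q) = (i, x0, y0)")
        case False
        then have "?E (i, x0, y0) (j, p, q)" using mcl_adj[OF K(1) i0 w] by auto
        from AD[OF this] show ?thesis using \<open>\<not> (\<exists>i x y z. (i, x, y) \<in> K \<and> (s i, y, z) \<in> K)\<close> i0 w by blast
      qed simp
      have L: "(i, x, y) \<in> K" if "x < 2" "y < 2" for x y
      proof (rule mcl_max[OF K(1)])
        show m: "(i, x, y) \<in> ?V" using i that V by simp
        fix u assume u: "u \<in> K" "u \<noteq> (i, x, y)"
        obtain j p q where jp: "u = (j, p, q)" by (cases u)
        show "?E (i, x, y) u" using Kform[of j p q] u A[OF m, of j p q] KV[OF u(1)] jp by auto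
      qed
      have D: "(\<exists>z. (s i, y, z) \<in> S) \<or> (\<exists>j w. (j, w, x) \<in> S \<and> s j = i)" if xy: "x < 2" "y < 2" for x y
      proof -
        obtain t where t: "t \<in> S" "?E (i, x, y) t" using dom[OF L[OF xy]] by blast
        obtain j p q where jp: "t = (j, p, q)" by (cases t)
        have tS: "(j, p, q) \<in> S" using t jp by simp
        have "p < 2" "q < 2" using V2[OF SV[OF tS]] by auto
        then have "i \<noteq> j" using KS[OF L[of p q]] tS by auto
        then show ?thesis using AD[of i x y j p q] t(2) jp tS by auto
      qed
      have "\<exists>y<2. \<not> (\<exists>z. (s i, y, z) \<in> S)" using above[of "s i"] by blast
      then obtain y where y: "y < 2" "\<not> (\<exists>z. (s i, y, z) \<in> S)" by blast
      then show False using below[OF i] D by blast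
    qed
  qed
  moreover have "?V \<noteq> {}" using n by (auto simp: V)
  ultimately show ?thesis using CIS_iff[OF G] by blast
qed

section \<open>Coordinates and isomorphisms\<close>

lemma isomorphicI:
  assumes "pair_graph G" "pair_graph H" "bij_betw f (pverts G) (pverts H)"
    and "\<And>u v. u \<in> pverts G \<Longrightarrow> v \<in> pverts G \<Longrightarrow> (f u, f v) \<in> parcs H \<longleftrightarrow> (u, v) \<in> parcs G"
  shows "isomorphic G H"
proof -
  interpret G: pair_graph G by fact
  interpret H: pair_graph H by fact
  show ?thesis using isomorphic_iff[OF G.pair_wf_digraph_axioms H.pair_wf_digraph_axioms] assms(3,4) by blast
qed

lemma isomorphicE:
  assumes "isomorphic G H" "pair_graph G" "pair_graph H"
  obtains f where "bij_betw f (pverts G) (pverts H)"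
    "\<And>u v. u \<in> pverts G \<Longrightarrow> v \<in> pverts G \<Longrightarrow> (f u, f v) \<in> parcs H \<longleftrightarrow> (u, v) \<in> parcs G"
proof -
  interpret G: pair_graph G by fact
  interpret H: pair_graph H by fact
  show ?thesis using isomorphic_iff[OF G.pair_wf_digraph_axioms H.pair_wf_digraph_axioms] assms(1) that by blast
qed

lemma isomorphic_sym:
  assumes "isomorphic G H" "pair_graph G" "pair_graph H" shows "isomorphic H G"
proof -
  obtain f where f: "bij_betw f (pverts G) (pverts H)"
    "\<And>u v. u \<in> pverts G \<Longrightarrow> v \<in> pverts G \<Longrightarrow> (f u, f v) \<in> parcs H \<longleftrightarrow> (u, v) \<in> parcs G"
    using isomorphicE[OF assms] by blast
  let ?g = "inv_into (pverts G) f"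
  have g: "bij_betw ?g (pverts H) (pverts G)" using bij_betw_inv_into[OF f(1)] .
  show ?thesis
  proof (rule isomorphicI[OF assms(3,2) g])
    fix u v assume "u \<in> pverts H" "v \<in> pverts H"
    then have "f (?g u) = u" "f (?g v) = v" "?g u \<in> pverts G" "?g v \<in> pverts G"
      using bij_betw_inv_into_right[OF f(1)] g by (auto simp: bij_betw_def)
    then show "(?g u, ?g v) \<in> parcs G \<longleftrightarrow> (u, v) \<in> parcs H" using f(2)[of "?g u" "?g v"] by simp
  qed
qed

lemma isomorphic_trans:
  assumes "isomorphic G H" "isomorphic H K" "pair_graph G" "pair_graph H" "pair_graph K" shows "isomorphic G K"
proof -
  obtain f where f: "bij_betw f (pverts G) (pverts H)"
    "\<And>u v. u \<in> pverts G \<Longrightarrow> v \<in> pverts G \<Longrightarrow> (f u, f v) \<in> parcs H \<longleftrightarrow> (u, v) \<in> parcs G"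
    using isomorphicE[OF assms(1,3,4)] by blast
  obtain g where g: "bij_betw g (pverts H) (pverts K)"
    "\<And>u v. u \<in> pverts H \<Longrightarrow> v \<in> pverts H \<Longrightarrow> (g u, g v) \<in> parcs K \<longleftrightarrow> (u, v) \<in> parcs H"
    using isomorphicE[OF assms(2,4,5)] by blast
  have "f u \<in> pverts H" if "u \<in> pverts G" for u using f(1) that by (auto simp: bij_betw_def)
  then show ?thesis using f(2) g(2)
    by (intro isomorphicI[OF assms(3,5) bij_betw_trans[OF f(1) g(1)]]) simp
qed

lemma pair_graph_complete_graph: "pair_graph (complete_graph n)"
  by (rule pair_graphI) (auto simp: complete_graph_def)

lemma pair_graph_complete_bipartite_graph: "pair_graph (complete_bipartite_graph m n)"
  by (rule pair_graphI) (auto simp: complete_bipartite_graph_def)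

lemma CIS_complete_graph: "1 \<le> n \<Longrightarrow> CIS (complete_graph n)"
  by (rule multipartite_CIS[OF pair_graph_complete_graph]) (auto simp: complete_graph_def)

lemma CIS_complete_bipartite_graph: "1 \<le> n \<Longrightarrow> CIS (complete_bipartite_graph n n)"
  by (rule multipartite_CIS[OF pair_graph_complete_bipartite_graph]) (auto simp: complete_bipartite_graph_def)

lemma CIS_edgeless: "1 \<le> n \<Longrightarrow> CIS (complement_graph (complete_graph n))"
  by (rule multipartite_CIS[OF pair_graph_complement_graph[OF pair_graph_complete_graph]])
    (auto simp: complete_graph_def complement_graph_def)

lemma CIS_cycle_4: "CIS (cycle_graph 4)"
proof (rule multipartite_CIS)
  show "pair_graph (cycle_graph 4)" by (rule pair_graph_cycle_graph) simp
  have four: "i < 4 \<longleftrightarrow> i = 0 \<or> i = 1 \<or> i = 2 \<or> i = 3" for i :: nat by auto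
  show "(x, y) \<in> parcs (cycle_graph 4) \<or> (y, z) \<in> parcs (cycle_graph 4)"
    if "x \<in> pverts (cycle_graph 4)" "y \<in> pverts (cycle_graph 4)" "z \<in> pverts (cycle_graph 4)" "(x, z) \<in> parcs (cycle_graph 4)" for x y z
    using that unfolding cycle_graph_def by (simp add: four) (elim disjE; simp)
qed (simp add: cycle_graph_def)

lemma line_graph_complete_bipartite:
  "pverts (line_graph (complete_bipartite_graph k k)) = (\<lambda>(i, j). {Inl i, Inr j}) ` ({..<k} \<times> {..<k})"
  "parcs (line_graph (complete_bipartite_graph k k)) =
    {(e, f). e \<in> pverts (line_graph (complete_bipartite_graph k k)) \<and> f \<in> pverts (line_graph (complete_bipartite_graph k k)) \<and> e \<noteq> f \<and> e \<inter> f \<noteq> {}}"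
proof -
  have "{{u, v} |u v. (u, v) \<in> parcs (complete_bipartite_graph k k)} = (\<lambda>(i, j). {Inl i, Inr j}) ` ({..<k} \<times> {..<k})"
    (is "?L = ?R")
  proof (intro equalityI subsetI)
    fix e assume "e \<in> ?L"
    then obtain u v where "e = {u, v}" "(u, v) \<in> parcs (complete_bipartite_graph k k)" by blast
    then show "e \<in> ?R" by (fastforce simp: complete_bipartite_graph_def image_iff doubleton_eq_iff)
  next
    fix e assume "e \<in> ?R"
    then obtain i j where "e = {Inl i, Inr j}" "i < k" "j < k" by auto
    moreover from this have "(Inl i, Inr j) \<in> parcs (complete_bipartite_graph k k)"
      by (simp add: complete_bipartite_graph_def)
    ultimately show "e \<in> ?L" by blast
  qed
  then show "pverts (line_graph (complete_bipartite_graph k k)) = ?R"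
    "parcs (line_graph (complete_bipartite_graph k k)) =
    {(e, f). e \<in> pverts (line_graph (complete_bipartite_graph k k)) \<and> f \<in> pverts (line_graph (complete_bipartite_graph k k)) \<and> e \<noteq> f \<and> e \<inter> f \<noteq> {}}"
    by (simp_all add: line_graph_def Let_def)
qed

lemma rook_isomorphic_line_graph: "isomorphic (rook_graph k) (line_graph (complete_bipartite_graph k k))"
proof (rule isomorphicI[OF pair_graph_rook_graph pair_graph_line_graph[OF pair_graph_complete_bipartite_graph]])
  let ?f = "\<lambda>(i, j). {Inl i, Inr j} :: (nat + nat) set"
  have inj: "inj ?f" by (auto simp: inj_def doubleton_eq_iff)
  show "bij_betw ?f (pverts (rook_graph k)) (pverts (line_graph (complete_bipartite_graph k k)))"
    unfolding bij_betw_def line_graph_complete_bipartite using inj_on_subset[OF inj] by (simp add: rook_graph_def)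
  fix u v assume "u \<in> pverts (rook_graph k)" "v \<in> pverts (rook_graph k)"
  then show "(?f u, ?f v) \<in> parcs (line_graph (complete_bipartite_graph k k)) \<longleftrightarrow> (u, v) \<in> parcs (rook_graph k)"
    unfolding line_graph_complete_bipartite by (cases u; cases v) (auto simp: rook_graph_def doubleton_eq_iff)
qed

lemma CIS_line_graph: "1 \<le> k \<Longrightarrow> CIS (line_graph (complete_bipartite_graph k k))"
  using CIS_isomorphic[OF pair_graph_line_graph[OF pair_graph_complete_bipartite_graph] _ pair_graph_rook_graph rook_CIS
      isomorphic_sym[OF rook_isomorphic_line_graph pair_graph_rook_graph pair_graph_line_graph[OF pair_graph_complete_bipartite_graph]]]
  by (auto simp: line_graph_complete_bipartite(1) lessThan_empty_iff)

lemma card_fibres: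
  assumes "finite V" and "\<And>u. u \<in> V \<Longrightarrow> card {v \<in> V. c v = c u} = p"
  shows "card V = card (c ` V) * p"
proof -
  have "card V = (\<Sum>y\<in>c ` V. card {v \<in> V. c v = y})"
    using sum.image_gen[OF assms(1), of "\<lambda>_. 1::nat" c] by simp
  also have "\<dots> = (\<Sum>y\<in>c ` V. p)" using assms(2) by (intro sum.cong) auto
  finally show ?thesis by simp
qed

text \<open>Supplies coordinates for lexicographic products: the class first, then a numbering
  inside the class.\<close>

lemma equipartition:
  fixes c :: "'a \<Rightarrow> 'b"
  assumes fin: "finite V" and X: "finite X" "card (c ` V) = card X" and p: "\<And>u. u \<in> V \<Longrightarrow> card {v \<in> V. c v = c u} = p"
  shows "\<exists>g. bij_betw g V (X \<times> {0..<p}) \<and> (\<forall>u\<in>V. \<forall>v\<in>V. fst (g u) = fst (g v) \<longleftrightarrow> c u = c v)"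
proof -
  obtain a where a: "bij_betw a (c ` V) X" using finite_same_card_bij[of "c ` V" X] fin X by auto
  have "\<exists>b. bij_betw b {v \<in> V. c v = K} {0..<p}" if "K \<in> c ` V" for K
    using ex_bij_betw_finite_nat[of "{v \<in> V. c v = K}"] fin p that by auto
  then obtain b where b: "\<And>K. K \<in> c ` V \<Longrightarrow> bij_betw (b K) {v \<in> V. c v = K} {0..<p}" by metis
  define g where "g v = (a (c v), b (c v) v)" for v
  have ac: "a (c u) = a (c v) \<longleftrightarrow> c u = c v" if "u \<in> V" "v \<in> V" for u v
    using a that by (auto simp: bij_betw_def inj_on_def)
  have "inj_on g V"
  proof (rule inj_onI)
    fix u v assume uv: "u \<in> V" "v \<in> V" "g u = g v"
    then have "c u = c v" using ac by (simp add: g_def)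
    then show "u = v" using uv b[of "c u"] by (auto simp: g_def bij_betw_def inj_on_def)
  qed
  moreover have "g ` V = X \<times> {0..<p}"
  proof (intro equalityI subsetI)
    fix x assume "x \<in> g ` V"
    then obtain v where v: "v \<in> V" "x = g v" by blast
    have "b (c v) v \<in> {0..<p}" by (rule bij_betwE[OF b, rule_format]) (use v(1) in auto)
    moreover have "a (c v) \<in> a ` (c ` V)" using v(1) by blast
    then have "a (c v) \<in> X" using a by (simp add: bij_betw_def)
    ultimately show "x \<in> X \<times> {0..<p}" using v(2) by (simp add: g_def)
  next
    fix x assume "x \<in> X \<times> {0..<p}"
    then obtain i j where x: "x = (i, j)" "i \<in> X" "j \<in> {0..<p}" by blast
    then have "i \<in> a ` (c ` V)" using a by (simp add: bij_betw_def)
    then obtain u where u: "u \<in> V" "i = a (c u)" by blast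
    then have "j \<in> b (c u) ` {v \<in> V. c v = c u}" using b[of "c u"] x(3) by (simp add: bij_betw_def)
    then obtain v where "v \<in> V" "c v = c u" "j = b (c u) v" by blast
    then have "x = g v" using u x(1) by (simp add: g_def)
    then show "x \<in> g ` V" using \<open>v \<in> V\<close> by blast
  qed
  ultimately show ?thesis using ac by (intro exI[of _ g]) (simp add: bij_betw_def g_def)
qed

text \<open>Non-adjacency is an equivalence relation, and the class of \<open>u\<close> is the
  complement of its neighbourhood, so all classes have size \<open>card V - d\<close>. A maximal
  clique meets each class exactly once, so there are \<open>k\<close> of them.\<close>

lemma (in pure_cis_graph) multipartite:
  assumes tr: "\<forall>x y z. E x z \<longrightarrow> y \<in> V \<longrightarrow> E y x \<or> E y z"
  shows "\<exists>p g. d = (k - 1) * p \<and> bij_betw g V ({0..<k} \<times> {0..<p}) \<and>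
    (\<forall>u\<in>V. \<forall>v\<in>V. E u v \<longleftrightarrow> fst (g u) \<noteq> fst (g v))"
proof -
  have trans: "\<not> E x z" if "x \<in> V" "y \<in> V" "z \<in> V" "\<not> E x y" "\<not> E y z" for x y z
    using nonadjacency_transitive[of x y z] tr that by blast
  define c where "c u = {v \<in> V. \<not> E u v}" for u
  have c_eq: "c u = c v \<longleftrightarrow> \<not> E u v" if uv: "u \<in> V" "v \<in> V" for u v
  proof
    assume "c u = c v"
    moreover have "v \<in> c v" using uv irrefl by (simp add: c_def)
    ultimately have "v \<in> c u" by simp
    then show "\<not> E u v" by (simp add: c_def)
  next
    assume n: "\<not> E u v"
    then have n': "\<not> E v u" using sym by blast
    show "c u = c v" using trans[OF uv(2,1) _ n'] trans[OF uv _ n] by (auto simp: c_def)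
  qed
  have cls: "{v \<in> V. c v = c u} = V - N u" if "u \<in> V" for u
  proof -
    have "{v \<in> V. c v = c u} = {v \<in> V. \<not> E v u}" using c_eq[OF _ that] by (simp cong: conj_cong)
    then show ?thesis using sym_iff[of u] by auto
  qed
  define p where "p = card V - d"
  have p: "card {v \<in> V. c v = c u} = p" if "u \<in> V" for u
  proof -
    have "N u \<subseteq> V" using EV2 by auto
    then show ?thesis unfolding cls[OF that] p_def using card_N[OF that] by (simp add: card_Diff_subset)
  qed
  obtain K where K: "mcl V K" using ex_mcl[OF finV, of "{}"] by (auto simp: cl_def)
  have KV: "u \<in> V" if "u \<in> K" for u using mcl_sub[OF K that] .
  have "inj_on c K" using mcl_adj[OF K] c_eq KV by (intro inj_onI) blast
  moreover have "c ` K = c ` V"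
  proof (intro equalityI subsetI)
    fix x assume "x \<in> c ` V"
    then obtain v where v: "v \<in> V" "x = c v" by blast
    have "\<exists>u\<in>K. \<not> E u v"
    proof (cases "v \<in> K")
      case True then show ?thesis using irrefl by blast
    next
      case False then show ?thesis using K v by (auto simp: mcl_def)
    qed
    then obtain u where "u \<in> K" "\<not> E u v" by blast
    then show "x \<in> c ` K" using c_eq[of u v] KV v by auto
  qed (use KV in auto)
  moreover have "card K = k" using K pureV by (simp add: pure_def)
  ultimately have k: "card (c ` V) = k" using card_image by metis
  obtain g where g: "bij_betw g V ({0..<k} \<times> {0..<p})" "\<forall>u\<in>V. \<forall>v\<in>V. fst (g u) = fst (g v) \<longleftrightarrow> c u = c v"
    using equipartition[of V "{0..<k}" c p] finV k p by auto
  have "card V = k * p" using bij_betw_same_card[OF g(1)] by (simp add: card_cartesian_product)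
  moreover obtain v where v: "v \<in> V" using nonempty by blast
  have "N v \<subseteq> V" using EV2 by auto
  then have "d \<le> card V" using card_mono[OF finV] card_N[OF v] by metis
  ultimately have "d = (k - 1) * p" by (simp add: p_def diff_mult_distrib)
  then show ?thesis using g c_eq by blast
qed

lemma connected_closed:
  assumes G: "pair_graph G" and conn: "Digraph_Component.connected (with_proj G)"
    and A: "A \<subseteq> pverts G" "A \<noteq> {}" "\<And>u v. u \<in> A \<Longrightarrow> (u, v) \<in> parcs G \<Longrightarrow> v \<in> A"
  shows "A = pverts G"
proof -
  interpret pair_graph G by fact
  have s: "strongly_connected (with_proj G)"
    using symmetric_connected_imp_strongly_connected[OF _ conn] sym_arcs by blast
  obtain u where u: "u \<in> A" using A(2) by blast
  have "v \<in> A" if v: "v \<in> pverts G" for v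
  proof -
    have "u \<rightarrow>\<^sup>*\<^bsub>with_proj G\<^esub> v" using s u A(1) v by (auto simp: strongly_connected_def)
    then show ?thesis
      by (induction rule: reachable_induct) (use u A(3) in \<open>auto simp: arcs_ends_conv\<close>)
  qed
  then show ?thesis using A(1) by blast
qed

lemma cis_graph_adj:
  assumes G: "pair_graph G" and conn: "Digraph_Component.connected (with_proj G)"
    and vt: "vertex_transitive G" and d: "has_valency G d" and cis: "CIS G"
  shows "cis_graph (adj G) (pverts G) d"
proof -
  interpret pair_graph G by fact
  interpret simple_graph "adj G" using simple_graph_adj[OF G] .
  have ne: "pverts G \<noteq> {}" using conn unfolding Digraph_Component.connected_def strongly_connected_def mk_symmetric_def by auto
  show ?thesis
  proof unfold_locales
    show "finite (pverts G)" by simp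
    show "pverts G \<noteq> {}" by fact
    show "adj G u v \<Longrightarrow> u \<in> pverts G" for u v using adj_verts[OF G] by blast
    show "A = pverts G" if "A \<subseteq> pverts G" "A \<noteq> {}" "\<And>u v. u \<in> A \<Longrightarrow> adj G u v \<Longrightarrow> v \<in> A" for A
      using connected_closed[OF G conn that(1,2)] that(3) by (auto simp: adj_def)
    show "cis (pverts G)" using CIS_iff[OF G ne] cis by blast
    show "card {w. adj G v w} = d" if v: "v \<in> pverts G" for v
    proof -
      have "out_arcs (with_proj G) v = Pair v ` {w. adj G v w}" by (auto simp: out_arcs_def adj_def)
      then have "card (out_arcs (with_proj G) v) = card {w. adj G v w}" by (simp add: card_image inj_on_def)
      then show ?thesis using d v by (simp add: has_valency_def out_degree_def)
    qed
    fix u v assume uv: "u \<in> pverts G" "v \<in> pverts G"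
    then obtain f where f: "automorphism G f" "f u = v" using vt by (auto simp: vertex_transitive_def)
    define g where "g x = (if x \<in> pverts G then f x else x)" for x
    have b: "bij_betw f (pverts G) (pverts G)" using f(1) by (simp add: automorphism_def)
    then have "bij_betw g (pverts G) (pverts G)" by (rule bij_betw_cong[THEN iffD1, rotated]) (simp add: g_def)
    then have perm: "g permutes pverts G" by (rule bij_imp_permutes) (simp add: g_def)
    have "adj G (g x) (g y) \<longleftrightarrow> adj G x y" for x y
    proof (cases "x \<in> pverts G \<and> y \<in> pverts G")
      case True
      then show ?thesis using f(1) by (simp add: automorphism_def g_def adj_def)
    next
      case False
      then have "\<not> (g x \<in> pverts G \<and> g y \<in> pverts G)" using permutes_in_image[OF perm] by simp
      then show ?thesis using adj_verts[OF G] False by blast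
    qed
    then show "\<exists>f. f permutes pverts G \<and> (\<forall>x y. adj G (f x) (f y) = adj G x y) \<and> f u = v"
      using perm f(2) uv(1) by (intro exI[of _ g]) (simp add: g_def)
  qed
qed

lemma isomorphic_complete_graph:
  assumes G: "pair_graph G" and V: "card (pverts G) = n"
    and E: "\<And>u v. u \<in> pverts G \<Longrightarrow> v \<in> pverts G \<Longrightarrow> adj G u v \<longleftrightarrow> u \<noteq> v"
  shows "isomorphic G (complete_graph n)"
proof -
  interpret pair_graph G by fact
  obtain f where f: "bij_betw f (pverts G) {0..<n}" using ex_bij_betw_finite_nat[of "pverts G"] V by auto
  show ?thesis
  proof (rule isomorphicI[OF G pair_graph_complete_graph])
    show "bij_betw f (pverts G) (pverts (complete_graph n))" using f by (simp add: complete_graph_def)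
    fix u v assume uv: "u \<in> pverts G" "v \<in> pverts G"
    then have "f u < n" "f v < n" "f u = f v \<longleftrightarrow> u = v"
      using bij_betwE[OF f] inj_on_eq_iff[OF bij_betw_imp_inj_on[OF f] uv] by auto
    then show "(f u, f v) \<in> parcs (complete_graph n) \<longleftrightarrow> (u, v) \<in> parcs G"
      using E[OF uv] by (simp add: complete_graph_def adj_def)
  qed
qed

lemma isomorphic_multipartite:
  assumes G: "pair_graph G" and g: "bij_betw g (pverts G) ({0..<k} \<times> {0..<p})"
    and E: "\<And>u v. u \<in> pverts G \<Longrightarrow> v \<in> pverts G \<Longrightarrow> adj G u v \<longleftrightarrow> fst (g u) \<noteq> fst (g v)"
  shows "isomorphic G (lex_product (complete_graph k) (complement_graph (complete_graph p)))"
proof (rule isomorphicI[OF G, of _ g])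
  let ?H = "lex_product (complete_graph k) (complement_graph (complete_graph p))"
  show "pair_graph ?H"
    by (intro pair_graph_lex_product pair_graph_complement_graph pair_graph_complete_graph)
  show "bij_betw g (pverts G) (pverts ?H)"
    using g by (simp add: lex_product_def complement_graph_def complete_graph_def)
  fix u v assume uv: "u \<in> pverts G" "v \<in> pverts G"
  then have "g u \<in> {0..<k} \<times> {0..<p}" "g v \<in> {0..<k} \<times> {0..<p}" using bij_betwE[OF g] by auto
  then show "(g u, g v) \<in> parcs ?H \<longleftrightarrow> (u, v) \<in> parcs G"
    using E[OF uv] by (cases "g u"; cases "g v") (simp add: lex_product_def complement_graph_def complete_graph_def adj_def)
qed

lemma isomorphic_complete_bipartite_graph:
  assumes G: "pair_graph G" and AB: "A \<inter> B = {}" "A \<union> B = pverts G" "card A = m" "card B = n"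
    and E: "\<And>u v. u \<in> pverts G \<Longrightarrow> v \<in> pverts G \<Longrightarrow> adj G u v \<longleftrightarrow> u \<in> A \<and> v \<in> B \<or> u \<in> B \<and> v \<in> A"
  shows "isomorphic G (complete_bipartite_graph m n)"
proof -
  interpret pair_graph G by fact
  have fin: "finite A" "finite B" using AB(2) finite_subset[of _ "pverts G"] by auto
  obtain a where a: "bij_betw a A (Inl ` {0..<m} :: (nat + nat) set)"
    using finite_same_card_bij[OF fin(1), of "Inl ` {0..<m} :: (nat + nat) set"] AB(3) by (auto simp: card_image)
  obtain b where b: "bij_betw b B (Inr ` {0..<n} :: (nat + nat) set)"
    using finite_same_card_bij[OF fin(2), of "Inr ` {0..<n} :: (nat + nat) set"] AB(4) by (auto simp: card_image)
  define f where "f u = (if u \<in> A then a u else b u)" for u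
  have fA: "bij_betw f A (Inl ` {0..<m})" using a by (rule bij_betw_cong[THEN iffD1, rotated]) (simp add: f_def)
  have fB: "bij_betw f B (Inr ` {0..<n})" using b by (rule bij_betw_cong[THEN iffD1, rotated]) (use AB(1) in \<open>auto simp: f_def\<close>)
  show ?thesis
  proof (rule isomorphicI[OF G pair_graph_complete_bipartite_graph])
    show "bij_betw f (pverts G) (pverts (complete_bipartite_graph m n))"
      using bij_betw_combine[OF fA fB] AB(2) by (auto simp: complete_bipartite_graph_def)
    fix u v assume uv: "u \<in> pverts G" "v \<in> pverts G"
    have *: "x \<in> A \<and> x \<notin> B \<and> f x \<in> Inl ` {0..<m} \<or> x \<in> B \<and> x \<notin> A \<and> f x \<in> Inr ` {0..<n}" if "x \<in> pverts G" for x
      using bij_betwE[OF fA] bij_betwE[OF fB] AB that by blast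
    show "(f u, f v) \<in> parcs (complete_bipartite_graph m n) \<longleftrightarrow> (u, v) \<in> parcs G"
      using E[OF uv] *[OF uv(1)] *[OF uv(2)] unfolding adj_def by (auto simp: complete_bipartite_graph_def)
  qed
qed

text \<open>Stated for any complete bipartite \<open>H\<close>, so that it covers both
  \<open>cycle_graph 4\<close> and \<open>complete_bipartite_graph 3 3\<close>.\<close>

lemma isomorphic_lex_bipartite:
  assumes G: "pair_graph G" and H: "pair_graph H"
    and AB: "A \<inter> B = {}" "A \<union> B = pverts G"
    and XY: "X \<inter> Y = {}" "pverts H = X \<union> Y" "parcs H = X \<times> Y \<union> Y \<times> X"
    and a: "bij_betw a A (X \<times> {0..<p})" and b: "bij_betw b B (Y \<times> {0..<p})"
    and E: "\<And>u v. u \<in> pverts G \<Longrightarrow> v \<in> pverts G \<Longrightarrow> adj G u v \<longleftrightarrow>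
      u \<noteq> v \<and> (u \<in> A \<and> v \<in> B \<or> u \<in> B \<and> v \<in> A \<or> u \<in> A \<and> v \<in> A \<and> fst (a u) = fst (a v) \<or> u \<in> B \<and> v \<in> B \<and> fst (b u) = fst (b v))"
  shows "isomorphic G (lex_product H (complete_graph p))"
proof -
  define f where "f u = (if u \<in> A then a u else b u)" for u
  have fA: "bij_betw f A (X \<times> {0..<p})" using a by (rule bij_betw_cong[THEN iffD1, rotated]) (simp add: f_def)
  have fB: "bij_betw f B (Y \<times> {0..<p})" using b by (rule bij_betw_cong[THEN iffD1, rotated]) (use AB(1) in \<open>auto simp: f_def\<close>)
  have f: "bij_betw f (pverts G) ((X \<union> Y) \<times> {0..<p})"
    using bij_betw_combine[OF fA fB] AB(2) XY(1) by (auto simp: Sigma_Un_distrib1)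
  show ?thesis
  proof (rule isomorphicI[OF G pair_graph_lex_product[OF H pair_graph_complete_graph]])
    show "bij_betw f (pverts G) (pverts (lex_product H (complete_graph p)))"
      using f XY(2) by (simp add: lex_product_def complete_graph_def)
    fix u v assume uv: "u \<in> pverts G" "v \<in> pverts G"
    have side: "x \<in> A \<and> x \<notin> B \<and> f x = a x \<and> fst (f x) \<in> X \<and> fst (f x) \<notin> Y \<and> snd (f x) < p \<or>
        x \<in> B \<and> x \<notin> A \<and> f x = b x \<and> fst (f x) \<in> Y \<and> fst (f x) \<notin> X \<and> snd (f x) < p" if "x \<in> pverts G" for x
    proof (cases "x \<in> A")
      case True
      then have "f x \<in> X \<times> {0..<p}" using bij_betwE[OF fA] by blast
      then show ?thesis using True AB(1) XY(1) by (auto simp: f_def mem_Times_iff)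
    next
      case False
      then have x: "x \<in> B" using AB(2) that by blast
      then have "f x \<in> Y \<times> {0..<p}" using bij_betwE[OF fB] by blast
      then show ?thesis using False x XY(1) by (auto simp: f_def mem_Times_iff)
    qed
    have inj: "f u = f v \<longleftrightarrow> u = v" using inj_on_eq_iff[OF bij_betw_imp_inj_on[OF f] uv] .
    have "(f u, f v) \<in> parcs (lex_product H (complete_graph p)) \<longleftrightarrow>
        fst (f u) \<in> X \<and> fst (f v) \<in> Y \<or> fst (f u) \<in> Y \<and> fst (f v) \<in> X \<or> fst (f u) = fst (f v) \<and> f u \<noteq> f v"
      using side[OF uv(1)] side[OF uv(2)] XY
      by (cases "f u"; cases "f v") (auto simp: lex_product_def complete_graph_def)
    then show "(f u, f v) \<in> parcs (lex_product H (complete_graph p)) \<longleftrightarrow> (u, v) \<in> parcs G"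
      using E[OF uv] side[OF uv(1)] side[OF uv(2)] inj unfolding adj_def by auto
  qed
qed

lemma isomorphic_Q_graph:
  assumes "pair_graph G" and "4 \<le> n" and f: "bij_betw f (pverts G) ({0..<n} \<times> {0..<2} \<times> {0..<2})"
    and "\<And>u v. u \<in> pverts G \<Longrightarrow> v \<in> pverts G \<Longrightarrow> adj G u v \<longleftrightarrow> (f u, f v) \<in> parcs (Q_graph n)"
  shows "isomorphic G (Q_graph n)"
proof (rule isomorphicI[OF assms(1)])
  show "pair_graph (Q_graph n)" using pair_graph_Q_graph assms(2) by simp
  show "bij_betw f (pverts G) (pverts (Q_graph n))" using f by (simp add: Q_graph_def Let_def)
qed (use assms(4) in \<open>simp add: adj_def\<close>)

lemma isomorphic_line_graph:
  assumes G: "pair_graph G" and cis: "rook_cis_graph (adj G) (pverts G) d k"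
  shows "isomorphic G (line_graph (complete_bipartite_graph k k))"
proof -
  interpret rook_cis_graph "adj G" "pverts G" d k by fact
  obtain r c where f: "bij_betw (\<lambda>v. (r v, c v)) (pverts G) ({..<k} \<times> {..<k})"
    and E: "\<And>u v. u \<in> pverts G \<Longrightarrow> v \<in> pverts G \<Longrightarrow> adj G u v \<longleftrightarrow> u \<noteq> v \<and> (r u = r v \<or> c u = c v)"
    using rook_coordinates by blast
  have "isomorphic G (rook_graph k)"
  proof (rule isomorphicI[OF G pair_graph_rook_graph])
    show "bij_betw (\<lambda>v. (r v, c v)) (pverts G) (pverts (rook_graph k))" using f by (simp add: rook_graph_def)
    fix u v assume uv: "u \<in> pverts G" "v \<in> pverts G"
    have "r u < k" "c u < k" "r v < k" "c v < k" using bij_betwE[OF f] uv by auto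
    moreover have "(r u, c u) = (r v, c v) \<longleftrightarrow> u = v" using inj_on_eq_iff[OF bij_betw_imp_inj_on[OF f] uv] .
    ultimately show "((r u, c u), (r v, c v)) \<in> parcs (rook_graph k) \<longleftrightarrow> (u, v) \<in> parcs G"
      using E[OF uv] unfolding adj_def by (auto simp: rook_graph_def)
  qed
  then show ?thesis
    by (rule isomorphic_trans[OF _ rook_isomorphic_line_graph G pair_graph_rook_graph
          pair_graph_line_graph[OF pair_graph_complete_bipartite_graph]])
qed

section \<open>The classification\<close>

lemma CIS_listed:
  assumes G: "pair_graph G" "pverts G \<noteq> {}"
    and R: "(\<exists>n. 1 \<le> n \<and> n \<le> 8 \<and> isomorphic G (complete_graph n)) \<or>
      (\<exists>n. 2 \<le> n \<and> n \<le> 7 \<and> isomorphic G (complete_bipartite_graph n n)) \<or>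
      isomorphic G (line_graph (complete_bipartite_graph 3 3)) \<or>
      isomorphic G (line_graph (complete_bipartite_graph 4 4)) \<or>
      isomorphic G (lex_product (cycle_graph 4) (complete_graph 2)) \<or>
      isomorphic G (lex_product (complete_graph 3) (complement_graph (complete_graph 2))) \<or>
      isomorphic G (lex_product (complete_graph 3) (complement_graph (complete_graph 3))) \<or>
      isomorphic G (lex_product (complete_graph 4) (complement_graph (complete_graph 2))) \<or>
      isomorphic G (lex_product (complete_bipartite_graph 3 3) (complete_graph 2)) \<or>
      (\<exists>n. 4 \<le> n \<and> isomorphic G (Q_graph n))"
  shows "CIS G"
proof -
  have P: "pverts (complete_graph n) \<noteq> {}" "pverts (complement_graph (complete_graph n)) \<noteq> {}"
    "pverts (complete_bipartite_graph n n) \<noteq> {}" "pverts (cycle_graph n) \<noteq> {}" if "1 \<le> n" for n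
    using that by (auto simp: complete_graph_def complement_graph_def complete_bipartite_graph_def cycle_graph_def)
  have pg: "pair_graph (complement_graph (complete_graph n))" "pair_graph (line_graph (complete_bipartite_graph n n))"
     for n by (intro pair_graph_complement_graph pair_graph_line_graph pair_graph_complete_graph pair_graph_complete_bipartite_graph)+
  have C4: "pair_graph (cycle_graph 4)" by (rule pair_graph_cycle_graph) simp
  note iso = CIS_isomorphic[OF G]
  have K: "CIS G" if "1 \<le> n" "isomorphic G (complete_graph n)" for n
    using iso[OF pair_graph_complete_graph CIS_complete_graph] that by blast
  have B: "CIS G" if "2 \<le> n" "isomorphic G (complete_bipartite_graph n n)" for n
    using iso[OF pair_graph_complete_bipartite_graph CIS_complete_bipartite_graph, of n] that by simp
  have L: "CIS G" if "1 \<le> n" "isomorphic G (line_graph (complete_bipartite_graph n n))" for n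
    using iso[OF pg(2) CIS_line_graph] that by blast
  have M: "CIS G" if "1 \<le> k" "1 \<le> p" "isomorphic G (lex_product (complete_graph k) (complement_graph (complete_graph p)))" for k p
    by (rule iso[OF pair_graph_lex_product[OF pair_graph_complete_graph pg(1)] lex_product_CIS[OF pair_graph_complete_graph
          P(1) CIS_complete_graph pg(1) P(2) CIS_edgeless]]) (use that in auto)
  have Q: "CIS G" if "4 \<le> n" "isomorphic G (Q_graph n)" for n
    using iso[OF pair_graph_Q_graph Q_CIS, of n] that by simp
  have X: "CIS G" if "isomorphic G (lex_product (cycle_graph 4) (complete_graph 2))"
    by (rule iso[OF pair_graph_lex_product[OF C4 pair_graph_complete_graph] lex_product_CIS[OF C4
          P(4) CIS_cycle_4 pair_graph_complete_graph P(1) CIS_complete_graph]]) (use that in auto)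
  have Y: "CIS G" if "isomorphic G (lex_product (complete_bipartite_graph 3 3) (complete_graph 2))"
    by (rule iso[OF pair_graph_lex_product[OF pair_graph_complete_bipartite_graph pair_graph_complete_graph]
          lex_product_CIS[OF pair_graph_complete_bipartite_graph
          P(3) CIS_complete_bipartite_graph pair_graph_complete_graph P(1) CIS_complete_graph]]) (use that in auto)
  show ?thesis using R
    using K B L[of 3] L[of 4] M[of 3 2] M[of 3 3] M[of 4 2] Q X Y by (elim disjE exE conjE) simp_all
qed

lemma (in pure_cis_graph) twin_free_if:
  assumes "\<And>v. v \<in> V \<Longrightarrow> card (twins v) = 1" and e: "E v w"
  shows "\<exists>x. E v x \<and> x \<noteq> w \<and> \<not> E w x"
proof (rule ccontr)
  assume no: "\<not> ?thesis"
  have v: "v \<in> V" using EV[OF e] .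
  have "w \<in> twins v" by (rule universal_twin[OF v e]) (use no in blast)
  moreover obtain z where "twins v = {z}" using assms(1)[OF v] by (auto simp: card_1_singleton_iff)
  ultimately show False using mem_twins[OF v] neq[OF e] by auto
qed

lemma isomorphic_twin_case:
  assumes G: "pair_graph G" and cis: "pure_cis_graph (adj G) (pverts G) d 4" and d: "d \<le> 7"
    and tw: "\<And>v. v \<in> pverts G \<Longrightarrow> card (cis_graph.twins (adj G) (pverts G) v) = 2"
  shows "isomorphic G (lex_product (cycle_graph 4) (complete_graph 2)) \<or>
    isomorphic G (lex_product (complete_bipartite_graph 3 3) (complete_graph 2))"
proof -
  interpret pure_cis_graph "adj G" "pverts G" d 4 by fact
  interpret cis_graph_4 "adj G" "pverts G" d by unfold_locales
  obtain v where v: "v \<in> pverts G" using nonempty by blast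
  have d5: "5 \<le> d" using twin_bound[OF v] tw[OF v] by simp
  then obtain A B where AB: "A \<inter> B = {}" "A \<union> B = pverts G" "card A = d - 1" "card B = d - 1"
    and T: "\<forall>x\<in>pverts G. card (twins x) = 2 \<and> twins x \<subseteq> (if x \<in> A then A else B)"
    and E: "\<forall>x\<in>pverts G. \<forall>y\<in>pverts G. adj G x y \<longleftrightarrow> x \<noteq> y \<and> (x \<in> A \<and> y \<in> B \<or> x \<in> B \<and> y \<in> A \<or> y \<in> twins x)"
    using twin_case[OF tw] by auto
  have tw_eq: "y \<in> twins x \<longleftrightarrow> y \<in> pverts G \<and> twins y = twins x" if "x \<in> pverts G" for x y
    using mem_twins[of y] unfolding twins_def by auto
  have fib: "card {y \<in> S. twins y = twins x} = 2" if S: "S = A \<or> S = B" and x: "x \<in> S" for S x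
  proof -
    have xV: "x \<in> pverts G" using S x AB(2) by blast
    have "twins x \<subseteq> S" using T xV S x AB(1) by (metis disjoint_iff)
    then have "{y \<in> S. twins y = twins x} = twins x" using tw_eq[OF xV] S AB(2) by blast
    then show ?thesis using tw[OF xV] by simp
  qed
  have fin: "finite A" "finite B" using AB(2) finV finite_subset[of _ "pverts G"] by auto
  have cA: "d - 1 = card (twins ` A) * 2" using card_fibres[OF fin(1), of twins 2] fib[of A] AB(3) by simp
  have cB: "d - 1 = card (twins ` B) * 2" using card_fibres[OF fin(2), of twins 2] fib[of B] AB(4) by simp
  have iso: "isomorphic G (lex_product H (complete_graph 2))"
    if H: "pair_graph H" and XY: "X \<inter> Y = {}" "pverts H = X \<union> Y" "parcs H = X \<times> Y \<union> Y \<times> X"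
      and c: "finite X" "finite Y" "d - 1 = card X * 2" "d - 1 = card Y * 2" for H :: "'b pair_pre_digraph" and X Y
  proof -
    obtain a where a: "bij_betw a A (X \<times> {0..<2::nat})" "\<forall>u\<in>A. \<forall>v\<in>A. fst (a u) = fst (a v) \<longleftrightarrow> twins u = twins v"
      using equipartition[OF fin(1) c(1), of twins 2] fib[of A] cA c(3) by auto
    obtain b where b: "bij_betw b B (Y \<times> {0..<2::nat})" "\<forall>u\<in>B. \<forall>v\<in>B. fst (b u) = fst (b v) \<longleftrightarrow> twins u = twins v"
      using equipartition[OF fin(2) c(2), of twins 2] fib[of B] cB c(4) by auto
    show ?thesis
    proof (rule isomorphic_lex_bipartite[OF G H AB(1,2) XY a(1) b(1)])
      fix u v assume uv: "u \<in> pverts G" "v \<in> pverts G"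
      have s: "u \<in> A \<and> u \<notin> B \<or> u \<in> B \<and> u \<notin> A" "v \<in> A \<and> v \<notin> B \<or> v \<in> B \<and> v \<notin> A" using uv AB(1,2) by auto
      have t: "v \<in> twins u \<longleftrightarrow> u \<in> A \<and> v \<in> A \<and> fst (a u) = fst (a v) \<or> u \<in> B \<and> v \<in> B \<and> fst (b u) = fst (b v)"
      proof (cases "u \<in> A \<longleftrightarrow> v \<in> A")
        case True
        then show ?thesis using tw_eq[OF uv(1), of v] uv(2) a(2) b(2) s by metis
      next
        case False
        have "v \<notin> twins u"
        proof
          assume "v \<in> twins u"
          then have "v \<in> (if u \<in> A then A else B)" using T uv(1) by blast
          then show False using False s by (auto split: if_splits)
        qed
        then show ?thesis using False s by blast
      qed
      show "adj G u v \<longleftrightarrow> u \<noteq> v \<and> (u \<in> A \<and> v \<in> B \<or> u \<in> B \<and> v \<in> A \<or> u \<in> A \<and> v \<in> A \<and> fst (a u) = fst (a v) \<or>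
          u \<in> B \<and> v \<in> B \<and> fst (b u) = fst (b v))"
        using bspec[OF bspec[OF E uv(1)] uv(2)] t by blast
    qed
  qed
  \<comment> \<open>Each part has \<open>d - 1\<close> vertices and is a union of twin pairs, so
    \<open>d\<close> is odd.\<close>
  have "d = 5 \<or> d = 7" using cA d5 d by presburger
  then show ?thesis
  proof
    assume d: "d = 5"
    have "isomorphic G (lex_product (cycle_graph 4) (complete_graph 2))"
    proof (rule iso[of _ "{0,2}" "{1,3}"])
      show "pair_graph (cycle_graph 4)" by (rule pair_graph_cycle_graph) simp
      have four: "i < 4 \<longleftrightarrow> i = 0 \<or> i = 1 \<or> i = 2 \<or> i = 3" for i :: nat by auto
      show "parcs (cycle_graph 4) = {0,2} \<times> {1,3} \<union> {1,3} \<times> {0,2}" "pverts (cycle_graph 4) = {0,2} \<union> {1,3}"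
        by (auto simp: cycle_graph_def four)
    qed (use d in auto)
    then show ?thesis by blast
  next
    assume d: "d = 7"
    have "isomorphic G (lex_product (complete_bipartite_graph 3 3) (complete_graph 2))"
      by (rule iso[OF pair_graph_complete_bipartite_graph, of "Inl ` {0..<3}" "Inr ` {0..<3}"])
        (use d in \<open>auto simp: complete_bipartite_graph_def card_image\<close>)
    then show ?thesis by blast
  qed
qed

lemma isomorphic_multipartite_case:
  assumes G: "pair_graph G" and cis: "pure_cis_graph (adj G) (pverts G) d k"
    and incomplete: "\<not> (\<forall>u\<in>pverts G. \<forall>w\<in>pverts G. u \<noteq> w \<longrightarrow> adj G u w)"
    and tr: "\<forall>x y z. adj G x z \<longrightarrow> y \<in> pverts G \<longrightarrow> adj G y x \<or> adj G y z"
  shows "\<exists>p. 2 \<le> p \<and> d = (k - 1) * p \<and> isomorphic G (lex_product (complete_graph k) (complement_graph (complete_graph p)))"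
proof -
  interpret pure_cis_graph "adj G" "pverts G" d k by fact
  obtain p :: nat and g :: "'a \<Rightarrow> nat \<times> nat" where p: "d = (k - 1) * p" "bij_betw g (pverts G) ({0..<k} \<times> {0..<p})"
    "\<forall>u\<in>pverts G. \<forall>v\<in>pverts G. adj G u v \<longleftrightarrow> fst (g u) \<noteq> fst (g v)" using multipartite[OF tr] by blast
  have "p \<noteq> 0" using p(2) nonempty by (auto simp: bij_betw_def)
  moreover have "p \<noteq> 1"
  proof
    assume "p = 1"
    then have "fst (g u) \<noteq> fst (g v)" if "u \<in> pverts G" "v \<in> pverts G" "u \<noteq> v" for u v
      using inj_on_eq_iff[OF bij_betw_imp_inj_on[OF p(2)] that(1,2)] bij_betwE[OF p(2)] that
      by (auto simp: mem_Times_iff prod_eq_iff)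
    then show False using p(3) incomplete by blast
  qed
  ultimately have "2 \<le> p" by simp
  then show ?thesis using isomorphic_multipartite[OF G p(2)] p(1,3) by blast
qed

lemma isomorphic_clique_number_3:
  assumes G: "pair_graph G" and cis: "pure_cis_graph (adj G) (pverts G) d 3" and d: "d \<le> 7"
    and incomplete: "\<not> (\<forall>u\<in>pverts G. \<forall>w\<in>pverts G. u \<noteq> w \<longrightarrow> adj G u w)"
  shows "isomorphic G (line_graph (complete_bipartite_graph 3 3)) \<or>
    isomorphic G (lex_product (complete_graph 3) (complement_graph (complete_graph 2))) \<or>
    isomorphic G (lex_product (complete_graph 3) (complement_graph (complete_graph 3)))"
proof -
  interpret pure_cis_graph "adj G" "pverts G" d 3 by fact
  interpret cis_graph_3 "adj G" "pverts G" d by unfold_locales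
  show ?thesis
  proof (cases "\<exists>u v w. tri u v w \<and> (\<forall>x. adj G u x \<longrightarrow> adj G x v \<or> adj G x w)")
    case True
    then obtain u v w where "tri u v w" "\<And>x. adj G u x \<Longrightarrow> adj G x v \<or> adj G x w" by blast
    then have "\<forall>x y z. adj G x z \<longrightarrow> y \<in> pverts G \<longrightarrow> adj G y x \<or> adj G y z" using connected_link by blast
    then obtain p where "2 \<le> p" "d = (3 - 1) * p" "isomorphic G (lex_product (complete_graph 3) (complement_graph (complete_graph p)))"
      using isomorphic_multipartite_case[OF G cis incomplete] by blast
    moreover from this d have "p = 2 \<or> p = 3" by simp arith
    ultimately show ?thesis by blast
  next
    case False
    interpret cis_graph_3_disconnected "adj G" "pverts G" d by unfold_locales (use False d in auto)
    have "rook_cis_graph (adj G) (pverts G) d 3"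
      by unfold_locales (use two_edges in auto)
    then show ?thesis using isomorphic_line_graph[OF G] by blast
  qed
qed

lemma isomorphic_clique_number_4:
  assumes G: "pair_graph G" and cis: "pure_cis_graph (adj G) (pverts G) d 4" and d: "d \<le> 7"
    and incomplete: "\<not> (\<forall>u\<in>pverts G. \<forall>w\<in>pverts G. u \<noteq> w \<longrightarrow> adj G u w)"
    and tw: "\<And>v. v \<in> pverts G \<Longrightarrow> card (cis_graph.twins (adj G) (pverts G) v) = 1"
  shows "isomorphic G (line_graph (complete_bipartite_graph 4 4)) \<or>
    isomorphic G (lex_product (complete_graph 4) (complement_graph (complete_graph 2))) \<or>
    (\<exists>n. 4 \<le> n \<and> isomorphic G (Q_graph n))"
proof -
  interpret pure_cis_graph "adj G" "pverts G" d 4 by fact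
  interpret cis_graph_4 "adj G" "pverts G" d by unfold_locales
  show ?thesis
  proof (cases "\<exists>u v. split_edge u v")
    case True
    then obtain u v where s: "split_edge u v" by blast
    then have "adj G u v" by (auto simp: split_edge_def clique4_def)
    then have u: "u \<in> pverts G" using EV by blast
    interpret cis_graph_4_twin_free "adj G" "pverts G" d
      by unfold_locales (use d twin_free_if[OF tw] in auto)
    interpret chain_cis_graph "adj G" "pverts G" d
    proof unfold_locales
      fix w assume w: "w \<in> pverts G"
      obtain f where "f \<in> Aut" "f u = w" using Aut_trans[OF u w] by blast
      then have "split_edge w (f v)" using Aut_split_edge s by blast
      then show "\<exists>x y b x1 x2 y1 y2. chain_link w x y b x1 x2 y1 y2" using split_edge_chain by blast
    qed
    obtain n f where "4 \<le> n" "bij_betw f (pverts G) ({0..<n} \<times> {0..<2} \<times> {0..<2})"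
      "\<forall>u\<in>pverts G. \<forall>w\<in>pverts G. adj G u w \<longleftrightarrow> (f u, f w) \<in> parcs (Q_graph n)"
      using Q_coordinates by blast
    then show ?thesis using isomorphic_Q_graph[OF G] by blast
  next
    case False
    interpret cis_graph_4_unsplit "adj G" "pverts G" d by unfold_locales (use False d in auto)
    from unsplit_cases show ?thesis
    proof
      assume "\<forall>x y z. adj G x z \<longrightarrow> y \<in> pverts G \<longrightarrow> adj G y x \<or> adj G y z"
      then obtain p where "2 \<le> p" "d = (4 - 1) * p" "isomorphic G (lex_product (complete_graph 4) (complement_graph (complete_graph p)))"
        using isomorphic_multipartite_case[OF G cis incomplete] by blast
      moreover from this d have "p = 2" by simp
      ultimately show ?thesis by blast
    next
      assume "d = 6 \<and> (\<forall>v\<in>pverts G. \<exists>A B. N v = A \<union> B \<and> A \<inter> B = {} \<and> cl A \<and> cl B \<and> card A = 3 \<and> card B = 3 \<and>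
          (\<forall>a\<in>A. \<forall>b\<in>B. \<not> adj G a b))"
      then have "rook_cis_graph (adj G) (pverts G) d 4"
        by unfold_locales auto
      then show ?thesis using isomorphic_line_graph[OF G] by blast
    qed
  qed
qed

theorem corollary5p6:
  fixes G :: "'a pair_pre_digraph" and d :: nat
  assumes "pair_graph G"
    and "Digraph_Component.connected (with_proj G)"
    and "vertex_transitive G"
    and "has_valency G d" and "d \<le> 7"
  shows "CIS G \<longleftrightarrow>
      (\<exists>n. 1 \<le> n \<and> n \<le> 8 \<and> isomorphic G (complete_graph n)) \<or>
      (\<exists>n. 2 \<le> n \<and> n \<le> 7 \<and> isomorphic G (complete_bipartite_graph n n)) \<or>
      isomorphic G (line_graph (complete_bipartite_graph 3 3)) \<or>
      isomorphic G (line_graph (complete_bipartite_graph 4 4)) \<or>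
      isomorphic G (lex_product (cycle_graph 4) (complete_graph 2)) \<or>
      isomorphic G (lex_product (complete_graph 3) (complement_graph (complete_graph 2))) \<or>
      isomorphic G (lex_product (complete_graph 3) (complement_graph (complete_graph 3))) \<or>
      isomorphic G (lex_product (complete_graph 4) (complement_graph (complete_graph 2))) \<or>
      isomorphic G (lex_product (complete_bipartite_graph 3 3) (complete_graph 2)) \<or>
      (\<exists>n. 4 \<le> n \<and> isomorphic G (Q_graph n))" (is "_ \<longleftrightarrow> ?R")
proof
  assume "CIS G"
  then interpret cis_graph "adj G" "pverts G" d using cis_graph_adj assms by blast
  note G = assms(1)
  obtain k where k: "pure (pverts G) k" using pure_exists by blast
  interpret pure_cis_graph "adj G" "pverts G" d k by unfold_locales (fact k)
  obtain v where v: "v \<in> pverts G" using nonempty by blast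
  show ?R
  proof (cases "\<forall>u\<in>pverts G. \<forall>w\<in>pverts G. u \<noteq> w \<longrightarrow> adj G u w")
    case True
    have "isomorphic G (complete_graph (Suc d))"
      by (rule isomorphic_complete_graph[OF G complete_card[OF True]]) (use True neq in blast)
    moreover have "1 \<le> Suc d" "Suc d \<le> 8" using assms(5) by simp_all
    ultimately show ?thesis by blast
  next
    case False
    then consider "k \<in> {2,3,4}" "card (twins v) = 1" | "k = 4" "card (twins v) = 2"
      using small_cases[OF assms(5) v] by blast
    then show ?thesis
    proof cases
      case 1
      have tw: "card (twins w) = 1" if "w \<in> pverts G" for w using card_twins[OF that v] 1(2) by simp
      consider "k = 2" | "k = 3" | "k = 4" using 1(1) by blast
      then show ?thesis
      proof cases
        case 1
        then obtain A B where AB: "A \<inter> B = {}" "A \<union> B = pverts G" "card A = d" "card B = d"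
          "\<forall>x\<in>pverts G. \<forall>y\<in>pverts G. adj G x y \<longleftrightarrow> x \<in> A \<and> y \<in> B \<or> x \<in> B \<and> y \<in> A" using bipartite_case by blast
        have "isomorphic G (complete_bipartite_graph d d)"
          by (rule isomorphic_complete_bipartite_graph[OF G AB(1-4)]) (use AB(5) in blast)
        moreover have "d \<noteq> 0"
        proof
          assume "d = 0"
          moreover have "finite A" "finite B" using AB(2) finV finite_subset[of _ "pverts G"] by auto
          ultimately show False using AB(2-4) v by auto
        qed
        \<comment> \<open>For \<open>d = 1\<close> the graph would be a single edge, hence complete,
          which this branch excludes.\<close>
        moreover have "d \<noteq> 1"
        proof
          assume "d = 1"
          then obtain a b where "A = {a}" "B = {b}" using AB(3,4) by (auto simp: card_1_singleton_iff)
          then show False using False AB(2,5) by auto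
        qed
        ultimately show ?thesis using assms(5) by (metis One_nat_def Suc_1 le_less_Suc_eq not_less_eq_eq not_le less_one)
      next
        case 2
        then have "pure_cis_graph (adj G) (pverts G) d 3" using pure_cis_graph_axioms by simp
        from isomorphic_clique_number_3[OF G this assms(5) False] show ?thesis by blast
      next
        case 3
        then have "pure_cis_graph (adj G) (pverts G) d 4" using pure_cis_graph_axioms by simp
        from isomorphic_clique_number_4[OF G this assms(5) False tw] show ?thesis by blast
      qed
    next
      case 2
      have tw: "card (twins w) = 2" if "w \<in> pverts G" for w using card_twins[OF that v] 2(2) by simp
      have "pure_cis_graph (adj G) (pverts G) d 4" using pure_cis_graph_axioms 2(1) by simp
      from isomorphic_twin_case[OF G this assms(5) tw] show ?thesis by blast
    qed
  qed
next
  assume R: ?R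
  have "pverts G \<noteq> {}"
    using assms(2) unfolding Digraph_Component.connected_def strongly_connected_def mk_symmetric_def by auto
  then show "CIS G" by (rule CIS_listed[OF assms(1) _ R])
qed

end
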